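(* Let $\mathfrak g$ be a symmetrizable Kac–Moody algebra, $(\Gamma_1,\Gamma_2,T)$ a nondegenerate generalized Belavin–Drinfeld triple for $\mathfrak g$, $V_1,\dots,V_r$ $\mathfrak g$-modules from the category $\mathcal O$, and $v_i\in V_i$ homogeneous vectors of weights $\nu_i$ such that $\nu=\sum_i\nu_i\in\mathfrak l^{\perp}$. Let $\lambda\in\mathfrak l^*$ and let $\mu$ be a generic element of the $\mathfrak l^*$-principal homogeneous space $\{\mu\in\mathfrak h^*: (\mu-\nu,\alpha)=(\mu,T\alpha)\ \forall \alpha\in\Gamma_1\}$. Then the function (formal series in $\lambda$) $\mathbb F^{v_1,\dots,v_r}(\lambda,\mu)$ defined in the context satisfies, for $i=1,\dots,r$, $$\Big(\sum_{j\in I_1}x_{j|V_i}\frac{\partial}{\partial x_j}+\sum_{j>i}r_T(\lambda)_{|V_i\otimes V_j}-\sum_{j<i}r_T(\lambda)_{|V_j\otimes V_i}\Big)\mathbb F^{v_1,\dots,v_r}(\lambda,\mu)=\frac12\big(\Delta_{\mu-\nu_{i+1}-\dots-\nu_r}-\Delta_{\mu-\nu_i-\dots-\nu_r}\big)\mathbb F^{v_1,\dots,v_r}(\lambda,\mu).$$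
   Context: Kac–Moody data. $A=(a_{ij})$ is a symmetrizable generalized Cartan matrix with realization $(\mathfrak h,\Gamma=\{\alpha_1,\dots,\alpha_n\}\subset\mathfrak h^*,\{h_1,\dots,h_n\}\subset\mathfrak h)$; $\mathfrak g=\mathfrak n_-\oplus\mathfrak h\oplus\mathfrak n_+$ is the Kac–Moody algebra with generators $e_i,f_i,\mathfrak h$; $(\,,)$ is a nondegenerate invariant bilinear form on $\mathfrak g$, used to identify $\mathfrak h$ with $\mathfrak h^*$. $\Delta^+$ is the set of positive roots. For $\alpha\in\Delta^+$ choose bases $e_\alpha^{(t)}$ of $\mathfrak g_\alpha$ and $f_\alpha^{(t)}$ of $\mathfrak g_{-\alpha}$ with $(e_\alpha^{(s)},f_\alpha^{(t)})=\delta_{st}$ (for $\alpha=\alpha_i$ simple: $e_\alpha=e_i$, $f_\alpha=f_i/(e_i,f_i)$); $h_\alpha=[e_\alpha^{(t)},f_\alpha^{(t)}]$. $\rho\in\mathfrak h^*$ satisfies $\langle\rho,h_i\rangle=1$ for all $i$. Sums $\sum_{\alpha,t}$ run over $\alpha\in\Delta^+$, $1\le t\le\dim\mathfrak g_\alpha$. Triples. A generalized Belavin–Drinfeld triple is $(\Gamma_1,\Gamma_2,T)$ with $\Gamma_1,\Gamma_2\subset\Gamma$ and $T:\Gamma_1\to\Gamma_2$ an inner-product-preserving bijection. Put $\mathfrak l=\big(\sum_{\alpha\in\Gamma_1}\mathbb C(\alpha-T\alpha)\big)^\perp\subset\mathfrak h$ and let $\mathfrak h_0=\mathfrak l^\perp$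 be its orthogonal complement in $\mathfrak h$. The triple is nondegenerate if $(\,,)|_{\mathfrak l}$ is nondegenerate; then $\mathfrak h=\mathfrak l\oplus\mathfrak h_0$. Choose an orthonormal basis $(x_j)_{j\in I}$ of $\mathfrak h$, $I=I_1\sqcup I_2$, with $\mathfrak l=\bigoplus_{j\in I_1}\mathbb Cx_j$, $\mathfrak h_0=\bigoplus_{j\in I_2}\mathbb Cx_j$. $\mathfrak l^*$ is regarded as a subspace of $\mathfrak h^*$ via the form. $\Gamma_3\subset\Gamma_1\cap\Gamma_2$ is the set of simple roots returning to themselves after applying $T$ several times; $\langle\Gamma_3\rangle$ is the set of positive roots that are combinations of elements of $\Gamma_3$. Let $\mathfrak h_i$ be the span of $h_\alpha$, $\alpha\in\Gamma_i$. The maps $B$, $B^{-1}$. $B:\mathfrak n_-\oplus\mathfrak h_1\to\mathfrak n_-\oplus\mathfrak h_2$ is the unique Lie algebra homomorphism with $B(f_\alpha)=f_{T\alpha}$, $B(h_\alpha)=h_{T\alpha}$ for $\alpha\in\Gamma_1$ and $B(f_\alpha)=0$ for simple $\alpha\notin\Gamma_1$; $B^{-1}:\mathfrak n_+\oplus\mathfrak h_2\to\mathfrak n_+\oplus\mathfrak h_1$ is the unique homomorphism with $B^{-1}(e_\alpha)=e_{T^{-1}\alpha}$, $B^{-1}(h_\alpha)=h_{T^{-1}\alpha}$ for $\alpha\in\Gamma_2$ and $B^{-1}(e_\alpha)=0$ for simple $\alpha\notin\Gamma_2$. They are extended to enveloping algebras. $B$ restricts to an automorphism of the subalgebra generated by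 $\mathfrak g_{\pm\alpha}$, $\alpha\in\Gamma_3$; for $\alpha\in\langle\Gamma_3\rangle$, $N_\alpha$ is the length of the orbit of $\alpha$ and the bases are chosen so that $B^{N_\alpha}f_\alpha^{(t)}=\theta_\alpha^{(t)}f_\alpha^{(t)}$, $B^{N_\alpha}e_\alpha^{(t)}=(\theta_\alpha^{(t)})^{-1}e_\alpha^{(t)}$. Cayley transform. $C_T:\mathfrak h_0\to\mathfrak h_0$ is the linear map such that $C_Tx$ is the unique $y\in\mathfrak h_0$ with $(\alpha-T\alpha,y)=(\alpha+T\alpha,x)$ for all $\alpha\in\Gamma_1$. The r-matrix. With $a\wedge b=a\otimes b-b\otimes a$, for $\lambda\in\mathfrak l^*$, $$r_T(\lambda)=-\tfrac12\sum_{j\in I}x_j\otimes x_j+\tfrac12\sum_{j\in I_2}C_Tx_j\otimes x_j-\sum_{\alpha,t}f_\alpha^{(t)}\otimes e_\alpha^{(t)}+\sum_{\alpha,t}\sum_{l\ge1}e^{-l(\alpha,\lambda)}e_\alpha^{(t)}\wedge B^lf_\alpha^{(t)}.$$ Verma modules, intertwiners, traces. $M_\lambda$ is the Verma module of highest weight $\lambda$ with highest weight vector $v_\lambda$, $M_\lambda^*$ its graded dual, $v_\lambda^*\in M_\lambda^*[-\lambda]$ the vector with $\langle v^*_\lambda,v_\lambda\rangle=1$; $\Delta_\lambda=(\lambda,\lambda+2\rho)$. For homogeneous $v\in V$ of weight $\kappa$ and $M^*_{\lambda-\kappa}$ irreducible (true for generic parameters), $\Phi^v_\lambda:M_\lambda\to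 M_{\lambda-\kappa}\otimes V$ is the unique $\mathfrak g$-intertwiner with $\langle v^*_{\lambda-\kappa},\Phi^v_\lambda v_\lambda\rangle=v$. For $\lambda\in\mathfrak h^*$, $e^\lambda$ acts on vectors of weight $\kappa$ by $e^{(\lambda,\kappa)}$. If $(\mu',\alpha)=(\mu,T\alpha)$ for all $\alpha\in\Gamma_1$, the linear map $B:M_{\mu'}\to M_\mu$ is $B(xv_{\mu'})=B(x)v_\mu$, $x\in U\mathfrak n_-$. For $\mu$ as in the claim take $\mu'=\mu-\nu$ and define $$F^{v_1,\dots,v_r}(\lambda,\mu)=\mathrm{Tr}\big(\Phi^{v_1}_{\mu-\nu_2-\dots-\nu_r}\cdots\Phi^{v_r}_\mu Be^\lambda\big),$$ the trace over $M_{\mu-\nu}$ of the composition $M_{\mu-\nu}\to M_{\mu-\nu}\otimes V_1\otimes\cdots\otimes V_r$; it is a formal series in $\lambda$ with values in $(V_1\otimes\cdots\otimes V_r)^{\mathfrak l}$. Put $\delta_B(\lambda)=\big(\mathrm{Tr}_{|M_{-\rho}}(Be^\lambda)\big)^{-1}$ and $\mathbb F^{v_1,\dots,v_r}(\lambda,\mu)=\delta_B(\lambda)F^{v_1,\dots,v_r}(\lambda,\mu)$. Notation: $x_{|V_i}$ means $x$ acting on the $i$-th tensor factor; $(a\otimes b)_{|V_i\otimes V_j}=a_{|V_i}b_{|V_j}$. $\partial/\partial x_j$ is the derivative with respect to $\lambda\in\mathfrak l^*$ in the direction of $x_j\in\mathfrak l\cong\mathfrak l^*$, so $\frac{\partial}{\partial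 x_j}e^{(\lambda,\kappa)}=\langle\kappa,x_j\rangle e^{(\lambda,\kappa)}$. *)

theory Defs
  imports "HOL-Analysis.Cartesian_Space" "HOL-Library.Function_Algebras"
begin

section \<open>Complex vector spaces\<close>

class complex_vector = ab_group_add +
  fixes scaleC :: "complex \<Rightarrow> 'a \<Rightarrow> 'a"  (infixr \<open>*\<^sub>C\<close> 75)
  assumes scaleC_add_right: "a *\<^sub>C (x + y) = a *\<^sub>C x + a *\<^sub>C y"
    and scaleC_add_left: "(a + b) *\<^sub>C x = a *\<^sub>C x + b *\<^sub>C x"
    and scaleC_scaleC: "a *\<^sub>C b *\<^sub>C x = (a * b) *\<^sub>C x"
    and scaleC_one: "1 *\<^sub>C x = x"

global_interpretation cvec: vector_space "scaleC :: complex \<Rightarrow> 'a \<Rightarrow> 'a::complex_vector"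
  by unfold_locales (auto simp: scaleC_add_right scaleC_add_left scaleC_scaleC scaleC_one)

instantiation complex :: complex_vector
begin
definition scaleC_complex :: "complex \<Rightarrow> complex \<Rightarrow> complex" where
  "scaleC_complex a x = a * x"
instance by standard (auto simp: scaleC_complex_def algebra_simps)
end

instantiation "fun" :: (type, complex_vector) complex_vector
begin
definition scaleC_fun :: "complex \<Rightarrow> ('a \<Rightarrow> 'b) \<Rightarrow> 'a \<Rightarrow> 'b" where
  "scaleC_fun a f = (\<lambda>x. a *\<^sub>C f x)"
instance
  by standard
    (auto simp: scaleC_fun_def plus_fun_def scaleC_add_right scaleC_add_left
      scaleC_scaleC scaleC_one)
end

definition linear_on :: "'a::complex_vector set \<Rightarrow> ('a \<Rightarrow> 'b::complex_vector) \<Rightarrow> bool" where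
  "linear_on W f \<longleftrightarrow>
     (\<forall>x\<in>W. \<forall>y\<in>W. f (x + y) = f x + f y) \<and> (\<forall>c. \<forall>x\<in>W. f (c *\<^sub>C x) = c *\<^sub>C f x)"

text \<open>Linear maps with domain the subspace \<open>W\<close>. They are extended by \<open>0\<close> outside \<open>W\<close>, so
  that a map is determined by its restriction to \<open>W\<close> and definite descriptions make sense.\<close>

definition linear_from :: "'a::complex_vector set \<Rightarrow> ('a \<Rightarrow> 'b::complex_vector) \<Rightarrow> bool" where
  "linear_from W f \<longleftrightarrow> linear_on W f \<and> (\<forall>x. x \<notin> W \<longrightarrow> f x = 0)"

definition dual_space :: "'a::complex_vector set \<Rightarrow> ('a \<Rightarrow> complex) set" where
  "dual_space W = {\<phi>. linear_from W \<phi>}"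

definition precomp :: "'a set \<Rightarrow> ('a \<Rightarrow> 'a) \<Rightarrow> ('a \<Rightarrow> complex) \<Rightarrow> 'a \<Rightarrow> complex" where
  "precomp W f \<phi> = (\<lambda>w. if w \<in> W then \<phi> (f w) else 0)"

text \<open>Locally finite sums: only finitely many terms are nonzero wherever this is used.\<close>

definition lfsum :: "'i set \<Rightarrow> ('i \<Rightarrow> 'a::comm_monoid_add) \<Rightarrow> 'a" where
  "lfsum S g = (\<Sum>s\<in>{s\<in>S. g s \<noteq> 0}. g s)"


section \<open>Kac--Moody algebras\<close>

text \<open>The Lie algebra is the whole type \<open>'g\<close>; simple roots are indexed by the finite type
  \<open>'n\<close>. \<open>cartan $ i $ j\<close> is \<open>a_ij = \<langle>\<alpha>_j, h_i\<rangle>\<close>; \<open>sroot i\<close> is \<open>\<alpha>_i\<close> as a functional on the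
  Cartan subalgebra \<open>csa\<close> (its values elsewhere are irrelevant); \<open>coroot i\<close> is \<open>h_i\<close>;
  \<open>form\<close> is the invariant bilinear form.\<close>

record ('n::finite, 'g) km_algebra =
  cartan :: "int ^ 'n ^ 'n"
  bracket :: "'g \<Rightarrow> 'g \<Rightarrow> 'g"
  csa :: "'g set"
  sroot :: "'n \<Rightarrow> 'g \<Rightarrow> complex"
  coroot :: "'n \<Rightarrow> 'g"
  gen_e :: "'n \<Rightarrow> 'g"
  gen_f :: "'n \<Rightarrow> 'g"
  form :: "'g \<Rightarrow> 'g \<Rightarrow> complex"

definition symmetrizable_gcm :: "int ^ 'n ^ 'n::finite \<Rightarrow> bool" where
  "symmetrizable_gcm A \<longleftrightarrow>
     (\<forall>i. A $ i $ i = 2) \<and>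
     (\<forall>i j. i \<noteq> j \<longrightarrow> A $ i $ j \<le> 0) \<and>
     (\<forall>i j. A $ i $ j = 0 \<longrightarrow> A $ j $ i = 0) \<and>
     (\<exists>d :: 'n \<Rightarrow> complex. (\<forall>i. d i \<noteq> 0) \<and>
        (\<forall>i j. d i * of_int (A $ i $ j) = d j * of_int (A $ j $ i)))"

definition lie_bracket :: "('g::complex_vector \<Rightarrow> 'g \<Rightarrow> 'g) \<Rightarrow> bool" where
  "lie_bracket br \<longleftrightarrow>
     (\<forall>x. linear_on UNIV (br x)) \<and> (\<forall>y. linear_on UNIV (\<lambda>x. br x y)) \<and>
     (\<forall>x. br x x = 0) \<and>
     (\<forall>x y z. br x (br y z) + br y (br z x) + br z (br x y) = 0)"

inductive_set lie_generated :: "('g::complex_vector \<Rightarrow> 'g \<Rightarrow> 'g) \<Rightarrow> 'g set \<Rightarrow> 'g set"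
  for br S where
    base: "x \<in> S \<Longrightarrow> x \<in> lie_generated br S"
  | zero: "0 \<in> lie_generated br S"
  | add: "x \<in> lie_generated br S \<Longrightarrow> y \<in> lie_generated br S \<Longrightarrow> x + y \<in> lie_generated br S"
  | scale: "x \<in> lie_generated br S \<Longrightarrow> c *\<^sub>C x \<in> lie_generated br S"
  | bracket: "x \<in> lie_generated br S \<Longrightarrow> y \<in> lie_generated br S \<Longrightarrow> br x y \<in> lie_generated br S"

definition lie_ideal :: "('g::complex_vector \<Rightarrow> 'g \<Rightarrow> 'g) \<Rightarrow> 'g set \<Rightarrow> bool" where
  "lie_ideal br J \<longleftrightarrow> cvec.subspace J \<and> (\<forall>x. \<forall>y\<in>J. br x y \<in> J)"

definition realization :: "('n::finite, 'g::complex_vector) km_algebra \<Rightarrow> bool" where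
  "realization K \<longleftrightarrow>
     (\<exists>Bs. finite Bs \<and> cvec.independent Bs \<and> cvec.span Bs = csa K \<and>
        card Bs = 2 * CARD('n) - rank (map_matrix complex_of_int (cartan K))) \<and>
     (\<forall>i. linear_on (csa K) (sroot K i)) \<and>
     (\<forall>i. coroot K i \<in> csa K) \<and>
     (\<forall>c. (\<forall>x\<in>csa K. (\<Sum>i\<in>UNIV. c i * sroot K i x) = 0) \<longrightarrow> (\<forall>i. c i = 0)) \<and>
     (\<forall>c. (\<Sum>i\<in>UNIV. c i *\<^sub>C coroot K i) = 0 \<longrightarrow> (\<forall>i. c i = 0)) \<and>
     (\<forall>i j. sroot K j (coroot K i) = of_int (cartan K $ i $ j))"

definition nondegenerate_on :: "('g::zero \<Rightarrow> 'g \<Rightarrow> complex) \<Rightarrow> 'g set \<Rightarrow> bool" where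
  "nondegenerate_on b W \<longleftrightarrow> (\<forall>x\<in>W. (\<forall>y\<in>W. b x y = 0) \<longrightarrow> x = 0)"

text \<open>A Kac--Moody algebra: the Lie algebra generated by \<open>\<hh>\<close>, \<open>e_i\<close>, \<open>f_i\<close> subject to the
  Chevalley relations, divided by the largest ideal meeting \<open>\<hh>\<close> trivially. Being such a quotient
  means: the relations hold, the generators generate, and no nonzero ideal meets \<open>\<hh>\<close>
  trivially.\<close>

definition symmetrizable_kac_moody :: "('n::finite, 'g::complex_vector) km_algebra \<Rightarrow> bool" where
  "symmetrizable_kac_moody K \<longleftrightarrow>
     symmetrizable_gcm (cartan K) \<and> lie_bracket (bracket K) \<and> realization K \<and>
     (\<forall>x\<in>csa K. \<forall>y\<in>csa K. bracket K x y = 0) \<and>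
     (\<forall>x\<in>csa K. \<forall>i. bracket K x (gen_e K i) = sroot K i x *\<^sub>C gen_e K i) \<and>
     (\<forall>x\<in>csa K. \<forall>i. bracket K x (gen_f K i) = (- sroot K i x) *\<^sub>C gen_f K i) \<and>
     (\<forall>i j. bracket K (gen_e K i) (gen_f K j) = (if i = j then coroot K i else 0)) \<and>
     lie_generated (bracket K) (csa K \<union> range (gen_e K) \<union> range (gen_f K)) = UNIV \<and>
     (\<forall>J. lie_ideal (bracket K) J \<and> J \<inter> csa K = {0} \<longrightarrow> J = {0})"

definition invariant_form :: "('n::finite, 'g::complex_vector) km_algebra \<Rightarrow> bool" where
  "invariant_form K \<longleftrightarrow>
     (\<forall>x. linear_on UNIV (form K x)) \<and> (\<forall>x y. form K x y = form K y x) \<and>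
     (\<forall>x y z. form K (bracket K x y) z = form K x (bracket K y z)) \<and>
     nondegenerate_on (form K) UNIV"

text \<open>From here on \<open>\<hh>\<close> is identified with \<open>\<hh>\<^sup>*\<close> through the form: a weight is an element
  \<open>\<kappa>\<close> of \<open>csa K\<close>, with \<open>\<langle>\<kappa>, x\<rangle> = form K \<kappa> x\<close> for \<open>x\<close> in \<open>csa K\<close>. \<open>root K i\<close> is the element
  so identified with the functional \<open>\<alpha>_i\<close>.\<close>

definition root :: "('n::finite, 'g) km_algebra \<Rightarrow> 'n \<Rightarrow> 'g" where
  "root K i = (THE y. y \<in> csa K \<and> (\<forall>x\<in>csa K. form K y x = sroot K i x))"

definition pos_lattice :: "('n::finite, 'g::complex_vector) km_algebra \<Rightarrow> 'g set" where
  "pos_lattice K = {(\<Sum>i\<in>UNIV. of_nat (c i) *\<^sub>C root K i) | c :: 'n \<Rightarrow> nat. True}"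

definition root_space :: "('n::finite, 'g::complex_vector) km_algebra \<Rightarrow> 'g \<Rightarrow> 'g set" where
  "root_space K \<alpha> = {y. \<forall>x\<in>csa K. bracket K x y = form K \<alpha> x *\<^sub>C y}"

definition pos_roots :: "('n::finite, 'g::complex_vector) km_algebra \<Rightarrow> 'g set" where
  "pos_roots K = {\<alpha> \<in> pos_lattice K. \<alpha> \<noteq> 0 \<and> root_space K \<alpha> \<noteq> {0}}"

definition n_plus :: "('n::finite, 'g::complex_vector) km_algebra \<Rightarrow> 'g set" where
  "n_plus K = lie_generated (bracket K) (range (gen_e K))"

definition n_minus :: "('n::finite, 'g::complex_vector) km_algebra \<Rightarrow> 'g set" where
  "n_minus K = lie_generated (bracket K) (range (gen_f K))"

definition weyl_vector :: "('n::finite, 'g) km_algebra \<Rightarrow> 'g \<Rightarrow> bool" where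
  "weyl_vector K \<rho> \<longleftrightarrow> \<rho> \<in> csa K \<and> (\<forall>i. form K \<rho> (coroot K i) = 1)"

definition Delta :: "('n::finite, 'g::complex_vector) km_algebra \<Rightarrow> 'g \<Rightarrow> 'g \<Rightarrow> complex" where
  "Delta K \<rho> \<kappa> = form K \<kappa> (\<kappa> + 2 *\<^sub>C \<rho>)"

text \<open>\<open>f_\<alpha>\<close> and \<open>h_\<alpha>\<close> for \<open>\<alpha> = \<alpha>_i\<close>; here \<open>e_\<alpha> = e_i\<close>.\<close>

definition simple_f :: "('n::finite, 'g::complex_vector) km_algebra \<Rightarrow> 'n \<Rightarrow> 'g" where
  "simple_f K i = (1 / form K (gen_e K i) (gen_f K i)) *\<^sub>C gen_f K i"

definition simple_h :: "('n::finite, 'g::complex_vector) km_algebra \<Rightarrow> 'n \<Rightarrow> 'g" where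
  "simple_h K i = bracket K (gen_e K i) (simple_f K i)"


section \<open>Generalized Belavin--Drinfeld triples\<close>

text \<open>\<open>\<Gamma>\<^sub>1\<close>, \<open>\<Gamma>\<^sub>2\<close> and \<open>T\<close> are given on indices of simple roots; \<open>T\<close> only matters on \<open>\<Gamma>\<^sub>1\<close>.\<close>

record 'n triple =
  Gam1 :: "'n set"
  Gam2 :: "'n set"
  Tmap :: "'n \<Rightarrow> 'n"

definition BD_triple :: "('n::finite, 'g) km_algebra \<Rightarrow> 'n triple \<Rightarrow> bool" where
  "BD_triple K \<tau> \<longleftrightarrow>
     bij_betw (Tmap \<tau>) (Gam1 \<tau>) (Gam2 \<tau>) \<and>
     (\<forall>i\<in>Gam1 \<tau>. \<forall>j\<in>Gam1 \<tau>.
        form K (root K (Tmap \<tau> i)) (root K (Tmap \<tau> j)) = form K (root K i) (root K j))"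

text \<open>The subspaces \<open>\<ll>\<close> and \<open>\<hh>\<^sub>0\<close> of \<open>\<hh>\<close>. With the identification above, \<open>lsub\<close> is also \<open>\<ll>\<^sup>*\<close>.\<close>

definition lsub :: "('n::finite, 'g::complex_vector) km_algebra \<Rightarrow> 'n triple \<Rightarrow> 'g set" where
  "lsub K \<tau> = {x \<in> csa K. \<forall>y \<in> cvec.span {root K i - root K (Tmap \<tau> i) | i. i \<in> Gam1 \<tau>}.
                 form K y x = 0}"

definition h0sub :: "('n::finite, 'g::complex_vector) km_algebra \<Rightarrow> 'n triple \<Rightarrow> 'g set" where
  "h0sub K \<tau> = {x \<in> csa K. \<forall>y \<in> lsub K \<tau>. form K y x = 0}"

definition nondegenerate_triple :: "('n::finite, 'g::complex_vector) km_algebra \<Rightarrow> 'n triple \<Rightarrow> bool" where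
  "nondegenerate_triple K \<tau> \<longleftrightarrow> nondegenerate_on (form K) (lsub K \<tau>)"

text \<open>Restriction of a weight to \<open>\<ll>\<close>, i.e. orthogonal projection \<open>\<hh> \<rightarrow> \<ll>\<close>.\<close>

definition lproj :: "('n::finite, 'g::complex_vector) km_algebra \<Rightarrow> 'n triple \<Rightarrow> 'g \<Rightarrow> 'g" where
  "lproj K \<tau> \<kappa> = (THE y. y \<in> lsub K \<tau> \<and> (\<forall>x\<in>lsub K \<tau>. form K y x = form K \<kappa> x))"

definition cayley :: "('n::finite, 'g::complex_vector) km_algebra \<Rightarrow> 'n triple \<Rightarrow> 'g \<Rightarrow> 'g" where
  "cayley K \<tau> x = (THE y. y \<in> h0sub K \<tau> \<and>
     (\<forall>i\<in>Gam1 \<tau>. form K (root K i - root K (Tmap \<tau> i)) y = form K (root K i + root K (Tmap \<tau> i)) x))"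

definition Gam3 :: "'n triple \<Rightarrow> 'n set" where
  "Gam3 \<tau> = {i. \<exists>k>0. (\<forall>m<k. (Tmap \<tau> ^^ m) i \<in> Gam1 \<tau>) \<and> (Tmap \<tau> ^^ k) i = i}"

definition Gam3_comb :: "('n::finite, 'g::complex_vector) km_algebra \<Rightarrow> 'n triple \<Rightarrow> ('n \<Rightarrow> nat) \<Rightarrow> 'g \<Rightarrow> bool" where
  "Gam3_comb K \<tau> c \<alpha> \<longleftrightarrow> (\<forall>i. c i \<noteq> 0 \<longrightarrow> i \<in> Gam3 \<tau>) \<and> \<alpha> = (\<Sum>i\<in>UNIV. of_nat (c i) *\<^sub>C root K i)"

definition Gam3_roots :: "('n::finite, 'g::complex_vector) km_algebra \<Rightarrow> 'n triple \<Rightarrow> 'g set" where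
  "Gam3_roots K \<tau> = {\<alpha> \<in> pos_roots K. \<exists>c. Gam3_comb K \<tau> c \<alpha>}"

text \<open>\<open>T\<close> extended additively to combinations of \<open>\<Gamma>\<^sub>3\<close>, and the orbit length \<open>N_\<alpha>\<close>.\<close>

definition T_root :: "('n::finite, 'g::complex_vector) km_algebra \<Rightarrow> 'n triple \<Rightarrow> 'g \<Rightarrow> 'g" where
  "T_root K \<tau> \<alpha> = (THE \<beta>. \<exists>c. Gam3_comb K \<tau> c \<alpha> \<and> \<beta> = (\<Sum>i\<in>UNIV. of_nat (c i) *\<^sub>C root K (Tmap \<tau> i)))"

definition orbit_length :: "('n::finite, 'g::complex_vector) km_algebra \<Rightarrow> 'n triple \<Rightarrow> 'g \<Rightarrow> nat" where
  "orbit_length K \<tau> \<alpha> = (LEAST N. N > 0 \<and> (T_root K \<tau> ^^ N) \<alpha> = \<alpha>)"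

definition lie_hom_from :: "('n::finite, 'g::complex_vector) km_algebra \<Rightarrow> 'g set \<Rightarrow> 'g set \<Rightarrow> ('g \<Rightarrow> 'g) \<Rightarrow> bool" where
  "lie_hom_from K S S' b \<longleftrightarrow> linear_from S b \<and> b ` S \<subseteq> S' \<and>
     (\<forall>x\<in>S. \<forall>y\<in>S. b (bracket K x y) = bracket K (b x) (b y))"

definition h_span :: "('n::finite, 'g::complex_vector) km_algebra \<Rightarrow> 'n set \<Rightarrow> 'g set" where
  "h_span K G = cvec.span (simple_h K ` G)"

definition sum_space :: "'g::plus set \<Rightarrow> 'g set \<Rightarrow> 'g set" where
  "sum_space S S' = {x + y | x y. x \<in> S \<and> y \<in> S'}"

definition Bmap :: "('n::finite, 'g::complex_vector) km_algebra \<Rightarrow> 'n triple \<Rightarrow> 'g \<Rightarrow> 'g" where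
  "Bmap K \<tau> = (THE b.
     lie_hom_from K (sum_space (n_minus K) (h_span K (Gam1 \<tau>)))
                    (sum_space (n_minus K) (h_span K (Gam2 \<tau>))) b \<and>
     (\<forall>i\<in>Gam1 \<tau>. b (simple_f K i) = simple_f K (Tmap \<tau> i) \<and> b (simple_h K i) = simple_h K (Tmap \<tau> i)) \<and>
     (\<forall>i. i \<notin> Gam1 \<tau> \<longrightarrow> b (simple_f K i) = 0))"

definition Binv :: "('n::finite, 'g::complex_vector) km_algebra \<Rightarrow> 'n triple \<Rightarrow> 'g \<Rightarrow> 'g" where
  "Binv K \<tau> = (THE b.
     lie_hom_from K (sum_space (n_plus K) (h_span K (Gam2 \<tau>)))
                    (sum_space (n_plus K) (h_span K (Gam1 \<tau>))) b \<and>
     (\<forall>i\<in>Gam1 \<tau>. b (gen_e K (Tmap \<tau> i)) = gen_e K i \<and> b (simple_h K (Tmap \<tau> i)) = simple_h K i) \<and>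
     (\<forall>i. i \<notin> Gam2 \<tau> \<longrightarrow> b (gen_e K i) = 0))"


section \<open>Bases\<close>

text \<open>\<open>eb \<alpha> t\<close> and \<open>fb \<alpha> t\<close>, for \<open>1 \<le> t \<le> dim \<gg>_\<alpha>\<close>, are \<open>e_\<alpha>\<^sup>(\<^sup>t\<^sup>)\<close> and \<open>f_\<alpha>\<^sup>(\<^sup>t\<^sup>)\<close>;
  \<open>onb j\<close>, for \<open>j\<close> in \<open>I = I1 \<union> I2\<close>, is \<open>x_j\<close>.\<close>

record 'g bases =
  eb :: "'g \<Rightarrow> nat \<Rightarrow> 'g"
  fb :: "'g \<Rightarrow> nat \<Rightarrow> 'g"
  onb :: "nat \<Rightarrow> 'g"
  I1 :: "nat set"
  I2 :: "nat set"

definition root_mult :: "('n::finite, 'g::complex_vector) km_algebra \<Rightarrow> 'g \<Rightarrow> nat" where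
  "root_mult K \<alpha> = cvec.dim (root_space K \<alpha>)"

text \<open>Linear independence of the two families follows from duality. On the part of \<open>\<nn>\<^sub>+\<close>
  generated by \<open>e_i\<close>, \<open>i\<close> in \<open>\<Gamma>\<^sub>3\<close>, the map \<open>Binv\<close> is the inverse of the automorphism \<open>B\<close>, so the last
  equation says \<open>B\<^sup>N e = \<theta>\<^sup>-\<^sup>1 e\<close>.\<close>

definition root_bases :: "('n::finite, 'g::complex_vector) km_algebra \<Rightarrow> 'n triple \<Rightarrow> 'g bases \<Rightarrow> bool" where
  "root_bases K \<tau> D \<longleftrightarrow>
     (\<forall>\<alpha>\<in>pos_roots K.
        cvec.span (eb D \<alpha> ` {1..root_mult K \<alpha>}) = root_space K \<alpha> \<and>
        cvec.span (fb D \<alpha> ` {1..root_mult K \<alpha>}) = root_space K (- \<alpha>) \<and>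
        (\<forall>s\<in>{1..root_mult K \<alpha>}. \<forall>t\<in>{1..root_mult K \<alpha>}.
           form K (eb D \<alpha> s) (fb D \<alpha> t) = (if s = t then 1 else 0))) \<and>
     (\<forall>i. eb D (root K i) 1 = gen_e K i \<and> fb D (root K i) 1 = simple_f K i) \<and>
     (\<forall>\<alpha>\<in>Gam3_roots K \<tau>. \<forall>t\<in>{1..root_mult K \<alpha>}. \<exists>\<theta>. \<theta> \<noteq> 0 \<and>
        (Bmap K \<tau> ^^ orbit_length K \<tau> \<alpha>) (fb D \<alpha> t) = \<theta> *\<^sub>C fb D \<alpha> t \<and>
        (Binv K \<tau> ^^ orbit_length K \<tau> \<alpha>) (eb D \<alpha> t) = \<theta> *\<^sub>C eb D \<alpha> t)"

definition adapted_onb :: "('n::finite, 'g::complex_vector) km_algebra \<Rightarrow> 'n triple \<Rightarrow> 'g bases \<Rightarrow> bool" where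
  "adapted_onb K \<tau> D \<longleftrightarrow>
     finite (I1 D) \<and> finite (I2 D) \<and> I1 D \<inter> I2 D = {} \<and>
     (\<forall>j\<in>I1 D \<union> I2 D. \<forall>k\<in>I1 D \<union> I2 D. form K (onb D j) (onb D k) = (if j = k then 1 else 0)) \<and>
     cvec.span (onb D ` I1 D) = lsub K \<tau> \<and> cvec.span (onb D ` I2 D) = h0sub K \<tau>"


section \<open>Modules\<close>

text \<open>Modules are subspaces of an ambient type, so that modules of different size can share it.\<close>

record ('g, 'v) gmod =
  mcarr :: "'v set"
  mact :: "'g \<Rightarrow> 'v \<Rightarrow> 'v"

definition g_module :: "('n::finite, 'g::complex_vector) km_algebra \<Rightarrow> ('g, 'v::complex_vector) gmod \<Rightarrow> bool" where
  "g_module K N \<longleftrightarrow> cvec.subspace (mcarr N) \<and>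
     (\<forall>x. linear_on (mcarr N) (mact N x) \<and> mact N x ` mcarr N \<subseteq> mcarr N) \<and>
     (\<forall>w\<in>mcarr N. linear_on UNIV (\<lambda>x. mact N x w)) \<and>
     (\<forall>x y. \<forall>w\<in>mcarr N. mact N (bracket K x y) w = mact N x (mact N y w) - mact N y (mact N x w))"

definition weight_space :: "('n::finite, 'g) km_algebra \<Rightarrow> ('g, 'v::complex_vector) gmod \<Rightarrow> 'g \<Rightarrow> 'v set" where
  "weight_space K N \<kappa> = {w \<in> mcarr N. \<forall>x\<in>csa K. mact N x w = form K \<kappa> x *\<^sub>C w}"

definition category_O :: "('n::finite, 'g::complex_vector) km_algebra \<Rightarrow> ('g, 'v::complex_vector) gmod \<Rightarrow> bool" where
  "category_O K N \<longleftrightarrow> g_module K N \<and>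
     mcarr N = cvec.span (\<Union>\<kappa>\<in>csa K. weight_space K N \<kappa>) \<and>
     (\<forall>\<kappa>\<in>csa K. \<exists>Bs. finite Bs \<and> weight_space K N \<kappa> \<subseteq> cvec.span Bs) \<and>
     (\<exists>S. finite S \<and> S \<subseteq> csa K \<and>
        (\<forall>\<kappa>\<in>csa K. weight_space K N \<kappa> \<noteq> {0} \<longrightarrow> (\<exists>s\<in>S. s - \<kappa> \<in> pos_lattice K)))"

definition irreducible_module :: "('g, 'v::complex_vector) gmod \<Rightarrow> bool" where
  "irreducible_module N \<longleftrightarrow> mcarr N \<noteq> {0} \<and>
     (\<forall>W. W \<subseteq> mcarr N \<and> cvec.subspace W \<and> (\<forall>x. mact N x ` W \<subseteq> W) \<longrightarrow> W = {0} \<or> W = mcarr N)"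

definition graded_dual :: "('n::finite, 'g) km_algebra \<Rightarrow> ('g, 'v::complex_vector) gmod \<Rightarrow> ('g, 'v \<Rightarrow> complex) gmod" where
  "graded_dual K N =
     \<lparr> mcarr = {\<psi> \<in> dual_space (mcarr N). finite {\<kappa>\<in>csa K. \<exists>w\<in>weight_space K N \<kappa>. \<psi> w \<noteq> 0}},
       mact = (\<lambda>x \<psi>. - precomp (mcarr N) (mact N x) \<psi>) \<rparr>"


section \<open>Verma modules\<close>

text \<open>The tensor algebra of \<open>\<gg>\<close> is the space of finite combinations of words in \<open>\<gg>\<close>. Dividing it
  by the span of the first two families below gives \<open>U\<gg>\<close>, and the last two families span the left
  ideal of \<open>U\<gg>\<close> generated by \<open>\<nn>\<^sub>+\<close> and all \<open>x - \<langle>\<kappa>, x\<rangle>\<close>. Hence a Verma module is a module with a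
  vector \<open>u\<close> such that \<open>w \<mapsto> w u\<close> identifies it with the quotient of words by these relations.\<close>

definition word :: "'g list \<Rightarrow> 'g list \<Rightarrow> complex" where
  "word w = (\<lambda>u. if u = w then 1 else 0)"

definition verma_relations :: "('n::finite, 'g::complex_vector) km_algebra \<Rightarrow> 'g \<Rightarrow> ('g list \<Rightarrow> complex) set" where
  "verma_relations K \<kappa> =
     {word (u @ [c *\<^sub>C a + b] @ w) - c *\<^sub>C word (u @ [a] @ w) - word (u @ [b] @ w) | u w a b c. True} \<union>
     {word (u @ [a, b] @ w) - word (u @ [b, a] @ w) - word (u @ [bracket K a b] @ w) | u w a b. True} \<union>
     {word (u @ [x]) | u x. x \<in> n_plus K} \<union>
     {word (u @ [x]) - form K \<kappa> x *\<^sub>C word u | u x. x \<in> csa K}"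

definition word_eval :: "('g, 'm::complex_vector) gmod \<Rightarrow> 'm \<Rightarrow> ('g list \<Rightarrow> complex) \<Rightarrow> 'm" where
  "word_eval N u p = (\<Sum>w\<in>{w. p w \<noteq> 0}. p w *\<^sub>C foldr (mact N) w u)"

definition verma_module :: "('n::finite, 'g::complex_vector) km_algebra \<Rightarrow> 'g \<Rightarrow> ('g, 'm::complex_vector) gmod \<Rightarrow> 'm \<Rightarrow> bool" where
  "verma_module K \<kappa> N u \<longleftrightarrow> g_module K N \<and> u \<in> mcarr N \<and>
     word_eval N u ` cvec.span (range word) = mcarr N \<and>
     {p \<in> cvec.span (range word). word_eval N u p = 0} = cvec.span (verma_relations K \<kappa>)"

definition dual_vacuum :: "('n::finite, 'g::complex_vector) km_algebra \<Rightarrow> ('g, 'm::complex_vector) gmod \<Rightarrow> 'g \<Rightarrow> 'm \<Rightarrow> 'm \<Rightarrow> complex" where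
  "dual_vacuum K N \<kappa> u = (THE \<psi>. \<psi> \<in> weight_space K (graded_dual K N) (- \<kappa>) \<and> \<psi> u = 1)"

text \<open>The map \<open>B\<close> between Verma modules \<open>N'\<close>, \<open>N\<close> with highest weight vectors \<open>u'\<close>, \<open>u\<close>. Words in
  \<open>\<nn>\<^sub>-\<close> span \<open>U\<nn>\<^sub>-\<close>.\<close>

definition Bverma :: "('n::finite, 'g::complex_vector) km_algebra \<Rightarrow> 'n triple \<Rightarrow> ('g, 'm::complex_vector) gmod \<Rightarrow> 'm \<Rightarrow> ('g, 'm) gmod \<Rightarrow> 'm \<Rightarrow> 'm \<Rightarrow> 'm" where
  "Bverma K \<tau> N' u' N u = (THE b. linear_from (mcarr N') b \<and>
     (\<forall>ws. set ws \<subseteq> n_minus K \<longrightarrow>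
        b (foldr (mact N') ws u') = foldr (mact N) (map (Bmap K \<tau>) ws) u))"


section \<open>Tensor products and intertwiners\<close>

text \<open>\<open>M \<otimes> V\<close> is realized faithfully inside the maps \<open>V\<^sup>* \<rightarrow> M\<close>, with \<open>m \<otimes> w\<close> acting as
  \<open>\<phi> \<mapsto> \<phi>(w) m\<close>. Functions are set to \<open>0\<close> outside \<open>V\<^sup>*\<close>.\<close>

definition mv_pure :: "('g, 'v::complex_vector) gmod \<Rightarrow> 'm::complex_vector \<Rightarrow> 'v \<Rightarrow> ('v \<Rightarrow> complex) \<Rightarrow> 'm" where
  "mv_pure V m w = (\<lambda>\<phi>. if \<phi> \<in> dual_space (mcarr V) then \<phi> w *\<^sub>C m else 0)"

definition mv_tensor :: "('g, 'm::complex_vector) gmod \<Rightarrow> ('g, 'v::complex_vector) gmod \<Rightarrow> (('v \<Rightarrow> complex) \<Rightarrow> 'm) set" where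
  "mv_tensor N V = cvec.span {mv_pure V m w | m w. m \<in> mcarr N \<and> w \<in> mcarr V}"

definition mv_act :: "('g, 'm::complex_vector) gmod \<Rightarrow> ('g, 'v::complex_vector) gmod \<Rightarrow> 'g \<Rightarrow> (('v \<Rightarrow> complex) \<Rightarrow> 'm) \<Rightarrow> ('v \<Rightarrow> complex) \<Rightarrow> 'm" where
  "mv_act N V x t = (\<lambda>\<phi>. if \<phi> \<in> dual_space (mcarr V)
     then mact N x (t \<phi>) + t (precomp (mcarr V) (mact V x) \<phi>) else 0)"

lemma precomp_dual_space:
  assumes "g_module K V" and "\<phi> \<in> dual_space (mcarr V)"
  shows "precomp (mcarr V) (mact V x) \<phi> \<in> dual_space (mcarr V)"
  using assms
  by (auto simp: g_module_def dual_space_def linear_from_def linear_on_def precomp_def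
      image_subset_iff cvec.subspace_add cvec.subspace_scale)

lemma mv_act_pure:
  assumes "g_module K V" and "g_module K N" and "w \<in> mcarr V" and "m \<in> mcarr N"
  shows "mv_act N V x (mv_pure V m w) = mv_pure V (mact N x m) w + mv_pure V m (mact V x w)"
  using precomp_dual_space[OF assms(1)] assms
  by (auto simp: mv_act_def mv_pure_def precomp_def plus_fun_def g_module_def linear_on_def)

text \<open>\<open>V_1 \<otimes> \<dots> \<otimes> V_r\<close> is likewise realized inside the functions of families of functionals
  \<open>(\<phi>_1, \<dots>, \<phi>_r)\<close>, as the span of the \<open>pure_tensor V r w\<close>. The operator \<open>x\<close> acting in the \<open>k\<close>-th
  factor is \<open>slot V r k x\<close>.\<close>

type_synonym 'v tensor = "(nat \<Rightarrow> 'v \<Rightarrow> complex) \<Rightarrow> complex"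

definition dual_families :: "(nat \<Rightarrow> ('g, 'v::complex_vector) gmod) \<Rightarrow> nat \<Rightarrow> (nat \<Rightarrow> 'v \<Rightarrow> complex) set" where
  "dual_families V r = {\<phi>. \<forall>k\<in>{1..r}. \<phi> k \<in> dual_space (mcarr (V k))}"

definition pure_tensor :: "(nat \<Rightarrow> ('g, 'v::complex_vector) gmod) \<Rightarrow> nat \<Rightarrow> (nat \<Rightarrow> 'v) \<Rightarrow> 'v tensor" where
  "pure_tensor V r w = (\<lambda>\<phi>. if \<phi> \<in> dual_families V r then \<Prod>k\<in>{1..r}. \<phi> k (w k) else 0)"

definition slot :: "(nat \<Rightarrow> ('g, 'v::complex_vector) gmod) \<Rightarrow> nat \<Rightarrow> nat \<Rightarrow> 'g \<Rightarrow> 'v tensor \<Rightarrow> 'v tensor" where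
  "slot V r k x t = (\<lambda>\<phi>. if \<phi> \<in> dual_families V r
     then t (\<phi>(k := precomp (mcarr (V k)) (mact (V k) x) (\<phi> k))) else 0)"

lemma slot_pure_tensor:
  assumes "\<forall>k\<in>{1..r}. g_module K (V k)" and "\<forall>k\<in>{1..r}. w k \<in> mcarr (V k)" and "k \<in> {1..r}"
  shows "slot V r k x (pure_tensor V r w) = pure_tensor V r (w(k := mact (V k) x (w k)))"
proof
  fix \<phi>
  have "\<phi>(k := precomp (mcarr (V k)) (mact (V k) x) (\<phi> k)) \<in> dual_families V r"
    if "\<phi> \<in> dual_families V r"
    using that assms precomp_dual_space by (fastforce simp: dual_families_def)
  moreover have "(\<Prod>j\<in>{1..r}. (\<phi>(k := precomp (mcarr (V k)) (mact (V k) x) (\<phi> k))) j (w j))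
      = (\<Prod>j\<in>{1..r}. \<phi> j ((w(k := mact (V k) x (w k))) j))"
    using assms by (intro prod.cong) (auto simp: precomp_def)
  ultimately show "slot V r k x (pure_tensor V r w) \<phi>
      = pure_tensor V r (w(k := mact (V k) x (w k))) \<phi>"
    by (auto simp: slot_def pure_tensor_def)
qed

text \<open>\<open>\<Phi>\<^sup>w_\<kappa> : M_\<kappa> \<rightarrow> M_\<^bsub>\<kappa>-\<nu>\<^esub> \<otimes> V\<close> for \<open>w\<close> of weight \<open>\<nu>\<close>, where \<open>M \<kappa>\<close> is the Verma module
  with highest weight vector \<open>vac \<kappa>\<close>. The last condition is \<open>\<langle>v\<^sup>*_\<^bsub>\<kappa>-\<nu>\<^esub>, \<Phi> v_\<kappa>\<rangle> = w\<close>, tested against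
  all functionals on \<open>V\<close>.\<close>

definition intertwiner ::
  "('n::finite, 'g::complex_vector) km_algebra \<Rightarrow> ('g \<Rightarrow> ('g, 'm::complex_vector) gmod) \<Rightarrow> ('g \<Rightarrow> 'm) \<Rightarrow>
   ('g, 'v::complex_vector) gmod \<Rightarrow> 'v \<Rightarrow> 'g \<Rightarrow> 'g \<Rightarrow> 'm \<Rightarrow> ('v \<Rightarrow> complex) \<Rightarrow> 'm" where
  "intertwiner K M vac V w \<nu> \<kappa> = (THE \<Phi>.
     linear_from (mcarr (M \<kappa>)) \<Phi> \<and>
     \<Phi> ` mcarr (M \<kappa>) \<subseteq> mv_tensor (M (\<kappa> - \<nu>)) V \<and>
     (\<forall>x. \<forall>m\<in>mcarr (M \<kappa>). \<Phi> (mact (M \<kappa>) x m) = mv_act (M (\<kappa> - \<nu>)) V x (\<Phi> m)) \<and>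
     (\<forall>\<phi>\<in>dual_space (mcarr V).
        dual_vacuum K (M (\<kappa> - \<nu>)) (\<kappa> - \<nu>) (vac (\<kappa> - \<nu>)) (\<Phi> (vac \<kappa>) \<phi>) = \<phi> w))"


section \<open>Formal series and traces\<close>

text \<open>A formal series in \<open>\<lambda>\<close> in \<open>\<ll>\<^sup>*\<close> is a formal combination of exponentials \<open>e\<^sup>(\<^sup>\<lambda>\<^sup>,\<^sup>\<eta>\<^sup>)\<close>, \<open>\<eta>\<close> in
  \<open>\<ll>\<close>. It is encoded by its coefficient function \<open>\<eta> \<mapsto> F \<eta>\<close>, which vanishes off \<open>\<ll>\<close>. Exponents
  lie in finitely many cones, so products make sense.\<close>

definition formal_series :: "('n::finite, 'g::complex_vector) km_algebra \<Rightarrow> 'n triple \<Rightarrow> ('g \<Rightarrow> 'a::zero) \<Rightarrow> bool" where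
  "formal_series K \<tau> F \<longleftrightarrow> (\<exists>S. finite S \<and> S \<subseteq> lsub K \<tau> \<and>
     (\<forall>\<eta>. F \<eta> \<noteq> 0 \<longrightarrow> \<eta> \<in> lsub K \<tau> \<and> (\<exists>s\<in>S. s - \<eta> \<in> lproj K \<tau> ` pos_lattice K)))"

definition series_mult ::
  "('n::finite, 'g::complex_vector) km_algebra \<Rightarrow> 'n triple \<Rightarrow> ('g \<Rightarrow> complex) \<Rightarrow> ('g \<Rightarrow> 'a::complex_vector) \<Rightarrow> 'g \<Rightarrow> 'a" where
  "series_mult K \<tau> d F = (\<lambda>\<eta>. lfsum (lsub K \<tau>) (\<lambda>\<xi>. d \<xi> *\<^sub>C F (\<eta> - \<xi>)))"

definition series_one :: "'g::zero \<Rightarrow> complex" where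
  "series_one = (\<lambda>\<eta>. if \<eta> = 0 then 1 else 0)"

definition series_inverse :: "('n::finite, 'g::complex_vector) km_algebra \<Rightarrow> 'n triple \<Rightarrow> ('g \<Rightarrow> complex) \<Rightarrow> 'g \<Rightarrow> complex" where
  "series_inverse K \<tau> F = (THE d. formal_series K \<tau> d \<and> series_mult K \<tau> d F = series_one)"

text \<open>Derivative with respect to \<open>\<lambda>\<close> in the direction of \<open>x\<close>: \<open>e\<^sup>(\<^sup>\<lambda>\<^sup>,\<^sup>\<eta>\<^sup>)\<close> is multiplied by
  \<open>\<langle>\<eta>, x\<rangle>\<close>.\<close>

definition series_deriv :: "('n::finite, 'g) km_algebra \<Rightarrow> 'g \<Rightarrow> ('g \<Rightarrow> 'a::complex_vector) \<Rightarrow> 'g \<Rightarrow> 'a" where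
  "series_deriv K x F = (\<lambda>\<eta>. form K \<eta> x *\<^sub>C F \<eta>)"

definition weight_basis :: "('n::finite, 'g::complex_vector) km_algebra \<Rightarrow> ('g, 'm::complex_vector) gmod \<Rightarrow> 'm set \<Rightarrow> bool" where
  "weight_basis K N Bs \<longleftrightarrow> cvec.independent Bs \<and> cvec.span Bs = mcarr N \<and>
     (\<forall>b\<in>Bs. \<exists>\<kappa>\<in>csa K. b \<in> weight_space K N \<kappa>)"

text \<open>\<open>Tr (A e\<^sup>\<lambda>)\<close> over \<open>N\<close>, for \<open>\<lambda>\<close> in \<open>\<ll>\<^sup>*\<close>. A basis vector \<open>b\<close> of weight \<open>\<kappa>\<close> contributes its
  diagonal entry of \<open>A\<close> times \<open>e\<^sup>(\<^sup>\<lambda>\<^sup>,\<^sup>\<kappa>\<^sup>)\<close>, so the coefficient at \<open>\<eta>\<close> is the sum over those \<open>b\<close> on which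
  \<open>\<ll>\<close> acts through \<open>\<eta>\<close>. There are finitely many when \<open>N\<close> is a Verma module, because \<open>\<ll>\<close> contains an
  element on which all simple roots take the value \<open>1\<close>. The choice of basis is immaterial.\<close>

definition twisted_trace ::
  "('n::finite, 'g::complex_vector) km_algebra \<Rightarrow> 'n triple \<Rightarrow> ('g, 'm::complex_vector) gmod \<Rightarrow> ('m \<Rightarrow> 'm) \<Rightarrow> 'g \<Rightarrow> complex" where
  "twisted_trace K \<tau> N A = (\<lambda>\<eta>. if \<eta> \<in> lsub K \<tau> then
     (let Bs = (SOME Bs. weight_basis K N Bs) in
        \<Sum>b\<in>{b\<in>Bs. \<forall>x\<in>lsub K \<tau>. mact N x b = form K \<eta> x *\<^sub>C b}. cvec.representation Bs (A b) b)
     else 0)"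

text \<open>\<open>F\<close> with values in \<open>V_1 \<otimes> \<dots> \<otimes> V_r\<close>. Evaluating the composition
  \<open>\<Phi>\<^sup>v\<^sup>1 \<cdots> \<Phi>\<^sup>v\<^sup>r B : M_\<^bsub>\<mu>-\<nu>\<^esub> \<rightarrow> M_\<^bsub>\<mu>-\<nu>\<^esub> \<otimes> V_1 \<otimes> \<dots> \<otimes> V_r\<close> on functionals \<open>\<phi>_1, \<dots>, \<phi>_r\<close> gives the
  endomorphism below of \<open>M_\<^bsub>\<mu>-\<nu>\<^esub>\<close>, in which \<open>\<Phi>\<^sup>v\<^sup>r\<close> is applied first.\<close>

definition trace_F ::
  "('n::finite, 'g::complex_vector) km_algebra \<Rightarrow> 'n triple \<Rightarrow> ('g \<Rightarrow> ('g, 'm::complex_vector) gmod) \<Rightarrow> ('g \<Rightarrow> 'm) \<Rightarrow>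
   nat \<Rightarrow> (nat \<Rightarrow> ('g, 'v::complex_vector) gmod) \<Rightarrow> (nat \<Rightarrow> 'v) \<Rightarrow> (nat \<Rightarrow> 'g) \<Rightarrow> 'g \<Rightarrow> 'g \<Rightarrow> 'v tensor" where
  "trace_F K \<tau> M vac r V v \<nu> \<mu> = (let \<mu>' = \<mu> - (\<Sum>k\<in>{1..r}. \<nu> k) in
     (\<lambda>\<eta> \<phi>. if \<phi> \<in> dual_families V r then
        twisted_trace K \<tau> (M \<mu>')
          (\<lambda>m. foldr (\<lambda>k m'. intertwiner K M vac (V k) (v k) (\<nu> k) (\<mu> - (\<Sum>j\<in>{k<..r}. \<nu> j)) m' (\<phi> k))
                 [1..<Suc r]
                 (Bverma K \<tau> (M \<mu>') (vac \<mu>') (M \<mu>) (vac \<mu>) m)) \<eta>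
      else 0))"

definition delta_B ::
  "('n::finite, 'g::complex_vector) km_algebra \<Rightarrow> 'n triple \<Rightarrow> ('g \<Rightarrow> ('g, 'm::complex_vector) gmod) \<Rightarrow> ('g \<Rightarrow> 'm) \<Rightarrow> 'g \<Rightarrow> 'g \<Rightarrow> complex" where
  "delta_B K \<tau> M vac \<rho> = series_inverse K \<tau>
     (twisted_trace K \<tau> (M (- \<rho>)) (Bverma K \<tau> (M (- \<rho>)) (vac (- \<rho>)) (M (- \<rho>)) (vac (- \<rho>))))"

definition trace_FF ::
  "('n::finite, 'g::complex_vector) km_algebra \<Rightarrow> 'n triple \<Rightarrow> 'g \<Rightarrow> ('g \<Rightarrow> ('g, 'm::complex_vector) gmod) \<Rightarrow> ('g \<Rightarrow> 'm) \<Rightarrow>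
   nat \<Rightarrow> (nat \<Rightarrow> ('g, 'v::complex_vector) gmod) \<Rightarrow> (nat \<Rightarrow> 'v) \<Rightarrow> (nat \<Rightarrow> 'g) \<Rightarrow> 'g \<Rightarrow> 'g \<Rightarrow> 'v tensor" where
  "trace_FF K \<tau> \<rho> M vac r V v \<nu> \<mu> =
     series_mult K \<tau> (delta_B K \<tau> M vac \<rho>) (trace_F K \<tau> M vac r V v \<nu> \<mu>)"


section \<open>The dynamical r-matrix\<close>

text \<open>The action of \<open>r_T(\<lambda>)\<close> on a tensor-valued formal series, first component on the \<open>a\<close>-th
  and second on the \<open>b\<close>-th factor. Multiplication by \<open>e\<^sup>-\<^sup>l\<^sup>(\<^sup>\<alpha>\<^sup>,\<^sup>\<lambda>\<^sup>)\<close> moves the coefficient at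
  \<open>\<eta> + l\<alpha>\<close> to \<open>\<eta>\<close>, where \<open>\<alpha>\<close> is restricted to \<open>\<ll>\<close>. The root sums are infinite but locally
  finite: on modules from category \<open>O\<close> almost all \<open>e_\<alpha>\<close> kill a given vector.\<close>

definition root_index :: "('n::finite, 'g::complex_vector) km_algebra \<Rightarrow> ('g \<times> nat) set" where
  "root_index K = (SIGMA \<alpha>:pos_roots K. {1..root_mult K \<alpha>})"

definition rT_act ::
  "('n::finite, 'g::complex_vector) km_algebra \<Rightarrow> 'n triple \<Rightarrow> 'g bases \<Rightarrow> nat \<Rightarrow> (nat \<Rightarrow> ('g, 'v::complex_vector) gmod) \<Rightarrow>
   nat \<Rightarrow> nat \<Rightarrow> ('g \<Rightarrow> 'v tensor) \<Rightarrow> 'g \<Rightarrow> 'v tensor" where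
  "rT_act K \<tau> D r V a b F = (let act2 = (\<lambda>x y t. slot V r a x (slot V r b y t)) in
     (\<lambda>\<eta>. - (1/2) *\<^sub>C (\<Sum>j\<in>I1 D \<union> I2 D. act2 (onb D j) (onb D j) (F \<eta>))
          + (1/2) *\<^sub>C (\<Sum>j\<in>I2 D. act2 (cayley K \<tau> (onb D j)) (onb D j) (F \<eta>))
          - lfsum (root_index K) (\<lambda>(\<alpha>, t). act2 (fb D \<alpha> t) (eb D \<alpha> t) (F \<eta>))
          + lfsum (root_index K \<times> {1..}) (\<lambda>((\<alpha>, t), l).
              act2 (eb D \<alpha> t) ((Bmap K \<tau> ^^ l) (fb D \<alpha> t)) (F (\<eta> + of_nat l *\<^sub>C lproj K \<tau> \<alpha>))
            - act2 ((Bmap K \<tau> ^^ l) (fb D \<alpha> t)) (eb D \<alpha> t) (F (\<eta> + of_nat l *\<^sub>C lproj K \<tau> \<alpha>)))))"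

end

theory Submission
  imports Defs
begin

text \<open>The Casimir element acts on \<open>M_\<kappa>\<close> by \<open>\<Delta>_\<kappa>\<close>. Inserting it on both sides of \<open>\<Phi>\<^sup>v\<^sup>i\<close> under the trace
  therefore writes \<open>1/2 (\<Delta> - \<Delta>') F\<close> as a sum of traces in which one leg of \<open>\<Sum> f_\<alpha> \<otimes> e_\<alpha>\<close> or
  \<open>\<Sum> x_j \<otimes> x_j\<close> acts in the Verma module and the other one in \<open>V_i\<close>. The leg in the Verma module is
  carried around the trace: passing an intertwiner leaves a term in which it acts in \<open>V_k\<close>, passing
  \<open>B\<close> applies \<open>B\<close> or its adjoint, and passing \<open>e\<^sup>\<lambda>\<close> moves the exponent. For \<open>e_\<alpha>\<close> and \<open>f_\<alpha>\<close> the exponent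
  leaves the support of the trace after finitely many turns, and the terms left behind are those of \<open>r_T(\<lambda>)\<close>. For elements of
  \<open>\<hh>\<close> a turn identifies \<open>\<alpha>\<close> with \<open>T\<alpha>\<close>, which produces the Cayley transform on \<open>\<hh>\<^sub>0\<close>, while elements of \<open>\<ll>\<close>
  differentiate the trace. The terms with both legs in \<open>V_i\<close> collapse, because \<open>[e_\<alpha>, B\<^sup>l f_\<alpha>]\<close> is a
  multiple of \<open>\<alpha>\<close>, and they cancel against the derivative of \<open>\<delta>\<^sub>B\<close>. That derivative comes from the same
  argument applied to the difference of the actions of \<open>\<gg>\<close> on \<open>M_\<^bsub>-\<rho>\<^esub>\<close> and \<open>M_\<^bsub>-\<rho>+y\<^esub>\<close>, \<open>y\<close> in \<open>\<ll>\<close>.\<close>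

section \<open>Linear algebra\<close>

text \<open>\<gg> is given as an algebra in which every nonzero ideal meets \<hh>, not by Serre
  relations. So \<open>B\<close> and the Chevalley involution are built as subalgebras of \<gg>
  \<times> \<gg>, and this property makes them single-valued. Verma modules are words modulo
  relations; their freeness over U(n_-) has to be recovered, and it yields \<open>B\<close> on Verma
  modules and the vectors from which the contravariant form and the intertwiners are built.
  Genericity of \<mu> enters as irreducibility of graded duals: it makes the contravariant form
  invertible. Root sums are infinite. They are cut off at height n, and identities are proved at one
  exponent for all large n. The element \<open>dd\<close> of \<ll>, on which all simple roots are 1,
  controls the cut-offs, as B preserves the degree it defines. The trace in \<delta>_B is over
  M_{-\<rho>} because the Casimir element puts a term \<rho> into V_i: \<rho> lies in \<ll>, and the
  leading exponent \<rho> of \<delta>_B cancels it. The sum of the [e_\<alpha>, B^l f_\<alpha>] has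
  no component in \<hh>_0, by cyclicity; its component in \<ll> is the rest of the logarithmic
  derivative of \<delta>_B.\<close>

lemma linear_on_add: "linear_on W f \<Longrightarrow> x \<in> W \<Longrightarrow> y \<in> W \<Longrightarrow> f (x + y) = f x + f y"
  by (simp add: linear_on_def)

lemma linear_on_scale: "linear_on W f \<Longrightarrow> x \<in> W \<Longrightarrow> f (c *\<^sub>C x) = c *\<^sub>C f x"
  by (simp add: linear_on_def)

lemma linear_on_0:
  assumes "linear_on W f" "cvec.subspace W" shows "f 0 = 0"
  using linear_on_scale[OF assms(1) cvec.subspace_0[OF assms(2)], of 0] by simp

lemma linear_on_minus: "linear_on W f \<Longrightarrow> x \<in> W \<Longrightarrow> f (- x) = - f x"
  using linear_on_scale[of W f x "-1"] by simp

lemma linear_on_diff: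
  assumes "linear_on W f" "cvec.subspace W" "x \<in> W" "y \<in> W" shows "f (x - y) = f x - f y"
  using linear_on_add[OF assms(1,3), of "- y"] linear_on_minus[OF assms(1,4)] assms(4)
    cvec.subspace_neg[OF assms(2,4)] by simp

lemma linear_on_sum:
  assumes "linear_on W f" "cvec.subspace W" "\<And>i. i \<in> A \<Longrightarrow> g i \<in> W"
  shows "f (\<Sum>i\<in>A. g i) = (\<Sum>i\<in>A. f (g i))"
  using assms(3)
proof (induction A rule: infinite_finite_induct)
  case (insert a A)
  then have "(\<Sum>i\<in>A. g i) \<in> W" by (intro cvec.subspace_sum[OF assms(2)]) auto
  with insert show ?case using linear_on_add[OF assms(1)] by simp
qed (simp_all add: linear_on_0[OF assms(1,2)])

lemma linear_on_subset: "linear_on W f \<Longrightarrow> U \<subseteq> W \<Longrightarrow> linear_on U f"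
  by (simp add: linear_on_def subset_iff)

lemma linear_on_compose:
  "linear_on W f \<Longrightarrow> f ` W \<subseteq> U \<Longrightarrow> linear_on U g \<Longrightarrow> linear_on W (\<lambda>x. g (f x))"
  by (auto simp: linear_on_def image_subset_iff)

lemma linear_on_span_mem:
  assumes "linear_on (cvec.span S) f" "cvec.subspace W"
    and "\<And>x. x \<in> S \<Longrightarrow> f x \<in> W" and "x \<in> cvec.span S"
  shows "f x \<in> W"
proof -
  have "cvec.subspace {x \<in> cvec.span S. f x \<in> W}"
    using assms(2) linear_on_0[OF assms(1)]
    by (auto simp: cvec.subspace_def linear_on_add[OF assms(1)] linear_on_scale[OF assms(1)]
        cvec.span_add cvec.span_scale cvec.span_zero)
  from cvec.span_minimal[OF _ this, of S] show ?thesis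
    using assms(3,4) cvec.span_superset by blast
qed

lemma linear_on_span_eq:
  assumes "linear_on (cvec.span S) f" "linear_on (cvec.span S) g"
    and "\<And>x. x \<in> S \<Longrightarrow> f x = g x" and "x \<in> cvec.span S"
  shows "f x = g x"
proof -
  have "linear_on (cvec.span S) (\<lambda>x. f x - g x)"
    using assms(1,2) by (auto simp: linear_on_def cvec.scale_right_diff_distrib)
  from linear_on_span_mem[OF this, of "{0}"] show ?thesis
    using assms(3,4) by simp
qed

lemma linear_fromD:
  "linear_from W f \<Longrightarrow> linear_on W f" "linear_from W f \<Longrightarrow> x \<notin> W \<Longrightarrow> f x = 0"
  by (auto simp: linear_from_def)

lemma subspace_sum_space:
  assumes "cvec.subspace S" "cvec.subspace S'" shows "cvec.subspace (sum_space S S')"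
proof -
  have "sum_space S S' = {x + y | x y. x \<in> S \<and> y \<in> S'}" by (simp add: sum_space_def)
  then show ?thesis using cvec.subspace_sums[OF assms] by simp
qed

lemma sum_spaceI: "x \<in> S \<Longrightarrow> y \<in> S' \<Longrightarrow> x + y \<in> sum_space S S'"
  by (auto simp: sum_space_def)

lemma sum_space_left: "(x :: 'a::complex_vector) \<in> S \<Longrightarrow> cvec.subspace S' \<Longrightarrow> x \<in> sum_space S S'"
  using sum_spaceI[of x S 0 S'] cvec.subspace_0 by auto

lemma sum_space_right: "(x :: 'a::complex_vector) \<in> S' \<Longrightarrow> cvec.subspace S \<Longrightarrow> x \<in> sum_space S S'"
  using sum_spaceI[of 0 S x S'] cvec.subspace_0 by auto

lemma lfsum_eq_sum:
  assumes "finite A" "A \<subseteq> S" "\<And>s. s \<in> S \<Longrightarrow> s \<notin> A \<Longrightarrow> g s = 0"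
  shows "lfsum S g = sum g A"
  unfolding lfsum_def using assms by (intro sum.mono_neutral_left) auto

text \<open>Pairs serve as points of graphs: the homomorphisms of \<gg> needed below are obtained as
  subalgebras of \<gg> \<times> \<gg>.\<close>

instantiation prod :: (complex_vector, complex_vector) complex_vector
begin
definition scaleC_prod :: "complex \<Rightarrow> 'a \<times> 'b \<Rightarrow> 'a \<times> 'b" where
  "scaleC_prod c p = (c *\<^sub>C fst p, c *\<^sub>C snd p)"
instance
  by standard (auto simp: scaleC_prod_def scaleC_add_right scaleC_add_left scaleC_scaleC scaleC_one)
end

lemma scaleC_Pair [simp]: "c *\<^sub>C (x, y) = (c *\<^sub>C x, c *\<^sub>C y)"
  by (simp add: scaleC_prod_def)

lemma scaleC_complex [simp]: "a *\<^sub>C (x :: complex) = a * x"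
  by (simp add: scaleC_complex_def)

lemma scaleC_fun_apply [simp]: "(a *\<^sub>C f) x = a *\<^sub>C f x"
  by (simp add: scaleC_fun_def)

lemma sum_fun_apply: "(\<Sum>i\<in>A. f i) x = (\<Sum>i\<in>A. f i x)" for f :: "'i \<Rightarrow> 'b \<Rightarrow> 'c::comm_monoid_add"
  by (induction A rule: infinite_finite_induct) auto

section \<open>Lie algebras with Chevalley generators\<close>

lemma subspace_lie_generated [simp, intro]: "cvec.subspace (lie_generated br S)"
  by (auto simp: cvec.subspace_def intro: lie_generated.intros)

lemma lie_generated_mono:
  assumes "S \<subseteq> lie_generated br S'" shows "lie_generated br S \<subseteq> lie_generated br S'"
proof
  fix x assume "x \<in> lie_generated br S"
  then show "x \<in> lie_generated br S'" by induction (use assms in \<open>auto intro: lie_generated.intros\<close>)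
qed

locale lie_algebra =
  fixes br :: "'a::complex_vector \<Rightarrow> 'a \<Rightarrow> 'a"
  assumes lie: "lie_bracket br"
begin

lemma linear_br: "linear_on UNIV (br x)" "linear_on UNIV (\<lambda>x. br x y)"
  using lie by (auto simp: lie_bracket_def)

lemma br_simps:
  "br x (y + z) = br x y + br x z" "br (x + y) z = br x z + br y z"
  "br x (c *\<^sub>C y) = c *\<^sub>C br x y" "br (c *\<^sub>C x) y = c *\<^sub>C br x y"
  "br x 0 = 0" "br 0 y = 0" "br x (- y) = - br x y" "br (- x) y = - br x y"
  "br x (y - z) = br x y - br x z" "br (x - y) z = br x z - br y z"
  using linear_on_add[OF linear_br(1)] linear_on_add[OF linear_br(2)]
    linear_on_scale[OF linear_br(1)] linear_on_scale[OF linear_br(2)]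
    linear_on_0[OF linear_br(1)] linear_on_0[OF linear_br(2)]
    linear_on_minus[OF linear_br(1)] linear_on_minus[OF linear_br(2)]
    linear_on_diff[OF linear_br(1)] linear_on_diff[OF linear_br(2)]
  by auto

lemma br_sum: "br x (\<Sum>i\<in>A. g i) = (\<Sum>i\<in>A. br x (g i))" "br (\<Sum>i\<in>A. g i) y = (\<Sum>i\<in>A. br (g i) y)"
  using linear_on_sum[OF linear_br(1)] linear_on_sum[OF linear_br(2)] by auto

lemma br_self: "br x x = 0"
  using lie by (auto simp: lie_bracket_def)

lemma br_anti: "br x y = - br y x"
proof -
  have "br (x + y) (x + y) = br x y + br y x" unfolding br_simps by (simp add: br_self)
  then show ?thesis by (simp add: br_self eq_neg_iff_add_eq_0)
qed

lemma br_jacobi: "br x (br y z) = br (br x y) z + br y (br x z)"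
proof -
  have "br x (br y z) + br y (br z x) + br z (br x y) = 0"
    using lie by (auto simp: lie_bracket_def)
  moreover have "br y (br z x) = - br y (br x z)" by (subst br_anti[of z x]) (simp add: br_simps)
  moreover have "br z (br x y) = - br (br x y) z" by (rule br_anti)
  ultimately show ?thesis by (simp add: algebra_simps)
qed

text \<open>By the Jacobi identity the elements whose adjoint action preserves \<open>W\<close> form
  a subalgebra, so it is enough to look at generators.\<close>

lemma lie_generated_ad:
  assumes "cvec.subspace W" and "\<And>x y. x \<in> S \<Longrightarrow> y \<in> W \<Longrightarrow> br x y \<in> W"
    and "x \<in> lie_generated br S" and "y \<in> W"
  shows "br x y \<in> W"
  using assms(3,4)
proof (induction arbitrary: y)
  case (bracket u v)
  have "br (br u v) y = br u (br v y) - br v (br u y)" using br_jacobi[of u v y] by simp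
  then show ?case using bracket assms(1) by (simp add: cvec.subspace_diff)
qed (use assms(1,2) in \<open>auto simp: br_simps cvec.subspace_add cvec.subspace_scale cvec.subspace_0\<close>)

lemma br_span_closed:
  assumes "\<And>x y. x \<in> S \<Longrightarrow> y \<in> S' \<Longrightarrow> br x y \<in> W" "cvec.subspace W"
    and "x \<in> cvec.span S" "y \<in> cvec.span S'"
  shows "br x y \<in> W"
proof -
  have "br x y \<in> W" if "x \<in> S" for x
    by (rule linear_on_span_mem[OF linear_on_subset[OF linear_br(1)] assms(2) _ assms(4)])
      (use assms(1) that in auto)
  then show ?thesis
    by (intro linear_on_span_mem[OF linear_on_subset[OF linear_br(2)] assms(2) _ assms(3)]) auto
qed

end

text \<open>Axioms weak enough to hold also for families of generators in \<gg> \<times> \<gg>: the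
  eigenvalues of \<open>H\<close> are unspecified, \<open>br (E i) (F j)\<close> may be any element
  of \<open>H\<close>, and generators may vanish.\<close>

locale chevalley = lie_algebra br for br :: "'a::complex_vector \<Rightarrow> 'a \<Rightarrow> 'a" +
  fixes E F :: "'n \<Rightarrow> 'a" and H :: "'a set"
  assumes H: "cvec.subspace H" and HH: "h \<in> H \<Longrightarrow> h' \<in> H \<Longrightarrow> br h h' = 0"
    and HE: "h \<in> H \<Longrightarrow> \<exists>c. br h (E i) = c *\<^sub>C E i" and HF: "h \<in> H \<Longrightarrow> \<exists>c. br h (F i) = c *\<^sub>C F i"
    and EF: "br (E i) (F j) \<in> H"
begin

abbreviation "Nplus \<equiv> lie_generated br (range E)"
abbreviation "Nminus \<equiv> lie_generated br (range F)"

lemma ad_H_Nminus: "y \<in> Nminus \<Longrightarrow> h \<in> H \<Longrightarrow> br h y \<in> Nminus"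
proof (induction rule: lie_generated.induct)
  case (base x)
  then show ?case using HF by (metis imageE lie_generated.base lie_generated.scale rangeI)
next
  case (bracket x y)
  then show ?case by (simp add: br_jacobi[of h] lie_generated.intros)
qed (auto simp: br_simps intro: lie_generated.intros)

text \<open>Jacobi splits the bracket of \<open>E i\<close> with \<open>br x y\<close> into brackets
  of an element of \<open>Nminus\<close> + \<open>H\<close> with one of \<open>Nminus\<close>, and
  \<open>H\<close> normalizes \<open>Nminus\<close>.\<close>

lemma ad_E_Nminus: "y \<in> Nminus \<Longrightarrow> br (E i) y \<in> sum_space Nminus H"
proof (induction rule: lie_generated.induct)
  case (base x)
  then show ?case using EF by (auto intro: sum_space_right)
next
  case (bracket x y)
  have 1: "br u y \<in> Nminus" if u: "u \<in> sum_space Nminus H" and "y \<in> Nminus" for u y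
  proof -
    from u obtain a h where "u = a + h" "a \<in> Nminus" "h \<in> H" by (auto simp: sum_space_def)
    then show ?thesis using that ad_H_Nminus[of y h]
      by (simp add: br_simps lie_generated.add lie_generated.bracket)
  qed
  have "br x (br (E i) y) = - br (br (E i) y) x" by (rule br_anti)
  then show ?case
    using 1[OF bracket.IH(1) bracket.hyps(2)] 1[OF bracket.IH(2) bracket.hyps(1)]
    by (simp add: br_jacobi[of "E i"]) (auto intro!: sum_space_left H simp: cvec.subspace_diff)
qed (auto simp: br_simps cvec.subspace_0 subspace_sum_space H cvec.subspace_add cvec.subspace_scale)

end

lemma (in chevalley) swap: "chevalley br F E H"
proof unfold_locales
  show "br (F i) (E j) \<in> H" for i j
    using br_anti[of "F i" "E j"] EF[of j i] H by (simp add: cvec.subspace_neg)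
qed (use H HH HE HF in auto)

text \<open>The sum of the three parts is stable under the adjoint action of every generator, hence
  of everything generated. It contains the generators, so it absorbs all brackets.\<close>

lemma (in chevalley) triangular:
  assumes "x \<in> lie_generated br (H \<union> range E \<union> range F)"
  shows "\<exists>a h b. x = a + h + b \<and> a \<in> Nminus \<and> h \<in> H \<and> b \<in> Nplus"
proof -
  interpret sw: chevalley br F E H by (rule swap)
  let ?W = "sum_space (sum_space Nminus H) Nplus"
  have W: "cvec.subspace ?W" by (intro subspace_sum_space H) auto
  have NW: "a \<in> ?W" if "a \<in> sum_space Nminus H \<or> a \<in> sum_space Nplus H" for a
    using that
  proof
    assume "a \<in> sum_space Nplus H"
    then obtain b h where "a = h + b" "b \<in> Nplus" "h \<in> H"
      by (auto simp: sum_space_def add.commute)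
    then have "h \<in> sum_space Nminus H" by (auto intro: sum_space_right)
    with \<open>a = h + b\<close> \<open>b \<in> Nplus\<close> show ?thesis by (auto intro: sum_spaceI)
  qed (auto intro: sum_space_left)
  have ad: "br z y \<in> ?W" if z: "z \<in> H \<union> range E \<union> range F" and "y \<in> ?W" for z y
  proof -
    obtain a h b where y: "y = a + h + b" "a \<in> Nminus" "h \<in> H" "b \<in> Nplus"
      using \<open>y \<in> ?W\<close> by (auto simp: sum_space_def)
    have "br z a \<in> ?W \<and> br z h \<in> ?W \<and> br z b \<in> ?W"
    proof (cases "z \<in> H")
      case True
      then show ?thesis
        using ad_H_Nminus[OF y(2)] sw.ad_H_Nminus[OF y(4)] HH[OF True y(3)]
        by (auto intro!: NW sum_space_left H simp: cvec.subspace_0[OF W])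
    next
      case False
      have sc: "\<exists>c. br z h = c *\<^sub>C z" if "z \<in> range E \<union> range F"
      proof -
        have "\<exists>c. br h z = c *\<^sub>C z" using that HE[OF y(3)] HF[OF y(3)] by auto
        then show ?thesis using br_anti[of z h] by (metis cvec.scale_minus_left)
      qed
      from False z consider i where "z = E i" | i where "z = F i" by auto
      then show ?thesis
      proof cases
        case 1
        then have "br z a \<in> ?W" using ad_E_Nminus[OF y(2)] by (auto intro: NW)
        moreover have "br z h \<in> Nplus" using sc 1 by (auto intro!: lie_generated.scale[OF lie_generated.base])
        moreover have "br z b \<in> Nplus" using 1 y by (auto intro: lie_generated.intros)
        ultimately show ?thesis by (auto intro!: NW sum_space_left H)
      next
        case 2
        then have "br z b \<in> ?W" using sw.ad_E_Nminus[OF y(4)] by (auto intro: NW)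
        moreover have "br z h \<in> Nminus" using sc 2 by (auto intro!: lie_generated.scale[OF lie_generated.base])
        moreover have "br z a \<in> Nminus" using 2 y by (auto intro: lie_generated.intros)
        ultimately show ?thesis by (auto intro!: NW sum_space_left H)
      qed
    qed
    then show ?thesis unfolding y(1) br_simps by (intro cvec.subspace_add[OF W]) auto
  qed
  have "x \<in> ?W" using assms
  proof induction
    case (base x)
    then consider "x \<in> H" | "x \<in> Nminus" | "x \<in> Nplus" by (auto intro: lie_generated.base)
    then show ?case by cases (auto intro: NW sum_space_left sum_space_right H)
  next
    case (bracket x y)
    then show ?case using lie_generated_ad[OF W ad] by blast
  qed (auto simp: cvec.subspace_0[OF W] cvec.subspace_add[OF W] cvec.subspace_scale[OF W])
  then show ?thesis by (auto simp: sum_space_def)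
qed

section \<open>Structure of the Kac--Moody algebra\<close>

locale bd_setting =
  fixes K :: "('n::finite, 'g::complex_vector) km_algebra" and \<tau> :: "'n triple"
    and D :: "'g bases" and \<rho> :: 'g
  assumes km: "symmetrizable_kac_moody K" and inv: "invariant_form K"
    and weyl: "weyl_vector K \<rho>" and bd: "BD_triple K \<tau>" and nondeg: "nondegenerate_triple K \<tau>"
    and bases: "root_bases K \<tau> D" and onb: "adapted_onb K \<tau> D"
begin

abbreviation "br \<equiv> bracket K"
abbreviation "fm \<equiv> form K"
abbreviation "\<hh> \<equiv> csa K"
abbreviation "\<alpha> \<equiv> root K"
abbreviation "e \<equiv> gen_e K"
abbreviation "f \<equiv> simple_f K"
abbreviation "T \<equiv> Tmap \<tau>"
abbreviation "G1 \<equiv> Gam1 \<tau>"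
abbreviation "G2 \<equiv> Gam2 \<tau>"
abbreviation "np \<equiv> n_plus K"
abbreviation "nm \<equiv> n_minus K"
abbreviation "\<ll> \<equiv> lsub K \<tau>"
abbreviation "\<xi> \<equiv> onb D"
abbreviation "I \<equiv> I1 D \<union> I2 D"
abbreviation "R \<equiv> root_index K"
abbreviation "E a \<equiv> eb D (fst a) (snd a)"
abbreviation "F a \<equiv> fb D (fst a) (snd a)"
abbreviation "Q \<equiv> pos_lattice K"

sublocale lie_algebra br
  using km by unfold_locales (simp add: symmetrizable_kac_moody_def)

lemma fm_linear: "linear_on UNIV (fm x)" and fm_sym: "fm x y = fm y x"
  and fm_inv: "fm (br x y) z = fm x (br y z)"
  and fm_nondeg: "(\<And>y. fm x y = 0) \<Longrightarrow> x = 0"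
  using inv unfolding invariant_form_def nondegenerate_on_def by (blast, metis, metis, blast)

lemma fm_linear_left: "linear_on UNIV (\<lambda>x. fm x y)"
  using fm_linear[of y] fm_sym by (simp add: linear_on_def)

lemma fm_simps:
  "fm x (y + z) = fm x y + fm x z" "fm (x + y) z = fm x z + fm y z"
  "fm x (c *\<^sub>C y) = c * fm x y" "fm (c *\<^sub>C x) y = c * fm x y"
  "fm x 0 = 0" "fm 0 y = 0" "fm x (- y) = - fm x y" "fm (- x) y = - fm x y"
  "fm x (y - z) = fm x y - fm x z" "fm (x - y) z = fm x z - fm y z"
  using linear_on_add[OF fm_linear] linear_on_add[OF fm_linear_left]
    linear_on_scale[OF fm_linear] linear_on_scale[OF fm_linear_left]
    linear_on_0[OF fm_linear] linear_on_0[OF fm_linear_left]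
    linear_on_minus[OF fm_linear] linear_on_minus[OF fm_linear_left]
    linear_on_diff[OF fm_linear] linear_on_diff[OF fm_linear_left]
  by auto

lemma fm_sum: "fm x (\<Sum>i\<in>A. g i) = (\<Sum>i\<in>A. fm x (g i))" "fm (\<Sum>i\<in>A. g i) y = (\<Sum>i\<in>A. fm (g i) y)"
  using linear_on_sum[OF fm_linear] linear_on_sum[OF fm_linear_left] by auto

lemma fm_inv': "fm x (br y z) = - fm (br y x) z"
  using fm_inv[of x y z] br_anti[of x y] by (simp add: fm_simps)

section \<open>Orthonormal bases, the Cartan subalgebra and the simple roots\<close>

lemma csa_subspace: "cvec.subspace \<hh>"
proof -
  have "realization K" using km by (simp add: symmetrizable_kac_moody_def)
  then obtain Bs where "cvec.span Bs = \<hh>" unfolding realization_def by blast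
  then show ?thesis using cvec.subspace_span by metis
qed

lemma onb_facts:
  "finite I" "I1 D \<inter> I2 D = {}" "finite (I1 D)" "finite (I2 D)"
  "j \<in> I \<Longrightarrow> k \<in> I \<Longrightarrow> fm (\<xi> j) (\<xi> k) = (if j = k then 1 else 0)"
  "cvec.span (\<xi> ` I1 D) = \<ll>" "cvec.span (\<xi> ` I2 D) = h0sub K \<tau>"
  using onb unfolding adapted_onb_def by auto

lemma onb_expand:
  assumes "J \<subseteq> I" "x \<in> cvec.span (\<xi> ` J)"
  shows "x = (\<Sum>j\<in>J. fm x (\<xi> j) *\<^sub>C \<xi> j)"
proof -
  have fin: "finite J" using assms(1) onb_facts(1) finite_subset by blast
  have lin: "linear_on (cvec.span (\<xi> ` J)) (\<lambda>x. \<Sum>j\<in>J. fm x (\<xi> j) *\<^sub>C \<xi> j)"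
    unfolding linear_on_def
    by (simp add: fm_simps cvec.scale_left_distrib sum.distrib cvec.scale_sum_right cvec.scale_scale)
  show ?thesis
  proof (rule linear_on_span_eq[OF _ lin _ assms(2)])
    fix x assume "x \<in> \<xi> ` J"
    then obtain k where k: "k \<in> J" "x = \<xi> k" by auto
    have "(\<Sum>j\<in>J. fm x (\<xi> j) *\<^sub>C \<xi> j) = (\<Sum>j\<in>J. if j = k then \<xi> k else 0)"
      using k assms(1) by (intro sum.cong) (auto simp: onb_facts(5) subset_iff)
    then show "x = (\<Sum>j\<in>J. fm x (\<xi> j) *\<^sub>C \<xi> j)" using k fin by simp
  qed (simp add: linear_on_def)
qed

lemma lsub_csa: "x \<in> \<ll> \<Longrightarrow> x \<in> \<hh>" and h0sub_csa: "x \<in> h0sub K \<tau> \<Longrightarrow> x \<in> \<hh>"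
  and lsub_h0sub: "x \<in> \<ll> \<Longrightarrow> y \<in> h0sub K \<tau> \<Longrightarrow> fm x y = 0"
  by (auto simp: lsub_def h0sub_def)

lemma onb_mem:
  "j \<in> I1 D \<Longrightarrow> \<xi> j \<in> \<ll>" "j \<in> I2 D \<Longrightarrow> \<xi> j \<in> h0sub K \<tau>" "j \<in> I \<Longrightarrow> \<xi> j \<in> \<hh>"
  using onb_facts(6,7) cvec.span_base lsub_csa h0sub_csa by (blast+)

lemma lsub_subspace: "cvec.subspace \<ll>" and h0sub_subspace: "cvec.subspace (h0sub K \<tau>)"
  using cvec.subspace_span onb_facts(6,7) by metis+

lemma lsub_expand: "x \<in> \<ll> \<Longrightarrow> x = (\<Sum>j\<in>I1 D. fm x (\<xi> j) *\<^sub>C \<xi> j)"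
  and h0sub_expand: "x \<in> h0sub K \<tau> \<Longrightarrow> x = (\<Sum>j\<in>I2 D. fm x (\<xi> j) *\<^sub>C \<xi> j)"
  using onb_expand[of "I1 D"] onb_expand[of "I2 D"] onb_facts by auto

text \<open>Subtracting from x its orthogonal projection \<open>p\<close> to \<ll> leaves a vector
  orthogonal to \<ll>, that is, one in the span of the second half of the basis.\<close>

lemma csa_span: "cvec.span (\<xi> ` I) = \<hh>"
proof
  show "cvec.span (\<xi> ` I) \<subseteq> \<hh>"
    by (rule cvec.span_minimal[OF _ csa_subspace]) (use onb_mem in auto)
  show "\<hh> \<subseteq> cvec.span (\<xi> ` I)"
  proof
    fix x assume x: "x \<in> \<hh>"
    define p where "p = (\<Sum>j\<in>I1 D. fm x (\<xi> j) *\<^sub>C \<xi> j)"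
    have p: "p \<in> cvec.span (\<xi> ` I1 D)"
      unfolding p_def by (intro cvec.span_sum cvec.span_scale cvec.span_base) auto
    then have pl: "p \<in> \<ll>" using onb_facts(6) by simp
    have "fm y (x - p) = 0" if y: "y \<in> \<ll>" for y
    proof -
      have "fm y x = (\<Sum>j\<in>I1 D. fm y (\<xi> j) * fm (\<xi> j) x)"
        by (subst lsub_expand[OF y]) (simp add: fm_sum fm_simps)
      also have "\<dots> = fm y p" unfolding p_def by (simp add: fm_sum fm_simps fm_sym[of x] mult.commute)
      finally show ?thesis by (simp add: fm_simps)
    qed
    then have "x - p \<in> h0sub K \<tau>"
      using x lsub_csa[OF pl] csa_subspace by (auto simp: h0sub_def cvec.subspace_diff)
    then have "x - p \<in> cvec.span (\<xi> ` I2 D)" using onb_facts(7) by simp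
    with p have "p + (x - p) \<in> cvec.span (\<xi> ` I)"
      by (intro cvec.span_add) (auto intro: subsetD[OF cvec.span_mono[OF image_mono]])
    then show "x \<in> cvec.span (\<xi> ` I)" by simp
  qed
qed

lemma csa_expand: "x \<in> \<hh> \<Longrightarrow> x = (\<Sum>j\<in>I. fm x (\<xi> j) *\<^sub>C \<xi> j)"
  using onb_expand[of I] csa_span by auto

lemma csa_nondeg: "x \<in> \<hh> \<Longrightarrow> (\<And>y. y \<in> \<hh> \<Longrightarrow> fm x y = 0) \<Longrightarrow> x = 0"
  using csa_expand[of x] onb_mem(3) by (metis (no_types, lifting) cvec.scale_zero_left sum.neutral)

lemma csa_eqI: "x \<in> \<hh> \<Longrightarrow> x' \<in> \<hh> \<Longrightarrow> (\<And>y. y \<in> \<hh> \<Longrightarrow> fm x y = fm x' y) \<Longrightarrow> x = x'"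
  using csa_nondeg[of "x - x'"] csa_subspace by (simp add: cvec.subspace_diff fm_simps)

lemma real: "realization K" using km by (simp add: symmetrizable_kac_moody_def)

lemma root_csa: "\<alpha> i \<in> \<hh>" and root_sroot: "x \<in> \<hh> \<Longrightarrow> fm (\<alpha> i) x = sroot K i x"
proof -
  define y where "y = (\<Sum>j\<in>I. sroot K i (\<xi> j) *\<^sub>C \<xi> j)"
  have lin: "linear_on \<hh> (sroot K i)" using real by (simp add: realization_def)
  have y: "y \<in> \<hh>"
    unfolding y_def by (intro cvec.subspace_sum[OF csa_subspace] cvec.subspace_scale[OF csa_subspace] onb_mem)
  have "fm y x = sroot K i x" if x: "x \<in> \<hh>" for x
  proof -
    have "sroot K i x = (\<Sum>j\<in>I. sroot K i (fm x (\<xi> j) *\<^sub>C \<xi> j))"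
      by (subst csa_expand[OF x], intro linear_on_sum[OF lin csa_subspace] cvec.subspace_scale[OF csa_subspace] onb_mem)
    also have "\<dots> = (\<Sum>j\<in>I. fm x (\<xi> j) * sroot K i (\<xi> j))"
      using onb_mem(3) by (intro sum.cong) (auto simp: linear_on_scale[OF lin])
    also have "\<dots> = fm y x" by (simp add: y_def fm_sum fm_simps fm_sym[of x] mult.commute)
    finally show ?thesis by simp
  qed
  with y have "y \<in> \<hh> \<and> (\<forall>x\<in>\<hh>. fm y x = sroot K i x)" by blast
  then have "\<exists>!y. y \<in> \<hh> \<and> (\<forall>x\<in>\<hh>. fm y x = sroot K i x)" using csa_eqI by (rule_tac ex1I) auto
  from theI'[OF this] have "\<alpha> i \<in> \<hh> \<and> (\<forall>x\<in>\<hh>. fm (\<alpha> i) x = sroot K i x)" unfolding root_def .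
  then show "\<alpha> i \<in> \<hh>" "x \<in> \<hh> \<Longrightarrow> fm (\<alpha> i) x = sroot K i x" by auto
qed

lemma csa_comm: "x \<in> \<hh> \<Longrightarrow> y \<in> \<hh> \<Longrightarrow> br x y = 0"
  and br_csa_e: "x \<in> \<hh> \<Longrightarrow> br x (e i) = fm (\<alpha> i) x *\<^sub>C e i"
  and br_csa_gen_f: "x \<in> \<hh> \<Longrightarrow> br x (gen_f K i) = (- fm (\<alpha> i) x) *\<^sub>C gen_f K i"
  and br_e_gen_f: "br (e i) (gen_f K j) = (if i = j then coroot K i else 0)"
  using km root_sroot[of x i] unfolding symmetrizable_kac_moody_def by (blast, metis, metis, blast)

lemma coroot: "coroot K i \<in> \<hh>" "coroot K i \<noteq> 0" "fm (\<alpha> i) (coroot K i) = 2"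
proof -
  show 1: "coroot K i \<in> \<hh>" using real by (simp add: realization_def)
  have "sroot K i (coroot K i) = of_int (cartan K $ i $ i)" using real by (simp add: realization_def)
  moreover have "cartan K $ i $ i = 2"
    using km by (simp add: symmetrizable_kac_moody_def symmetrizable_gcm_def)
  ultimately show 2: "fm (\<alpha> i) (coroot K i) = 2" using root_sroot[OF 1] by simp
  then show "coroot K i \<noteq> 0" by (auto simp: fm_simps)
qed

text \<open>Invariance gives (h_i, y) = (e_i, [f_i, y]), a multiple of \<langle>\<alpha>_i,
  y\<rangle>. With the normalized \<open>f i\<close> this becomes [e_i, f_i] = \<alpha>_i, so that
  \<open>simple_h\<close> is the simple root itself.\<close>

lemma coroot_root: "coroot K i = fm (e i) (gen_f K i) *\<^sub>C \<alpha> i"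
proof (rule csa_eqI)
  fix y assume y: "y \<in> \<hh>"
  have "fm (coroot K i) y = fm (e i) (br (gen_f K i) y)" using fm_inv br_e_gen_f by metis
  also have "br (gen_f K i) y = fm (\<alpha> i) y *\<^sub>C gen_f K i"
    using br_anti[of "gen_f K i" y] br_csa_gen_f[OF y] by simp
  finally show "fm (coroot K i) y = fm (fm (e i) (gen_f K i) *\<^sub>C \<alpha> i) y" by (simp add: fm_simps)
qed (use coroot root_csa csa_subspace in \<open>auto simp: cvec.subspace_scale\<close>)

lemma e_gen_f_nonzero: "fm (e i) (gen_f K i) \<noteq> 0"
  using coroot_root[of i] coroot(2)[of i] by auto

lemma br_e_f: "br (e i) (f j) = (if i = j then \<alpha> i else 0)"
  using e_gen_f_nonzero[of i] coroot_root[of i]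
  by (auto simp: simple_f_def br_simps br_e_gen_f)

lemma simple_h_root: "simple_h K i = \<alpha> i"
  by (simp add: simple_h_def br_e_f)

lemma br_csa_f: "x \<in> \<hh> \<Longrightarrow> br x (f i) = (- fm (\<alpha> i) x) *\<^sub>C f i"
  by (simp add: simple_f_def br_simps br_csa_gen_f mult.commute)

lemma n_minus_f: "nm = lie_generated br (range f)"
proof -
  have "f i \<in> lie_generated br (range (gen_f K))" for i
    unfolding simple_f_def by (auto intro: lie_generated.scale lie_generated.base)
  moreover have "gen_f K i \<in> lie_generated br (range f)" for i
  proof -
    have "fm (e i) (gen_f K i) *\<^sub>C f i = gen_f K i"
      using e_gen_f_nonzero[of i] by (simp add: simple_f_def)
    then show ?thesis by (metis lie_generated.base lie_generated.scale rangeI)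
  qed
  ultimately show ?thesis unfolding n_minus_def by (intro antisym lie_generated_mono) auto
qed

lemma root_indep: "(\<Sum>i\<in>UNIV. c i *\<^sub>C \<alpha> i) = 0 \<Longrightarrow> c i = 0"
proof -
  assume *: "(\<Sum>i\<in>UNIV. c i *\<^sub>C \<alpha> i) = 0"
  have "(\<Sum>i\<in>UNIV. c i * sroot K i x) = 0" if "x \<in> \<hh>" for x
  proof -
    have "(\<Sum>i\<in>UNIV. c i * sroot K i x) = fm (\<Sum>i\<in>UNIV. c i *\<^sub>C \<alpha> i) x"
      using that by (simp add: fm_sum fm_simps root_sroot)
    then show ?thesis using * by (simp add: fm_simps)
  qed
  then show ?thesis using real by (simp add: realization_def)
qed

lemma root_inj: "inj \<alpha>"
proof (rule injI, rule ccontr)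
  fix i j assume *: "\<alpha> i = \<alpha> j" "i \<noteq> j"
  have "(\<Sum>k\<in>UNIV. (if k = i then 1 else if k = j then -1 else 0) *\<^sub>C \<alpha> k)
      = (\<Sum>k\<in>UNIV. (if k = i then \<alpha> k else 0) + (if k = j then - \<alpha> k else 0))"
    using *(2) by (intro sum.cong) auto
  also have "\<dots> = 0" using * by (simp add: sum.distrib)
  finally have "(if i = i then 1 else if i = j then -1 else 0 :: complex) = 0" by (rule root_indep)
  then show False by simp
qed

section \<open>The triple, the subspace \<ll> and the height function\<close>

lemma T_G2: "i \<in> G1 \<Longrightarrow> T i \<in> G2" and T_inj: "i \<in> G1 \<Longrightarrow> j \<in> G1 \<Longrightarrow> T i = T j \<longleftrightarrow> i = j"
  and T_surj: "k \<in> G2 \<Longrightarrow> \<exists>i\<in>G1. k = T i"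
  and T_form: "i \<in> G1 \<Longrightarrow> j \<in> G1 \<Longrightarrow> fm (\<alpha> (T i)) (\<alpha> (T j)) = fm (\<alpha> i) (\<alpha> j)"
  using bd unfolding BD_triple_def bij_betw_def inj_on_def by auto

lemma lsub_iff: "x \<in> \<ll> \<longleftrightarrow> x \<in> \<hh> \<and> (\<forall>i\<in>G1. fm (\<alpha> (T i)) x = fm (\<alpha> i) x)"
proof -
  have "(\<forall>y\<in>cvec.span {\<alpha> i - \<alpha> (T i) |i. i \<in> G1}. fm y x = 0) \<longleftrightarrow> (\<forall>i\<in>G1. fm (\<alpha> i - \<alpha> (T i)) x = 0)"
    (is "?l \<longleftrightarrow> ?r")
  proof
    assume r: ?r
    show ?l
    proof
      fix y assume "y \<in> cvec.span {\<alpha> i - \<alpha> (T i) |i. i \<in> G1}"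
      then show "fm y x = 0"
        by (rule linear_on_span_eq[OF linear_on_subset[OF fm_linear_left] linear_on_subset[where f="\<lambda>_. 0"], rotated -1])
          (use r in \<open>auto simp: linear_on_def\<close>)
    qed
  qed (auto intro: cvec.span_base)
  then show ?thesis by (auto simp: lsub_def fm_simps)
qed

text \<open>Independence of the simple roots provides a functional with value 1 on all of them, and
  the orthonormal basis represents it by an element of \<hh>. Taking equal values on \<alpha>_i and
  on its image under T, this element lies in \<ll>; so the degree it defines is visible to the
  formal variable \<lambda>.\<close>

lemma exists_height_element: "\<exists>d\<in>\<ll>. \<forall>i. fm d (\<alpha> i) = 1"
proof -
  interpret cp: vector_space_pair "scaleC :: complex \<Rightarrow> 'g \<Rightarrow> 'g" "scaleC :: complex \<Rightarrow> complex \<Rightarrow> complex"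
    by unfold_locales
  have "cvec.independent (range \<alpha>)"
  proof (rule cvec.independent_if_scalars_zero)
    fix g x assume s: "(\<Sum>x\<in>range \<alpha>. g x *\<^sub>C x) = 0" and "x \<in> range \<alpha>"
    have "(\<Sum>i\<in>UNIV. g (\<alpha> i) *\<^sub>C \<alpha> i) = 0"
      using s root_inj by (simp add: sum.reindex)
    then have "g (\<alpha> i) = 0" for i by (rule root_indep)
    then show "g x = 0" using \<open>x \<in> range \<alpha>\<close> by blast
  qed simp
  from cp.linear_independent_extend[OF this, of "\<lambda>_. 1"] obtain g :: "'g \<Rightarrow> complex"
    where g: "Vector_Spaces.linear (*\<^sub>C) (*\<^sub>C) g" "\<And>i. g (\<alpha> i) = 1" by auto
  define d where "d = (\<Sum>j\<in>I. g (\<xi> j) *\<^sub>C \<xi> j)"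
  have d: "d \<in> \<hh>"
    unfolding d_def by (intro cvec.subspace_sum[OF csa_subspace] cvec.subspace_scale[OF csa_subspace] onb_mem)
  have *: "fm d (\<alpha> i) = 1" for i
  proof -
    have "1 = g (\<Sum>j\<in>I. fm (\<alpha> i) (\<xi> j) *\<^sub>C \<xi> j)" using g(2)[of i] by (subst csa_expand[OF root_csa, symmetric]) simp
    also have "\<dots> = (\<Sum>j\<in>I. fm (\<alpha> i) (\<xi> j) * g (\<xi> j))"
      by (simp add: cp.linear_sum[OF g(1)] cp.linear_scale[OF g(1)])
    also have "\<dots> = fm d (\<alpha> i)" by (simp add: d_def fm_sum fm_simps fm_sym[of "\<alpha> i"] mult.commute)
    finally show ?thesis by simp
  qed
  then have "fm (\<alpha> i) d = 1" for i using fm_sym by metis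
  with d have "d \<in> \<ll>" by (simp add: lsub_iff)
  with * show ?thesis by (intro bexI[of _ d]) auto
qed

definition dd :: 'g where "dd = (SOME d. d \<in> \<ll> \<and> (\<forall>i. fm d (\<alpha> i) = 1))"

lemma dd: "dd \<in> \<ll>" "fm dd (\<alpha> i) = 1" "dd \<in> \<hh>"
proof -
  have "\<exists>d. d \<in> \<ll> \<and> (\<forall>i. fm d (\<alpha> i) = 1)" using exists_height_element by blast
  from someI_ex[OF this] show "dd \<in> \<ll>" "fm dd (\<alpha> i) = 1" by (auto simp: dd_def)
  then show "dd \<in> \<hh>" by (simp add: lsub_csa)
qed

text \<open>Meaningful only where \<open>dd\<close> takes a natural value, in particular on \<open>Q\<close>.\<close>

definition ht :: "'g \<Rightarrow> nat" where "ht x = nat \<lfloor>Re (fm dd x)\<rfloor>"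

lemma fm_dd_sum: "fm dd (\<Sum>i\<in>UNIV. of_nat (c i) *\<^sub>C \<alpha> i) = of_nat (\<Sum>i\<in>UNIV. c i)"
  by (simp add: fm_sum fm_simps dd)

lemma ht_eqI: "fm dd \<gamma> = of_nat n \<Longrightarrow> ht \<gamma> = n"
  by (simp add: ht_def)

lemma fm_dd_Q: "\<gamma> \<in> Q \<Longrightarrow> fm dd \<gamma> = of_nat (ht \<gamma>)"
proof -
  assume "\<gamma> \<in> Q"
  then obtain c where "\<gamma> = (\<Sum>i\<in>UNIV. of_nat (c i) *\<^sub>C \<alpha> i)" unfolding pos_lattice_def by blast
  then have "fm dd \<gamma> = of_nat (\<Sum>i\<in>UNIV. c i)" using fm_dd_sum by blast
  then show ?thesis using ht_eqI by metis
qed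

lemma Q_csa: "\<gamma> \<in> Q \<Longrightarrow> \<gamma> \<in> \<hh>"
  unfolding pos_lattice_def
  by (auto intro!: cvec.subspace_sum[OF csa_subspace] cvec.subspace_scale[OF csa_subspace] root_csa)

lemma Q_0: "0 \<in> Q"
  unfolding pos_lattice_def by (auto intro!: exI[of _ "\<lambda>_. 0"])

lemma Q_root: "\<alpha> i \<in> Q"
proof -
  have "(\<Sum>j\<in>UNIV. of_nat (if j = i then 1 else 0) *\<^sub>C \<alpha> j) = \<alpha> i"
    by (subst sum.mono_neutral_right[of UNIV "{i}"]) auto
  then show ?thesis unfolding pos_lattice_def mem_Collect_eq
    by (intro exI[of _ "\<lambda>j. if j = i then 1 else 0"]) simp
qed

lemma Q_add: "\<gamma> \<in> Q \<Longrightarrow> \<delta> \<in> Q \<Longrightarrow> \<gamma> + \<delta> \<in> Q"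
proof -
  assume "\<gamma> \<in> Q" "\<delta> \<in> Q"
  then obtain c d where "\<gamma> = (\<Sum>i\<in>UNIV. of_nat (c i) *\<^sub>C \<alpha> i)" "\<delta> = (\<Sum>i\<in>UNIV. of_nat (d i) *\<^sub>C \<alpha> i)"
    unfolding pos_lattice_def by auto
  then have "\<gamma> + \<delta> = (\<Sum>i\<in>UNIV. of_nat (c i + d i) *\<^sub>C \<alpha> i)"
    by (simp add: sum.distrib cvec.scale_left_distrib)
  then show ?thesis unfolding pos_lattice_def by (auto intro!: exI[of _ "\<lambda>i. c i + d i"])
qed

lemma ht_0 [simp]: "ht 0 = 0" by (simp add: ht_def fm_simps)

lemma ht_add: "\<gamma> \<in> Q \<Longrightarrow> \<delta> \<in> Q \<Longrightarrow> ht (\<gamma> + \<delta>) = ht \<gamma> + ht \<delta>"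
  by (rule ht_eqI) (simp add: fm_simps fm_dd_Q)

lemma ht_pos: "\<gamma> \<in> Q \<Longrightarrow> ht \<gamma> = 0 \<longleftrightarrow> \<gamma> = 0"
proof
  assume "\<gamma> \<in> Q" "ht \<gamma> = 0"
  then obtain c where c: "\<gamma> = (\<Sum>i\<in>UNIV. of_nat (c i) *\<^sub>C \<alpha> i)" unfolding pos_lattice_def by auto
  then have "(\<Sum>i\<in>UNIV. c i) = 0" using \<open>ht \<gamma> = 0\<close> ht_eqI[OF fm_dd_sum] by simp
  then show "\<gamma> = 0" using c by simp
qed simp

lemma finite_Q: "finite {\<gamma> \<in> Q. ht \<gamma> \<le> N}"
proof -
  have "{\<gamma> \<in> Q. ht \<gamma> \<le> N} \<subseteq> (\<lambda>c. \<Sum>i\<in>UNIV. of_nat (c i) *\<^sub>C \<alpha> i) ` (PiE UNIV (\<lambda>_. {..N}))"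
  proof
    fix \<gamma> assume g: "\<gamma> \<in> {\<gamma> \<in> Q. ht \<gamma> \<le> N}"
    then obtain c where c: "\<gamma> = (\<Sum>i\<in>UNIV. of_nat (c i) *\<^sub>C \<alpha> i)" unfolding pos_lattice_def by auto
    then have "(\<Sum>i\<in>UNIV. c i) \<le> N" using g ht_eqI[OF fm_dd_sum, of c] by simp
    moreover have "c i \<le> (\<Sum>i\<in>UNIV. c i)" for i by (rule member_le_sum) auto
    ultimately have "c \<in> PiE UNIV (\<lambda>_. {..N})" by (auto intro: order_trans)
    with c show "\<gamma> \<in> (\<lambda>c. \<Sum>i\<in>UNIV. of_nat (c i) *\<^sub>C \<alpha> i) ` (PiE UNIV (\<lambda>_. {..N}))" by blast
  qed
  then show ?thesis by (rule finite_subset) (auto intro!: finite_imageI finite_PiE)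
qed

end

section \<open>Triangular decomposition, root spaces and dual bases\<close>

context bd_setting
begin

sublocale ch: chevalley br e f \<hh>
proof
  show "\<exists>c. br h (e i) = c *\<^sub>C e i" "\<exists>c. br h (f i) = c *\<^sub>C f i" if "h \<in> \<hh>" for h i
    using br_csa_e[OF that] br_csa_f[OF that] by blast+
  show "br (e i) (f j) \<in> \<hh>" for i j
    using root_csa csa_subspace by (simp add: br_e_f cvec.subspace_0)
qed (use csa_subspace csa_comm in auto)

lemma np_eq: "np = ch.Nplus" and nm_eq: "nm = ch.Nminus"
  by (simp_all add: n_plus_def n_minus_f)

lemma np_subspace: "cvec.subspace np" and nm_subspace: "cvec.subspace nm"
  by (simp_all add: np_eq nm_eq)

lemma e_np: "e i \<in> np" and f_nm: "f i \<in> nm"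
  by (auto simp: np_eq nm_eq intro: lie_generated.base)

lemma br_np: "x \<in> np \<Longrightarrow> y \<in> np \<Longrightarrow> br x y \<in> np" and br_nm: "x \<in> nm \<Longrightarrow> y \<in> nm \<Longrightarrow> br x y \<in> nm"
  by (auto simp: np_eq nm_eq intro: lie_generated.bracket)

lemma generated: "lie_generated br (\<hh> \<union> range e \<union> range f) = UNIV"
proof -
  have "gen_f K i \<in> lie_generated br (\<hh> \<union> range e \<union> range f)" for i
  proof -
    have "fm (e i) (gen_f K i) *\<^sub>C f i = gen_f K i"
      using e_gen_f_nonzero[of i] by (simp add: simple_f_def)
    then show ?thesis by (metis UnCI lie_generated.base lie_generated.scale rangeI)
  qed
  then have "lie_generated br (\<hh> \<union> range e \<union> range (gen_f K)) \<subseteq> lie_generated br (\<hh> \<union> range e \<union> range f)"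
    by (intro lie_generated_mono) (auto intro: lie_generated.base)
  then show ?thesis using km by (auto simp: symmetrizable_kac_moody_def)
qed

lemma triangular: "\<exists>a h b. x = a + h + b \<and> a \<in> nm \<and> h \<in> \<hh> \<and> b \<in> np"
  using ch.triangular[of x] generated by (simp add: np_eq nm_eq)

lemma root_spaceD: "x \<in> root_space K \<gamma> \<Longrightarrow> h \<in> \<hh> \<Longrightarrow> br h x = fm \<gamma> h *\<^sub>C x"
  by (simp add: root_space_def)

lemma root_space_br:
  "x \<in> root_space K \<gamma> \<Longrightarrow> y \<in> root_space K \<delta> \<Longrightarrow> br x y \<in> root_space K (\<gamma> + \<delta>)"
  unfolding root_space_def
  by (auto simp: br_jacobi[of _ x] br_simps fm_simps cvec.scale_left_distrib)

lemma root_space_fm: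
  assumes "x \<in> root_space K \<gamma>" "y \<in> root_space K \<delta>" "\<gamma> \<in> \<hh>" "\<delta> \<in> \<hh>" "\<gamma> + \<delta> \<noteq> 0"
  shows "fm x y = 0"
proof -
  obtain h where h: "h \<in> \<hh>" "fm (\<gamma> + \<delta>) h \<noteq> 0"
    using csa_nondeg[of "\<gamma> + \<delta>"] assms csa_subspace by (metis cvec.subspace_add)
  have "fm (br h x) y + fm x (br h y) = 0" using fm_inv'[of x h y] by simp
  then have "fm (\<gamma> + \<delta>) h * fm x y = 0"
    using root_spaceD[OF assms(1) h(1)] root_spaceD[OF assms(2) h(1)]
    by (simp add: fm_simps algebra_simps)
  then show ?thesis using h by simp
qed

text \<open>Invariance of the form under \<open>dd\<close> alone. Elements such as B^l f_\<alpha>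
  are tracked below only by the action of \<ll>, so the degree takes the place of the full
  weight.\<close>

lemma fm_dd_eq_0:
  assumes "br dd x = c *\<^sub>C x" "br dd y = d *\<^sub>C y" "c + d \<noteq> 0"
  shows "fm x y = 0"
proof -
  have "fm (br dd x) y + fm x (br dd y) = 0" using fm_inv'[of x dd y] by simp
  then have "(c + d) * fm x y = 0" using assms by (simp add: fm_simps algebra_simps)
  then show ?thesis using assms(3) by simp
qed

lemma csa_root_space: "h \<in> \<hh> \<Longrightarrow> h \<in> root_space K 0"
  by (simp add: root_space_def csa_comm fm_simps)

lemma e_root_space: "e i \<in> root_space K (\<alpha> i)" and f_root_space: "f i \<in> root_space K (- \<alpha> i)"
  by (auto simp: root_space_def br_csa_e br_csa_f fm_simps)

lemma generated_weights:
  assumes "\<And>i. g i \<in> root_space K (w i)" "\<And>i. w i \<in> S" "\<And>\<gamma> \<delta>. \<gamma> \<in> S \<Longrightarrow> \<delta> \<in> S \<Longrightarrow> \<gamma> + \<delta> \<in> S"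
  shows "lie_generated br (range g) \<subseteq> cvec.span (\<Union>\<gamma>\<in>S. root_space K \<gamma>)"
proof
  fix x assume "x \<in> lie_generated br (range g)"
  then show "x \<in> cvec.span (\<Union>\<gamma>\<in>S. root_space K \<gamma>)"
  proof induction
    case (base x)
    then show ?case using assms(1,2) by (auto intro!: cvec.span_base)
  next
    case (bracket x y)
    have "br x y \<in> cvec.span (\<Union>\<gamma>\<in>S. root_space K \<gamma>)"
      if xy: "x \<in> (\<Union>\<gamma>\<in>S. root_space K \<gamma>)" "y \<in> (\<Union>\<gamma>\<in>S. root_space K \<gamma>)" for x y
    proof -
      obtain \<gamma> \<delta> where g: "\<gamma> \<in> S" "\<delta> \<in> S" and "x \<in> root_space K \<gamma>" "y \<in> root_space K \<delta>"
        using xy by blast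
      then have "br x y \<in> root_space K (\<gamma> + \<delta>)" by (intro root_space_br)
      with assms(3)[OF g] show ?thesis by (intro cvec.span_base) blast
    qed
    from br_span_closed[OF this cvec.subspace_span] bracket.IH show ?case by blast
  qed (auto intro: cvec.span_zero cvec.span_add cvec.span_scale)
qed

lemma ht_Q_pos: "\<gamma> \<in> Q - {0} \<Longrightarrow> ht \<gamma> > 0"
  using ht_pos by auto

lemma Q_add_nonzero: "\<gamma> \<in> Q - {0} \<Longrightarrow> \<delta> \<in> Q \<Longrightarrow> \<gamma> + \<delta> \<noteq> 0"
  using ht_Q_pos[of \<gamma>] ht_add[of \<gamma> \<delta>] by auto

lemma np_weights: "np \<subseteq> cvec.span (\<Union>\<gamma>\<in>Q - {0}. root_space K \<gamma>)"
  and nm_weights: "nm \<subseteq> cvec.span (\<Union>\<gamma>\<in>Q - {0}. root_space K (- \<gamma>))"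
proof -
  have add: "\<gamma> + \<delta> \<in> Q - {0}" if "\<gamma> \<in> Q - {0}" "\<delta> \<in> Q - {0}" for \<gamma> \<delta>
    using that Q_add Q_add_nonzero by blast
  have r: "\<alpha> i \<in> Q - {0}" for i
  proof -
    have "fm dd (\<alpha> i) \<noteq> 0" by (simp add: dd)
    then have "\<alpha> i \<noteq> 0" by (metis fm_simps(5))
    then show ?thesis using Q_root by simp
  qed
  show "np \<subseteq> cvec.span (\<Union>\<gamma>\<in>Q - {0}. root_space K \<gamma>)"
    unfolding np_eq by (rule generated_weights[of e \<alpha>]) (use e_root_space r add in auto)
  have "nm \<subseteq> cvec.span (\<Union>\<gamma>\<in>uminus ` (Q - {0}). root_space K \<gamma>)"
    unfolding nm_eq
  proof (rule generated_weights[of f "\<lambda>i. - \<alpha> i"])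
    fix \<gamma> \<delta> assume "\<gamma> \<in> uminus ` (Q - {0})" "\<delta> \<in> uminus ` (Q - {0})"
    then obtain \<gamma>' \<delta>' where "\<gamma> = - \<gamma>'" "\<delta> = - \<delta>'" "\<gamma>' \<in> Q - {0}" "\<delta>' \<in> Q - {0}" by blast
    with add[of \<gamma>' \<delta>'] show "\<gamma> + \<delta> \<in> uminus ` (Q - {0})" by (intro image_eqI[of _ _ "\<gamma>' + \<delta>'"]) auto
  qed (use f_root_space r in blast)+
  then show "nm \<subseteq> cvec.span (\<Union>\<gamma>\<in>Q - {0}. root_space K (- \<gamma>))" by simp
qed

lemma orthogonal_imp_0:
  assumes "\<And>\<gamma> y. \<gamma> \<in> Q - {0} \<Longrightarrow> y \<in> root_space K \<gamma> \<Longrightarrow> fm x y = 0"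
    and "\<And>\<gamma> y. \<gamma> \<in> Q - {0} \<Longrightarrow> y \<in> root_space K (- \<gamma>) \<Longrightarrow> fm x y = 0"
    and "\<And>h. h \<in> \<hh> \<Longrightarrow> fm x h = 0"
  shows "x = 0"
proof (rule fm_nondeg)
  fix y
  have z: "fm x y = 0" if "y \<in> cvec.span S" "\<And>y. y \<in> S \<Longrightarrow> fm x y = 0" for y S
    by (rule linear_on_span_eq[OF linear_on_subset[OF fm_linear] linear_on_subset[where f="\<lambda>_. 0"]])
      (use that in \<open>auto simp: linear_on_def\<close>)
  obtain a h b where "y = a + h + b" "a \<in> nm" "h \<in> \<hh>" "b \<in> np" using triangular by blast
  moreover have "fm x a = 0" "fm x b = 0"
    using z[of a "\<Union>\<gamma>\<in>Q - {0}. root_space K (- \<gamma>)"] z[of b "\<Union>\<gamma>\<in>Q - {0}. root_space K \<gamma>"]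
      np_weights nm_weights \<open>a \<in> nm\<close> \<open>b \<in> np\<close> assms(1,2) by blast+
  ultimately show "fm x y = 0" using assms(3) by (simp add: fm_simps)
qed

text \<open>Only the root space of \<gamma> can pair nontrivially with that of -\<gamma>. If the
  former vanished, x would be orthogonal to everything.\<close>

lemma negative_root:
  assumes "\<gamma> \<in> Q - {0}" "x \<in> root_space K (- \<gamma>)" "x \<noteq> 0"
  shows "\<gamma> \<in> pos_roots K"
proof (rule ccontr)
  assume "\<gamma> \<notin> pos_roots K"
  then have "root_space K \<gamma> = {0}" using assms by (simp add: pos_roots_def)
  then have 1: "fm x y = 0" if "\<delta> \<in> Q - {0}" "y \<in> root_space K \<delta>" for \<delta> y
    using that assms root_space_fm[of x "- \<gamma>" y \<delta>] Q_csa csa_subspace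
    by (cases "\<delta> = \<gamma>") (auto simp: fm_simps cvec.subspace_neg add.commute eq_neg_iff_add_eq_0)
  have 2: "fm x y = 0" if "\<delta> \<in> Q - {0}" "y \<in> root_space K (- \<delta>)" for \<delta> y
    using that assms root_space_fm[of x "- \<gamma>" y "- \<delta>"] Q_csa csa_subspace Q_add_nonzero[of \<gamma> \<delta>]
    by (auto simp: cvec.subspace_neg add_eq_0_iff)
  have 3: "fm x h = 0" if "h \<in> \<hh>" for h
    using that assms root_space_fm[of x "- \<gamma>" h 0] Q_csa csa_subspace csa_root_space
    by (auto simp: cvec.subspace_neg cvec.subspace_0)
  have "x = 0" by (rule orthogonal_imp_0) (fact 1 2 3)+
  then show False using assms(3) by simp
qed

lemma rootD:
  assumes "a \<in> R"
  shows "fst a \<in> pos_roots K" "fst a \<in> Q - {0}" "fst a \<in> Q" "fst a \<in> \<hh>" "ht (fst a) > 0"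
    "E a \<in> root_space K (fst a)" "F a \<in> root_space K (- fst a)"
proof -
  have a: "fst a \<in> pos_roots K" "snd a \<in> {1..root_mult K (fst a)}"
    using assms by (auto simp: root_index_def)
  then show "fst a \<in> pos_roots K" "fst a \<in> Q - {0}" "fst a \<in> Q" by (auto simp: pos_roots_def)
  then show "fst a \<in> \<hh>" "ht (fst a) > 0" using Q_csa ht_Q_pos by auto
  have "E a \<in> cvec.span (eb D (fst a) ` {1..root_mult K (fst a)})"
    "F a \<in> cvec.span (fb D (fst a) ` {1..root_mult K (fst a)})"
    using a(2) by (auto intro: cvec.span_base)
  then show "E a \<in> root_space K (fst a)" "F a \<in> root_space K (- fst a)"
    using bases a(1) unfolding root_bases_def by auto
qed

lemma pos_root_space:
  assumes "\<gamma> \<in> pos_roots K"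
  shows "root_space K \<gamma> = cvec.span (E ` {a \<in> R. fst a = \<gamma>})"
    "root_space K (- \<gamma>) = cvec.span (F ` {a \<in> R. fst a = \<gamma>})"
proof -
  have "E ` {a \<in> R. fst a = \<gamma>} = eb D \<gamma> ` {1..root_mult K \<gamma>}"
    "F ` {a \<in> R. fst a = \<gamma>} = fb D \<gamma> ` {1..root_mult K \<gamma>}"
    using assms by (force simp: root_index_def)+
  then show "root_space K \<gamma> = cvec.span (E ` {a \<in> R. fst a = \<gamma>})"
    "root_space K (- \<gamma>) = cvec.span (F ` {a \<in> R. fst a = \<gamma>})"
    using bases assms unfolding root_bases_def by auto
qed

lemma weights_span:
  assumes "\<gamma> \<in> Q - {0}"
  shows "root_space K \<gamma> \<subseteq> cvec.span (E ` R)" "root_space K (- \<gamma>) \<subseteq> cvec.span (F ` R)"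
proof -
  show "root_space K \<gamma> \<subseteq> cvec.span (E ` R)"
  proof (cases "\<gamma> \<in> pos_roots K")
    case True
    then show ?thesis unfolding pos_root_space(1)[OF True] by (intro cvec.span_mono) auto
  next
    case False
    then have "root_space K \<gamma> = {0}" using assms by (simp add: pos_roots_def)
    then show ?thesis by (simp add: cvec.span_zero)
  qed
  show "root_space K (- \<gamma>) \<subseteq> cvec.span (F ` R)"
  proof (cases "\<gamma> \<in> pos_roots K")
    case True
    then show ?thesis unfolding pos_root_space(2)[OF True] by (intro cvec.span_mono) auto
  next
    case False
    then have "root_space K (- \<gamma>) \<subseteq> {0}" using assms negative_root by blast
    then show ?thesis using cvec.span_zero by blast
  qed
qed

lemma np_span': "np \<subseteq> cvec.span (E ` R)" and nm_span': "nm \<subseteq> cvec.span (F ` R)"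
  by (intro subset_trans[OF np_weights] subset_trans[OF nm_weights] cvec.span_minimal
      cvec.subspace_span; use weights_span in blast)+

lemma fm_EE: "a \<in> R \<Longrightarrow> b \<in> R \<Longrightarrow> fm (E a) (E b) = 0"
  and fm_FF: "a \<in> R \<Longrightarrow> b \<in> R \<Longrightarrow> fm (F a) (F b) = 0"
  and fm_E_csa: "a \<in> R \<Longrightarrow> h \<in> \<hh> \<Longrightarrow> fm (E a) h = 0"
  and fm_F_csa: "a \<in> R \<Longrightarrow> h \<in> \<hh> \<Longrightarrow> fm (F a) h = 0"
  and fm_EF: "a \<in> R \<Longrightarrow> b \<in> R \<Longrightarrow> fm (E a) (F b) = (if a = b then 1 else 0)"
proof -
  assume a: "a \<in> R"
  note A = rootD[OF a]
  show "fm (E a) h = 0" "fm (F a) h = 0" if "h \<in> \<hh>"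
    using root_space_fm[OF A(6) csa_root_space[OF that]] root_space_fm[OF A(7) csa_root_space[OF that]]
      A(2,4) csa_subspace by (auto simp: cvec.subspace_neg cvec.subspace_0)
  assume b: "b \<in> R"
  note B = rootD[OF b]
  have nz: "fst a + fst b \<noteq> 0" using Q_add_nonzero[OF A(2) B(3)] .
  then have "- fst a + - fst b \<noteq> 0" by (metis add.inverse_distrib_swap add.commute neg_0_equal_iff_equal)
  then show "fm (E a) (E b) = 0" "fm (F a) (F b) = 0"
    using nz root_space_fm[OF A(6) B(6)] root_space_fm[OF A(7) B(7)] A(4) B(4) csa_subspace
    by (auto simp: cvec.subspace_neg)
  show "fm (E a) (F b) = (if a = b then 1 else 0)"
  proof (cases "fst a = fst b")
    case True
    obtain \<gamma> s t where "a = (\<gamma>, s)" "b = (\<gamma>, t)" using True by (cases a, cases b) auto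
    then show ?thesis using bases a b unfolding root_bases_def root_index_def by auto
  next
    case False
    then have "fst a + - fst b \<noteq> 0" by (simp add: add_eq_0_iff)
    then show ?thesis using False root_space_fm[OF A(6) B(7)] A(4) B(4) csa_subspace
      by (auto simp: cvec.subspace_neg)
  qed
qed

lemma span_orthogonal:
  assumes "x \<in> cvec.span S" "\<And>z. z \<in> S \<Longrightarrow> fm z y = 0" shows "fm x y = 0"
  by (rule linear_on_span_eq[OF linear_on_subset[OF fm_linear_left] linear_on_subset[where f="\<lambda>_. 0"]])
    (use assms in \<open>auto simp: linear_on_def\<close>)

lemma eq_0I:
  assumes "\<And>a. a \<in> R \<Longrightarrow> fm x (E a) = 0" "\<And>a. a \<in> R \<Longrightarrow> fm x (F a) = 0" "\<And>h. h \<in> \<hh> \<Longrightarrow> fm x h = 0"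
  shows "x = 0"
proof (rule orthogonal_imp_0)
  fix \<gamma> y assume g: "\<gamma> \<in> Q - {0}"
  show "fm x y = 0" if "y \<in> root_space K \<gamma>"
  proof -
    have "fm y x = 0"
      by (rule span_orthogonal[of y "E ` R"]) (use that assms(1) weights_span(1)[OF g] in \<open>auto simp: fm_sym[of _ x]\<close>)
    then show ?thesis by (simp add: fm_sym[of x])
  qed
  show "fm x y = 0" if "y \<in> root_space K (- \<gamma>)"
  proof -
    have "fm y x = 0"
      by (rule span_orthogonal[of y "F ` R"]) (use that assms(2) weights_span(2)[OF g] in \<open>auto simp: fm_sym[of _ x]\<close>)
    then show ?thesis by (simp add: fm_sym[of x])
  qed
qed (use assms in auto)

lemma np_orthogonal:
  assumes "x \<in> np" shows "b \<in> R \<Longrightarrow> fm x (E b) = 0" "h \<in> \<hh> \<Longrightarrow> fm x h = 0"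
  using assms np_span' span_orthogonal[of x "E ` R"] fm_EE fm_E_csa by blast+

lemma nm_orthogonal:
  assumes "x \<in> nm" shows "b \<in> R \<Longrightarrow> fm x (F b) = 0" "h \<in> \<hh> \<Longrightarrow> fm x h = 0"
  using assms nm_span' span_orthogonal[of x "F ` R"] fm_FF fm_F_csa by blast+

text \<open>The difference of E_a and its component in n_+ is orthogonal to n_+ and to \<hh> because
  both of them are, and orthogonal to n_- because it lies in n_- + \<hh>. Nondegeneracy makes it
  zero; the same works for F_a.\<close>

lemma E_np: "a \<in> R \<Longrightarrow> E a \<in> np" and F_nm: "a \<in> R \<Longrightarrow> F a \<in> nm"
proof -
  assume a: "a \<in> R"
  obtain p h q where d: "E a = p + h + q" "p \<in> nm" "h \<in> \<hh>" "q \<in> np" using triangular by blast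
  have z: "E a - q = p + h" using d by simp
  have "E a - q = 0"
  proof (rule eq_0I)
    show "fm (E a - q) (E b) = 0" if "b \<in> R" for b
      using np_orthogonal(1)[OF d(4) that] fm_EE[OF a that] by (simp add: fm_simps)
    show "fm (E a - q) h' = 0" if "h' \<in> \<hh>" for h'
      using np_orthogonal(2)[OF d(4) that] fm_E_csa[OF a that] by (simp add: fm_simps)
    show "fm (E a - q) (F b) = 0" if "b \<in> R" for b
      unfolding z using d that nm_orthogonal fm_F_csa[OF that] by (simp add: fm_simps fm_sym[of h])
  qed
  then show "E a \<in> np" using d(4) by simp
  obtain p h q where d: "F a = p + h + q" "p \<in> nm" "h \<in> \<hh>" "q \<in> np" using triangular by blast
  have z: "F a - p = h + q" using d by simp
  have "F a - p = 0"
  proof (rule eq_0I)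
    show "fm (F a - p) (F b) = 0" if "b \<in> R" for b
      using nm_orthogonal(1)[OF d(2) that] fm_FF[OF a that] by (simp add: fm_simps)
    show "fm (F a - p) h' = 0" if "h' \<in> \<hh>" for h'
      using nm_orthogonal(2)[OF d(2) that] fm_F_csa[OF a that] by (simp add: fm_simps)
    show "fm (F a - p) (E b) = 0" if "b \<in> R" for b
      unfolding z using d that np_orthogonal fm_E_csa[OF that] by (simp add: fm_simps fm_sym[of h])
  qed
  then show "F a \<in> nm" using d(2) by simp
qed

lemma np_span: "np = cvec.span (E ` R)" and nm_span: "nm = cvec.span (F ` R)"
  using np_span' nm_span' E_np F_nm
  by (intro antisym cvec.span_minimal np_subspace nm_subspace; blast)+

text \<open>Finite cut-off of the root sums. Powers of B preserve the degree, so expansions of B^l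
  f_\<alpha> in the basis \<open>F\<close> stay inside the cut-off that contains \<alpha>.\<close>

definition Rn :: "nat \<Rightarrow> ('g \<times> nat) set" where "Rn n = {a \<in> R. ht (fst a) \<le> n}"

lemma Rn: "a \<in> Rn n \<Longrightarrow> a \<in> R" "a \<in> Rn n \<longleftrightarrow> a \<in> R \<and> ht (fst a) \<le> n" "Rn n \<subseteq> R" "m \<le> n \<Longrightarrow> Rn m \<subseteq> Rn n"
  by (auto simp: Rn_def)

lemma finite_Rn: "finite (Rn n)"
proof (rule finite_subset)
  show "Rn n \<subseteq> (SIGMA \<gamma>:{\<gamma> \<in> Q. ht \<gamma> \<le> n}. {1..root_mult K \<gamma>})"
    by (auto simp: Rn_def root_index_def pos_roots_def)
qed (use finite_Q in auto)

lemma br_csa_E: "a \<in> R \<Longrightarrow> h \<in> \<hh> \<Longrightarrow> br h (E a) = fm (fst a) h *\<^sub>C E a"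
  and br_csa_F: "a \<in> R \<Longrightarrow> h \<in> \<hh> \<Longrightarrow> br h (F a) = (- fm (fst a) h) *\<^sub>C F a"
  using rootD(6,7) root_spaceD by (fastforce simp: fm_simps)+

lemma br_dd_E: "a \<in> R \<Longrightarrow> br dd (E a) = of_nat (ht (fst a)) *\<^sub>C E a"
  and br_dd_F: "a \<in> R \<Longrightarrow> br dd (F a) = (- of_nat (ht (fst a))) *\<^sub>C F a"
  using br_csa_E[of a dd] br_csa_F[of a dd] dd fm_dd_Q rootD(3) fm_sym by metis+

lemma np_expand:
  assumes "x \<in> np" "br dd x = of_nat n *\<^sub>C x" "n \<le> N"
  shows "x = (\<Sum>a\<in>Rn N. fm x (F a) *\<^sub>C E a)"
proof -
  let ?s = "\<Sum>a\<in>Rn N. fm x (F a) *\<^sub>C E a"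
  have s: "?s \<in> np" by (intro cvec.subspace_sum[OF np_subspace] cvec.subspace_scale[OF np_subspace] E_np Rn)
  have "x - ?s = 0"
  proof (rule eq_0I)
    fix b assume b: "b \<in> R"
    have "fm ?s (F b) = (\<Sum>a\<in>Rn N. if a = b then fm x (F b) else 0)"
      unfolding fm_sum
    proof (intro sum.cong refl)
      fix a assume "a \<in> Rn N"
      then show "fm (fm x (F a) *\<^sub>C E a) (F b) = (if a = b then fm x (F b) else 0)"
        using b Rn(1)[of a N] by (simp add: fm_simps fm_EF)
    qed
    also have "\<dots> = fm x (F b)"
    proof (cases "b \<in> Rn N")
      case False
      then have "ht (fst b) \<noteq> n" using b assms(3) by (auto simp: Rn_def)
      then have "fm x (F b) = 0"
        using fm_dd_eq_0[OF assms(2) br_dd_F[OF b]] by (simp add: add_eq_0_iff)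
      then show ?thesis by (simp add: finite_Rn)
    qed (simp add: finite_Rn)
    finally show "fm (x - ?s) (F b) = 0" by (simp add: fm_simps)
    show "fm (x - ?s) (E b) = 0" using assms(1) s np_orthogonal b by (simp add: fm_simps)
  qed (use assms(1) s np_orthogonal in \<open>simp add: fm_simps\<close>)
  then show ?thesis by simp
qed

lemma nm_expand:
  assumes "x \<in> nm" "br dd x = (- of_nat n) *\<^sub>C x" "n \<le> N"
  shows "x = (\<Sum>a\<in>Rn N. fm x (E a) *\<^sub>C F a)"
proof -
  let ?s = "\<Sum>a\<in>Rn N. fm x (E a) *\<^sub>C F a"
  have s: "?s \<in> nm" by (intro cvec.subspace_sum[OF nm_subspace] cvec.subspace_scale[OF nm_subspace] F_nm Rn)
  have "x - ?s = 0"
  proof (rule eq_0I)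
    fix b assume b: "b \<in> R"
    have "fm ?s (E b) = (\<Sum>a\<in>Rn N. if a = b then fm x (E b) else 0)"
      unfolding fm_sum
    proof (intro sum.cong refl)
      fix a assume "a \<in> Rn N"
      then show "fm (fm x (E a) *\<^sub>C F a) (E b) = (if a = b then fm x (E b) else 0)"
        using b Rn(1)[of a N] by (simp add: fm_simps fm_EF fm_sym[of "F a"])
    qed
    also have "\<dots> = fm x (E b)"
    proof (cases "b \<in> Rn N")
      case False
      then have "ht (fst b) \<noteq> n" using b assms(3) by (auto simp: Rn_def)
      then have "fm x (E b) = 0"
        using fm_dd_eq_0[OF assms(2) br_dd_E[OF b]] by (simp add: add_eq_0_iff)
      then show ?thesis by (simp add: finite_Rn)
    qed (simp add: finite_Rn)
    finally show "fm (x - ?s) (E b) = 0" by (simp add: fm_simps)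
    show "fm (x - ?s) (F b) = 0" using assms(1) s nm_orthogonal b by (simp add: fm_simps)
  qed (use assms(1) s nm_orthogonal in \<open>simp add: fm_simps\<close>)
  then show ?thesis by simp
qed

text \<open>The closure of \<open>Y\<close> under \<hh> and the f_i. For a subspace \<open>Y\<close>
  of n_- stable under all ad e_i this is already the ideal generated by \<open>Y\<close>.\<close>

inductive_set ad_lower :: "'g set \<Rightarrow> 'g set" for Y where
  base: "y \<in> Y \<Longrightarrow> y \<in> ad_lower Y"
| add: "x \<in> ad_lower Y \<Longrightarrow> y \<in> ad_lower Y \<Longrightarrow> x + y \<in> ad_lower Y"
| scale: "x \<in> ad_lower Y \<Longrightarrow> c *\<^sub>C x \<in> ad_lower Y"
| ad: "x \<in> ad_lower Y \<Longrightarrow> z \<in> \<hh> \<union> range f \<Longrightarrow> br z x \<in> ad_lower Y"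

lemma nm_csa: "x \<in> nm \<Longrightarrow> x \<in> \<hh> \<Longrightarrow> x = 0"
  by (rule eq_0I) (use nm_orthogonal fm_E_csa in \<open>auto simp: fm_sym[of x \<open>E _\<close>]\<close>)

text \<open>By Jacobi, ad e_i passes through the lowering operators at the cost of brackets in \<hh>
  and multiples of ad e_i, so lowering \<open>Y\<close> yields an ideal. It stays inside n_-, hence
  meets \<hh> trivially and is zero. This takes over the role of the Serre relations.\<close>

lemma nm_stable_zero:
  assumes "cvec.subspace Y" "Y \<subseteq> nm" "\<And>i y. y \<in> Y \<Longrightarrow> br (e i) y \<in> Y"
  shows "Y \<subseteq> {0}"
proof -
  have nm: "x \<in> nm" if "x \<in> ad_lower Y" for x
    using that
  proof induction
    case (ad x z)
    then show ?case using ch.ad_H_Nminus[of x z] br_nm[OF f_nm, of x] by (auto simp: nm_eq)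
  qed (use assms(2) nm_subspace in \<open>auto simp: cvec.subspace_add cvec.subspace_scale\<close>)
  have sub: "cvec.subspace (ad_lower Y)"
    using cvec.subspace_0[OF assms(1)] by (auto simp: cvec.subspace_def intro: ad_lower.intros)
  have e: "br (e i) x \<in> ad_lower Y" if "x \<in> ad_lower Y" for i x
    using that
  proof induction
    case (ad x z)
    have j: "br (e i) (br z x) = br (br (e i) z) x + br z (br (e i) x)" by (rule br_jacobi)
    have 1: "br z (br (e i) x) \<in> ad_lower Y" using ad by (auto intro: ad_lower.intros)
    have "br (br (e i) z) x \<in> ad_lower Y"
    proof (cases "z \<in> \<hh>")
      case True
      have "br (e i) z = (- fm (\<alpha> i) z) *\<^sub>C e i"
        using br_anti[of "e i" z] br_csa_e[OF True] by simp
      then show ?thesis using ad by (simp add: br_simps ad_lower.scale cvec.subspace_neg[OF sub])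
    next
      case False
      then obtain j where "z = f j" using ad by auto
      then show ?thesis
        using ad root_csa by (auto simp: br_e_f br_simps cvec.subspace_0[OF sub] intro: ad_lower.ad)
    qed
    then show ?case using 1 j by (simp add: ad_lower.add)
  qed (use assms(3) in \<open>auto simp: br_simps intro: ad_lower.intros\<close>)
  have "br z x \<in> ad_lower Y" if "x \<in> ad_lower Y" for z x
    by (rule lie_generated_ad[OF sub, of "\<hh> \<union> range e \<union> range f"])
      (use that e generated in \<open>auto intro: ad_lower.ad\<close>)
  then have "lie_ideal br (ad_lower Y)" using sub by (auto simp: lie_ideal_def)
  moreover have "ad_lower Y \<inter> \<hh> = {0}"
    using nm nm_csa cvec.subspace_0[OF sub] cvec.subspace_0[OF csa_subspace] by blast
  ultimately have "ad_lower Y = {0}" using km unfolding symmetrizable_kac_moody_def by blast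
  then show ?thesis using ad_lower.base by blast
qed

end

definition pair_bracket :: "('a \<Rightarrow> 'a \<Rightarrow> 'a) \<Rightarrow> 'a \<times> 'a \<Rightarrow> 'a \<times> 'a \<Rightarrow> 'a \<times> 'a" where
  "pair_bracket br p q = (br (fst p) (fst q), br (snd p) (snd q))"

lemma pair_bracket_Pair [simp]: "pair_bracket br (x, y) (x', y') = (br x x', br y y')"
  by (simp add: pair_bracket_def)

lemma (in lie_algebra) lie_bracket_pair: "lie_bracket (pair_bracket br)"
  unfolding lie_bracket_def
proof (intro conjI allI)
  show "pair_bracket br x (pair_bracket br y z) + pair_bracket br y (pair_bracket br z x)
      + pair_bracket br z (pair_bracket br x y) = 0" for x y z
    using lie by (simp add: pair_bracket_def lie_bracket_def zero_prod_def)
qed (auto simp: linear_on_def pair_bracket_def br_simps br_self zero_prod_def split_paired_all)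

context bd_setting
begin

section \<open>The Lie algebra homomorphism attached to a triple\<close>

text \<open>The subalgebra of \<open>\<gg> \<times> \<gg>\<close> generated by the following pairs contains the graph of \<open>B\<close>. It is single-valued
  on \<open>\<nn>\<^sub>-\<close>, because the \<open>y\<close> in \<open>\<nn>\<^sub>-\<close> related to \<open>0\<close> form a subspace stable under all \<open>ad e_k\<close>. No presentation of
  \<open>\<nn>\<^sub>-\<close> is needed.\<close>

definition BE :: "'n \<Rightarrow> 'g \<times> 'g" where "BE i = (if i \<in> G1 then (e i, e (T i)) else 0)"
definition BF :: "'n \<Rightarrow> 'g \<times> 'g" where "BF i = (f i, if i \<in> G1 then f (T i) else 0)"
definition BH :: "('g \<times> 'g) set" where
  "BH = {(\<Sum>i\<in>G1. c i *\<^sub>C \<alpha> i, \<Sum>i\<in>G1. c i *\<^sub>C \<alpha> (T i)) | c. True}"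

text \<open>The pairs for which B intertwines ad h and ad h'. They include (\<alpha>_i, \<alpha>_{T
  i}) and (y, y) for y in \<ll>, the two ways in which an element of \<hh> gets past B under the
  trace.\<close>

definition compat :: "'g \<Rightarrow> 'g \<Rightarrow> bool" where
  "compat h h' \<longleftrightarrow> h \<in> \<hh> \<and> h' \<in> \<hh> \<and> (\<forall>i\<in>G1. fm (\<alpha> (T i)) h' = fm (\<alpha> i) h)"

lemma compat_csa: "compat h h' \<Longrightarrow> h \<in> \<hh>" "compat h h' \<Longrightarrow> h' \<in> \<hh>"
  by (auto simp: compat_def)

lemma compat_lsub: "y \<in> \<ll> \<Longrightarrow> compat y y"
  by (auto simp: compat_def lsub_iff)

lemma compat_root: "i \<in> G1 \<Longrightarrow> compat (\<alpha> i) (\<alpha> (T i))"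
  using T_form root_csa by (auto simp: compat_def)

lemma BH_compat: "(h, h') \<in> BH \<Longrightarrow> compat h h'"
  using T_form root_csa csa_subspace
  by (auto simp: BH_def compat_def fm_sum fm_simps cvec.subspace_sum cvec.subspace_scale intro!: sum.cong)

lemma br_compat_BF: "compat h h' \<Longrightarrow> pair_bracket br (h, h') (BF i) = (- fm (\<alpha> i) h) *\<^sub>C BF i"
  by (auto simp: BF_def compat_def br_csa_f br_simps)

lemma BH_subspace: "cvec.subspace BH"
  unfolding cvec.subspace_def
proof (intro conjI ballI allI)
  show "0 \<in> BH" unfolding BH_def by (auto simp: zero_prod_def intro!: exI[of _ "\<lambda>_. 0"])
next
  fix x y assume "x \<in> BH" "y \<in> BH"
  then obtain c d where "x = (\<Sum>i\<in>G1. c i *\<^sub>C \<alpha> i, \<Sum>i\<in>G1. c i *\<^sub>C \<alpha> (T i))"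
    "y = (\<Sum>i\<in>G1. d i *\<^sub>C \<alpha> i, \<Sum>i\<in>G1. d i *\<^sub>C \<alpha> (T i))" by (auto simp: BH_def)
  then show "x + y \<in> BH" unfolding BH_def
    by (auto simp: cvec.scale_left_distrib sum.distrib intro!: exI[of _ "\<lambda>i. c i + d i"])
next
  fix a x assume "x \<in> BH"
  then obtain c where "x = (\<Sum>i\<in>G1. c i *\<^sub>C \<alpha> i, \<Sum>i\<in>G1. c i *\<^sub>C \<alpha> (T i))" by (auto simp: BH_def)
  then show "a *\<^sub>C x \<in> BH" unfolding BH_def
    by (auto simp: cvec.scale_sum_right intro!: exI[of _ "\<lambda>i. a * c i"])
qed

lemma root_BH: assumes "i \<in> G1" shows "(\<alpha> i, \<alpha> (T i)) \<in> BH"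
proof -
  have "(\<Sum>j\<in>G1. (if j = i then 1 else 0) *\<^sub>C g j) = g i" for g :: "'n \<Rightarrow> 'g"
    using assms by (subst sum.mono_neutral_right[of G1 "{i}"]) auto
  then show ?thesis unfolding BH_def by (auto intro!: exI[of _ "\<lambda>j. if j = i then 1 else 0"])
qed

text \<open>Injectivity of T makes the brackets of \<open>BE i\<close> with \<open>BF j\<close>
  vanish off the diagonal. That T preserves inner products makes \<open>BH\<close> act by one scalar
  on both components of a generator.\<close>

sublocale gb: chevalley "pair_bracket br" BE BF BH
proof
  show "lie_bracket (pair_bracket br)" by (rule lie_bracket_pair)
  show "pair_bracket br (BE i) (BF j) \<in> BH" for i j
    using root_BH[of i] T_inj[of i j] cvec.subspace_0[OF BH_subspace]
    by (cases "i = j") (auto simp: BE_def BF_def br_e_f br_simps zero_prod_def)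
  show "\<exists>c. pair_bracket br h (BE i) = c *\<^sub>C BE i" if h: "h \<in> BH" for h i
  proof (intro exI)
    show "pair_bracket br h (BE i) = fm (\<alpha> i) (fst h) *\<^sub>C BE i"
      using BH_compat[of "fst h" "snd h"] h
      by (cases h) (auto simp: BE_def compat_def br_csa_e br_simps zero_prod_def)
  qed
  show "\<exists>c. pair_bracket br h (BF i) = c *\<^sub>C BF i" if h: "h \<in> BH" for h i
    using br_compat_BF[of "fst h" "snd h" i] BH_compat[of "fst h" "snd h"] h by (metis prod.collapse)
  show "pair_bracket br h h' = 0" if "h \<in> BH" "h' \<in> BH" for h h'
    using that BH_compat[of "fst h" "snd h"] BH_compat[of "fst h'" "snd h'"]
    by (cases h, cases h') (auto simp: compat_def csa_comm zero_prod_def)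
qed (rule BH_subspace)

lemma NB_nm: "p \<in> gb.Nminus \<Longrightarrow> fst p \<in> nm \<and> snd p \<in> nm"
proof (induction rule: lie_generated.induct)
  case (base p)
  then show ?case using f_nm cvec.subspace_0[OF nm_subspace] by (auto simp: BF_def)
next
  case (bracket x y)
  then show ?case using br_nm by (simp add: pair_bracket_def)
qed (auto simp: cvec.subspace_0 cvec.subspace_add nm_subspace cvec.subspace_scale scaleC_prod_def)

lemma NB_total: "x \<in> nm \<Longrightarrow> \<exists>y. (x, y) \<in> gb.Nminus"
  unfolding nm_eq
proof (induction rule: lie_generated.induct)
  case (base x)
  then obtain i where "x = f i" by auto
  then have "(x, snd (BF i)) \<in> gb.Nminus"
    by (intro lie_generated.base) (auto simp: BF_def)
  then show ?case by blast
next
  case zero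
  have "(0, 0) \<in> gb.Nminus" using lie_generated.zero by (metis zero_prod_def)
  then show ?case by blast
next
  case (add x y)
  then obtain x' y' where "(x, x') \<in> gb.Nminus" "(y, y') \<in> gb.Nminus" by blast
  from lie_generated.add[OF this] show ?case by auto
next
  case (scale x c)
  then obtain x' where "(x, x') \<in> gb.Nminus" by blast
  from lie_generated.scale[OF this, of c] show ?case by auto
next
  case (bracket x y)
  then obtain x' y' where "(x, x') \<in> gb.Nminus" "(y, y') \<in> gb.Nminus" by blast
  from lie_generated.bracket[OF this] show ?case by auto
qed

text \<open>Second components lie in the subalgebra generated by the f_j with j in \<Gamma>_2, and
  e_k commutes with these generators when k is outside \<Gamma>_2.\<close>

lemma NB_e: "p \<in> gb.Nminus \<Longrightarrow> k \<notin> G2 \<Longrightarrow> br (e k) (snd p) = 0"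
proof (induction rule: lie_generated.induct)
  case (base p)
  then show ?case using T_G2 by (auto simp: BF_def br_e_f br_simps)
next
  case (bracket x y)
  then show ?case by (simp add: pair_bracket_def br_jacobi br_simps)
qed (auto simp: br_simps scaleC_prod_def)

lemma BH_0: assumes "(0, h) \<in> BH" shows "h = 0"
proof -
  obtain c where c: "(\<Sum>i\<in>G1. c i *\<^sub>C \<alpha> i) = 0" "h = (\<Sum>i\<in>G1. c i *\<^sub>C \<alpha> (T i))"
    using assms by (auto simp: BH_def)
  have "(\<Sum>i\<in>UNIV. (if i \<in> G1 then c i else 0) *\<^sub>C \<alpha> i) = (\<Sum>i\<in>G1. c i *\<^sub>C \<alpha> i)"
    by (rule sum.mono_neutral_cong_right) auto
  then have "(if i \<in> G1 then c i else 0) = 0" for i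
    using root_indep[of "\<lambda>i. if i \<in> G1 then c i else 0"] c(1) by simp
  then have "c i = 0" if "i \<in> G1" for i using that by metis
  then show ?thesis using c(2) by simp
qed

lemma NB_functional: assumes "(0, y) \<in> gb.Nminus" shows "y = 0"
proof -
  let ?Y = "{y. (0, y) \<in> gb.Nminus}"
  have sub: "cvec.subspace ?Y"
    unfolding cvec.subspace_def
    using lie_generated.zero[of "pair_bracket br" "range BF"] lie_generated.add[of "(0, _)" "pair_bracket br" "range BF" "(0, _)"]
      lie_generated.scale[of "(0, _)" "pair_bracket br" "range BF"]
    by (auto simp: zero_prod_def)
  have "?Y \<subseteq> {0}"
  proof (rule nm_stable_zero[OF sub])
    show "?Y \<subseteq> nm" using NB_nm by auto
    fix k y assume y: "y \<in> ?Y"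
    show "br (e k) y \<in> ?Y"
    proof (cases "k \<in> G2")
      case True
      then obtain i where i: "i \<in> G1" "k = T i" using T_surj by blast
      \<comment> \<open>Raising (0, y) by (e_i, e_k) stays in the relation up to a Cartan pair (h1,
        h2). As n_- meets \<hh> trivially, h1 = 0, and independence of the simple roots gives h2 =
        0.\<close>
      have "pair_bracket br (BE i) (0, y) \<in> sum_space gb.Nminus BH"
        using y by (intro gb.ad_E_Nminus) simp
      then have "(0, br (e k) y) \<in> sum_space gb.Nminus BH" using i by (simp add: BE_def br_simps)
      then obtain x1 y1 h1 h2 where *: "(x1, y1) \<in> gb.Nminus" "(h1, h2) \<in> BH" "x1 + h1 = 0" "br (e k) y = y1 + h2"
        unfolding sum_space_def by auto
      have "x1 \<in> nm" "h1 \<in> \<hh>" using NB_nm[OF *(1)] compat_csa(1)[OF BH_compat[OF *(2)]] by auto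
      moreover have x1: "x1 = - h1" using *(3) by (simp add: eq_neg_iff_add_eq_0)
      ultimately have "x1 = 0" using nm_csa[of x1] csa_subspace by (simp add: cvec.subspace_neg)
      with *(2) x1 have "h2 = 0" using BH_0 by simp
      then show ?thesis using * \<open>x1 = 0\<close> by simp
    next
      case False
      then show ?thesis using NB_e[of "(0, y)" k] y cvec.subspace_0[OF sub] by simp
    qed
  qed
  then show ?thesis using assms by blast
qed

section \<open>Existence, uniqueness and equivariance of B\<close>

abbreviation "dom1 \<equiv> sum_space nm (h_span K G1)"
abbreviation "dom2 \<equiv> sum_space nm (h_span K G2)"
abbreviation "Brel \<equiv> sum_space gb.Nminus BH"

lemma h_span_eq: "h_span K A = {\<Sum>i\<in>A. c i *\<^sub>C \<alpha> i | c. True}"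
proof -
  have "h_span K A = cvec.span (\<alpha> ` A)" by (simp add: h_span_def simple_h_root)
  also have "\<dots> = range (\<lambda>u. \<Sum>v\<in>\<alpha> ` A. u v *\<^sub>C v)" by (rule cvec.span_finite) simp
  also have "\<dots> = range (\<lambda>u. \<Sum>i\<in>A. u (\<alpha> i) *\<^sub>C \<alpha> i)"
    using root_inj by (simp add: sum.reindex inj_on_def)
  also have "\<dots> = {\<Sum>i\<in>A. c i *\<^sub>C \<alpha> i | c. True}"
  proof -
    have "(\<Sum>i\<in>A. c i *\<^sub>C \<alpha> i) \<in> range (\<lambda>u. \<Sum>i\<in>A. u (\<alpha> i) *\<^sub>C \<alpha> i)" for c
      using root_inj by (intro range_eqI[of _ _ "\<lambda>v. c (inv \<alpha> v)"]) (simp add: inv_f_f)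
    then show ?thesis by auto
  qed
  finally show ?thesis .
qed

lemma Brel_subspace: "cvec.subspace Brel"
  by (intro subspace_sum_space BH_subspace) simp

lemma Brel_functional: assumes "(x, z) \<in> Brel" "(x, z') \<in> Brel" shows "z = z'"
proof -
  have "(0, z - z') \<in> Brel" using cvec.subspace_diff[OF Brel_subspace assms] by simp
  then obtain x1 y1 h1 h2 where *: "(x1, y1) \<in> gb.Nminus" "(h1, h2) \<in> BH" "x1 + h1 = 0" "z - z' = y1 + h2"
    unfolding sum_space_def by auto
  have "x1 \<in> nm" "h1 \<in> \<hh>" using NB_nm[OF *(1)] compat_csa(1)[OF BH_compat[OF *(2)]] by auto
  moreover have x1: "x1 = - h1" using *(3) by (simp add: eq_neg_iff_add_eq_0)
  ultimately have "x1 = 0" using nm_csa[of x1] csa_subspace by (simp add: cvec.subspace_neg)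
  with * x1 have "h2 = 0" "y1 = 0" using BH_0 NB_functional by auto
  then show ?thesis using * by simp
qed

lemma Brel_total: assumes "x \<in> dom1" shows "\<exists>z. (x, z) \<in> Brel"
proof -
  obtain n c where x: "x = n + (\<Sum>i\<in>G1. c i *\<^sub>C \<alpha> i)" "n \<in> nm"
    using assms by (auto simp: sum_space_def h_span_eq)
  obtain m where "(n, m) \<in> gb.Nminus" using NB_total x by blast
  then have "(n, m) + (\<Sum>i\<in>G1. c i *\<^sub>C \<alpha> i, \<Sum>i\<in>G1. c i *\<^sub>C \<alpha> (T i)) \<in> Brel"
    by (rule sum_spaceI) (auto simp: BH_def)
  then show ?thesis using x by auto
qed

lemma Brel_dom: "(x, z) \<in> Brel \<Longrightarrow> x \<in> dom1 \<and> z \<in> dom2"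
proof -
  assume "(x, z) \<in> Brel"
  then obtain x1 y1 c where *: "(x1, y1) \<in> gb.Nminus" "x = x1 + (\<Sum>i\<in>G1. c i *\<^sub>C \<alpha> i)" "z = y1 + (\<Sum>i\<in>G1. c i *\<^sub>C \<alpha> (T i))"
    by (auto simp: sum_space_def BH_def)
  have "(\<Sum>i\<in>G1. c i *\<^sub>C \<alpha> (T i)) \<in> h_span K G2"
    unfolding h_span_def simple_h_root by (intro cvec.span_sum cvec.span_scale cvec.span_base) (use T_G2 in auto)
  then show ?thesis using * NB_nm[OF *(1)] by (auto intro!: sum_spaceI simp: h_span_eq[of G1])
qed

lemma Brel_br: assumes "p \<in> Brel" "q \<in> Brel" shows "pair_bracket br p q \<in> Brel"
proof -
  obtain n h m k where *: "p = n + h" "q = m + k" "n \<in> gb.Nminus" "h \<in> BH" "m \<in> gb.Nminus" "k \<in> BH"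
    using assms by (auto simp: sum_space_def)
  have k: "pair_bracket br n k = - pair_bracket br k n" by (rule gb.br_anti)
  have "pair_bracket br p q = pair_bracket br n m + pair_bracket br h m - pair_bracket br k n"
    using * gb.HH[of h k] by (simp add: gb.br_simps k)
  moreover have "\<dots> \<in> gb.Nminus"
    using * gb.ad_H_Nminus[of m h] gb.ad_H_Nminus[of n k]
    by (auto intro!: cvec.subspace_diff lie_generated.add intro: lie_generated.bracket)
  ultimately have "pair_bracket br p q \<in> gb.Nminus" by simp
  then show ?thesis by (intro sum_space_left BH_subspace)
qed

definition is_B :: "('g \<Rightarrow> 'g) \<Rightarrow> bool" where
  "is_B b \<longleftrightarrow> lie_hom_from K dom1 dom2 b \<and>
     (\<forall>i\<in>G1. b (f i) = f (T i) \<and> b (simple_h K i) = simple_h K (T i)) \<and> (\<forall>i. i \<notin> G1 \<longrightarrow> b (f i) = 0)"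

lemma is_B_exists: "\<exists>b. is_B b"
proof
  define b where "b x = (if x \<in> dom1 then (THE z. (x, z) \<in> Brel) else 0)" for x
  have b: "b x = z" if "(x, z) \<in> Brel" for x z
    using that Brel_dom[OF that] Brel_functional unfolding b_def by (auto intro!: the_equality)
  have b': "(x, b x) \<in> Brel" if "x \<in> dom1" for x
    using Brel_total[OF that] b by metis
  have "linear_on dom1 b"
    unfolding linear_on_def
  proof (intro conjI ballI allI)
    show "b (x + y) = b x + b y" if "x \<in> dom1" "y \<in> dom1" for x y
      using cvec.subspace_add[OF Brel_subspace b'[OF that(1)] b'[OF that(2)]] b by simp
    show "b (c *\<^sub>C x) = c *\<^sub>C b x" if "x \<in> dom1" for x c
      using cvec.subspace_scale[OF Brel_subspace b'[OF that]] b by simp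
  qed
  moreover have "b ` dom1 \<subseteq> dom2" using b' Brel_dom by blast
  moreover have "b (br x y) = br (b x) (b y)" if "x \<in> dom1" "y \<in> dom1" for x y
    using Brel_br[OF b'[OF that(1)] b'[OF that(2)]] b by simp
  ultimately have "lie_hom_from K dom1 dom2 b"
    by (auto simp: lie_hom_from_def linear_from_def b_def)
  moreover have "b (f i) = (if i \<in> G1 then f (T i) else 0)" for i
    by (intro b sum_space_left BH_subspace lie_generated.base) (auto simp: BF_def)
  moreover have "b (\<alpha> i) = \<alpha> (T i)" if "i \<in> G1" for i
    by (intro b sum_space_right root_BH that) simp
  ultimately show "is_B b" by (auto simp: is_B_def simple_h_root)
qed

lemma dom1_nm: "x \<in> nm \<Longrightarrow> x \<in> dom1"
  by (intro sum_space_left) (auto simp: h_span_def)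

lemma is_B_unique: assumes "is_B b" "is_B b'" shows "b = b'"
proof
  fix x
  have lin: "linear_on dom1 b" "linear_on dom1 b'" and out: "x \<notin> dom1 \<Longrightarrow> b x = b' x"
    and br: "\<And>x y. x \<in> dom1 \<Longrightarrow> y \<in> dom1 \<Longrightarrow> b (br x y) = br (b x) (b y) \<and> b' (br x y) = br (b' x) (b' y)"
    using assms by (auto simp: is_B_def lie_hom_from_def linear_from_def)
  have sub: "cvec.subspace dom1" by (intro subspace_sum_space) (auto simp: h_span_def nm_subspace)
  have 1: "b x = b' x" if "x \<in> nm" for x
    using that unfolding nm_eq
  proof induction
    case (base x)
    then obtain i where "x = f i" by auto
    then show ?case using assms by (cases "i \<in> G1") (auto simp: is_B_def)
  next
    case zero
    then show ?case using linear_on_0[OF lin(1) sub] linear_on_0[OF lin(2) sub] by simp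
  next
    case (add x y)
    then have "x \<in> dom1" "y \<in> dom1" using dom1_nm by (auto simp: nm_eq)
    with add lin show ?case by (simp add: linear_on_def)
  next
    case (scale x c)
    then have "x \<in> dom1" using dom1_nm by (auto simp: nm_eq)
    with scale lin show ?case by (simp add: linear_on_def)
  next
    case (bracket x y)
    then have "x \<in> dom1" "y \<in> dom1" using dom1_nm by (auto simp: nm_eq)
    with bracket br show ?case by simp
  qed
  have hs: "h_span K G1 \<subseteq> dom1" by (auto intro: sum_space_right nm_subspace)
  have 2: "b x = b' x" if "x \<in> h_span K G1" for x
    using that linear_on_subset[OF lin(1) hs] linear_on_subset[OF lin(2) hs] unfolding h_span_def
    by (rule linear_on_span_eq[rotated -1]) (use assms in \<open>auto simp: is_B_def\<close>)
  show "b x = b' x"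
  proof (cases "x \<in> dom1")
    case True
    then obtain n h where *: "x = n + h" "n \<in> nm" "h \<in> h_span K G1" by (auto simp: sum_space_def)
    then have "n \<in> dom1" "h \<in> dom1" using dom1_nm hs by auto
    then show ?thesis
      using 1[OF *(2)] 2[OF *(3)] * by (simp add: linear_on_add[OF lin(1)] linear_on_add[OF lin(2)])
  qed (rule out)
qed

abbreviation "B \<equiv> Bmap K \<tau>"

lemma is_B: "is_B B"
proof -
  have "\<exists>!b. is_B b" using is_B_exists is_B_unique by blast
  from theI'[OF this] show ?thesis unfolding Bmap_def is_B_def[symmetric] .
qed

lemma B_linear: "linear_on nm B" and B_br: "x \<in> nm \<Longrightarrow> y \<in> nm \<Longrightarrow> B (br x y) = br (B x) (B y)"
  and B_f: "B (f i) = (if i \<in> G1 then f (T i) else 0)"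
  using is_B dom1_nm linear_on_subset[of dom1 B nm]
  by (auto simp: is_B_def lie_hom_from_def linear_from_def)

lemma B_scale: "x \<in> nm \<Longrightarrow> B (c *\<^sub>C x) = c *\<^sub>C B x" and B_minus: "x \<in> nm \<Longrightarrow> B (- x) = - B x"
  using linear_on_scale[OF B_linear] linear_on_minus[OF B_linear] by auto

lemma B_nm: "x \<in> nm \<Longrightarrow> B x \<in> nm"
  unfolding nm_eq
proof (induction rule: lie_generated.induct)
  case (base x)
  then obtain i where "x = f i" by auto
  then show ?case by (simp add: B_f lie_generated.base[OF rangeI] lie_generated.zero)
next
  case zero
  then show ?case using linear_on_0[OF B_linear nm_subspace] by (auto intro: lie_generated.intros)
next
  case (add x y)
  then show ?case using linear_on_add[OF B_linear] by (auto simp: nm_eq intro: lie_generated.intros)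
next
  case (scale x c)
  then show ?case using linear_on_scale[OF B_linear] by (auto simp: nm_eq intro: lie_generated.intros)
next
  case (bracket x y)
  then show ?case using B_br by (auto simp: nm_eq intro: lie_generated.intros)
qed

lemma br_csa_nm: "h \<in> \<hh> \<Longrightarrow> x \<in> nm \<Longrightarrow> br h x \<in> nm"
  using ch.ad_H_Nminus by (simp add: nm_eq)

lemma B_compat: assumes c: "compat h h'" shows "x \<in> nm \<Longrightarrow> br h' (B x) = B (br h x)"
  unfolding nm_eq
proof (induction rule: lie_generated.induct)
  case (base x)
  then obtain i where "x = f i" by auto
  then show ?case using c f_nm[of i] nm_subspace
    by (auto simp: B_f compat_def br_csa_f br_simps B_scale B_minus cvec.subspace_scale)
next
  case zero
  then show ?case using linear_on_0[OF B_linear nm_subspace] by (simp add: br_simps)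
next
  case (add x y)
  then show ?case using linear_on_add[OF B_linear] br_csa_nm[OF compat_csa(1)[OF c]] by (simp add: nm_eq br_simps)
next
  case (scale x c')
  then show ?case using linear_on_scale[OF B_linear] br_csa_nm[OF compat_csa(1)[OF c]] by (simp add: nm_eq br_simps)
next
  case (bracket x y)
  then have *: "x \<in> nm" "y \<in> nm" "br h x \<in> nm" "br h y \<in> nm"
    using br_csa_nm[OF compat_csa(1)[OF c]] by (auto simp: nm_eq)
  have "B (br h (br x y)) = B (br (br h x) y) + B (br x (br h y))"
    using * br_nm by (simp add: br_jacobi[of h x] linear_on_add[OF B_linear])
  then show ?case using * bracket.IH by (simp add: B_br br_jacobi[of h'])
qed

text \<open>Two evaluations of (E_a, B [h, F_b]). Written with the matrix entry as a factor:
  wherever the entry of B is nonzero, h' on one root equals h on the other.\<close>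

lemma B_matrix_compat:
  assumes "a \<in> R" "b \<in> R" "compat h h'"
  shows "fm h' (fst a) * fm (E a) (B (F b)) = fm h (fst b) * fm (E a) (B (F b))"
proof -
  have h: "h \<in> \<hh>" "h' \<in> \<hh>" using assms compat_csa by auto
  have F: "F b \<in> nm" using F_nm assms by auto
  have "fm (E a) (br h' (B (F b))) = - (fm (fst a) h' * fm (E a) (B (F b)))"
    using fm_inv'[of "E a" h'] br_csa_E[OF assms(1) h(2)] by (simp add: fm_simps)
  moreover have "fm (E a) (B (br h (F b))) = - (fm (fst b) h * fm (E a) (B (F b)))"
    using br_csa_F[OF assms(2) h(1)] F nm_subspace
    by (simp add: fm_simps B_scale B_minus cvec.subspace_scale)
  ultimately show ?thesis
    using B_compat[OF assms(3) F] fm_sym[of h' "fst a"] fm_sym[of h "fst b"] by auto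
qed

lemma B_pow_nm: "x \<in> nm \<Longrightarrow> (B ^^ l) x \<in> nm"
  by (induction l) (auto intro: B_nm)

lemma B_pow_lsub: assumes "y \<in> \<ll>" "x \<in> nm" shows "br y ((B ^^ l) x) = (B ^^ l) (br y x)"
proof (induction l)
  case (Suc l)
  have "br y ((B ^^ Suc l) x) = B (br y ((B ^^ l) x))"
    using B_compat[OF compat_lsub[OF assms(1)] B_pow_nm[OF assms(2)]] by simp
  then show ?case using Suc by simp
qed simp

lemma B_pow_linear: "linear_on nm (B ^^ l)"
proof (induction l)
  case 0
  show ?case by (simp add: linear_on_def)
next
  case (Suc l)
  have "linear_on nm (\<lambda>x. B ((B ^^ l) x))"
    using linear_on_compose[OF Suc _ B_linear] B_pow_nm by auto
  then show ?case by (simp add: o_def)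
qed

lemma B_pow_F: assumes "a \<in> R" "y \<in> \<ll>" shows "br y ((B ^^ l) (F a)) = (- fm (fst a) y) *\<^sub>C (B ^^ l) (F a)"
  unfolding B_pow_lsub[OF assms(2) F_nm[OF assms(1)]] br_csa_F[OF assms(1) lsub_csa[OF assms(2)]]
  by (rule linear_on_scale[OF B_pow_linear F_nm[OF assms(1)]])

lemma br_dd_B_pow_F: "a \<in> R \<Longrightarrow> br dd ((B ^^ l) (F a)) = (- of_nat (ht (fst a))) *\<^sub>C (B ^^ l) (F a)"
  using B_pow_F[OF _ dd(1)] fm_dd_Q rootD(3) fm_sym by metis

text \<open>Diagonal matrix entries of B^l on n_- in the basis \<open>F\<close>, read off with the
  dual basis \<open>E\<close>. Their weighted sums over roots are traces of B^l.\<close>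

definition zc :: "nat \<Rightarrow> 'g \<times> nat \<Rightarrow> complex" where "zc l a = fm (E a) ((B ^^ l) (F a))"

text \<open>The bracket has degree 0, so for degree reasons it is orthogonal to all root vectors;
  its pairing with \<hh> is found by invariance. Nondegeneracy then identifies it.\<close>

lemma br_E_B_pow_F: assumes a: "a \<in> R" shows "br (E a) ((B ^^ l) (F a)) = zc l a *\<^sub>C fst a"
proof -
  let ?n = "of_nat (ht (fst a)) :: complex"
  define y where "y = (B ^^ l) (F a)"
  have y: "br dd y = (- ?n) *\<^sub>C y" "y \<in> nm" unfolding y_def using br_dd_B_pow_F[OF a] B_pow_nm F_nm[OF a] by auto
  have w: "br dd (br (E a) y - zc l a *\<^sub>C fst a) = 0 *\<^sub>C (br (E a) y - zc l a *\<^sub>C fst a)"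
    using br_jacobi[of dd "E a" y] br_dd_E[OF a] y(1) csa_comm[OF dd(3) rootD(4)[OF a]]
    by (simp add: br_simps)
  have "br (E a) y - zc l a *\<^sub>C fst a = 0"
  proof (rule eq_0I)
    fix b assume b: "b \<in> R"
    show "fm (br (E a) y - zc l a *\<^sub>C fst a) (E b) = 0" "fm (br (E a) y - zc l a *\<^sub>C fst a) (F b) = 0"
      using fm_dd_eq_0[OF w br_dd_E[OF b]] fm_dd_eq_0[OF w br_dd_F[OF b]] rootD(5)[OF b] by auto
  next
    fix h assume h: "h \<in> \<hh>"
    have "fm (br (E a) y) h = - fm (br y (E a)) h" using br_anti[of "E a" y] by (simp add: fm_simps)
    also have "\<dots> = - fm y (br (E a) h)" by (simp add: fm_inv)
    also have "br (E a) h = - (fm (fst a) h *\<^sub>C E a)" using br_anti[of "E a" h] br_csa_E[OF a h] by simp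
    finally show "fm (br (E a) y - zc l a *\<^sub>C fst a) h = 0"
      by (simp add: fm_simps zc_def y_def fm_sym[of "(B ^^ l) (F a)"])
  qed
  then show ?thesis by (simp add: y_def)
qed

end

context bd_setting
begin

section \<open>The Chevalley involution\<close>

definition WE :: "'n \<Rightarrow> 'g \<times> 'g" where "WE i = (e i, - f i)"
definition WF :: "'n \<Rightarrow> 'g \<times> 'g" where "WF i = (f i, - e i)"
definition WH :: "('g \<times> 'g) set" where "WH = {(h, - h) | h. h \<in> \<hh>}"

sublocale gw: chevalley "pair_bracket br" WE WF WH
proof
  show "cvec.subspace WH"
    using csa_subspace unfolding cvec.subspace_def by (auto simp: WH_def zero_prod_def)
  show "pair_bracket br (WE i) (WF j) \<in> WH" for i j
    using root_csa csa_subspace br_anti[of "f i" "e j"]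
    by (auto simp: WE_def WF_def WH_def br_simps br_e_f cvec.subspace_0)
  show "\<exists>c. pair_bracket br h (WE i) = c *\<^sub>C WE i" if "h \<in> WH" for h i
    using that by (auto simp: WE_def WH_def br_simps br_csa_e br_csa_f intro!: exI[of _ "fm (\<alpha> i) (fst h)"])
  show "\<exists>c. pair_bracket br h (WF i) = c *\<^sub>C WF i" if "h \<in> WH" for h i
    using that by (auto simp: WF_def WH_def br_simps br_csa_e br_csa_f intro!: exI[of _ "- fm (\<alpha> i) (fst h)"])
  show "pair_bracket br h h' = 0" if "h \<in> WH" "h' \<in> WH" for h h'
    using that by (auto simp: WH_def br_simps csa_comm zero_prod_def)
qed

text \<open>Graph of the Chevalley involution for the normalized f_i. The involution is needed to
  turn the dual of a Verma module into a module with a highest weight vector.\<close>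

definition Wrel :: "('g \<times> 'g) set" where
  "Wrel = lie_generated (pair_bracket br) (WH \<union> range WE \<union> range WF)"

lemma Wrel_subspace: "cvec.subspace Wrel"
  by (simp add: Wrel_def)

lemma Wrel_gen: "h \<in> \<hh> \<Longrightarrow> (h, - h) \<in> Wrel" "(e i, - f i) \<in> Wrel" "(f i, - e i) \<in> Wrel"
  unfolding Wrel_def by (rule lie_generated.base, auto simp: WH_def WE_def WF_def)+

lemma Wrel_br: "(x, y) \<in> Wrel \<Longrightarrow> (x', y') \<in> Wrel \<Longrightarrow> (br x x', br y y') \<in> Wrel"
  unfolding Wrel_def using lie_generated.bracket by fastforce

lemma Wrel_sym: "p \<in> Wrel \<Longrightarrow> (snd p, fst p) \<in> Wrel"
  unfolding Wrel_def
proof (induction rule: lie_generated.induct)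
  case (base p)
  have neg: "(- x, - y) \<in> Wrel" if "(x, y) \<in> Wrel" for x y
    using cvec.subspace_neg[OF Wrel_subspace that] by simp
  have "(snd p, fst p) \<in> Wrel"
    using base neg[OF Wrel_gen(1)] neg[OF Wrel_gen(2)] neg[OF Wrel_gen(3)]
    by (auto simp: WH_def WE_def WF_def)
  then show ?case by (simp add: Wrel_def)
next
  case zero
  then show ?case using cvec.subspace_0[OF Wrel_subspace] by (simp add: Wrel_def zero_prod_def)
next
  case (add x y)
  from lie_generated.add[OF add.IH] show ?case by simp
next
  case (scale x c)
  from lie_generated.scale[OF scale.IH, of c] show ?case by (simp add: scaleC_prod_def)
next
  case (bracket x y)
  from lie_generated.bracket[OF bracket.IH] show ?case by (simp add: pair_bracket_def)
qed

lemma Wrel_total: "\<exists>y. (x, y) \<in> Wrel"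
proof -
  have "x \<in> lie_generated br (\<hh> \<union> range e \<union> range f)" using generated by simp
  then show ?thesis
  proof induction
    case (base x)
    then show ?case using Wrel_gen by blast
  next
    case zero
    then show ?case using cvec.subspace_0[OF Wrel_subspace] by (auto simp: zero_prod_def)
  next
    case (add x y)
    then obtain x' y' where "(x, x') \<in> Wrel" "(y, y') \<in> Wrel" by blast
    from cvec.subspace_add[OF Wrel_subspace this] show ?case by auto
  next
    case (scale x c)
    then obtain x' where "(x, x') \<in> Wrel" by blast
    from cvec.subspace_scale[OF Wrel_subspace this, of c] show ?case by auto
  next
    case (bracket x y)
    then show ?case using Wrel_br by blast
  qed
qed

lemma direct_sum_0:
  assumes "a + h + b = 0" "a \<in> nm" "h \<in> \<hh>" "b \<in> np" shows "a = 0" "h = 0" "b = 0"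
proof -
  have "a = - (h + b)" using assms(1) by (metis add.assoc eq_neg_iff_add_eq_0)
  then have a: "fm a x = - fm h x - fm b x" for x by (simp add: fm_simps)
  show a0: "a = 0"
  proof (rule eq_0I)
    show "fm a (E c) = 0" if "c \<in> R" for c
      using a[of "E c"] that np_orthogonal(1)[OF assms(4) that] fm_E_csa[OF that assms(3)] fm_sym[of h] by simp
  qed (use nm_orthogonal assms(2) in auto)
  then have "b = - h" using assms(1) by (metis add.commute add.left_neutral eq_neg_iff_add_eq_0)
  then have b: "fm b x = - fm h x" for x by (simp add: fm_simps)
  show "b = 0"
  proof (rule eq_0I)
    show "fm b (F c) = 0" if "c \<in> R" for c
      using b[of "F c"] fm_F_csa[OF that assms(3)] fm_sym[of h] by simp
  qed (use np_orthogonal assms(4) in auto)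
  with a0 assms(1) show "h = 0" by simp
qed

lemma gw_sides: "p \<in> gw.Nminus \<Longrightarrow> fst p \<in> nm \<and> snd p \<in> np" "q \<in> gw.Nplus \<Longrightarrow> fst q \<in> np \<and> snd q \<in> nm"
proof -
  show "fst p \<in> nm \<and> snd p \<in> np" if "p \<in> gw.Nminus"
    using that
  proof (induction rule: lie_generated.induct)
    case (base p)
    then show ?case using f_nm e_np cvec.subspace_neg[OF np_subspace] by (auto simp: WF_def)
  qed (auto simp: cvec.subspace_0 cvec.subspace_add nm_subspace np_subspace cvec.subspace_scale scaleC_prod_def
      pair_bracket_def br_nm br_np)
  show "fst q \<in> np \<and> snd q \<in> nm" if "q \<in> gw.Nplus"
    using that
  proof (induction rule: lie_generated.induct)
    case (base p)
    then show ?case using f_nm e_np cvec.subspace_neg[OF nm_subspace] by (auto simp: WE_def)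
  qed (auto simp: cvec.subspace_0 cvec.subspace_add nm_subspace np_subspace cvec.subspace_scale scaleC_prod_def
      pair_bracket_def br_nm br_np)
qed

text \<open>The elements related to 0 form an ideal, because by symmetry the second projection of
  \<open>Wrel\<close> is onto \<gg>. Decomposing (0, y) triangularly inside the relation and
  comparing components shows that this ideal meets \<hh> trivially.\<close>

lemma Wrel_0: assumes "(0, y) \<in> Wrel" shows "y = 0"
proof -
  let ?J = "{y. (0, y) \<in> Wrel}"
  have "lie_ideal br ?J"
    unfolding lie_ideal_def
  proof (intro conjI allI ballI)
    show "cvec.subspace ?J"
      unfolding cvec.subspace_def
      using cvec.subspace_0[OF Wrel_subspace] cvec.subspace_add[OF Wrel_subspace, of "(0, _)" "(0, _)"]
        cvec.subspace_scale[OF Wrel_subspace, of "(0, _)"] by (auto simp: zero_prod_def)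
    fix z y assume "y \<in> ?J"
    moreover obtain x where "(x, z) \<in> Wrel" using Wrel_total[of z] Wrel_sym by fastforce
    ultimately show "br z y \<in> ?J" using Wrel_br[of x z 0 y] by (simp add: br_simps)
  qed
  moreover have "?J \<inter> \<hh> = {0}"
  proof -
    have "y = 0" if y: "(0, y) \<in> Wrel" "y \<in> \<hh>" for y
    proof -
      obtain a h b where *: "(0, y) = a + h + b" "a \<in> gw.Nminus" "h \<in> WH" "b \<in> gw.Nplus"
        using gw.triangular y(1) unfolding Wrel_def by blast
      obtain h' where h': "h = (h', - h')" "h' \<in> \<hh>" using *(3) by (auto simp: WH_def)
      note s = gw_sides(1)[OF *(2)] gw_sides(2)[OF *(4)]
      have "fst a + h' + fst b = 0" using arg_cong[OF *(1), of fst] h' by simp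
      then have "h' = 0" using direct_sum_0(2) s h' by blast
      moreover have "y = snd a - h' + snd b" using arg_cong[OF *(1), of snd] h' by simp
      ultimately have "snd b + (- y) + snd a = 0" by simp
      then have "- y = 0" using direct_sum_0(2) s y(2) csa_subspace cvec.subspace_neg by blast
      then show ?thesis by simp
    qed
    then show ?thesis
      using cvec.subspace_0[OF csa_subspace] cvec.subspace_0[OF Wrel_subspace] by (auto simp: zero_prod_def)
  qed
  ultimately have "?J = {0}" using km unfolding symmetrizable_kac_moody_def by blast
  then show ?thesis using assms by blast
qed

definition \<omega> :: "'g \<Rightarrow> 'g" where "\<omega> x = (THE y. (x, y) \<in> Wrel)"

lemma \<omega>_eqI: "(x, y) \<in> Wrel \<Longrightarrow> \<omega> x = y"
  unfolding \<omega>_def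
proof (rule the_equality)
  fix z assume "(x, y) \<in> Wrel" "(x, z) \<in> Wrel"
  from cvec.subspace_diff[OF Wrel_subspace this] Wrel_0[of "y - z"] show "z = y" by simp
qed

lemma \<omega>_rel: "(x, \<omega> x) \<in> Wrel"
  using Wrel_total[of x] \<omega>_eqI by metis

lemma \<omega>_simps:
  "\<omega> (x + y) = \<omega> x + \<omega> y" "\<omega> (c *\<^sub>C x) = c *\<^sub>C \<omega> x" "\<omega> (br x y) = br (\<omega> x) (\<omega> y)" "\<omega> (\<omega> x) = x"
  "\<omega> (e i) = - f i" "\<omega> (f i) = - e i" "h \<in> \<hh> \<Longrightarrow> \<omega> h = - h"
  using cvec.subspace_add[OF Wrel_subspace \<omega>_rel \<omega>_rel, of x y]
    cvec.subspace_scale[OF Wrel_subspace \<omega>_rel, of c x] Wrel_br[OF \<omega>_rel \<omega>_rel, of x y]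
    Wrel_sym[OF \<omega>_rel, of x] Wrel_gen by (auto intro!: \<omega>_eqI)

lemma \<omega>_np: "x \<in> np \<Longrightarrow> \<omega> x \<in> nm" and \<omega>_nm: "x \<in> nm \<Longrightarrow> \<omega> x \<in> np"
proof -
  have 0: "\<omega> 0 = 0" using \<omega>_simps(2)[of 0 0] by simp
  show "\<omega> x \<in> nm" if "x \<in> np"
    using that unfolding np_eq
  proof (induction rule: lie_generated.induct)
    case (base x)
    then show ?case using f_nm cvec.subspace_neg[OF nm_subspace] by (auto simp: \<omega>_simps)
  qed (auto simp: \<omega>_simps 0 cvec.subspace_0 cvec.subspace_add cvec.subspace_scale nm_subspace br_nm)
  show "\<omega> x \<in> np" if "x \<in> nm"
    using that unfolding nm_eq
  proof (induction rule: lie_generated.induct)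
    case (base x)
    then show ?case using e_np cvec.subspace_neg[OF np_subspace] by (auto simp: \<omega>_simps)
  qed (auto simp: \<omega>_simps 0 cvec.subspace_0 cvec.subspace_add cvec.subspace_scale np_subspace br_np)
qed

section \<open>Projection to n_- along the Borel subalgebra\<close>

lemma borel_subspace: "cvec.subspace (sum_space \<hh> np)"
  by (intro subspace_sum_space csa_subspace np_subspace)

definition pm :: "'g \<Rightarrow> 'g" where "pm x = (THE a. a \<in> nm \<and> x - a \<in> sum_space \<hh> np)"

lemma pm_eqI: assumes "a \<in> nm" "x - a \<in> sum_space \<hh> np" shows "pm x = a"
  unfolding pm_def
proof (rule the_equality)
  fix a' assume a': "a' \<in> nm \<and> x - a' \<in> sum_space \<hh> np"
  then have "(x - a) - (x - a') \<in> sum_space \<hh> np"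
    using cvec.subspace_diff[OF borel_subspace assms(2), of "x - a'"] by blast
  then obtain h b where *: "a' - a = h + b" "h \<in> \<hh>" "b \<in> np" by (auto simp: sum_space_def)
  have "(a - a') + h + b = 0" using *(1) by (simp add: algebra_simps)
  then have "a - a' = 0"
    using direct_sum_0(1) * assms(1) a' cvec.subspace_diff[OF nm_subspace] by blast
  then show "a' = a" by simp
qed (use assms in auto)

lemma pm_nm: "pm x \<in> nm" and pm_rest: "x - pm x \<in> sum_space \<hh> np"
proof -
  obtain a h b where *: "x = a + h + b" "a \<in> nm" "h \<in> \<hh>" "b \<in> np" using triangular by blast
  then have "x - a \<in> sum_space \<hh> np" by (auto intro: sum_spaceI simp: add.assoc)
  with * pm_eqI show "pm x \<in> nm" "x - pm x \<in> sum_space \<hh> np" by metis+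
qed

lemma pm_add: "pm (x + y) = pm x + pm y"
  using cvec.subspace_add[OF borel_subspace pm_rest pm_rest, of x y]
  by (intro pm_eqI cvec.subspace_add[OF nm_subspace] pm_nm) (simp add: algebra_simps)

lemma pm_scale: "pm (c *\<^sub>C x) = c *\<^sub>C pm x"
  using cvec.subspace_scale[OF borel_subspace pm_rest, of c x]
  by (intro pm_eqI cvec.subspace_scale[OF nm_subspace] pm_nm) (simp add: cvec.scale_right_diff_distrib)

lemma pm_id: "x \<in> nm \<Longrightarrow> pm x = x"
  by (rule pm_eqI) (use cvec.subspace_0[OF borel_subspace] in auto)

lemma pm_borel: "x \<in> sum_space \<hh> np \<Longrightarrow> pm x = 0"
  by (rule pm_eqI) (use cvec.subspace_0[OF nm_subspace] in auto)

lemma br_csa_np: "h \<in> \<hh> \<Longrightarrow> x \<in> np \<Longrightarrow> br h x \<in> np"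
  using ch.swap chevalley.ad_H_Nminus by (fastforce simp: np_eq)

lemma br_borel: "x \<in> sum_space \<hh> np \<Longrightarrow> y \<in> sum_space \<hh> np \<Longrightarrow> br x y \<in> np"
proof -
  assume "x \<in> sum_space \<hh> np" "y \<in> sum_space \<hh> np"
  then obtain h a k b where *: "x = h + a" "y = k + b" "h \<in> \<hh>" "k \<in> \<hh>" "a \<in> np" "b \<in> np"
    by (auto simp: sum_space_def)
  have "br x y = br h b - br k a + br a b"
    using * br_anti[of a k] by (simp add: br_simps csa_comm)
  then show ?thesis using * br_csa_np br_np np_subspace
    by (simp add: cvec.subspace_add cvec.subspace_diff)
qed

end

section \<open>Linear maps out of Verma modules\<close>

definition lin_ext :: "('g list \<Rightarrow> 'x::complex_vector) \<Rightarrow> ('g list \<Rightarrow> complex) \<Rightarrow> 'x" where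
  "lin_ext \<Phi> p = (\<Sum>w\<in>{w. p w \<noteq> 0}. p w *\<^sub>C \<Phi> w)"

abbreviation (input) words :: "('g list \<Rightarrow> complex) set" where "words \<equiv> cvec.span (range word)"

lemma word_eval_lin_ext: "word_eval N u = lin_ext (\<lambda>w. foldr (mact N) w u)"
  by (simp add: word_eval_def lin_ext_def fun_eq_iff)

lemma finite_support: assumes "p \<in> words" shows "finite {w. p w \<noteq> 0}"
proof -
  have "cvec.subspace {p :: 'a list \<Rightarrow> complex. finite {w. p w \<noteq> 0}}"
    unfolding cvec.subspace_def
  proof (intro conjI ballI allI; clarsimp)
    fix p q :: "'a list \<Rightarrow> complex" assume "finite {w. p w \<noteq> 0}" "finite {w. q w \<noteq> 0}"
    then have "finite ({w. p w \<noteq> 0} \<union> {w. q w \<noteq> 0})" by simp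
    then show "finite {w. p w + q w \<noteq> 0}" by (rule rev_finite_subset) auto
  qed
  moreover have "range word \<subseteq> {p :: 'a list \<Rightarrow> complex. finite {w. p w \<noteq> 0}}"
    by (auto simp: word_def)
  ultimately show ?thesis using assms cvec.span_minimal by blast
qed

lemma lin_ext_eq: "finite A \<Longrightarrow> {w. p w \<noteq> 0} \<subseteq> A \<Longrightarrow> lin_ext \<Phi> p = (\<Sum>w\<in>A. p w *\<^sub>C \<Phi> w)"
  unfolding lin_ext_def by (rule sum.mono_neutral_left) auto

lemma lin_ext_linear: "linear_on words (lin_ext \<Phi>)"
  unfolding linear_on_def
proof (intro conjI ballI allI)
  fix p q :: "'a list \<Rightarrow> complex" assume *: "p \<in> words" "q \<in> words"
  let ?A = "{w. p w \<noteq> 0} \<union> {w. q w \<noteq> 0}"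
  have fin: "finite ?A" using * finite_support by auto
  have "lin_ext \<Phi> (p + q) = (\<Sum>w\<in>?A. (p + q) w *\<^sub>C \<Phi> w)" by (rule lin_ext_eq[OF fin]) auto
  also have "\<dots> = (\<Sum>w\<in>?A. p w *\<^sub>C \<Phi> w) + (\<Sum>w\<in>?A. q w *\<^sub>C \<Phi> w)"
    by (simp add: cvec.scale_left_distrib sum.distrib)
  also have "\<dots> = lin_ext \<Phi> p + lin_ext \<Phi> q"
    using lin_ext_eq[OF fin, of p \<Phi>] lin_ext_eq[OF fin, of q \<Phi>] by auto
  finally show "lin_ext \<Phi> (p + q) = lin_ext \<Phi> p + lin_ext \<Phi> q" .
next
  fix c and p :: "'a list \<Rightarrow> complex" assume "p \<in> words"
  then have "lin_ext \<Phi> (c *\<^sub>C p) = (\<Sum>w\<in>{w. p w \<noteq> 0}. (c *\<^sub>C p) w *\<^sub>C \<Phi> w)"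
    by (intro lin_ext_eq finite_support) auto
  then show "lin_ext \<Phi> (c *\<^sub>C p) = c *\<^sub>C lin_ext \<Phi> p"
    by (simp add: lin_ext_def cvec.scale_sum_right)
qed

lemma lin_ext_word [simp]: "lin_ext \<Phi> (word w) = \<Phi> w"
  by (subst lin_ext_eq[of "{w}"]) (auto simp: word_def)

lemma word_words: "word w \<in> words"
  by (simp add: cvec.span_base)

lemma lin_ext_diff: "p \<in> words \<Longrightarrow> q \<in> words \<Longrightarrow> lin_ext \<Phi> (p - q) = lin_ext \<Phi> p - lin_ext \<Phi> q"
  by (rule linear_on_diff[OF lin_ext_linear cvec.subspace_span])

lemma lin_ext_scale: "p \<in> words \<Longrightarrow> lin_ext \<Phi> (c *\<^sub>C p) = c *\<^sub>C lin_ext \<Phi> p"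
  by (rule linear_on_scale[OF lin_ext_linear])

text \<open>The defining relations of M_\<kappa> read as conditions on a function on words, arranged
  so that its linear extension kills \<open>verma_relations\<close>.\<close>

definition word_relations ::
    "('n::finite, 'g::complex_vector) km_algebra \<Rightarrow> 'g \<Rightarrow> ('g list \<Rightarrow> 'x::complex_vector) \<Rightarrow> bool" where
  "word_relations K \<kappa> \<Phi> \<longleftrightarrow>
     (\<forall>u w a b c. \<Phi> (u @ [c *\<^sub>C a + b] @ w) = c *\<^sub>C \<Phi> (u @ [a] @ w) + \<Phi> (u @ [b] @ w)) \<and>
     (\<forall>u w a b. \<Phi> (u @ [a, b] @ w) - \<Phi> (u @ [b, a] @ w) = \<Phi> (u @ [bracket K a b] @ w)) \<and>
     (\<forall>u x. x \<in> n_plus K \<longrightarrow> \<Phi> (u @ [x]) = 0) \<and>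
     (\<forall>u x. x \<in> csa K \<longrightarrow> \<Phi> (u @ [x]) = form K \<kappa> x *\<^sub>C \<Phi> u)"

lemma verma_relations_words: "verma_relations K \<kappa> \<subseteq> words"
  unfolding verma_relations_def
  by (auto intro!: cvec.span_diff cvec.span_scale word_words)

lemma lin_ext_relation:
  assumes "word_relations K \<kappa> \<Phi>" "p \<in> verma_relations K \<kappa>" shows "lin_ext \<Phi> p = 0"
proof -
  note simps = lin_ext_diff lin_ext_scale word_words cvec.span_diff cvec.span_scale
  from assms(2) consider
      (lin) u w a b c where "p = word (u @ [c *\<^sub>C a + b] @ w) - c *\<^sub>C word (u @ [a] @ w) - word (u @ [b] @ w)"
    | (brk) u w a b where "p = word (u @ [a, b] @ w) - word (u @ [b, a] @ w) - word (u @ [bracket K a b] @ w)"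
    | (np) u x where "p = word (u @ [x])" "x \<in> n_plus K"
    | (csa) u x where "p = word (u @ [x]) - form K \<kappa> x *\<^sub>C word u" "x \<in> csa K"
    unfolding verma_relations_def by blast
  then show ?thesis
  proof cases
    case lin
    have "\<Phi> (u @ [c *\<^sub>C a + b] @ w) = c *\<^sub>C \<Phi> (u @ [a] @ w) + \<Phi> (u @ [b] @ w)"
      using assms(1) unfolding word_relations_def by blast
    then show ?thesis unfolding lin by (simp add: simps)
  next
    case brk
    have "\<Phi> (u @ [a, b] @ w) - \<Phi> (u @ [b, a] @ w) = \<Phi> (u @ [bracket K a b] @ w)"
      using assms(1) unfolding word_relations_def by blast
    then show ?thesis unfolding brk by (simp add: simps)
  next
    case np
    then show ?thesis using assms(1) unfolding word_relations_def by simp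
  next
    case csa
    have "\<Phi> (u @ [x]) = form K \<kappa> x *\<^sub>C \<Phi> u"
      using assms(1) csa(2) unfolding word_relations_def by blast
    then show ?thesis unfolding csa(1) by (simp add: simps)
  qed
qed

text \<open>The kernel of \<open>word_eval\<close> is spanned by the relations, so the linear
  extension takes the same value on all words combinations that represent one vector. Any chosen
  preimage may therefore be used.\<close>

lemma verma_lift:
  fixes \<Phi> :: "'g::complex_vector list \<Rightarrow> 'x::complex_vector"
  assumes V: "verma_module K \<kappa> N u" and \<Phi>: "word_relations K \<kappa> \<Phi>"
  shows "\<exists>\<theta>. linear_from (mcarr N) \<theta> \<and> (\<forall>ws. \<theta> (foldr (mact N) ws u) = \<Phi> ws)"
proof -
  have carr: "word_eval N u ` words = mcarr N"
    and ker: "{p \<in> words. word_eval N u p = 0} = cvec.span (verma_relations K \<kappa>)"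
    using V by (auto simp: verma_module_def)
  have we_lin: "linear_on words (word_eval N u)" unfolding word_eval_lin_ext by (rule lin_ext_linear)
  have key: "lin_ext \<Phi> p = lin_ext \<Phi> q"
    if pq: "p \<in> words" "q \<in> words" "word_eval N u p = word_eval N u q" for p q
  proof -
    have "p - q \<in> {p \<in> words. word_eval N u p = 0}"
      using pq linear_on_diff[OF we_lin cvec.subspace_span pq(1,2)] by (simp add: cvec.span_diff)
    then have "p - q \<in> cvec.span (verma_relations K \<kappa>)" using ker by simp
    then have "lin_ext \<Phi> (p - q) = 0"
    proof (rule linear_on_span_eq[rotated -1])
      show "linear_on (cvec.span (verma_relations K \<kappa>)) (lin_ext \<Phi>)"
        by (rule linear_on_subset[OF lin_ext_linear])
          (rule cvec.span_minimal[OF verma_relations_words cvec.subspace_span])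
      show "linear_on (cvec.span (verma_relations K \<kappa>)) (\<lambda>_. 0 :: 'x)" by (simp add: linear_on_def)
    qed (rule lin_ext_relation[OF \<Phi>])
    then show ?thesis using pq by (simp add: lin_ext_diff)
  qed
  define \<theta> where "\<theta> m = (if m \<in> mcarr N then lin_ext \<Phi> (SOME p. p \<in> words \<and> word_eval N u p = m) else 0)" for m
  have \<theta>: "\<theta> (word_eval N u p) = lin_ext \<Phi> p" if p: "p \<in> words" for p
  proof -
    let ?q = "SOME q. q \<in> words \<and> word_eval N u q = word_eval N u p"
    have "\<exists>q. q \<in> words \<and> word_eval N u q = word_eval N u p" using p by blast
    from someI_ex[OF this] have "?q \<in> words" "word_eval N u ?q = word_eval N u p" by blast+
    then have "lin_ext \<Phi> ?q = lin_ext \<Phi> p" using key p by blast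
    moreover have "word_eval N u p \<in> mcarr N" using carr p by blast
    ultimately show ?thesis by (simp add: \<theta>_def)
  qed
  have "linear_on (mcarr N) \<theta>"
    unfolding linear_on_def
  proof (intro conjI ballI allI)
    fix x y assume "x \<in> mcarr N" "y \<in> mcarr N"
    then obtain p q where p: "p \<in> words" "q \<in> words" and xy: "x = word_eval N u p" "y = word_eval N u q"
      using carr by blast
    have "x + y = word_eval N u (p + q)" using xy linear_on_add[OF we_lin p] by simp
    then show "\<theta> (x + y) = \<theta> x + \<theta> y"
      using \<theta>[OF cvec.span_add[OF p]] \<theta> p xy linear_on_add[OF lin_ext_linear p] by simp
  next
    fix c x assume "x \<in> mcarr N"
    then obtain p where p: "p \<in> words" and x: "x = word_eval N u p" using carr by blast
    have "c *\<^sub>C x = word_eval N u (c *\<^sub>C p)" using x linear_on_scale[OF we_lin p] by simp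
    then show "\<theta> (c *\<^sub>C x) = c *\<^sub>C \<theta> x"
      using \<theta>[OF cvec.span_scale[OF p]] \<theta> p x lin_ext_scale[OF p] by simp
  qed
  moreover have "\<theta> (foldr (mact N) ws u) = \<Phi> ws" for ws
    using \<theta>[OF word_words[of ws]] by (simp add: word_eval_lin_ext)
  ultimately show ?thesis by (auto simp: linear_from_def \<theta>_def)
qed

lemma verma_span:
  assumes "verma_module K \<kappa> N u" shows "mcarr N = cvec.span (range (\<lambda>ws. foldr (mact N) ws u))"
proof
  have carr: "word_eval N u ` words = mcarr N" and sub: "cvec.subspace (mcarr N)"
    using assms by (auto simp: verma_module_def g_module_def)
  show "mcarr N \<subseteq> cvec.span (range (\<lambda>ws. foldr (mact N) ws u))"
  proof
    fix m assume "m \<in> mcarr N"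
    then obtain p where p: "p \<in> words" "m = lin_ext (\<lambda>ws. foldr (mact N) ws u) p"
      using carr by (auto simp: word_eval_lin_ext)
    show "m \<in> cvec.span (range (\<lambda>ws. foldr (mact N) ws u))"
      unfolding p(2) by (rule linear_on_span_mem[OF lin_ext_linear cvec.subspace_span _ p(1)])
        (auto intro!: cvec.span_base)
  qed
  have "foldr (mact N) ws u \<in> mcarr N" for ws
    using carr word_words[of ws] by (auto simp: word_eval_lin_ext intro!: image_eqI[of _ _ "word ws"])
  then show "cvec.span (range (\<lambda>ws. foldr (mact N) ws u)) \<subseteq> mcarr N"
    by (intro cvec.span_minimal sub) auto
qed

text \<open>The derivation of the tensor algebra that extends ad b, given as the list of its
  summands: in each of them ad b hits one letter. Every summand keeps the length of the word, which
  is what the recursions below rely on.\<close>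

primrec ad_words :: "('g \<Rightarrow> 'g \<Rightarrow> 'g) \<Rightarrow> 'g \<Rightarrow> 'g list \<Rightarrow> 'g list list" where
  "ad_words br b [] = []"
| "ad_words br b (y # w) = (br b y # w) # map ((#) y) (ad_words br b w)"

lemma ad_words_length: "z \<in> set (ad_words br b w) \<Longrightarrow> length z = length w"
  by (induction w arbitrary: z) auto

lemma ad_words_append:
  "ad_words br b (u @ w) = map (\<lambda>z. z @ w) (ad_words br b u) @ map (\<lambda>z. u @ z) (ad_words br b w)"
  by (induction u) (auto simp: o_def)

lemma sum_list_eq_0: "(\<And>x. x \<in> set xs \<Longrightarrow> g x = 0) \<Longrightarrow> (\<Sum>x\<leftarrow>xs. g x) = (0 :: 'a::comm_monoid_add)"
  by (induction xs) auto

lemma sum_list_scaleC: "(\<Sum>x\<leftarrow>xs. c *\<^sub>C g x) = c *\<^sub>C (\<Sum>x\<leftarrow>xs. g x)"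
  by (induction xs) (auto simp: cvec.scale_right_distrib)

text \<open>Input for the freeness of M_\<kappa> over U(n_-): a space \<open>X\<close> with an
  action of n_- alone, and the intended image \<open>u0\<close> of the highest weight
  vector.\<close>

locale free_extension = bd_setting K \<tau> D \<rho>
  for K :: "('n::finite, 'g::complex_vector) km_algebra" and \<tau> D \<rho> +
  fixes \<kappa> :: 'g and X :: "'x::complex_vector set" and act :: "'g \<Rightarrow> 'x \<Rightarrow> 'x" and u0 :: 'x
  assumes \<kappa>: "\<kappa> \<in> csa K" and X: "cvec.subspace X" and u0: "u0 \<in> X"
    and act: "x \<in> n_minus K \<Longrightarrow> linear_on X (act x)" "x \<in> n_minus K \<Longrightarrow> w \<in> X \<Longrightarrow> act x w \<in> X"
      "w \<in> X \<Longrightarrow> linear_on (n_minus K) (\<lambda>x. act x w)"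
      "x \<in> n_minus K \<Longrightarrow> y \<in> n_minus K \<Longrightarrow> w \<in> X \<Longrightarrow>
        act (bracket K x y) w = act x (act y w) - act y (act x w)"
begin

text \<open>\<open>\<Phi> w\<close> is the value on the word \<open>w\<close> of the wanted map \<open>M_\<kappa> \<rightarrow> X\<close>: the \<open>\<nn>\<^sub>-\<close>-part of the first
  letter is pulled out by equivariance, the other part is commuted to the right end of the word. This
  recursion on the length replaces the Poincare-Birkhoff-Witt theorem.\<close>

function \<Phi> :: "'g list \<Rightarrow> 'x" where
  "\<Phi> [] = u0"
| "\<Phi> (x # w) = act (pm x) (\<Phi> w) + (\<Sum>z\<leftarrow>ad_words br (x - pm x) w. \<Phi> z) + fm \<kappa> x *\<^sub>C \<Phi> w"
  by pat_completeness auto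
termination by (relation "measure length") (auto dest: ad_words_length)
declare \<Phi>.simps [simp del]

lemma \<Phi>_X: "\<Phi> w \<in> X"
proof (induction w rule: \<Phi>.induct)
  case (2 x w)
  have "(\<Sum>z\<leftarrow>zs. \<Phi> z) \<in> X" if "\<And>z. z \<in> set zs \<Longrightarrow> \<Phi> z \<in> X" for zs
    using that by (induction zs) (auto simp: cvec.subspace_0[OF X] cvec.subspace_add[OF X])
  then have "(\<Sum>z\<leftarrow>ad_words br (x - pm x) w. \<Phi> z) \<in> X" using 2 by blast
  with 2 show ?case
    by (auto simp: \<Phi>.simps pm_nm intro!: cvec.subspace_add[OF X] cvec.subspace_scale[OF X] act)
qed (simp add: \<Phi>.simps u0)

abbreviation "Sad b u w \<equiv> (\<Sum>z\<leftarrow>ad_words br b w. \<Phi> (u @ z))"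

lemma act_lin_left: "act (pm (c *\<^sub>C a + b)) (\<Phi> w) = c *\<^sub>C act (pm a) (\<Phi> w) + act (pm b) (\<Phi> w)"
  using act(3)[OF \<Phi>_X[of w]] pm_nm nm_subspace
  by (simp add: pm_add pm_scale linear_on_def cvec.subspace_scale)

lemma act_lin_right: "x \<in> nm \<Longrightarrow> act x (c *\<^sub>C \<Phi> v + \<Phi> w) = c *\<^sub>C act x (\<Phi> v) + act x (\<Phi> w)"
  using act(1)[of x] \<Phi>_X X by (simp add: linear_on_def cvec.subspace_scale)

text \<open>Linearity in a letter is assumed only for words below a length bound, so that the lemma
  can be used inside the induction that proves this linearity.\<close>

lemma Sad_linear_aux:
  assumes "\<And>v x y w'. length v + length w' < length u + length w \<Longrightarrow>
      \<Phi> (v @ (c *\<^sub>C x + y) # w') = c *\<^sub>C \<Phi> (v @ x # w') + \<Phi> (v @ y # w')"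
  shows "Sad (c *\<^sub>C a + b) u w = c *\<^sub>C Sad a u w + Sad b u w"
  using assms
proof (induction w arbitrary: u)
  case (Cons y w)
  have "Sad (c *\<^sub>C a + b) (u @ [y]) w = c *\<^sub>C Sad a (u @ [y]) w + Sad b (u @ [y]) w"
    by (rule Cons.IH) (use Cons.prems in simp)
  moreover have "\<Phi> (u @ (c *\<^sub>C br a y + br b y) # w) = c *\<^sub>C \<Phi> (u @ br a y # w) + \<Phi> (u @ br b y # w)"
    by (rule Cons.prems) simp
  ultimately show ?case by (simp add: o_def br_simps cvec.scale_right_distrib)
qed simp

lemma \<Phi>_linear: "\<Phi> (u @ (c *\<^sub>C a + b) # w) = c *\<^sub>C \<Phi> (u @ a # w) + \<Phi> (u @ b # w)"
proof (induction "length u + length w" arbitrary: u a b w rule: less_induct)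
  case less
  note IH = less
  show ?case
  proof (cases u)
    case Nil
    have "Sad (c *\<^sub>C (a - pm a) + (b - pm b)) [] w = c *\<^sub>C Sad (a - pm a) [] w + Sad (b - pm b) [] w"
      by (rule Sad_linear_aux) (use IH Nil in simp)
    moreover have "c *\<^sub>C a + b - pm (c *\<^sub>C a + b) = c *\<^sub>C (a - pm a) + (b - pm b)"
      by (simp add: pm_add pm_scale cvec.scale_right_diff_distrib)
    ultimately have "Sad (c *\<^sub>C a + b - pm (c *\<^sub>C a + b)) [] w = c *\<^sub>C Sad (a - pm a) [] w + Sad (b - pm b) [] w"
      by metis
    then show ?thesis
      using Nil by (simp add: \<Phi>.simps act_lin_left fm_simps cvec.scale_left_distrib cvec.scale_right_distrib)
  next
    case (Cons x v)
    define y where "y = x - pm x"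
    have 1: "\<Phi> (v @ (c *\<^sub>C a + b) # w) = c *\<^sub>C \<Phi> (v @ a # w) + \<Phi> (v @ b # w)"
      by (rule IH) (simp add: Cons)
    have 2: "(\<Sum>z\<leftarrow>ad_words br y v. \<Phi> (z @ (c *\<^sub>C a + b) # w))
        = c *\<^sub>C (\<Sum>z\<leftarrow>ad_words br y v. \<Phi> (z @ a # w)) + (\<Sum>z\<leftarrow>ad_words br y v. \<Phi> (z @ b # w))"
    proof -
      have "(\<Sum>z\<leftarrow>ad_words br y v. \<Phi> (z @ (c *\<^sub>C a + b) # w))
          = (\<Sum>z\<leftarrow>ad_words br y v. c *\<^sub>C \<Phi> (z @ a # w) + \<Phi> (z @ b # w))"
        by (intro arg_cong[of _ _ sum_list] map_cong refl IH) (auto simp: Cons dest: ad_words_length)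
      then show ?thesis by (simp add: sum_list_addf sum_list_scaleC)
    qed
    have 3: "\<Phi> (v @ br y (c *\<^sub>C a + b) # w) = c *\<^sub>C \<Phi> (v @ br y a # w) + \<Phi> (v @ br y b # w)"
      unfolding br_simps by (rule IH) (simp add: Cons)
    have 4: "(\<Sum>z\<leftarrow>ad_words br y w. \<Phi> (v @ (c *\<^sub>C a + b) # z))
        = c *\<^sub>C (\<Sum>z\<leftarrow>ad_words br y w. \<Phi> (v @ a # z)) + (\<Sum>z\<leftarrow>ad_words br y w. \<Phi> (v @ b # z))"
    proof -
      have "(\<Sum>z\<leftarrow>ad_words br y w. \<Phi> (v @ (c *\<^sub>C a + b) # z))
          = (\<Sum>z\<leftarrow>ad_words br y w. c *\<^sub>C \<Phi> (v @ a # z) + \<Phi> (v @ b # z))"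
        by (intro arg_cong[of _ _ sum_list] map_cong refl IH) (auto simp: Cons dest: ad_words_length)
      then show ?thesis by (simp add: sum_list_addf sum_list_scaleC)
    qed
    have exp: "\<Phi> (u @ d # w) = act (pm x) (\<Phi> (v @ d # w)) + ((\<Sum>z\<leftarrow>ad_words br y v. \<Phi> (z @ d # w))
        + (\<Phi> (v @ br y d # w) + (\<Sum>z\<leftarrow>ad_words br y w. \<Phi> (v @ d # z)))) + fm \<kappa> x *\<^sub>C \<Phi> (v @ d # w)" for d
      by (simp add: Cons \<Phi>.simps ad_words_append o_def y_def)
    then show ?thesis
      unfolding exp
      by (simp add: 1 2 4 3 act_lin_right[OF pm_nm] cvec.scale_right_distrib mult.commute[of c])
  qed
qed

lemma \<Phi>_add: "\<Phi> (u @ (a + b) # w) = \<Phi> (u @ a # w) + \<Phi> (u @ b # w)"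
  using \<Phi>_linear[of u 1] by simp

lemma \<Phi>_0: "\<Phi> (u @ 0 # w) = 0"
  using \<Phi>_add[of u 0 0 w] by simp

lemma \<Phi>_minus: "\<Phi> (u @ (- a) # w) = - \<Phi> (u @ a # w)"
  using \<Phi>_linear[of u "-1" a 0 w] by (simp add: \<Phi>_0)

lemma \<Phi>_diff: "\<Phi> (u @ (a - b) # w) = \<Phi> (u @ a # w) - \<Phi> (u @ b # w)"
  using \<Phi>_add[of u a "- b" w] by (simp add: \<Phi>_minus)

lemma Sad_linear: "Sad (c *\<^sub>C a + b) u w = c *\<^sub>C Sad a u w + Sad b u w"
  by (rule Sad_linear_aux) (rule \<Phi>_linear)

lemma Sad_0: "Sad 0 u w = 0"
  using Sad_linear[where c=1 and a=0 and b=0] by simp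

lemma Sad_minus: "Sad (- a) u w = - Sad a u w"
  using Sad_linear[where c="-1" and a=a and b=0] by (simp add: Sad_0)

lemma act_0: "act 0 (\<Phi> w) = 0"
  by (rule linear_on_0[OF act(3)[OF \<Phi>_X] nm_subspace])

lemma \<Phi>_nm: "x \<in> nm \<Longrightarrow> \<Phi> (x # w) = act x (\<Phi> w)"
  using Sad_0[of "[]"] nm_orthogonal(2)[of x \<kappa>] \<kappa> by (simp add: \<Phi>.simps pm_id fm_sym[of \<kappa>])

lemma \<Phi>_borel: "x \<in> sum_space \<hh> np \<Longrightarrow> \<Phi> (x # w) = Sad x [] w + fm \<kappa> x *\<^sub>C \<Phi> w"
  by (simp add: \<Phi>.simps pm_borel act_0)

text \<open>Commutators of the derivations are the derivations of commutators. The two contributions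
  in which different letters are hit cancel, and on a single letter this is the Jacobi
  identity.\<close>

lemma Sad_Sad: "(\<Sum>z\<leftarrow>ad_words br a w. Sad b u z) - (\<Sum>z\<leftarrow>ad_words br b w. Sad a u z) = Sad (br b a) u w"
proof (induction w arbitrary: u)
  case (Cons y w)
  have IH: "(\<Sum>z\<leftarrow>ad_words br a w. Sad b (u @ [y]) z) - (\<Sum>z\<leftarrow>ad_words br b w. Sad a (u @ [y]) z)
    = Sad (br b a) (u @ [y]) w" by (rule Cons.IH)
  have j: "br (br b a) y = br b (br a y) - br a (br b y)" by (simp add: br_jacobi[of b a])
  show ?case
    using IH by (simp add: o_def sum_list_addf j \<Phi>_diff algebra_simps)
qed simp

text \<open>The defect of the commutator relation at two adjacent letters. It is additive and
  antisymmetric in them, so both letters may be decomposed along n_- and the Borel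
  subalgebra.\<close>

definition \<Delta>\<Phi> :: "'g list \<Rightarrow> 'g \<Rightarrow> 'g \<Rightarrow> 'g list \<Rightarrow> 'x" where
  "\<Delta>\<Phi> u a b w = \<Phi> (u @ a # b # w) - \<Phi> (u @ b # a # w) - \<Phi> (u @ br a b # w)"

lemma \<Delta>\<Phi>_add:
  "\<Delta>\<Phi> u (a + a') b w = \<Delta>\<Phi> u a b w + \<Delta>\<Phi> u a' b w" "\<Delta>\<Phi> u b (a + a') w = \<Delta>\<Phi> u b a w + \<Delta>\<Phi> u b a' w"
  using \<Phi>_add[of "u @ [b]" a a' w]
  by (simp_all add: \<Delta>\<Phi>_def \<Phi>_add br_simps)

lemma \<Delta>\<Phi>_anti: "\<Delta>\<Phi> u b a w = - \<Delta>\<Phi> u a b w"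
  using br_anti[of b a] by (simp add: \<Delta>\<Phi>_def \<Phi>_minus)

text \<open>Two letters in n_-: \<open>X\<close> is a module for n_-. One in n_-, one in the Borel
  subalgebra: the recursion commutes the second past the first. Two in the Borel subalgebra: their
  derivations obey \<open>Sad_Sad\<close>, the scalar parts commute, and \<kappa> vanishes on the
  bracket, which lies in n_+.\<close>

lemma \<Delta>\<Phi>_Nil: "\<Delta>\<Phi> [] a b w = 0"
proof -
  have nn: "\<Delta>\<Phi> [] a b w = 0" if "a \<in> nm" "b \<in> nm" for a b
    using that br_nm by (simp add: \<Delta>\<Phi>_def \<Phi>_nm act(4) \<Phi>_X)
  have bn: "\<Delta>\<Phi> [] a b w = 0" if ab: "a \<in> sum_space \<hh> np" "b \<in> nm" for a b
  proof -
    have "(\<Sum>z\<leftarrow>zs. \<Phi> (b # z)) = act b (\<Sum>z\<leftarrow>zs. \<Phi> z)" for zs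
    proof -
      have mem: "(\<Sum>z\<leftarrow>zs. \<Phi> z) \<in> X" for zs
        by (induction zs) (auto simp: cvec.subspace_0[OF X] cvec.subspace_add[OF X] \<Phi>_X)
      show ?thesis
        by (induction zs) (auto simp: linear_on_0[OF act(1) X] \<Phi>_nm ab(2) linear_on_add[OF act(1)] \<Phi>_X mem)
    qed
    moreover have "(\<Sum>z\<leftarrow>ad_words br a w. \<Phi> z) \<in> X" for w
    proof -
      have "(\<Sum>z\<leftarrow>zs. \<Phi> z) \<in> X" for zs
        by (induction zs) (auto simp: cvec.subspace_0[OF X] cvec.subspace_add[OF X] \<Phi>_X)
      then show ?thesis .
    qed
    ultimately show ?thesis
      using ab by (simp add: \<Delta>\<Phi>_def \<Phi>_borel \<Phi>_nm o_def linear_on_add[OF act(1)] linear_on_scale[OF act(1)]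
          \<Phi>_X cvec.subspace_scale[OF X])
  qed
  have bb: "\<Delta>\<Phi> [] a b w = 0" if ab: "a \<in> sum_space \<hh> np" "b \<in> sum_space \<hh> np" for a b
  proof -
    have c: "br a b \<in> np" by (rule br_borel[OF ab])
    have chi: "fm \<kappa> (br a b) = 0" using np_orthogonal(2)[OF c \<kappa>] fm_sym by metis
    have "br a b \<in> sum_space \<hh> np" using c csa_subspace by (intro sum_space_right)
    then have 1: "\<Phi> (br a b # w) = Sad (br a b) [] w" using \<Phi>_borel chi by simp
    have 2: "\<Phi> (br b a # w) = - \<Phi> (br a b # w)" using \<Phi>_minus[of "[]" "br a b" w] br_anti[of b a] by simp
    have S: "Sad b [] (a # w) = \<Phi> (br b a # w) + (\<Sum>z\<leftarrow>ad_words br b w. Sad a [] z) + fm \<kappa> a *\<^sub>C Sad b [] w"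
      using ab by (simp add: o_def \<Phi>_borel sum_list_addf sum_list_scaleC)
    have S': "Sad a [] (b # w) = \<Phi> (br a b # w) + (\<Sum>z\<leftarrow>ad_words br a w. Sad b [] z) + fm \<kappa> b *\<^sub>C Sad a [] w"
      using ab by (simp add: o_def \<Phi>_borel sum_list_addf sum_list_scaleC)
    have "\<Phi> (a # b # w) - \<Phi> (b # a # w)
        = 2 *\<^sub>C \<Phi> (br a b # w) + ((\<Sum>z\<leftarrow>ad_words br a w. Sad b [] z) - (\<Sum>z\<leftarrow>ad_words br b w. Sad a [] z))"
      using \<Phi>_borel[OF ab(1), of "b # w"] \<Phi>_borel[OF ab(2), of "a # w"] S S' 2
        \<Phi>_borel[OF ab(1), of w] \<Phi>_borel[OF ab(2), of w]
      by (simp add: cvec.scale_right_distrib mult.commute cvec.scale_left_distrib[of 1 1, simplified] algebra_simps)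
    also have "\<dots> = 2 *\<^sub>C \<Phi> (br a b # w) + Sad (br b a) [] w" by (subst Sad_Sad) simp
    also have "Sad (br b a) [] w = - Sad (br a b) [] w"
      using Sad_minus[where a="br a b" and u="[]"] br_anti[of b a] by simp
    finally show ?thesis
      using 1 by (simp add: \<Delta>\<Phi>_def cvec.scale_left_distrib[of 1 1, simplified])
  qed
  have "\<Delta>\<Phi> [] a b w = \<Delta>\<Phi> [] (pm a + (a - pm a)) (pm b + (b - pm b)) w" by simp
  also have "\<dots> = 0"
    unfolding \<Delta>\<Phi>_add
    using nn[OF pm_nm pm_nm] bn[OF pm_rest pm_nm, of a b] bn[OF pm_rest pm_nm, of b a] bb[OF pm_rest pm_rest, of a b]
      \<Delta>\<Phi>_anti[of "[]" "pm a" "b - pm b" w] by simp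
  finally show ?thesis .
qed

text \<open>Induction on the length: the first letter either acts on \<open>X\<close> or is spread
  over the rest as a derivation. The terms in which it hits a or b recombine by the Jacobi identity;
  all others are defects of shorter words.\<close>

lemma \<Delta>\<Phi>_0: "\<Delta>\<Phi> u a b w = 0"
proof (induction "length u + length w" arbitrary: u a b w rule: less_induct)
  case less
  note IH = less
  show ?case
  proof (cases u)
    case Nil
    then show ?thesis by (simp add: \<Delta>\<Phi>_Nil)
  next
    case (Cons x v)
    let ?y = "x - pm x"
    have 0: "\<Delta>\<Phi> v a b w = 0" by (rule IH) (simp add: Cons)
    have 1: "(\<Sum>z\<leftarrow>ad_words br ?y v. \<Delta>\<Phi> z a b w) = 0"
      by (intro sum_list_eq_0 IH) (auto simp: Cons dest: ad_words_length)
    have 2: "(\<Sum>z\<leftarrow>ad_words br ?y w. \<Delta>\<Phi> v a b z) = 0"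
      by (intro sum_list_eq_0 IH) (auto simp: Cons dest: ad_words_length)
    have 3: "\<Delta>\<Phi> v (br ?y a) b w = 0" "\<Delta>\<Phi> v a (br ?y b) w = 0" by (rule IH, simp add: Cons)+
    have j: "br ?y (br a b) = br (br ?y a) b + br a (br ?y b)" by (rule br_jacobi)
    have 4: "act (pm x) (\<Phi> (v @ a # b # w)) - act (pm x) (\<Phi> (v @ b # a # w)) = act (pm x) (\<Phi> (v @ br a b # w))"
      using 0 linear_on_diff[OF act(1)[OF pm_nm] X \<Phi>_X \<Phi>_X, of x "v @ a # b # w" "v @ b # a # w"]
      by (simp add: \<Delta>\<Phi>_def)
    have 5: "\<Phi> (v @ a # b # w) = \<Phi> (v @ b # a # w) + \<Phi> (v @ br a b # w)" using 0 by (simp add: \<Delta>\<Phi>_def algebra_simps)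
    show ?thesis
      using 1 2 3 4
      by (simp add: Cons \<Delta>\<Phi>_def \<Phi>.simps ad_words_append o_def sum_list_addf sum_list_subtractf j \<Phi>_add
          cvec.scale_right_distrib 5 algebra_simps)
  qed
qed

text \<open>The only new term arises when the derivation hits the last letter x. It is a bracket of
  two elements of the Borel subalgebra, hence in n_+, where \<kappa> vanishes.\<close>

lemma \<Phi>_right: "x \<in> sum_space \<hh> np \<Longrightarrow> \<Phi> (u @ [x]) = fm \<kappa> x *\<^sub>C \<Phi> u"
proof (induction "length u" arbitrary: u x rule: less_induct)
  case less
  show ?case
  proof (cases u)
    case Nil
    then show ?thesis using \<Phi>_borel[OF less.prems, of "[]"] by (simp add: \<Phi>.simps(1))
  next
    case (Cons y v)
    let ?y = "y - pm y"
    have 1: "\<Phi> (v @ [x]) = fm \<kappa> x *\<^sub>C \<Phi> v" by (rule less) (simp_all add: Cons less.prems)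
    have 2: "(\<Sum>z\<leftarrow>ad_words br ?y v. \<Phi> (z @ [x])) = fm \<kappa> x *\<^sub>C (\<Sum>z\<leftarrow>ad_words br ?y v. \<Phi> z)"
      unfolding sum_list_scaleC[symmetric]
      by (intro arg_cong[of _ _ sum_list] map_cong refl less) (auto simp: Cons less.prems dest: ad_words_length)
    have b: "br ?y x \<in> np" by (rule br_borel[OF pm_rest less.prems])
    have "\<Phi> (v @ [br ?y x]) = fm \<kappa> (br ?y x) *\<^sub>C \<Phi> v"
      by (rule less) (use b csa_subspace in \<open>auto simp: Cons intro: sum_space_right\<close>)
    then have 3: "\<Phi> (v @ [br ?y x]) = 0" using np_orthogonal(2)[OF b \<kappa>] fm_sym[of \<kappa>] by simp
    show ?thesis
      using 2 3 linear_on_scale[OF act(1)[OF pm_nm] \<Phi>_X]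
      by (simp add: Cons \<Phi>.simps ad_words_append o_def 1 cvec.scale_right_distrib mult.commute)
  qed
qed

lemma word_relations_\<Phi>: "word_relations K \<kappa> \<Phi>"
  unfolding word_relations_def
proof (intro conjI allI impI)
  show "\<Phi> (u @ [c *\<^sub>C a + b] @ w) = c *\<^sub>C \<Phi> (u @ [a] @ w) + \<Phi> (u @ [b] @ w)" for u a b c w
    using \<Phi>_linear by simp
  show "\<Phi> (u @ [a, b] @ w) - \<Phi> (u @ [b, a] @ w) = \<Phi> (u @ [br a b] @ w)" for u a b w
    using \<Delta>\<Phi>_0[of u a b w] by (simp add: \<Delta>\<Phi>_def)
  show "\<Phi> (u @ [x]) = 0" if "x \<in> np" for u x
    using \<Phi>_right[of x u] that csa_subspace np_orthogonal(2)[OF that \<kappa>] fm_sym[of \<kappa>]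
    by (auto intro: sum_space_right)
  show "\<Phi> (u @ [x]) = fm \<kappa> x *\<^sub>C \<Phi> u" if "x \<in> \<hh>" for u x
    using \<Phi>_right[of x u] that np_subspace by (auto intro: sum_space_left)
qed

text \<open>Freeness of M_\<kappa> over U(n_-), stated as a universal property. The target carries
  an action of n_- only, which can be twisted at will: through B, through the involution, or by
  zero.\<close>

lemma free_extension:
  assumes V: "verma_module K \<kappa> N v"
  shows "\<exists>\<theta>. linear_from (mcarr N) \<theta> \<and> \<theta> ` mcarr N \<subseteq> X \<and> \<theta> v = u0 \<and>
    (\<forall>x\<in>nm. \<forall>m\<in>mcarr N. \<theta> (mact N x m) = act x (\<theta> m))"
proof -
  obtain \<theta> where lin: "linear_from (mcarr N) \<theta>" and \<theta>: "\<And>ws. \<theta> (foldr (mact N) ws v) = \<Phi> ws"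
    using verma_lift[OF V word_relations_\<Phi>] by (elim exE conjE) simp
  note sp = verma_span[OF V]
  have lo: "linear_on (cvec.span (range (\<lambda>ws. foldr (mact N) ws v))) \<theta>"
    using lin sp by (simp add: linear_from_def)
  have im: "\<theta> m \<in> X" if "m \<in> mcarr N" for m
    by (rule linear_on_span_mem[OF lo X]) (use that sp \<theta> \<Phi>_X in auto)
  have "\<theta> (mact N x m) = act x (\<theta> m)" if x: "x \<in> nm" and m: "m \<in> mcarr N" for x m
  proof (rule linear_on_span_eq[where f = "\<lambda>m. \<theta> (mact N x m)" and g = "\<lambda>m. act x (\<theta> m)" and x = m])
    have N: "linear_on (mcarr N) (mact N x)" "mact N x ` mcarr N \<subseteq> mcarr N"
      using V by (auto simp: verma_module_def g_module_def)
    show "linear_on (cvec.span (range (\<lambda>ws. foldr (mact N) ws v))) (\<lambda>m. \<theta> (mact N x m))"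
      unfolding sp[symmetric] by (rule linear_on_compose[OF N linear_fromD(1)[OF lin]])
    show "linear_on (cvec.span (range (\<lambda>ws. foldr (mact N) ws v))) (\<lambda>m. act x (\<theta> m))"
      unfolding sp[symmetric]
      by (rule linear_on_compose[OF linear_fromD(1)[OF lin] _ act(1)[OF x]]) (use im in blast)
    show "m \<in> cvec.span (range (\<lambda>ws. foldr (mact N) ws v))" using m sp by simp
    fix m' assume "m' \<in> range (\<lambda>ws. foldr (mact N) ws v)"
    then obtain ws where "m' = foldr (mact N) ws v" by blast
    then show "\<theta> (mact N x m') = act x (\<theta> m')"
      using \<theta>[of "x # ws"] \<theta>[of ws] \<Phi>_nm[OF x] by simp
  qed
  moreover have "\<theta> v = u0" using \<theta>[of "[]"] by (simp add: \<Phi>.simps)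
  ultimately show ?thesis using lin im by blast
qed

end

section \<open>Modules\<close>

locale gmodule =
  fixes K :: "('n::finite, 'g::complex_vector) km_algebra" and N :: "('g, 'm::complex_vector) gmod"
  assumes gm: "g_module K N"
begin

lemma carr: "cvec.subspace (mcarr N)"
  using gm by (simp add: g_module_def)

lemma act_linear: "linear_on (mcarr N) (mact N x)"
  using gm by (simp add: g_module_def)

lemma act_linear_left: "m \<in> mcarr N \<Longrightarrow> linear_on UNIV (\<lambda>x. mact N x m)"
  using gm by (simp add: g_module_def)

lemma act_carr [simp, intro]: "m \<in> mcarr N \<Longrightarrow> mact N x m \<in> mcarr N"
  using gm by (auto simp: g_module_def)

lemma carr_simps [simp]: "0 \<in> mcarr N" "m \<in> mcarr N \<Longrightarrow> m' \<in> mcarr N \<Longrightarrow> m + m' \<in> mcarr N"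
  "m \<in> mcarr N \<Longrightarrow> c *\<^sub>C m \<in> mcarr N" "m \<in> mcarr N \<Longrightarrow> - m \<in> mcarr N"
  "m \<in> mcarr N \<Longrightarrow> m' \<in> mcarr N \<Longrightarrow> m - m' \<in> mcarr N"
  using carr by (auto simp: cvec.subspace_0 cvec.subspace_add cvec.subspace_scale cvec.subspace_neg cvec.subspace_diff)

lemma carr_sum: "(\<And>i. i \<in> A \<Longrightarrow> g i \<in> mcarr N) \<Longrightarrow> (\<Sum>i\<in>A. g i) \<in> mcarr N"
  using carr by (rule cvec.subspace_sum)

lemma act_simps:
  "m \<in> mcarr N \<Longrightarrow> m' \<in> mcarr N \<Longrightarrow> mact N x (m + m') = mact N x m + mact N x m'"
  "m \<in> mcarr N \<Longrightarrow> mact N x (c *\<^sub>C m) = c *\<^sub>C mact N x m"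
  "mact N x 0 = 0" "m \<in> mcarr N \<Longrightarrow> mact N x (- m) = - mact N x m"
  "m \<in> mcarr N \<Longrightarrow> m' \<in> mcarr N \<Longrightarrow> mact N x (m - m') = mact N x m - mact N x m'"
  using act_linear[of x] carr
  by (auto simp: linear_on_add linear_on_scale linear_on_0 linear_on_minus linear_on_diff)

lemma act_left_simps:
  assumes "m \<in> mcarr N"
  shows "mact N (x + y) m = mact N x m + mact N y m" "mact N (c *\<^sub>C x) m = c *\<^sub>C mact N x m"
    "mact N 0 m = 0" "mact N (- x) m = - mact N x m" "mact N (x - y) m = mact N x m - mact N y m"
  using linear_on_add[OF act_linear_left[OF assms]] linear_on_scale[OF act_linear_left[OF assms]]
    linear_on_0[OF act_linear_left[OF assms]] linear_on_minus[OF act_linear_left[OF assms]]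
    linear_on_diff[OF act_linear_left[OF assms]] by auto

lemma act_sum: "(\<And>i. i \<in> A \<Longrightarrow> g i \<in> mcarr N) \<Longrightarrow> mact N x (\<Sum>i\<in>A. g i) = (\<Sum>i\<in>A. mact N x (g i))"
  by (rule linear_on_sum[OF act_linear carr])

lemma act_left_sum: "m \<in> mcarr N \<Longrightarrow> mact N (\<Sum>i\<in>A. g i) m = (\<Sum>i\<in>A. mact N (g i) m)"
  by (rule linear_on_sum[OF act_linear_left]) auto

lemma act_br: "m \<in> mcarr N \<Longrightarrow> mact N (bracket K x y) m = mact N x (mact N y m) - mact N y (mact N x m)"
  using gm by (simp add: g_module_def)

lemma act_swap: "m \<in> mcarr N \<Longrightarrow> mact N x (mact N y m) = mact N y (mact N x m) + mact N (bracket K x y) m"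
  by (simp add: act_br)

lemma foldr_carr: "m \<in> mcarr N \<Longrightarrow> foldr (mact N) ws m \<in> mcarr N"
  by (induction ws) auto

lemma foldr_linear: "linear_on (mcarr N) (foldr (mact N) ws)"
  by (induction ws) (auto simp: linear_on_def act_simps foldr_carr)

end

section \<open>Weight spaces and the commutation of the Casimir sum with f_i\<close>

context bd_setting
begin

lemma weight_spaceD:
  "w \<in> weight_space K N \<gamma> \<Longrightarrow> w \<in> mcarr N" "w \<in> weight_space K N \<gamma> \<Longrightarrow> h \<in> \<hh> \<Longrightarrow> mact N h w = fm \<gamma> h *\<^sub>C w"
  by (auto simp: weight_space_def)

lemma weight_space_subspace: assumes "g_module K N" shows "cvec.subspace (weight_space K N \<gamma>)"
proof -
  interpret gmodule K N by unfold_locales (rule assms)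
  show ?thesis unfolding cvec.subspace_def
    by (auto simp: weight_space_def act_simps cvec.scale_right_distrib mult.commute)
qed

text \<open>Applying h minus its eigenvalue at \<delta> removes one summand and multiplies the
  others by scalars; nondegeneracy of the form on \<hh> provides an h for which a given scalar is
  nonzero.\<close>

lemma weight_independent:
  assumes N: "g_module K N" and "finite S" "S \<subseteq> \<hh>" "\<And>\<gamma>. \<gamma> \<in> S \<Longrightarrow> y \<gamma> \<in> weight_space K N \<gamma>"
    and "(\<Sum>\<gamma>\<in>S. y \<gamma>) = 0" and "\<gamma> \<in> S"
  shows "y \<gamma> = 0"
  using assms(2-)
proof (induction S arbitrary: y \<gamma> rule: finite_induct)
  case (insert \<delta> S)
  interpret gmodule K N by unfold_locales (rule N)
  have y: "y \<gamma> \<in> weight_space K N \<gamma>" "y \<gamma> \<in> mcarr N" if "\<gamma> \<in> insert \<delta> S" for \<gamma>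
    using insert.prems(2) that weight_spaceD by auto
  have z: "y \<gamma> = 0" if "\<gamma> \<in> S" for \<gamma>
  proof -
    have "fm (\<gamma> - \<delta>) h *\<^sub>C y \<gamma> = 0" if h: "h \<in> \<hh>" for h
    proof (rule insert.IH)
      have "0 = mact N h (\<Sum>\<gamma>\<in>insert \<delta> S. y \<gamma>) - fm \<delta> h *\<^sub>C (\<Sum>\<gamma>\<in>insert \<delta> S. y \<gamma>)"
        using insert.prems(3) by (simp add: act_simps)
      also have "mact N h (\<Sum>\<gamma>\<in>insert \<delta> S. y \<gamma>) = (\<Sum>\<gamma>\<in>insert \<delta> S. mact N h (y \<gamma>))" by (rule act_sum) (rule y)
      also have "\<dots> = (\<Sum>\<gamma>\<in>insert \<delta> S. fm \<gamma> h *\<^sub>C y \<gamma>)"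
        using y(1) h by (intro sum.cong) (auto simp: weight_spaceD(2))
      also have "\<dots> - fm \<delta> h *\<^sub>C (\<Sum>\<gamma>\<in>insert \<delta> S. y \<gamma>) = (\<Sum>\<gamma>\<in>insert \<delta> S. fm (\<gamma> - \<delta>) h *\<^sub>C y \<gamma>)"
        unfolding cvec.scale_sum_right sum_subtractf[symmetric]
        by (simp only: fm_simps cvec.scale_left_diff_distrib)
      also have "\<dots> = (\<Sum>\<gamma>\<in>S. fm (\<gamma> - \<delta>) h *\<^sub>C y \<gamma>)" using insert.hyps by (simp add: fm_simps)
      finally show "(\<Sum>\<gamma>\<in>S. fm (\<gamma> - \<delta>) h *\<^sub>C y \<gamma>) = 0" by simp
      show "fm (\<gamma> - \<delta>) h *\<^sub>C y \<gamma> \<in> weight_space K N \<gamma>" if "\<gamma> \<in> S" for \<gamma>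
        using y(1)[of \<gamma>] that weight_space_subspace[OF N] by (auto intro: cvec.subspace_scale)
    qed (use insert.prems(1) \<open>\<gamma> \<in> S\<close> in auto)
    moreover have "\<exists>h\<in>\<hh>. fm (\<gamma> - \<delta>) h \<noteq> 0"
    proof (rule ccontr)
      assume "\<not> (\<exists>h\<in>\<hh>. fm (\<gamma> - \<delta>) h \<noteq> 0)"
      moreover have "\<gamma> - \<delta> \<in> \<hh>"
        using \<open>\<gamma> \<in> S\<close> insert.prems(1) by (intro cvec.subspace_diff csa_subspace) auto
      ultimately have "\<gamma> - \<delta> = 0" using csa_nondeg by blast
      then show False using insert.hyps(2) \<open>\<gamma> \<in> S\<close> by simp
    qed
    ultimately show ?thesis by auto
  qed
  then have "y \<delta> = 0" using insert.prems(3) insert.hyps by simp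
  with z insert.prems(4) show ?case by auto
qed simp

lemma act_weight:
  assumes "g_module K N" "m \<in> weight_space K N \<gamma>" "x \<in> root_space K \<delta>"
  shows "mact N x m \<in> weight_space K N (\<gamma> + \<delta>)"
proof -
  interpret gmodule K N by unfold_locales (rule assms)
  show ?thesis
    using assms(2,3) act_swap[of m _ x]
    by (auto simp: weight_space_def root_space_def act_simps act_left_simps fm_simps cvec.scale_left_distrib)
qed

text \<open>Triangularity puts the bracket into n_+ + \<hh>, and its Cartan part is determined by
  pairing with \<hh>, where invariance gives (x, f_i) \<alpha>_i.\<close>

lemma np_br_f:
  assumes "x \<in> np" shows "br x (f i) - fm x (f i) *\<^sub>C \<alpha> i \<in> np"
proof -
  interpret sw: chevalley br f e \<hh> by (rule ch.swap)
  obtain p h where ph: "br (f i) x = p + h" "p \<in> np" "h \<in> \<hh>"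
    using sw.ad_E_Nminus[of x i] assms by (auto simp: sum_space_def np_eq)
  have "br x (f i) = - p - h" using br_anti[of x "f i"] ph by simp
  moreover have "fm x (f i) *\<^sub>C \<alpha> i = - h"
  proof (rule csa_eqI[symmetric])
    fix k assume k: "k \<in> \<hh>"
    have "fm (br x (f i)) k = fm x (br (f i) k)" by (rule fm_inv)
    also have "br (f i) k = fm (\<alpha> i) k *\<^sub>C f i" using br_anti[of "f i" k] br_csa_f[OF k] by simp
    finally show "fm (- h) k = fm (fm x (f i) *\<^sub>C \<alpha> i) k"
      using np_orthogonal(2)[OF ph(2) k] \<open>br x (f i) = - p - h\<close> by (simp add: fm_simps)
  qed (use ph root_csa csa_subspace in \<open>auto simp: cvec.subspace_neg cvec.subspace_scale\<close>)
  ultimately show ?thesis using ph np_subspace by (simp add: cvec.subspace_neg)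
qed

lemma br_E_f_expand:
  assumes "a \<in> Rn N"
  shows "br (E a) (f i) = fm (E a) (f i) *\<^sub>C \<alpha> i + (\<Sum>b\<in>Rn N. fm (br (E a) (f i)) (F b) *\<^sub>C E b)"
proof -
  have a: "a \<in> R" "ht (fst a) \<le> N" using assms Rn by auto
  let ?z = "br (E a) (f i) - fm (E a) (f i) *\<^sub>C \<alpha> i" and ?n = "ht (fst a) - 1"
  have n: "of_nat (ht (fst a)) = (of_nat ?n :: complex) + 1" using rootD(5)[OF a(1)] by (simp add: of_nat_diff)
  have df: "br dd (f i) = (- 1) *\<^sub>C f i" using br_csa_f[OF dd(3)] dd(2) fm_sym[of "\<alpha> i"] by simp
  \<comment> \<open>The Cartan term is present only for height 1. The bracket then has degree 0,
    which is also the degree of \<alpha>_i, so subtracting the term keeps the degree.\<close>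
  have "fm (E a) (f i) \<noteq> 0 \<Longrightarrow> (of_nat ?n :: complex) = 0"
    using fm_dd_eq_0[OF br_dd_E[OF a(1)] df] n by (auto simp: add_eq_0_iff2)
  moreover have "br dd (br (E a) (f i)) = of_nat ?n *\<^sub>C br (E a) (f i)"
    using br_dd_E[OF a(1)] df n by (simp add: br_jacobi[of dd] br_simps cvec.scale_left_distrib)
  ultimately have "br dd ?z = of_nat ?n *\<^sub>C ?z"
    using csa_comm[OF dd(3) root_csa] by (cases "fm (E a) (f i) = 0") (auto simp: br_simps)
  then have "?z = (\<Sum>b\<in>Rn N. fm ?z (F b) *\<^sub>C E b)"
    by (rule np_expand[OF np_br_f[OF E_np[OF a(1)]]]) (use a(2) in linarith)
  moreover have "fm ?z (F b) = fm (br (E a) (f i)) (F b)" if "b \<in> Rn N" for b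
    using fm_F_csa[OF Rn(1)[OF that] root_csa[of i]] fm_sym[of "\<alpha> i"] by (simp add: fm_simps)
  ultimately have "?z = (\<Sum>b\<in>Rn N. fm (br (E a) (f i)) (F b) *\<^sub>C E b)" by simp
  then show ?thesis by (simp add: algebra_simps)
qed

lemma br_F_f_expand:
  assumes "a \<in> R" "ht (fst a) < N"
  shows "br (F a) (f i) = (\<Sum>b\<in>Rn N. fm (br (F a) (f i)) (E b) *\<^sub>C F b)"
proof (rule nm_expand)
  show "br (F a) (f i) \<in> nm" by (intro br_nm F_nm f_nm assms)
  have "br dd (f i) = (- 1) *\<^sub>C f i" using br_csa_f[OF dd(3)] dd(2) fm_sym[of "\<alpha> i"] by simp
  then show "br dd (br (F a) (f i)) = (- of_nat (Suc (ht (fst a)))) *\<^sub>C br (F a) (f i)"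
    using br_dd_F[OF assms(1)] by (simp add: br_jacobi[of dd] br_simps cvec.scale_left_diff_distrib)
qed (use assms in simp)

lemma f_expand: "N \<ge> 1 \<Longrightarrow> f i = (\<Sum>a\<in>Rn N. fm (f i) (E a) *\<^sub>C F a)"
  by (rule nm_expand[OF f_nm, of i 1]) (use br_csa_f[OF dd(3), of i] dd(2) fm_sym[of "\<alpha> i"] in auto)

lemma rho_root: "fm \<rho> (\<alpha> i) = fm (\<alpha> i) (\<alpha> i) / 2"
proof -
  have c: "coroot K i = fm (e i) (gen_f K i) *\<^sub>C \<alpha> i" by (rule coroot_root)
  have "fm \<rho> (coroot K i) = 1" using weyl by (simp add: weyl_vector_def)
  then have 1: "fm (e i) (gen_f K i) * fm \<rho> (\<alpha> i) = 1" by (simp add: c fm_simps)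
  have 2: "fm (e i) (gen_f K i) * fm (\<alpha> i) (\<alpha> i) = 2" using coroot(3)[of i] by (simp add: c fm_simps)
  have "fm (e i) (gen_f K i) * (2 * fm \<rho> (\<alpha> i)) = fm (e i) (gen_f K i) * fm (\<alpha> i) (\<alpha> i)" using 1 2 by simp
  then show ?thesis using e_gen_f_nonzero[of i] by (simp add: mult.commute)
qed

lemma rho_csa: "\<rho> \<in> \<hh>" using weyl by (simp add: weyl_vector_def)

text \<open>Expanding [E_a, f_i] and [F_a, f_i] in the bases, invariance makes the structure
  constants opposite, and the double sums cancel. What remains is the Cartan part, which sums to f_i
  \<alpha>_i. The bracket with F_a raises the height by one; this stays within the cut-off because n
  > k and because E_a kills m above height k.\<close>

lemma casimir_step:
  assumes N: "g_module K N" and m: "m \<in> mcarr N" and E0: "\<And>a. a \<in> R \<Longrightarrow> ht (fst a) > k \<Longrightarrow> mact N (E a) m = 0"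
    and n: "n > k"
  shows "(\<Sum>a\<in>Rn n. mact N (F a) (mact N (E a) (mact N (f i) m)))
    = mact N (f i) (\<Sum>a\<in>Rn n. mact N (F a) (mact N (E a) m)) + mact N (f i) (mact N (\<alpha> i) m)"
proof -
  interpret gmodule K N by unfold_locales (rule N)
  define cE where "cE a b = fm (br (E a) (f i)) (F b)" for a b
  have cF: "fm (br (F a) (f i)) (E b) = - cE b a" for a b
    using fm_inv[of "E b" "f i" "F a"] br_anti[of "f i" "F a"] fm_sym[of "br (F a) (f i)"]
    by (simp add: cE_def fm_simps)
  have 1: "mact N (F a) (mact N (E a) (mact N (f i) m)) = mact N (f i) (mact N (F a) (mact N (E a) m))
      + mact N (br (F a) (f i)) (mact N (E a) m) + mact N (F a) (mact N (br (E a) (f i)) m)" for a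
    using m by (simp add: act_swap[of m "E a" "f i"] act_simps act_swap[of "mact N (E a) m" "F a" "f i"])
  have 2: "mact N (br (F a) (f i)) (mact N (E a) m) = (\<Sum>b\<in>Rn n. (- cE b a) *\<^sub>C mact N (F b) (mact N (E a) m))"
    if a: "a \<in> Rn n" for a
  proof (cases "ht (fst a) > k")
    case True
    then show ?thesis using E0 Rn(1)[OF a] by (simp add: act_simps)
  next
    case False
    then have "br (F a) (f i) = (\<Sum>b\<in>Rn n. (- cE b a) *\<^sub>C F b)"
      using br_F_f_expand[of a n i] Rn(1)[OF a] n by (simp add: cF)
    then show ?thesis using m by (simp add: act_left_sum act_left_simps)
  qed
  have 3: "mact N (F a) (mact N (br (E a) (f i)) m)
      = fm (E a) (f i) *\<^sub>C mact N (F a) (mact N (\<alpha> i) m) + (\<Sum>b\<in>Rn n. cE a b *\<^sub>C mact N (F a) (mact N (E b) m))"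
    if a: "a \<in> Rn n" for a
    using m by (subst br_E_f_expand[OF a]) (simp add: act_left_sum act_left_simps act_simps act_sum carr_sum cE_def)
  have 4: "mact N (f i) (mact N (\<alpha> i) m) = (\<Sum>a\<in>Rn n. fm (E a) (f i) *\<^sub>C mact N (F a) (mact N (\<alpha> i) m))"
    using n m by (subst f_expand[of n]) (auto simp: act_left_sum act_left_simps fm_sym[of "f i"])
  have "(\<Sum>a\<in>Rn n. \<Sum>b\<in>Rn n. (- cE b a) *\<^sub>C mact N (F b) (mact N (E a) m))
      + (\<Sum>a\<in>Rn n. \<Sum>b\<in>Rn n. cE a b *\<^sub>C mact N (F a) (mact N (E b) m)) = 0"
    by (subst sum.swap) (simp add: sum_negf)
  then show ?thesis
    using m by (simp add: 1 sum.distrib 2 3 4 act_sum)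
qed

end

section \<open>Verma modules\<close>

locale verma = bd_setting K \<tau> D \<rho>
  for K :: "('n::finite, 'g::complex_vector) km_algebra" and \<tau> D \<rho> +
  fixes \<kappa> :: 'g and N :: "('g, 'm::complex_vector) gmod" and v :: 'm
  assumes \<kappa>: "\<kappa> \<in> csa K" and V: "verma_module K \<kappa> N v"
begin

sublocale gmodule K N
  using V by unfold_locales (simp add: verma_module_def)

lemma v_carr [simp]: "v \<in> mcarr N"
  using V by (simp add: verma_module_def)

lemma v_np: "x \<in> np \<Longrightarrow> mact N x v = 0" and v_csa: "h \<in> \<hh> \<Longrightarrow> mact N h v = fm \<kappa> h *\<^sub>C v"
proof -
  have *: "word_eval N v p = 0" if "p \<in> verma_relations K \<kappa>" for p
  proof -
    have "p \<in> cvec.span (verma_relations K \<kappa>)" using that by (rule cvec.span_base)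
    then show ?thesis using V by (auto simp: verma_module_def)
  qed
  show "mact N x v = 0" if "x \<in> np"
  proof -
    have "word ([] @ [x]) \<in> verma_relations K \<kappa>" using that unfolding verma_relations_def by blast
    from *[OF this] show ?thesis by (simp add: word_eval_lin_ext)
  qed
  show "mact N h v = fm \<kappa> h *\<^sub>C v" if "h \<in> \<hh>"
  proof -
    have "word ([] @ [h]) - fm \<kappa> h *\<^sub>C word [] \<in> verma_relations K \<kappa>"
      using that unfolding verma_relations_def by blast
    from *[OF this] show ?thesis
      by (simp add: word_eval_lin_ext lin_ext_diff lin_ext_scale word_words cvec.span_scale)
  qed
qed

text \<open>Monomials in the f_i on the highest weight vector. They span M_\<kappa> and are weight
  vectors, so linear identities on M_\<kappa> are checked on them; linear independence is never
  claimed.\<close>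

definition fw :: "'n list \<Rightarrow> 'm" where "fw is = foldr (mact N) (map f is) v"
definition wt :: "'n list \<Rightarrow> 'g" where "wt is = (\<Sum>i\<leftarrow>is. \<alpha> i)"

lemma fw_Nil [simp]: "fw [] = v" and fw_Cons: "fw (i # is) = mact N (f i) (fw is)"
  by (simp_all add: fw_def)

lemma fw_carr [simp]: "fw is \<in> mcarr N"
  by (simp add: fw_def foldr_carr)

lemma wt_Q: "wt is \<in> Q" and ht_wt: "ht (wt is) = length is"
proof -
  have r: "ht (\<alpha> i) = 1" for i by (rule ht_eqI) (simp add: dd)
  have "wt is \<in> Q \<and> ht (wt is) = length is"
    by (induction "is") (auto simp: wt_def Q_0 Q_add Q_root ht_add r)
  then show "wt is \<in> Q" "ht (wt is) = length is" by auto
qed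

lemma wt_csa: "wt is \<in> \<hh>"
  using wt_Q Q_csa by blast

lemma fw_weight: "fw is \<in> weight_space K N (\<kappa> - wt is)"
proof (induction "is")
  case Nil
  then show ?case by (simp add: wt_def weight_space_def v_csa)
next
  case (Cons i "is")
  from act_weight[OF gm Cons.IH f_root_space[of i]] show ?case
    by (simp add: fw_Cons wt_def algebra_simps)
qed

lemma fw_span: "mcarr N = cvec.span (range fw)"
proof
  let ?W = "cvec.span (range fw)"
  show sub: "?W \<subseteq> mcarr N" by (rule cvec.span_minimal[OF _ carr]) auto
  have f: "mact N (f i) w \<in> ?W" if "w \<in> ?W" for i w
    by (rule linear_on_span_mem[OF linear_on_subset[OF act_linear sub] cvec.subspace_span _ that])
      (auto intro!: cvec.span_base simp: fw_Cons[symmetric])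
  have h: "mact N h w \<in> ?W" if h: "h \<in> \<hh>" and "w \<in> ?W" for h w
  proof (rule linear_on_span_mem[OF linear_on_subset[OF act_linear sub] cvec.subspace_span _ that(2)])
    fix x assume "x \<in> range fw"
    then obtain "is" where "x = fw is" by blast
    then show "mact N h x \<in> ?W"
      using weight_spaceD(2)[OF fw_weight h, of "is"] by (auto intro: cvec.span_scale cvec.span_base)
  qed
  have e0: "mact N (e i) (fw is) \<in> ?W" for i "is"
  proof (induction "is")
    case Nil
    then show ?case by (simp add: v_np e_np cvec.span_zero)
  next
    case (Cons j "is")
    have fw: "fw is \<in> ?W" by (auto intro: cvec.span_base)
    have "mact N (e i) (fw (j # is)) = mact N (f j) (mact N (e i) (fw is)) + mact N (br (e i) (f j)) (fw is)"
      by (simp add: fw_Cons act_swap[of _ "e i"])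
    moreover have "mact N (br (e i) (f j)) (fw is) \<in> ?W"
      using h[OF root_csa[of i] fw] by (cases "i = j") (auto simp: br_e_f act_left_simps cvec.span_zero)
    ultimately show ?case using f[OF Cons.IH] by (simp add: cvec.span_add)
  qed
  have e: "mact N (e i) w \<in> ?W" if "w \<in> ?W" for i w
    by (rule linear_on_span_mem[OF linear_on_subset[OF act_linear sub] cvec.subspace_span _ that]) (use e0 in auto)
  have g: "mact N x w \<in> ?W" if "w \<in> ?W" for x w
  proof -
    have "x \<in> lie_generated br (\<hh> \<union> range e \<union> range f)" using generated by simp
    then show ?thesis using that
    proof (induction arbitrary: w)
      case (bracket x y)
      have "mact N x (mact N y w) \<in> ?W" "mact N y (mact N x w) \<in> ?W" using bracket by blast+
      then show ?case using subsetD[OF sub bracket.prems] by (simp add: act_br cvec.span_diff)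
    next
      case (add x y)
      then show ?case using subsetD[OF sub add.prems] by (simp add: act_left_simps cvec.span_add)
    next
      case (scale x c)
      then show ?case using subsetD[OF sub scale.prems] by (simp add: act_left_simps cvec.span_scale)
    next
      case zero
      then show ?case using subsetD[OF sub zero.prems] by (simp add: act_left_simps cvec.span_zero)
    next
      case (base x)
      then show ?case using f e h by blast
    qed
  qed
  have "foldr (mact N) ws v \<in> ?W" for ws
  proof (induction ws)
    case Nil
    have "fw [] \<in> ?W" by (intro cvec.span_base rangeI)
    then show ?case by simp
  qed (simp add: g)
  then have "cvec.span (range (\<lambda>ws. foldr (mact N) ws v)) \<subseteq> ?W"
    by (intro cvec.span_minimal cvec.subspace_span) auto
  then show "mcarr N \<subseteq> ?W" unfolding verma_span[OF V] .
qed

lemma fw_induct: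
  assumes "m \<in> mcarr N" "cvec.subspace W" "\<And>is. fw is \<in> W" shows "m \<in> W"
  using assms cvec.span_minimal[of "range fw" W] fw_span by auto

lemma fw_eq:
  assumes "linear_on (mcarr N) g" "linear_on (mcarr N) g'" "\<And>is. g (fw is) = g' (fw is)" "m \<in> mcarr N"
  shows "g m = g' m"
  by (rule linear_on_span_eq[of "range fw" g g']) (use assms fw_span in auto)

text \<open>Group the monomials in an expansion of m by weight; independence of weight spaces kills
  every group with the wrong eigenvalues. The set \<open>H\<close> is kept general because it will
  be \<hh> for weights, \<ll> for exponents of the trace and {\<open>dd\<close>} for
  degrees.\<close>

lemma weight_vector_span:
  assumes m: "m \<in> mcarr N" and H: "H \<subseteq> \<hh>" "\<And>h. h \<in> H \<Longrightarrow> mact N h m = c h *\<^sub>C m"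
  shows "m \<in> cvec.span {fw is | is. \<forall>h\<in>H. fm (\<kappa> - wt is) h = c h}"
proof -
  obtain t r where t: "finite t" "t \<subseteq> range fw" and mr: "m = (\<Sum>a\<in>t. r a *\<^sub>C a)"
    using m fw_span unfolding cvec.span_explicit by auto
  define J where "J a = (SOME is. a = fw is)" for a
  have J: "a = fw (J a)" if "a \<in> t" for a
  proof -
    have "\<exists>is. a = fw is" using t(2) that by blast
    from someI_ex[OF this] show ?thesis by (simp add: J_def)
  qed
  define W where "W a = \<kappa> - wt (J a)" for a
  define y where "y \<gamma> = (\<Sum>a\<in>{a \<in> t. W a = \<gamma>}. r a *\<^sub>C a)" for \<gamma>
  have m: "m = (\<Sum>\<gamma>\<in>W ` t. y \<gamma>)" unfolding mr y_def by (rule sum.image_gen[OF t(1)])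
  have yw: "y \<gamma> \<in> weight_space K N \<gamma>" for \<gamma>
    unfolding y_def
  proof (intro cvec.subspace_sum cvec.subspace_scale weight_space_subspace gm)
    fix a assume "a \<in> {a \<in> t. W a = \<gamma>}"
    then show "a \<in> weight_space K N \<gamma>" using fw_weight[of "J a"] J[of a] by (auto simp: W_def)
  qed
  have Wt: "W ` t \<subseteq> \<hh>" using wt_csa \<kappa> csa_subspace by (auto simp: W_def cvec.subspace_diff)
  have z: "y \<gamma> = 0" if g: "\<gamma> \<in> W ` t" "h \<in> H" "fm \<gamma> h \<noteq> c h" for \<gamma> h
  proof -
    have "(fm \<gamma> h - c h) *\<^sub>C y \<gamma> = 0"
    proof (rule weight_independent[OF gm _ Wt _ _ g(1)])
      have "(\<Sum>\<gamma>\<in>W ` t. fm \<gamma> h *\<^sub>C y \<gamma>) = (\<Sum>\<gamma>\<in>W ` t. mact N h (y \<gamma>))"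
        using g(2) H(1) weight_spaceD(2)[OF yw] by (intro sum.cong) auto
      also have "\<dots> = mact N h m" unfolding m using weight_spaceD(1)[OF yw] by (simp add: act_sum)
      also have "\<dots> = c h *\<^sub>C m" using H g by simp
      finally have "(\<Sum>\<gamma>\<in>W ` t. fm \<gamma> h *\<^sub>C y \<gamma>) = c h *\<^sub>C m" .
      then have "(\<Sum>\<gamma>\<in>W ` t. fm \<gamma> h *\<^sub>C y \<gamma>) - (\<Sum>\<gamma>\<in>W ` t. c h *\<^sub>C y \<gamma>) = 0"
        unfolding cvec.scale_sum_right[symmetric] m[symmetric] by simp
      then show "(\<Sum>\<gamma>\<in>W ` t. (fm \<gamma> h - c h) *\<^sub>C y \<gamma>) = 0"
        unfolding sum_subtractf[symmetric] by (simp only: cvec.scale_left_diff_distrib)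
      show "(fm \<gamma> h - c h) *\<^sub>C y \<gamma> \<in> weight_space K N \<gamma>" for \<gamma>
        by (intro cvec.subspace_scale weight_space_subspace gm yw)
    qed (use t(1) in simp)
    then show ?thesis using g(3) by simp
  qed
  let ?S = "cvec.span {fw is | is. \<forall>h\<in>H. fm (\<kappa> - wt is) h = c h}"
  have "y \<gamma> \<in> ?S" if "\<gamma> \<in> W ` t" for \<gamma>
  proof (cases "\<forall>h\<in>H. fm \<gamma> h = c h")
    case True
    show ?thesis unfolding y_def
    proof (intro cvec.span_sum cvec.span_scale cvec.span_base)
      fix a assume "a \<in> {a \<in> t. W a = \<gamma>}"
      then show "a \<in> {fw is | is. \<forall>h\<in>H. fm (\<kappa> - wt is) h = c h}" using J[of a] True by (auto simp: W_def)
    qed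
  qed (use z[OF that] cvec.span_zero in auto)
  then show ?thesis unfolding m by (rule cvec.span_sum)
qed

lemma degree_span:
  assumes "m \<in> mcarr N" "mact N dd m = (fm \<kappa> dd - of_nat n) *\<^sub>C m"
  shows "m \<in> cvec.span (fw ` {is. length is = n})"
proof -
  have "m \<in> cvec.span {fw is | is. \<forall>h\<in>{dd}. fm (\<kappa> - wt is) h = fm \<kappa> dd - of_nat n}"
    by (rule weight_vector_span) (use assms dd in auto)
  moreover have "fm (\<kappa> - wt is) dd = fm \<kappa> dd - of_nat (length is)" for "is"
    using fm_dd_Q[OF wt_Q, of "is"] fm_sym[of dd] by (simp add: fm_simps ht_wt)
  ultimately show ?thesis by (simp add: setcompr_eq_image)
qed

lemma degree_zero:
  assumes "m \<in> mcarr N" "mact N dd m = (fm \<kappa> dd + c) *\<^sub>C m" "\<And>n. c \<noteq> - of_nat n"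
  shows "m = 0"
proof -
  have "m \<in> cvec.span {fw is | is. \<forall>h\<in>{dd}. fm (\<kappa> - wt is) h = fm \<kappa> dd + c}"
    by (rule weight_vector_span) (use assms dd in auto)
  moreover have "fm (\<kappa> - wt is) dd = fm \<kappa> dd - of_nat (length is)" for "is"
    using fm_dd_Q[OF wt_Q, of "is"] fm_sym[of dd] by (simp add: fm_simps ht_wt)
  moreover have "fm \<kappa> dd - of_nat n \<noteq> fm \<kappa> dd + c" for n
    using assms(3)[of n] by (metis add_left_cancel diff_conv_add_uminus)
  ultimately show ?thesis by simp
qed

lemma E_fw: assumes "a \<in> R" "ht (fst a) > length is" shows "mact N (E a) (fw is) = 0"
proof (rule degree_zero)
  have "mact N dd (fw is) = (fm \<kappa> dd - of_nat (length is)) *\<^sub>C fw is"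
    using weight_spaceD(2)[OF fw_weight dd(3), of "is"] fm_dd_Q[OF wt_Q, of "is"] fm_sym[of dd]
    by (simp add: fm_simps ht_wt)
  then show "mact N dd (mact N (E a) (fw is)) = (fm \<kappa> dd + (of_nat (ht (fst a)) - of_nat (length is))) *\<^sub>C mact N (E a) (fw is)"
    by (simp add: act_swap[of _ dd] act_simps br_dd_E[OF assms(1)] act_left_simps
        cvec.scale_left_distrib cvec.scale_left_diff_distrib)
  fix n
  have "of_nat (ht (fst a)) - of_nat (length is) \<noteq> (- of_nat n :: complex)"
  proof
    assume "of_nat (ht (fst a)) - of_nat (length is) = (- of_nat n :: complex)"
    then have "of_nat (ht (fst a) + n) = (of_nat (length is) :: complex)" by (simp add: algebra_simps)
    then have "ht (fst a) + n = length is" unfolding of_nat_eq_iff .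
    then show False using assms by simp
  qed
  then show "of_nat (ht (fst a)) - of_nat (length is) \<noteq> (- of_nat n :: complex)" .
qed simp

lemma casimir_fw:
  "n \<ge> length is \<Longrightarrow> (\<Sum>a\<in>Rn n. mact N (F a) (mact N (E a) (fw is)))
    = ((Delta K \<rho> \<kappa> - Delta K \<rho> (\<kappa> - wt is)) / 2) *\<^sub>C fw is"
proof (induction "is")
  case Nil
  then show ?case using v_np[OF E_np] Rn(1) by (simp add: wt_def act_simps)
next
  case (Cons i "is")
  have h: "mact N (\<alpha> i) (fw is) = fm (\<kappa> - wt is) (\<alpha> i) *\<^sub>C fw is" by (rule weight_spaceD(2)[OF fw_weight root_csa])
  have "(\<Sum>a\<in>Rn n. mact N (F a) (mact N (E a) (mact N (f i) (fw is))))
      = mact N (f i) (\<Sum>a\<in>Rn n. mact N (F a) (mact N (E a) (fw is))) + mact N (f i) (mact N (\<alpha> i) (fw is))"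
    by (rule casimir_step[OF gm fw_carr, where k = "length is"]) (use Cons.prems E_fw in auto)
  also have "\<dots> = ((Delta K \<rho> \<kappa> - Delta K \<rho> (\<kappa> - wt is)) / 2 + fm (\<kappa> - wt is) (\<alpha> i)) *\<^sub>C fw (i # is)"
    using Cons by (simp add: h act_simps fw_Cons cvec.scale_left_distrib)
  also have "(Delta K \<rho> \<kappa> - Delta K \<rho> (\<kappa> - wt is)) / 2 + fm (\<kappa> - wt is) (\<alpha> i)
      = (Delta K \<rho> \<kappa> - Delta K \<rho> (\<kappa> - wt (i # is))) / 2"
  proof -
    \<comment> \<open>The quadratic term (\<alpha>_i, \<alpha>_i) is cancelled by 2 (\<rho>,
      \<alpha>_i), so each f_i changes the eigenvalue exactly by the term from
      \<open>casimir_step\<close>.\<close>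
    have "Delta K \<rho> (g - \<alpha> i) = Delta K \<rho> g - 2 * fm g (\<alpha> i)" for g
      using rho_root[of i] fm_sym[of "\<alpha> i" g] fm_sym[of "\<alpha> i" \<rho>] by (simp add: Delta_def fm_simps algebra_simps)
    from this[of "\<kappa> - wt is"] have "Delta K \<rho> (\<kappa> - wt (i # is)) = Delta K \<rho> (\<kappa> - wt is) - 2 * fm (\<kappa> - wt is) (\<alpha> i)"
      by (simp add: wt_def diff_diff_eq add.commute)
    moreover have "(d - x) / 2 + p = (d - y) / 2" if "y = x - 2 * p" for d x y p :: complex
      unfolding that by (simp add: diff_divide_distrib)
    ultimately show ?thesis by blast
  qed
  finally show ?case by (simp add: fw_Cons)
qed

lemma csa_casimir:
  assumes "m \<in> weight_space K N \<gamma>" "\<gamma> \<in> \<hh>"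
  shows "(\<Sum>j\<in>I. mact N (\<xi> j) (mact N (\<xi> j) m)) + 2 *\<^sub>C mact N \<rho> m = Delta K \<rho> \<gamma> *\<^sub>C m"
proof -
  have "mact N (\<xi> j) (mact N (\<xi> j) m) = (fm \<gamma> (\<xi> j) * fm \<gamma> (\<xi> j)) *\<^sub>C m" if "j \<in> I" for j
    using weight_spaceD[OF assms(1)] onb_mem(3)[OF that] by (simp add: act_simps)
  then have "(\<Sum>j\<in>I. mact N (\<xi> j) (mact N (\<xi> j) m)) = (\<Sum>j\<in>I. fm \<gamma> (\<xi> j) * fm \<gamma> (\<xi> j)) *\<^sub>C m"
    by (simp add: cvec.scale_sum_left)
  also have "(\<Sum>j\<in>I. fm \<gamma> (\<xi> j) * fm \<gamma> (\<xi> j)) = fm \<gamma> (\<Sum>j\<in>I. fm \<gamma> (\<xi> j) *\<^sub>C \<xi> j)"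
    by (simp add: fm_sum fm_simps)
  also have "\<dots> = fm \<gamma> \<gamma>" using csa_expand[OF assms(2)] by simp
  finally show ?thesis
    using weight_spaceD(2)[OF assms(1) rho_csa]
    by (simp add: Delta_def fm_simps cvec.scale_left_distrib)
qed

text \<open>On a monomial of weight \<gamma> the root part contributes \<Delta>_\<kappa> -
  \<Delta>_\<gamma> and the Cartan part \<Delta>_\<gamma>. The cut-off that suffices depends on the
  vector, hence the filter.\<close>

lemma casimir:
  assumes "m \<in> mcarr N"
  shows "\<forall>\<^sub>F n in sequentially. 2 *\<^sub>C (\<Sum>a\<in>Rn n. mact N (F a) (mact N (E a) m))
    + (\<Sum>j\<in>I. mact N (\<xi> j) (mact N (\<xi> j) m)) + 2 *\<^sub>C mact N \<rho> m = Delta K \<rho> \<kappa> *\<^sub>C m"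
    (is "\<forall>\<^sub>F n in _. ?C n m = _")
proof -
  have lin: "linear_on (mcarr N) (?C n)" for n
    unfolding linear_on_def
    by (auto simp: act_simps sum.distrib cvec.scale_right_distrib cvec.scale_sum_right mult.commute)
  let ?W = "{m \<in> mcarr N. \<forall>\<^sub>F n in sequentially. ?C n m = Delta K \<rho> \<kappa> *\<^sub>C m}"
  have "m \<in> ?W"
  proof (rule fw_induct[OF assms])
    show "cvec.subspace ?W"
      unfolding cvec.subspace_def
    proof (intro conjI ballI allI; clarify)
      fix x y assume x: "x \<in> mcarr N" "\<forall>\<^sub>F n in sequentially. ?C n x = Delta K \<rho> \<kappa> *\<^sub>C x"
        and y: "y \<in> mcarr N" "\<forall>\<^sub>F n in sequentially. ?C n y = Delta K \<rho> \<kappa> *\<^sub>C y"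
      from x(2) y(2) have "\<forall>\<^sub>F n in sequentially. ?C n (x + y) = Delta K \<rho> \<kappa> *\<^sub>C (x + y)"
        by eventually_elim (simp only: linear_on_add[OF lin x(1) y(1)] cvec.scale_right_distrib)
      with x y show "x + y \<in> mcarr N \<and> (\<forall>\<^sub>F n in sequentially. ?C n (x + y) = Delta K \<rho> \<kappa> *\<^sub>C (x + y))" by simp
    next
      fix c x assume x: "x \<in> mcarr N" "\<forall>\<^sub>F n in sequentially. ?C n x = Delta K \<rho> \<kappa> *\<^sub>C x"
      from x(2) have "\<forall>\<^sub>F n in sequentially. ?C n (c *\<^sub>C x) = Delta K \<rho> \<kappa> *\<^sub>C c *\<^sub>C x"
        by eventually_elim (simp only: linear_on_scale[OF lin x(1)] cvec.scale_scale mult.commute)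
      with x show "c *\<^sub>C x \<in> mcarr N \<and> (\<forall>\<^sub>F n in sequentially. ?C n (c *\<^sub>C x) = Delta K \<rho> \<kappa> *\<^sub>C c *\<^sub>C x)" by simp
    qed (simp add: act_simps)
    fix "is"
    have "?C n (fw is) = Delta K \<rho> \<kappa> *\<^sub>C fw is" if "n \<ge> length is" for n
    proof -
      have "?C n (fw is) = (Delta K \<rho> \<kappa> - Delta K \<rho> (\<kappa> - wt is)) *\<^sub>C fw is
          + ((\<Sum>j\<in>I. mact N (\<xi> j) (mact N (\<xi> j) (fw is))) + 2 *\<^sub>C mact N \<rho> (fw is))"
        by (simp add: casimir_fw[OF that] add.assoc)
      also have "\<dots> = Delta K \<rho> \<kappa> *\<^sub>C fw is"
        using csa_casimir[OF fw_weight, of "is"] \<kappa> wt_csa csa_subspace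
        by (simp add: cvec.subspace_diff cvec.scale_left_diff_distrib)
      finally show ?thesis .
    qed
    then show "fw is \<in> ?W" using eventually_sequentially by auto
  qed
  then show ?thesis by simp
qed

lemma hom_exists:
  assumes N': "g_module K N'" and u: "u \<in> mcarr N'" "\<And>i. mact N' (e i) u = 0" "\<And>h. h \<in> \<hh> \<Longrightarrow> mact N' h u = fm \<kappa> h *\<^sub>C u"
  shows "\<exists>\<theta>. linear_from (mcarr N) \<theta> \<and> \<theta> ` mcarr N \<subseteq> mcarr N' \<and> \<theta> v = u \<and>
    (\<forall>x. \<forall>m\<in>mcarr N. \<theta> (mact N x m) = mact N' x (\<theta> m))"
proof -
  interpret N': gmodule K N' by unfold_locales (rule N')
  have np: "mact N' x u = 0" if "x \<in> np" for x
    using that unfolding np_eq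
  proof induction
    case (base x)
    then show ?case using u by auto
  qed (auto simp: N'.act_left_simps N'.act_br N'.act_simps u)
  let ?\<Phi> = "\<lambda>ws. foldr (mact N') ws u"
  have "word_relations K \<kappa> ?\<Phi>"
    unfolding word_relations_def
  proof (intro conjI allI impI)
    note l = linear_on_add[OF N'.foldr_linear] linear_on_scale[OF N'.foldr_linear] linear_on_diff[OF N'.foldr_linear N'.carr]
      linear_on_0[OF N'.foldr_linear N'.carr]
    show "?\<Phi> (u' @ [c *\<^sub>C a + b] @ w) = c *\<^sub>C ?\<Phi> (u' @ [a] @ w) + ?\<Phi> (u' @ [b] @ w)" for u' a b c w
      by (simp add: N'.act_left_simps N'.foldr_carr u l)
    show "?\<Phi> (u' @ [a, b] @ w) - ?\<Phi> (u' @ [b, a] @ w) = ?\<Phi> (u' @ [br a b] @ w)" for u' a b w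
      by (simp add: N'.act_br N'.foldr_carr u l)
    show "?\<Phi> (u' @ [x]) = 0" if "x \<in> np" for u' x
      using np[OF that] by (simp add: l)
    show "?\<Phi> (u' @ [x]) = fm \<kappa> x *\<^sub>C ?\<Phi> u'" if "x \<in> \<hh>" for u' x
      using u(3)[OF that] u(1) by (simp add: l)
  qed
  from verma_lift[OF V this] obtain \<theta> where lin: "linear_from (mcarr N) \<theta>"
    and \<theta>: "\<And>ws. \<theta> (foldr (mact N) ws v) = ?\<Phi> ws" by (elim exE conjE) simp
  note sp = verma_span[OF V]
  have lo: "linear_on (cvec.span (range (\<lambda>ws. foldr (mact N) ws v))) \<theta>"
    using lin sp by (simp add: linear_from_def)
  have im: "\<theta> m \<in> mcarr N'" if "m \<in> mcarr N" for m
    by (rule linear_on_span_mem[OF lo N'.carr]) (use that sp \<theta> N'.foldr_carr u in auto)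
  have "\<theta> (mact N x m) = mact N' x (\<theta> m)" if m: "m \<in> mcarr N" for x m
  proof (rule linear_on_span_eq[where f = "\<lambda>m. \<theta> (mact N x m)" and g = "\<lambda>m. mact N' x (\<theta> m)" and x = m])
    show "linear_on (cvec.span (range (\<lambda>ws. foldr (mact N) ws v))) (\<lambda>m. \<theta> (mact N x m))"
      unfolding sp[symmetric] by (rule linear_on_compose[OF act_linear _ linear_fromD(1)[OF lin]]) auto
    show "linear_on (cvec.span (range (\<lambda>ws. foldr (mact N) ws v))) (\<lambda>m. mact N' x (\<theta> m))"
      unfolding sp[symmetric]
      by (rule linear_on_compose[OF linear_fromD(1)[OF lin] _ N'.act_linear]) (use im in blast)
    show "m \<in> cvec.span (range (\<lambda>ws. foldr (mact N) ws v))" using m sp by simp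
    fix m' assume "m' \<in> range (\<lambda>ws. foldr (mact N) ws v)"
    then obtain ws where "m' = foldr (mact N) ws v" by blast
    then show "\<theta> (mact N x m') = mact N' x (\<theta> m')" using \<theta>[of "x # ws"] \<theta>[of ws] by simp
  qed
  moreover have "\<theta> v = u" using \<theta>[of "[]"] by simp
  ultimately show ?thesis using lin im by blast
qed

lemma free_map_exists:
  fixes act :: "'g \<Rightarrow> 'x::complex_vector \<Rightarrow> 'x"
  assumes "cvec.subspace X" "u \<in> X" "\<And>x. x \<in> nm \<Longrightarrow> linear_on X (act x)"
    "\<And>x w. x \<in> nm \<Longrightarrow> w \<in> X \<Longrightarrow> act x w \<in> X" "\<And>w. w \<in> X \<Longrightarrow> linear_on nm (\<lambda>x. act x w)"
    "\<And>x y w. x \<in> nm \<Longrightarrow> y \<in> nm \<Longrightarrow> w \<in> X \<Longrightarrow> act (br x y) w = act x (act y w) - act y (act x w)"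
  shows "\<exists>\<theta>. linear_from (mcarr N) \<theta> \<and> \<theta> ` mcarr N \<subseteq> X \<and> \<theta> v = u \<and>
    (\<forall>x\<in>nm. \<forall>m\<in>mcarr N. \<theta> (mact N x m) = act x (\<theta> m))"
proof -
  interpret fe: free_extension K \<tau> D \<rho> \<kappa> X act u
    by unfold_locales (use assms \<kappa> in auto)
  show ?thesis by (rule fe.free_extension[OF V])
qed

end

context bd_setting
begin

section \<open>The adjoint of \<open>B\<close>\<close>

text \<open>x' is the image of x under the adjoint of B for the pairing of n_+ with n_-. A relation
  suffices, since existence matters only for the elements \<open>Et l a\<close>.\<close>

definition adj :: "'g \<Rightarrow> 'g \<Rightarrow> bool" where
  "adj x x' \<longleftrightarrow> x \<in> np \<and> x' \<in> np \<and> (\<forall>y\<in>nm. fm x' y = fm x (B y))"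

text \<open>The l-th power of the adjoint of B on E_a, expanded in the basis \<open>E\<close>. Since
  B preserves degrees, the sum may stop at the height of a.\<close>

definition Et :: "nat \<Rightarrow> 'g \<times> nat \<Rightarrow> 'g" where
  "Et l a = (\<Sum>b\<in>Rn (ht (fst a)). fm (E a) ((B ^^ l) (F b)) *\<^sub>C E b)"

lemma Bpow_matrix:
  assumes "a \<in> R" "b \<in> R" "y \<in> \<ll>"
  shows "fm (fst a) y * fm (E a) ((B ^^ l) (F b)) = fm (fst b) y * fm (E a) ((B ^^ l) (F b))"
proof -
  have "fm (E a) (br y ((B ^^ l) (F b))) = - (fm (fst a) y * fm (E a) ((B ^^ l) (F b)))"
    using fm_inv'[of "E a" y] br_csa_E[OF assms(1) lsub_csa[OF assms(3)]] by (simp add: fm_simps)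
  then show ?thesis using B_pow_F[OF assms(2,3)] by (auto simp: fm_simps)
qed

lemma Bpow_matrix_ht:
  assumes "a \<in> R" "b \<in> R" "fm (E a) ((B ^^ l) (F b)) \<noteq> 0" shows "ht (fst a) = ht (fst b)"
proof -
  have "fm (fst a) dd = fm (fst b) dd" using Bpow_matrix[OF assms(1,2) dd(1), of l] assms(3) by simp
  then have "(of_nat (ht (fst a)) :: complex) = of_nat (ht (fst b))"
    using fm_dd_Q[OF rootD(3)[OF assms(1)]] fm_dd_Q[OF rootD(3)[OF assms(2)]] fm_sym[of dd] by simp
  then show ?thesis by simp
qed

lemma Et_extend:
  assumes "a \<in> Rn n" shows "Et l a = (\<Sum>b\<in>Rn n. fm (E a) ((B ^^ l) (F b)) *\<^sub>C E b)"
  unfolding Et_def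
proof (rule sum.mono_neutral_left[OF finite_Rn])
  show "Rn (ht (fst a)) \<subseteq> Rn n" using assms by (intro Rn) (simp add: Rn_def)
  show "\<forall>b\<in>Rn n - Rn (ht (fst a)). fm (E a) ((B ^^ l) (F b)) *\<^sub>C E b = 0"
  proof
    fix b assume b: "b \<in> Rn n - Rn (ht (fst a))"
    then have "ht (fst a) \<noteq> ht (fst b)" by (auto simp: Rn_def)
    then show "fm (E a) ((B ^^ l) (F b)) *\<^sub>C E b = 0"
      using Bpow_matrix_ht[of a b l] Rn(1)[OF assms] b Rn(1)[of b n] by auto
  qed
qed

lemma Et_np: "a \<in> R \<Longrightarrow> Et l a \<in> np"
  unfolding Et_def by (intro cvec.subspace_sum[OF np_subspace] cvec.subspace_scale[OF np_subspace] E_np Rn)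

lemma Rn_self: "a \<in> R \<Longrightarrow> a \<in> Rn (ht (fst a))"
  by (simp add: Rn_def)

lemma Et_0: assumes "a \<in> R" shows "Et 0 a = E a"
proof -
  have "Et 0 a = (\<Sum>b\<in>Rn (ht (fst a)). if b = a then E a else 0)"
    unfolding Et_def using assms Rn(1) by (intro sum.cong) (auto simp: fm_EF)
  then show ?thesis using Rn_self[OF assms] finite_Rn by simp
qed

lemma fm_Et: assumes a: "a \<in> R" and y: "y \<in> nm" shows "fm (Et l a) y = fm (E a) ((B ^^ l) y)"
proof (rule linear_on_span_eq[of "F ` R" "fm (Et l a)" "\<lambda>y. fm (E a) ((B ^^ l) y)" y])
  show "linear_on (cvec.span (F ` R)) (\<lambda>y. fm (E a) ((B ^^ l) y))"
    using B_pow_linear[of l] unfolding nm_span[symmetric] by (simp add: linear_on_def fm_simps)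
  fix z assume "z \<in> F ` R"
  then obtain c where c: "c \<in> R" "z = F c" by blast
  let ?n = "max (ht (fst a)) (ht (fst c))"
  have ac: "a \<in> Rn ?n" "c \<in> Rn ?n" using a c by (auto simp: Rn_def)
  have "fm (Et l a) z = (\<Sum>b\<in>Rn ?n. fm (E a) ((B ^^ l) (F b)) * fm (E b) (F c))"
    by (simp add: Et_extend[OF ac(1)] fm_sum fm_simps c)
  also have "\<dots> = (\<Sum>b\<in>Rn ?n. if b = c then fm (E a) ((B ^^ l) (F c)) else 0)"
    using c Rn(1) by (intro sum.cong) (auto simp: fm_EF)
  finally show "fm (Et l a) z = fm (E a) ((B ^^ l) z)" using ac finite_Rn c by simp
qed (use y nm_span linear_on_subset[OF fm_linear] in auto)

lemma adj_Et: "a \<in> R \<Longrightarrow> adj (Et l a) (Et (Suc l) a)"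
  using Et_np fm_Et B_nm by (auto simp: adj_def funpow_swap1)

lemma br_lsub_Et: assumes "a \<in> R" "y \<in> \<ll>" shows "br y (Et l a) = fm (fst a) y *\<^sub>C Et l a"
  unfolding Et_def br_sum cvec.scale_sum_right
proof (intro sum.cong refl)
  fix b assume "b \<in> Rn (ht (fst a))"
  then have b: "b \<in> R" by (rule Rn)
  show "br y (fm (E a) ((B ^^ l) (F b)) *\<^sub>C E b) = fm (fst a) y *\<^sub>C fm (E a) ((B ^^ l) (F b)) *\<^sub>C E b"
    using Bpow_matrix[OF assms(1) b assms(2), of l] br_csa_E[OF b lsub_csa[OF assms(2)]]
    by (auto simp: br_simps mult.commute)
qed

lemma Bpow_F_expand:
  assumes "b \<in> Rn n" shows "(B ^^ l) (F b) = (\<Sum>a\<in>Rn n. fm (E a) ((B ^^ l) (F b)) *\<^sub>C F a)"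
  using nm_expand[OF B_pow_nm[OF F_nm] br_dd_B_pow_F] assms Rn(1)[OF assms]
  by (simp add: Rn(2) fm_sym[of "E _"])

lemma lproj_eqI:
  assumes "y \<in> \<ll>" "\<And>x. x \<in> \<ll> \<Longrightarrow> fm y x = fm \<kappa> x" shows "lproj K \<tau> \<kappa> = y"
  unfolding lproj_def
proof (rule the_equality)
  fix z assume z: "z \<in> \<ll> \<and> (\<forall>x\<in>\<ll>. fm z x = fm \<kappa> x)"
  then have "\<forall>x\<in>\<ll>. fm (z - y) x = 0" using assms by (simp add: fm_simps)
  moreover have "z - y \<in> \<ll>" using z assms by (simp add: cvec.subspace_diff lsub_subspace)
  ultimately have "z - y = 0" using nondeg unfolding nondegenerate_triple_def nondegenerate_on_def by blast
  then show "z = y" by simp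
qed (use assms in auto)

lemma lproj: "lproj K \<tau> \<kappa> \<in> \<ll>" "x \<in> \<ll> \<Longrightarrow> fm (lproj K \<tau> \<kappa>) x = fm \<kappa> x"
proof -
  define y where "y = (\<Sum>j\<in>I1 D. fm \<kappa> (\<xi> j) *\<^sub>C \<xi> j)"
  have y: "y \<in> \<ll>"
    unfolding y_def by (intro cvec.subspace_sum[OF lsub_subspace] cvec.subspace_scale[OF lsub_subspace] onb_mem)
  have eq: "fm y x = fm \<kappa> x" if "x \<in> \<ll>" for x
  proof -
    have "fm \<kappa> x = (\<Sum>j\<in>I1 D. fm x (\<xi> j) * fm \<kappa> (\<xi> j))"
      by (subst lsub_expand[OF that]) (simp add: fm_sum fm_simps)
    then show ?thesis by (simp add: y_def fm_sum fm_simps fm_sym[of x] mult.commute)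
  qed
  then have "lproj K \<tau> \<kappa> = y" using y by (intro lproj_eqI)
  with y eq show "lproj K \<tau> \<kappa> \<in> \<ll>" "x \<in> \<ll> \<Longrightarrow> fm (lproj K \<tau> \<kappa>) x = fm \<kappa> x" by auto
qed

lemma lproj_sym: "x \<in> \<ll> \<Longrightarrow> fm x (lproj K \<tau> \<kappa>) = fm \<kappa> x"
  using lproj(2)[of x \<kappa>] fm_sym by simp

lemma lproj_add: "lproj K \<tau> (x + y) = lproj K \<tau> x + lproj K \<tau> y"
  and lproj_diff: "lproj K \<tau> (x - y) = lproj K \<tau> x - lproj K \<tau> y"
  and lproj_lsub: "z \<in> \<ll> \<Longrightarrow> lproj K \<tau> z = z"
  using lproj lsub_subspace by (auto intro!: lproj_eqI simp: fm_simps cvec.subspace_add cvec.subspace_diff)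

lemma lsub_eqI: "x \<in> \<ll> \<Longrightarrow> y \<in> \<ll> \<Longrightarrow> (\<And>z. z \<in> \<ll> \<Longrightarrow> fm x z = fm y z) \<Longrightarrow> x = y"
  using lproj_eqI[of x y] lproj_lsub[of y] by simp

end

section \<open>The map \<open>B\<close> on Verma modules\<close>

locale verma_pair = src: verma K \<tau> D \<rho> \<kappa>' N' v' + tgt: verma K \<tau> D \<rho> \<kappa> N v
  for K :: "('n::finite, 'g::complex_vector) km_algebra" and \<tau> D \<rho> \<kappa>' \<kappa>
    and N' N :: "('g, 'm::complex_vector) gmod" and v' v +
  assumes Bcond: "i \<in> Gam1 \<tau> \<Longrightarrow> form K \<kappa>' (root K i) = form K \<kappa> (root K (Tmap \<tau> i))"
begin

abbreviation "BV \<equiv> Bverma K \<tau> N' v' N v"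

text \<open>Letting x in n_- act on the target through B x makes the target a module for n_-, and
  freeness of the source gives the map. It agrees with \<open>Bverma\<close> because monomials in
  the f_i span.\<close>

lemma BV: "linear_from (mcarr N') BV" "m \<in> mcarr N' \<Longrightarrow> BV m \<in> mcarr N" "BV v' = v"
  "x \<in> src.nm \<Longrightarrow> m \<in> mcarr N' \<Longrightarrow> BV (mact N' x m) = mact N (src.B x) (BV m)"
proof -
  have "\<exists>\<theta>. linear_from (mcarr N') \<theta> \<and> \<theta> ` mcarr N' \<subseteq> mcarr N \<and> \<theta> v' = v \<and>
    (\<forall>x\<in>src.nm. \<forall>m\<in>mcarr N'. \<theta> (mact N' x m) = mact N (src.B x) (\<theta> m))"
  proof (rule src.free_map_exists)
    show "linear_on src.nm (\<lambda>x. mact N (src.B x) w)" if "w \<in> mcarr N" for w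
      by (rule linear_on_compose[OF src.B_linear _ tgt.act_linear_left[OF that]]) simp
  qed (auto simp: tgt.carr tgt.act_linear src.B_br tgt.act_br)
  then obtain \<theta> where \<theta>: "linear_from (mcarr N') \<theta>" "\<And>m. m \<in> mcarr N' \<Longrightarrow> \<theta> m \<in> mcarr N" "\<theta> v' = v"
    "\<And>x m. x \<in> src.nm \<Longrightarrow> m \<in> mcarr N' \<Longrightarrow> \<theta> (mact N' x m) = mact N (src.B x) (\<theta> m)"
    by (elim exE conjE) (simp add: image_subset_iff)
  have w: "\<theta> (foldr (mact N') ws v') = foldr (mact N) (map src.B ws) v" if "set ws \<subseteq> src.nm" for ws
    using that by (induction ws) (auto simp: \<theta> src.foldr_carr)
  have "BV = \<theta>"
    unfolding Bverma_def
  proof (rule the_equality)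
    fix b assume b: "linear_from (mcarr N') b \<and>
      (\<forall>ws. set ws \<subseteq> n_minus K \<longrightarrow> b (foldr (mact N') ws v') = foldr (mact N) (map (Bmap K \<tau>) ws) v)"
    have "b m = \<theta> m" if "m \<in> mcarr N'" for m
    proof (rule src.fw_eq[OF linear_fromD(1) linear_fromD(1)[OF \<theta>(1)] _ that])
      fix "is"
      have "set (map src.f is) \<subseteq> src.nm" using src.f_nm by auto
      then show "b (src.fw is) = \<theta> (src.fw is)" unfolding src.fw_def using b w by metis
    qed (use b in blast)
    then show "b = \<theta>" using b \<theta>(1) by (auto simp: linear_from_def fun_eq_iff) metis
  qed (use \<theta>(1) w in auto)
  then show "linear_from (mcarr N') BV" "m \<in> mcarr N' \<Longrightarrow> BV m \<in> mcarr N" "BV v' = v"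
    "x \<in> src.nm \<Longrightarrow> m \<in> mcarr N' \<Longrightarrow> BV (mact N' x m) = mact N (src.B x) (BV m)"
    using \<theta> by auto
qed

lemmas BV_linear = linear_fromD(1)[OF BV(1)]

lemma BV_simps:
  "m \<in> mcarr N' \<Longrightarrow> m' \<in> mcarr N' \<Longrightarrow> BV (m + m') = BV m + BV m'"
  "m \<in> mcarr N' \<Longrightarrow> BV (c *\<^sub>C m) = c *\<^sub>C BV m" "BV 0 = 0"
  using BV_linear src.carr by (auto simp: linear_on_add linear_on_scale linear_on_0)

text \<open>The second assumption settles the highest weight vector; each further f_i is passed by
  the equivariance of B.\<close>

lemma BV_csa:
  assumes c: "src.compat h h'" "form K \<kappa> h' = form K \<kappa>' h" and m: "m \<in> mcarr N'"
  shows "mact N h' (BV m) = BV (mact N' h m)"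
proof (rule src.fw_eq[OF _ _ _ m, where g = "\<lambda>m. mact N h' (BV m)"])
  show "linear_on (mcarr N') (\<lambda>m. mact N h' (BV m))"
    by (rule linear_on_compose[OF BV_linear _ tgt.act_linear]) (use BV(2) in auto)
  show "linear_on (mcarr N') (\<lambda>m. BV (mact N' h m))"
    by (rule linear_on_compose[OF src.act_linear _ BV_linear]) auto
  fix "is" show "mact N h' (BV (src.fw is)) = BV (mact N' h (src.fw is))"
  proof (induction "is")
    case Nil
    then show ?case
      using tgt.v_csa src.v_csa src.compat_csa[OF c(1)] by (simp add: BV BV_simps c(2))
  next
    case (Cons i "is")
    let ?m = "src.fw is"
    have "mact N h' (BV (src.fw (i # is))) = mact N h' (mact N (src.B (src.f i)) (BV ?m))"
      by (simp add: src.fw_Cons BV src.f_nm)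
    also have "\<dots> = mact N (src.B (src.f i)) (mact N h' (BV ?m)) + mact N (src.br h' (src.B (src.f i))) (BV ?m)"
      by (simp add: tgt.act_swap[of _ h'] BV)
    also have "\<dots> = BV (mact N' (src.f i) (mact N' h ?m)) + BV (mact N' (src.br h (src.f i)) ?m)"
      using src.B_compat[OF c(1) src.f_nm] src.f_nm src.br_csa_nm[OF src.compat_csa(1)[OF c(1)] src.f_nm]
      by (simp add: Cons BV)
    also have "\<dots> = BV (mact N' h (src.fw (i # is)))"
      by (simp add: src.fw_Cons src.act_swap[of _ h] BV_simps)
    finally show ?case .
  qed
qed

text \<open>Induction over monomials, for all adjoint pairs at once. The n_+ parts of [x, B f_i] and
  [x', f_i] are again adjoint, so the induction hypothesis applies to them, and the Cartan parts
  match by \<open>Bcond\<close>. If i is outside \<Gamma>_1, then B f_i = 0 and [x', f_i] is adjoint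
  to 0.\<close>

lemma BV_adj:
  assumes "src.adj x x'" and m: "m \<in> mcarr N'" shows "mact N x (BV m) = BV (mact N' x' m)"
proof (rule src.fw_eq[OF _ _ _ m, where g = "\<lambda>m. mact N x (BV m)"])
  show "linear_on (mcarr N') (\<lambda>m. mact N x (BV m))"
    by (rule linear_on_compose[OF BV_linear _ tgt.act_linear]) (use BV(2) in auto)
  show "linear_on (mcarr N') (\<lambda>m. BV (mact N' x' m))"
    by (rule linear_on_compose[OF src.act_linear _ BV_linear]) auto
  fix "is" show "mact N x (BV (src.fw is)) = BV (mact N' x' (src.fw is))"
    using assms(1)
  proof (induction "is" arbitrary: x x')
    case Nil
    then show ?case by (simp add: BV BV_simps src.adj_def tgt.v_np src.v_np)
  next
    case (Cons i "is")
    let ?m = "src.fw is" and ?f = "src.f i"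
    have x: "x \<in> src.np" "x' \<in> src.np" and fx: "\<And>y. y \<in> src.nm \<Longrightarrow> form K x' y = form K x (src.B y)"
      using Cons.prems by (auto simp: src.adj_def)
    define z' where "z' = src.br x' ?f - form K x' ?f *\<^sub>C src.\<alpha> i"
    have z': "z' \<in> src.np" unfolding z'_def by (rule src.np_br_f[OF x(2)])
    have z'y: "form K z' y = form K x (src.br (src.B ?f) (src.B y))" if "y \<in> src.nm" for y
    proof -
      have "form K z' y = form K x' (src.br ?f y)"
        using src.nm_orthogonal(2)[OF that src.root_csa[of i]] src.fm_sym[of "src.\<alpha> i"]
        by (simp add: z'_def src.fm_simps src.fm_inv)
      then show ?thesis using fx src.br_nm[OF src.f_nm that] src.B_br[OF src.f_nm that] by simp
    qed
    have key: "mact N (src.br x (src.B ?f)) (BV ?m) = BV (mact N' (src.br x' ?f) ?m)"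
    proof (cases "i \<in> src.G1")
      case False
      then have B0: "src.B ?f = 0" by (simp add: src.B_f)
      then have "src.adj 0 z'"
        using z' z'y src.np_subspace by (simp add: src.adj_def cvec.subspace_0 src.br_simps src.fm_simps)
      from Cons.IH[OF this] have "BV (mact N' z' ?m) = 0" by (simp add: tgt.act_left_simps BV)
      moreover have "z' = src.br x' ?f" using fx[OF src.f_nm[of i]] B0 by (simp add: z'_def src.fm_simps)
      ultimately show ?thesis using B0 by (simp add: src.br_simps tgt.act_left_simps BV)
    next
      case True
      let ?j = "src.T i"
      have Bf: "src.B ?f = src.f ?j" using True by (simp add: src.B_f)
      define z where "z = src.br x (src.f ?j) - form K x (src.f ?j) *\<^sub>C src.\<alpha> ?j"
      have z: "z \<in> src.np" unfolding z_def by (rule src.np_br_f[OF x(1)])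
      have "form K z (src.B y) = form K x (src.br (src.B ?f) (src.B y))" if "y \<in> src.nm" for y
        using src.nm_orthogonal(2)[OF src.B_nm[OF that] src.root_csa[of ?j]] src.fm_sym[of "src.\<alpha> ?j"]
        by (simp add: z_def Bf src.fm_simps src.fm_inv)
      then have "src.adj z z'" using z z' z'y by (simp add: src.adj_def)
      note IH = Cons.IH[OF this]
      have c: "form K x' ?f = form K x (src.f ?j)" using fx[OF src.f_nm[of i]] Bf by simp
      have h: "mact N (src.\<alpha> ?j) (BV ?m) = BV (mact N' (src.\<alpha> i) ?m)"
        by (rule BV_csa[OF src.compat_root[OF True] Bcond[OF True, symmetric]]) simp
      have "src.br x (src.B ?f) = z + form K x (src.f ?j) *\<^sub>C src.\<alpha> ?j" by (simp add: z_def Bf)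
      moreover have "src.br x' ?f = z' + form K x (src.f ?j) *\<^sub>C src.\<alpha> i" by (simp add: z'_def c)
      ultimately show ?thesis
        using IH h by (simp add: tgt.act_left_simps src.act_left_simps BV BV_simps)
    qed
    have "mact N x (BV (src.fw (i # is))) = mact N x (mact N (src.B ?f) (BV ?m))"
      by (simp add: src.fw_Cons BV src.f_nm)
    also have "\<dots> = mact N (src.B ?f) (mact N x (BV ?m)) + mact N (src.br x (src.B ?f)) (BV ?m)"
      by (simp add: tgt.act_swap[of _ x] BV)
    also have "\<dots> = BV (mact N' ?f (mact N' x' ?m)) + BV (mact N' (src.br x' ?f) ?m)"
      using Cons.IH[OF Cons.prems] key by (simp add: BV src.f_nm)
    also have "\<dots> = BV (mact N' x' (src.fw (i # is)))"
      by (simp add: src.fw_Cons src.act_swap[of _ x'] BV_simps)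
    finally show ?case .
  qed
qed

end

section \<open>Traces\<close>

context verma
begin

lemma weight_basis_exists: "\<exists>Bs. weight_basis K N Bs"
proof -
  obtain Bs where Bs: "Bs \<subseteq> range fw" "cvec.independent Bs" "range fw \<subseteq> cvec.span Bs"
    using cvec.maximal_independent_subset by blast
  have "cvec.span Bs = mcarr N"
    unfolding fw_span using Bs by (metis cvec.span_mono cvec.span_span subset_antisym)
  moreover have "\<exists>\<gamma>\<in>\<hh>. b \<in> weight_space K N \<gamma>" if "b \<in> Bs" for b
    using Bs(1) that fw_weight wt_csa \<kappa> csa_subspace by (blast intro: cvec.subspace_diff)
  ultimately show ?thesis using Bs(2) by (auto simp: weight_basis_def)
qed

text \<open>The very choice made inside \<open>twisted_trace\<close>, so that traces are sums over
  this basis by definition.\<close>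

definition Bs :: "'m set" where "Bs = (SOME Bs. weight_basis K N Bs)"

abbreviation "rep \<equiv> cvec.representation Bs"

lemma Bs: "cvec.independent Bs" "cvec.span Bs = mcarr N" "b \<in> Bs \<Longrightarrow> b \<in> mcarr N" "b \<in> Bs \<Longrightarrow> b \<noteq> 0"
proof -
  have "weight_basis K N Bs" unfolding Bs_def by (rule someI_ex[OF weight_basis_exists])
  then show 1: "cvec.independent Bs" "cvec.span Bs = mcarr N" by (auto simp: weight_basis_def)
  show "b \<in> Bs \<Longrightarrow> b \<in> mcarr N" using 1(2) cvec.span_base by blast
  show "b \<in> Bs \<Longrightarrow> b \<noteq> 0" using 1(1) cvec.dependent_zero by blast
qed

lemma Bs_weight: assumes "b \<in> Bs" shows "\<exists>\<gamma>\<in>\<hh>. b \<in> weight_space K N \<gamma>"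
proof -
  have "weight_basis K N Bs" unfolding Bs_def by (rule someI_ex[OF weight_basis_exists])
  then show ?thesis using assms by (simp add: weight_basis_def)
qed

definition Bl :: "'g \<Rightarrow> 'm set" where "Bl \<eta> = {b \<in> Bs. \<forall>x\<in>\<ll>. mact N x b = fm \<eta> x *\<^sub>C b}"

lemma Bl_exists: assumes "b \<in> Bs" shows "\<exists>\<eta>\<in>\<ll>. b \<in> Bl \<eta>"
proof -
  obtain \<gamma> where g: "b \<in> weight_space K N \<gamma>" using Bs_weight[OF assms] by blast
  have "b \<in> Bl (lproj K \<tau> \<gamma>)"
    using assms weight_spaceD(2)[OF g] lsub_csa lproj(2) by (simp add: Bl_def)
  then show ?thesis using lproj(1) by blast
qed

lemma Bl_unique: assumes "b \<in> Bl \<eta>" "b \<in> Bl \<eta>'" "\<eta> \<in> \<ll>" "\<eta>' \<in> \<ll>" shows "\<eta> = \<eta>'"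
proof (rule lsub_eqI)
  fix x assume "x \<in> \<ll>"
  then have "fm \<eta> x *\<^sub>C b = fm \<eta>' x *\<^sub>C b" using assms by (auto simp: Bl_def)
  then show "fm \<eta> x = fm \<eta>' x" using Bs(4)[of b] assms(1) by (auto simp: Bl_def)
qed (use assms in auto)

lemma Bl_support: assumes "b \<in> Bl \<eta>" "\<eta> \<in> \<ll>" shows "\<exists>\<beta>\<in>Q. \<eta> = lproj K \<tau> (\<kappa> - \<beta>)"
proof -
  have b: "b \<in> Bs" "\<And>x. x \<in> \<ll> \<Longrightarrow> mact N x b = fm \<eta> x *\<^sub>C b" using assms by (auto simp: Bl_def)
  have "b \<in> cvec.span {fw is | is. \<forall>h\<in>\<ll>. fm (\<kappa> - wt is) h = fm \<eta> h}"
    by (rule weight_vector_span) (use b Bs(3) lsub_csa in auto)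
  moreover have "b \<noteq> 0" using Bs(4) b by blast
  ultimately have "{fw is | is. \<forall>h\<in>\<ll>. fm (\<kappa> - wt is) h = fm \<eta> h} \<noteq> {}"
    using cvec.span_empty by (metis singletonD)
  then obtain "is" where "\<forall>h\<in>\<ll>. fm (\<kappa> - wt is) h = fm \<eta> h" by blast
  then have "\<eta> = lproj K \<tau> (\<kappa> - wt is)" using assms(2) by (intro lproj_eqI[symmetric]) auto
  then show ?thesis using wt_Q by blast
qed

text \<open>As \<open>dd\<close> lies in \<ll>, the exponent fixes the length of the monomials that
  can occur, and there are finitely many words of a given length.\<close>

lemma finite_Bl: assumes "\<eta> \<in> \<ll>" shows "finite (Bl \<eta>)"
proof (cases "Bl \<eta> = {}")
  case False
  then obtain b where "b \<in> Bl \<eta>" by blast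
  then obtain \<beta> where \<beta>: "\<beta> \<in> Q" "\<eta> = lproj K \<tau> (\<kappa> - \<beta>)" using Bl_support assms by blast
  have d: "fm \<eta> dd = fm \<kappa> dd - of_nat (ht \<beta>)"
    using \<beta> lproj(2)[OF dd(1)] fm_dd_Q[OF \<beta>(1)] fm_sym[of dd] by (simp add: fm_simps)
  have "Bl \<eta> \<subseteq> cvec.span (fw ` {is. length is = ht \<beta>})"
    using Bs(3) dd(1) d by (auto simp: Bl_def intro!: degree_span)
  moreover have "finite (fw ` {is :: 'n list. length is = ht \<beta>})"
    using finite_lists_length_eq[of "UNIV :: 'n set" "ht \<beta>"] by simp
  moreover have "cvec.independent (Bl \<eta>)"
    by (rule cvec.independent_mono[OF Bs(1)]) (auto simp: Bl_def)
  ultimately show ?thesis using cvec.independent_span_bound by blast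
qed simp

lemma rep_linear: "linear_on (mcarr N) (\<lambda>m. rep m b)"
  using Bs(1,2) by (auto simp: linear_on_def cvec.representation_add cvec.representation_scale)

lemma rep_basis: "c \<in> Bs \<Longrightarrow> rep c b = (if c = b then 1 else 0)"
  using cvec.representation_basis[OF Bs(1), of c] by auto

lemma rep_act:
  assumes b: "b \<in> Bs" "mact N x b = c *\<^sub>C b" and x: "x \<in> \<hh>" and m: "m \<in> mcarr N"
  shows "rep (mact N x m) b = c * rep m b"
proof (rule linear_on_span_eq[of Bs "\<lambda>m. rep (mact N x m) b" "\<lambda>m. c * rep m b" m])
  show "linear_on (cvec.span Bs) (\<lambda>m. rep (mact N x m) b)"
    unfolding Bs(2) by (rule linear_on_compose[OF act_linear _ rep_linear]) auto
  show "linear_on (cvec.span Bs) (\<lambda>m. c * rep m b)"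
    unfolding Bs(2) using rep_linear[of b] by (auto simp: linear_on_def algebra_simps)
  fix d assume d: "d \<in> Bs"
  obtain \<gamma> where g: "d \<in> weight_space K N \<gamma>" using Bs_weight[OF d] by blast
  have "rep (mact N x d) b = fm \<gamma> x * rep d b"
    using weight_spaceD(2)[OF g x] Bs(3)[OF d] linear_on_scale[OF rep_linear] by simp
  then show "rep (mact N x d) b = c * rep d b"
    using rep_basis[OF d, of b] weight_spaceD(2)[OF g x] b Bs(4)[OF d] by (cases "d = b") auto
qed (use m Bs in auto)

lemma rep_expand: "m \<in> mcarr N \<Longrightarrow> finite {b. rep m b \<noteq> 0} \<and> {b. rep m b \<noteq> 0} \<subseteq> Bs \<and> m = (\<Sum>b | rep m b \<noteq> 0. rep m b *\<^sub>C b)"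
  using cvec.finite_representation[of Bs m] cvec.representation_ne_zero[of Bs m]
    cvec.sum_nonzero_representation_eq[OF Bs(1), of m] Bs(2) by auto

section \<open>Linearity, support and cyclicity of the trace\<close>

abbreviation "tt \<equiv> twisted_trace K \<tau> N"

lemma tt_eq: "\<eta> \<in> \<ll> \<Longrightarrow> tt A \<eta> = (\<Sum>b\<in>Bl \<eta>. rep (A b) b)"
  and tt_outside: "\<eta> \<notin> \<ll> \<Longrightarrow> tt A \<eta> = 0"
  by (simp_all add: twisted_trace_def Bl_def Bs_def Let_def)

lemma tt_support: "tt A \<eta> \<noteq> 0 \<Longrightarrow> \<eta> \<in> \<ll> \<and> (\<exists>\<beta>\<in>Q. \<eta> = lproj K \<tau> (\<kappa> - \<beta>))"
proof -
  assume *: "tt A \<eta> \<noteq> 0"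
  then have "\<eta> \<in> \<ll>" using tt_outside by blast
  with * have "Bl \<eta> \<noteq> {}" using tt_eq by auto
  then show ?thesis using Bl_support \<open>\<eta> \<in> \<ll>\<close> by blast
qed

lemma tt_cong: "(\<And>m. m \<in> mcarr N \<Longrightarrow> A m = A' m) \<Longrightarrow> tt A \<eta> = tt A' \<eta>"
  using Bs(3) by (cases "\<eta> \<in> \<ll>") (auto simp: tt_eq tt_outside Bl_def intro!: sum.cong)

lemma tt_add:
  assumes "\<And>m. m \<in> mcarr N \<Longrightarrow> A m \<in> mcarr N" "\<And>m. m \<in> mcarr N \<Longrightarrow> A' m \<in> mcarr N"
  shows "tt (\<lambda>m. A m + A' m) \<eta> = tt A \<eta> + tt A' \<eta>"
  using assms Bs(3) linear_on_add[OF rep_linear]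
  by (cases "\<eta> \<in> \<ll>") (auto simp: tt_eq tt_outside Bl_def sum.distrib[symmetric] intro!: sum.cong)

lemma tt_scale:
  assumes "\<And>m. m \<in> mcarr N \<Longrightarrow> A m \<in> mcarr N"
  shows "tt (\<lambda>m. c *\<^sub>C A m) \<eta> = c * tt A \<eta>"
  using assms Bs(3) linear_on_scale[OF rep_linear]
  by (cases "\<eta> \<in> \<ll>") (auto simp: tt_eq tt_outside Bl_def sum_distrib_left intro!: sum.cong)

lemma tt_0: "tt (\<lambda>m. 0) \<eta> = 0"
  using tt_scale[of "\<lambda>m. m" 0 \<eta>] by simp

lemma tt_sum:
  assumes "\<And>i m. i \<in> S \<Longrightarrow> m \<in> mcarr N \<Longrightarrow> A i m \<in> mcarr N"
  shows "tt (\<lambda>m. \<Sum>i\<in>S. A i m) \<eta> = (\<Sum>i\<in>S. tt (A i) \<eta>)"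
  using assms
proof (induction S rule: infinite_finite_induct)
  case (insert x S)
  then have "tt (\<lambda>m. A x m + (\<Sum>i\<in>S. A i m)) \<eta> = tt (A x) \<eta> + tt (\<lambda>m. \<Sum>i\<in>S. A i m) \<eta>"
    by (intro tt_add carr_sum) auto
  with insert show ?case by simp
qed (simp_all add: tt_0)

lemma tt_lsub:
  assumes "linear_on (mcarr N) A" "\<And>m. m \<in> mcarr N \<Longrightarrow> A m \<in> mcarr N" "y \<in> \<ll>"
  shows "tt (\<lambda>m. A (mact N y m)) \<eta> = fm \<eta> y * tt A \<eta>"
proof (cases "\<eta> \<in> \<ll>")
  case True
  have "rep (A (mact N y b)) b = fm \<eta> y * rep (A b) b" if "b \<in> Bl \<eta>" for b
    using that assms Bs(3)[of b] linear_on_scale[OF rep_linear] linear_on_scale[OF assms(1)] by (auto simp: Bl_def)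
  then show ?thesis using True by (simp add: tt_eq sum_distrib_left)
qed (simp add: tt_outside)

text \<open>P has \<ll>-weight s, so its nonzero matrix entries lead from exponent \<eta> to
  exponent \<eta> + s. Both traces are then the same finite double sum, with A an arbitrary
  operator; the shift by s is the effect of passing e^\<lambda>.\<close>

lemma tt_cyclic:
  assumes P: "linear_on (mcarr N) P" "\<And>m. m \<in> mcarr N \<Longrightarrow> P m \<in> mcarr N"
    and shift: "\<And>x m. x \<in> \<ll> \<Longrightarrow> m \<in> mcarr N \<Longrightarrow> mact N x (P m) = P (mact N x m) + fm s x *\<^sub>C P m"
    and A: "linear_on (mcarr N) A" "\<And>m. m \<in> mcarr N \<Longrightarrow> A m \<in> mcarr N"
    and s: "s \<in> \<ll>"
  shows "tt (\<lambda>m. P (A m)) (\<eta> + s) = tt (\<lambda>m. A (P m)) \<eta>"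
proof (cases "\<eta> \<in> \<ll>")
  case False
  then have "\<eta> + s \<notin> \<ll>" using s cvec.subspace_diff[OF lsub_subspace, of "\<eta> + s" s] by auto
  with False show ?thesis by (simp add: tt_outside)
next
  case True
  then have es: "\<eta> + s \<in> \<ll>" using s lsub_subspace by (simp add: cvec.subspace_add)
  have nz: "b \<in> Bl (\<eta> + s) \<longleftrightarrow> c \<in> Bl \<eta>" if c: "c \<in> Bs" and b: "b \<in> Bs" and r: "rep (P c) b \<noteq> 0" for b c
  proof -
    obtain \<gamma> \<delta> where g: "\<gamma> \<in> \<ll>" "c \<in> Bl \<gamma>" and d: "\<delta> \<in> \<ll>" "b \<in> Bl \<delta>" using Bl_exists b c by blast
    have "\<delta> = \<gamma> + s"
    proof (rule lsub_eqI)
      fix x assume x: "x \<in> \<ll>"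
      have "mact N x (P c) = fm (\<gamma> + s) x *\<^sub>C P c"
        using shift[OF x Bs(3)[OF c]] g(2) x linear_on_scale[OF P(1) Bs(3)[OF c]]
        by (simp add: Bl_def fm_simps cvec.scale_left_distrib)
      then have "fm (\<gamma> + s) x * rep (P c) b = fm \<delta> x * rep (P c) b"
        using rep_act[OF b _ lsub_csa[OF x] P(2)[OF Bs(3)[OF c]], of "fm \<delta> x"] d(2) x linear_on_scale[OF rep_linear P(2)[OF Bs(3)[OF c]]]
        by (simp add: Bl_def)
      then show "fm \<delta> x = fm (\<gamma> + s) x" using r by simp
    qed (use g d s lsub_subspace in \<open>auto simp: cvec.subspace_add\<close>)
    then show ?thesis using g d True es Bl_unique by (metis add_right_cancel)
  qed
  have A': "rep (P (A b)) b = (\<Sum>c\<in>Bl \<eta>. rep (A b) c * rep (P c) b)" if b: "b \<in> Bl (\<eta> + s)" for b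
  proof -
    have bB: "b \<in> Bs" using b by (simp add: Bl_def)
    note ex = rep_expand[OF A(2)[OF Bs(3)[OF bB]]]
    let ?C = "{c. rep (A b) c \<noteq> 0}"
    have CN: "c \<in> mcarr N" if "c \<in> ?C" for c using that ex Bs(3) by blast
    have lin: "linear_on (mcarr N) (\<lambda>m. rep (P m) b)" by (rule linear_on_compose[OF P(1) _ rep_linear]) (use P in auto)
    have "rep (P (A b)) b = rep (P (\<Sum>c\<in>?C. rep (A b) c *\<^sub>C c)) b" using ex by simp
    also have "\<dots> = (\<Sum>c\<in>?C. rep (P (rep (A b) c *\<^sub>C c)) b)" by (rule linear_on_sum[OF lin carr]) (use CN in auto)
    also have "\<dots> = (\<Sum>c\<in>?C. rep (A b) c * rep (P c) b)"
      using linear_on_scale[OF lin] CN by (intro sum.cong) auto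
    also have "\<dots> = (\<Sum>c\<in>?C \<inter> Bl \<eta>. rep (A b) c * rep (P c) b)"
      using ex nz[OF _ bB] b by (intro sum.mono_neutral_right) auto
    also have "\<dots> = (\<Sum>c\<in>Bl \<eta>. rep (A b) c * rep (P c) b)"
      using finite_Bl[OF True] by (intro sum.mono_neutral_left) auto
    finally show ?thesis .
  qed
  have P': "rep (A (P c)) c = (\<Sum>b\<in>Bl (\<eta> + s). rep (P c) b * rep (A b) c)" if c: "c \<in> Bl \<eta>" for c
  proof -
    have cB: "c \<in> Bs" using c by (simp add: Bl_def)
    note ex = rep_expand[OF P(2)[OF Bs(3)[OF cB]]]
    let ?C = "{b. rep (P c) b \<noteq> 0}"
    have CN: "b \<in> mcarr N" if "b \<in> ?C" for b using that ex Bs(3) by blast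
    have lin: "linear_on (mcarr N) (\<lambda>m. rep (A m) c)" by (rule linear_on_compose[OF A(1) _ rep_linear]) (use A in auto)
    have "rep (A (P c)) c = rep (A (\<Sum>b\<in>?C. rep (P c) b *\<^sub>C b)) c" using ex by simp
    also have "\<dots> = (\<Sum>b\<in>?C. rep (A (rep (P c) b *\<^sub>C b)) c)" by (rule linear_on_sum[OF lin carr]) (use CN in auto)
    also have "\<dots> = (\<Sum>b\<in>?C. rep (P c) b * rep (A b) c)"
      using linear_on_scale[OF lin] CN by (intro sum.cong) auto
    also have "\<dots> = (\<Sum>b\<in>Bl (\<eta> + s). rep (P c) b * rep (A b) c)"
      using ex nz[OF cB] c finite_Bl[OF es] by (intro sum.mono_neutral_left) auto
    finally show ?thesis .
  qed
  have "tt (\<lambda>m. P (A m)) (\<eta> + s) = (\<Sum>b\<in>Bl (\<eta> + s). \<Sum>c\<in>Bl \<eta>. rep (A b) c * rep (P c) b)"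
    using A' es by (simp add: tt_eq)
  also have "\<dots> = (\<Sum>c\<in>Bl \<eta>. \<Sum>b\<in>Bl (\<eta> + s). rep (P c) b * rep (A b) c)"
    by (subst sum.swap) (simp add: mult.commute)
  also have "\<dots> = tt (\<lambda>m. A (P m)) \<eta>" using P' True by (simp add: tt_eq)
  finally show ?thesis .
qed

end

section \<open>The contravariant form\<close>

context verma
begin

abbreviation "vs \<equiv> dual_vacuum K N \<kappa> v"
abbreviation "GD \<equiv> mcarr (graded_dual K N)"

lemma GD_iff: "\<psi> \<in> GD \<longleftrightarrow> linear_from (mcarr N) \<psi> \<and> finite {\<gamma>\<in>\<hh>. \<exists>w\<in>weight_space K N \<gamma>. \<psi> w \<noteq> 0}"
  by (simp add: graded_dual_def dual_space_def)

lemma linear_from_eqI: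
  assumes "linear_from (mcarr N) \<psi>" "linear_from (mcarr N) \<psi>'" "\<And>is. \<psi> (fw is) = \<psi>' (fw is)"
  shows "\<psi> = \<psi>'"
proof
  fix m show "\<psi> m = \<psi>' m"
    using fw_eq[OF linear_fromD(1)[OF assms(1)] linear_fromD(1)[OF assms(2)] assms(3)]
      linear_fromD(2)[OF assms(1)] linear_fromD(2)[OF assms(2)] by (cases "m \<in> mcarr N") auto
qed

text \<open>Freeness applied to the complex numbers with n_- acting by zero gives the projection to
  the highest weight line. Uniqueness: a functional of weight -\<kappa> vanishes on every monomial
  of positive length, since \<open>dd\<close> has a different eigenvalue there.\<close>

lemma vs: "linear_from (mcarr N) vs" "vs v = 1" "vs (fw is) = (if is = [] then 1 else 0)"
proof -
  have "\<exists>\<theta>. linear_from (mcarr N) \<theta> \<and> \<theta> ` mcarr N \<subseteq> UNIV \<and> \<theta> v = (1 :: complex) \<and>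
    (\<forall>x\<in>nm. \<forall>m\<in>mcarr N. \<theta> (mact N x m) = (\<lambda>_ _. 0) x (\<theta> m))"
    by (rule free_map_exists) (auto simp: linear_on_def)
  then obtain \<theta> :: "'m \<Rightarrow> complex" where lin: "linear_from (mcarr N) \<theta>" and \<theta>: "\<theta> v = 1"
    "\<And>x m. x \<in> nm \<Longrightarrow> m \<in> mcarr N \<Longrightarrow> \<theta> (mact N x m) = 0" by blast
  note lo = linear_fromD(1)[OF lin]
  have fw: "\<theta> (fw is) = (if is = [] then 1 else 0)" for "is"
    using \<theta> f_nm by (cases "is") (auto simp: fw_Cons)
  have act: "\<theta> (mact N h m) = fm \<kappa> h * \<theta> m" if h: "h \<in> \<hh>" and m: "m \<in> mcarr N" for h m
  proof (rule fw_eq[OF _ _ _ m, where g = "\<lambda>m. \<theta> (mact N h m)"])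
    show "linear_on (mcarr N) (\<lambda>m. \<theta> (mact N h m))" by (rule linear_on_compose[OF act_linear _ lo]) auto
    show "linear_on (mcarr N) (\<lambda>m. fm \<kappa> h * \<theta> m)" using lo by (auto simp: linear_on_def algebra_simps)
    show "\<theta> (mact N h (fw is)) = fm \<kappa> h * \<theta> (fw is)" for "is"
      using weight_spaceD(2)[OF fw_weight h, of "is"] linear_on_scale[OF lo fw_carr]
      by (cases "is") (auto simp: fw wt_def \<theta> linear_on_scale[OF lo v_carr])
  qed
  have gr: "{\<gamma>\<in>\<hh>. \<exists>w\<in>weight_space K N \<gamma>. \<theta> w \<noteq> 0} \<subseteq> {\<kappa>}"
  proof (clarify, rule csa_eqI)
    fix \<gamma> w h assume *: "w \<in> weight_space K N \<gamma>" "\<theta> w \<noteq> 0" "h \<in> \<hh>"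
    then have "\<theta> (fm \<gamma> h *\<^sub>C w) = fm \<kappa> h * \<theta> w" using act weight_spaceD by metis
    then show "fm \<gamma> h = fm \<kappa> h" using * linear_on_scale[OF lo] weight_spaceD(1) by force
  qed (use \<kappa> in auto)
  have mem: "\<theta> \<in> weight_space K (graded_dual K N) (- \<kappa>)"
  proof -
    have "\<theta> \<in> GD" using lin finite_subset[OF gr] by (simp add: GD_iff)
    moreover have "mact (graded_dual K N) h \<theta> = fm (- \<kappa>) h *\<^sub>C \<theta>" if "h \<in> \<hh>" for h
      using act[OF that] linear_fromD(2)[OF lin] by (auto simp: graded_dual_def precomp_def fun_eq_iff fm_simps)
    ultimately show ?thesis by (simp add: weight_space_def)
  qed
  have uniq: "\<psi> = \<theta>" if p: "\<psi> \<in> weight_space K (graded_dual K N) (- \<kappa>)" "\<psi> v = 1" for \<psi>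
  proof (rule linear_from_eqI[OF _ lin])
    show pl: "linear_from (mcarr N) \<psi>" using p by (simp add: weight_space_def GD_iff)
    fix "is"
    have "mact (graded_dual K N) dd \<psi> = fm (- \<kappa>) dd *\<^sub>C \<psi>" using p(1) dd(3) by (simp add: weight_space_def)
    from fun_cong[OF this, of "fw is"] have "\<psi> (mact N dd (fw is)) = fm \<kappa> dd * \<psi> (fw is)"
      by (simp add: graded_dual_def precomp_def fm_simps)
    moreover have "mact N dd (fw is) = (fm \<kappa> dd - of_nat (length is)) *\<^sub>C fw is"
      using weight_spaceD(2)[OF fw_weight dd(3), of "is"] fm_dd_Q[OF wt_Q, of "is"] fm_sym[of dd]
      by (simp add: fm_simps ht_wt)
    ultimately have "(fm \<kappa> dd - of_nat (length is)) * \<psi> (fw is) = fm \<kappa> dd * \<psi> (fw is)"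
      using linear_on_scale[OF linear_fromD(1)[OF pl] fw_carr] by simp
    then have "of_nat (length is) * \<psi> (fw is) = 0" by (simp add: left_diff_distrib)
    then have "is = [] \<or> \<psi> (fw is) = 0" by simp
    then consider "is = []" | "is \<noteq> []" "\<psi> (fw is) = 0" by blast
    then show "\<psi> (fw is) = \<theta> (fw is)"
    proof cases
      case 1
      then show ?thesis using p(2) \<theta>(1) by simp
    next
      case 2
      then show ?thesis using fw[of "is"] by simp
    qed
  qed
  have "vs = \<theta>"
    unfolding dual_vacuum_def
  proof (rule the_equality)
    show "\<theta> \<in> weight_space K (graded_dual K N) (- \<kappa>) \<and> \<theta> v = 1" using mem \<theta>(1) by blast
  qed (use uniq in blast)
  then show "linear_from (mcarr N) vs" "vs v = 1" "vs (fw is) = (if is = [] then 1 else 0)"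
    using lin \<theta> fw by auto
qed

text \<open>The full dual with \<gg> acting through the involution: \<open>vs\<close> becomes a
  highest weight vector of weight \<kappa>, so M_\<kappa> maps to it.\<close>

definition Ndual :: "('g, 'm \<Rightarrow> complex) gmod" where
  "Ndual = \<lparr>mcarr = dual_space (mcarr N), mact = (\<lambda>x \<psi>. - precomp (mcarr N) (mact N (\<omega> x)) \<psi>)\<rparr>"

lemma Ndual_act: "mact Ndual x \<psi> m = (if m \<in> mcarr N then - \<psi> (mact N (\<omega> x) m) else 0)"
  by (simp add: Ndual_def precomp_def)

lemma Ndual_carr: "\<psi> \<in> mcarr Ndual \<longleftrightarrow> linear_from (mcarr N) \<psi>"
  by (simp add: Ndual_def dual_space_def)

lemma Ndual_module: "g_module K Ndual"
  unfolding g_module_def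
proof (intro conjI allI ballI)
  show "cvec.subspace (mcarr Ndual)"
    by (auto simp: cvec.subspace_def Ndual_carr linear_from_def linear_on_def algebra_simps)
  show "linear_on (mcarr Ndual) (mact Ndual x)" for x
    by (auto simp: linear_on_def fun_eq_iff Ndual_act)
  show "mact Ndual x ` mcarr Ndual \<subseteq> mcarr Ndual" for x
    by (auto simp: Ndual_carr linear_from_def linear_on_def Ndual_act act_simps)
  fix \<psi> assume "\<psi> \<in> mcarr Ndual"
  then have lin: "linear_on (mcarr N) \<psi>" by (simp add: Ndual_carr linear_from_def)
  show "linear_on UNIV (\<lambda>x. mact Ndual x \<psi>)"
    using lin by (auto simp: linear_on_def fun_eq_iff Ndual_act \<omega>_simps act_left_simps)
  show "mact Ndual (br x y) \<psi> = mact Ndual x (mact Ndual y \<psi>) - mact Ndual y (mact Ndual x \<psi>)" for x y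
    by (auto simp: fun_eq_iff Ndual_act \<omega>_simps act_br linear_on_diff[OF lin carr])
qed

text \<open>The contravariant (Shapovalov) form, encoded as the homomorphism from M_\<kappa> to its
  twisted dual that sends the highest weight vector to \<open>vs\<close>.\<close>

definition S :: "'m \<Rightarrow> 'm \<Rightarrow> complex" where
  "S = (SOME \<theta>. linear_from (mcarr N) \<theta> \<and> \<theta> ` mcarr N \<subseteq> mcarr Ndual \<and> \<theta> v = vs \<and>
    (\<forall>x. \<forall>m\<in>mcarr N. \<theta> (mact N x m) = mact Ndual x (\<theta> m)))"

lemma S: "linear_from (mcarr N) S" "m \<in> mcarr N \<Longrightarrow> linear_from (mcarr N) (S m)" "S v = vs"
  "m \<in> mcarr N \<Longrightarrow> m' \<in> mcarr N \<Longrightarrow> S (mact N x m) m' = - S m (mact N (\<omega> x) m')"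
proof -
  have "\<exists>\<theta>. linear_from (mcarr N) \<theta> \<and> \<theta> ` mcarr N \<subseteq> mcarr Ndual \<and> \<theta> v = vs \<and>
    (\<forall>x. \<forall>m\<in>mcarr N. \<theta> (mact N x m) = mact Ndual x (\<theta> m))"
  proof (rule hom_exists[OF Ndual_module])
    note lo = linear_fromD(1)[OF vs(1)]
    show "vs \<in> mcarr Ndual" using vs by (simp add: Ndual_carr)
    have fv: "vs (mact N (f i) m) = 0" if m: "m \<in> mcarr N" for i m
    proof (rule fw_eq[OF _ _ _ m, where g' = "\<lambda>_. 0"])
      show "linear_on (mcarr N) (\<lambda>m. vs (mact N (f i) m))" by (rule linear_on_compose[OF act_linear _ lo]) auto
      show "vs (mact N (f i) (fw is)) = 0" for "is" using vs(3)[of "i # is"] by (simp add: fw_Cons)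
    qed (simp add: linear_on_def)
    then show "mact Ndual (e i) vs = 0" for i
      by (auto simp: fun_eq_iff Ndual_act \<omega>_simps act_left_simps linear_on_minus[OF lo])
    show "mact Ndual h vs = fm \<kappa> h *\<^sub>C vs" if h: "h \<in> \<hh>" for h
    proof (rule linear_from_eqI)
      show "linear_from (mcarr N) (mact Ndual h vs)"
        using Ndual_module vs(1) unfolding g_module_def Ndual_carr[symmetric] by blast
      show "linear_from (mcarr N) (fm \<kappa> h *\<^sub>C vs)"
        using vs(1) by (auto simp: linear_from_def linear_on_def algebra_simps)
      fix "is"
      have "mact Ndual h vs (fw is) = vs (mact N h (fw is))"
        by (simp add: Ndual_act \<omega>_simps h act_left_simps linear_on_minus[OF lo])
      also have "\<dots> = fm (\<kappa> - wt is) h * vs (fw is)"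
        using weight_spaceD(2)[OF fw_weight h, of "is"] linear_on_scale[OF lo fw_carr] by simp
      also have "\<dots> = fm \<kappa> h * vs (fw is)" using vs(3)[of "is"] by (cases "is") (auto simp: wt_def)
      finally show "mact Ndual h vs (fw is) = (fm \<kappa> h *\<^sub>C vs) (fw is)" by simp
    qed
  qed
  from someI_ex[OF this] have *: "linear_from (mcarr N) S" "S ` mcarr N \<subseteq> mcarr Ndual" "S v = vs"
    "\<forall>x. \<forall>m\<in>mcarr N. S (mact N x m) = mact Ndual x (S m)" by (auto simp: S_def)
  then show "linear_from (mcarr N) S" "S v = vs" by auto
  show "m \<in> mcarr N \<Longrightarrow> linear_from (mcarr N) (S m)" using *(2) Ndual_carr by blast
  show "m \<in> mcarr N \<Longrightarrow> m' \<in> mcarr N \<Longrightarrow> S (mact N x m) m' = - S m (mact N (\<omega> x) m')"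
    using *(4) by (simp add: Ndual_act)
qed

lemma S_linear: "m \<in> mcarr N \<Longrightarrow> linear_on (mcarr N) (S m)"
  using S(2) by (simp add: linear_from_def)

lemma S_simps:
  "m \<in> mcarr N \<Longrightarrow> m' \<in> mcarr N \<Longrightarrow> S (m + m') w = S m w + S m' w" "m \<in> mcarr N \<Longrightarrow> S (c *\<^sub>C m) w = c * S m w"
  using linear_on_add[OF linear_fromD(1)[OF S(1)]] linear_on_scale[OF linear_fromD(1)[OF S(1)]] by auto

lemma S_sum: "(\<And>i. i \<in> A \<Longrightarrow> g i \<in> mcarr N) \<Longrightarrow> S (\<Sum>i\<in>A. g i) w = (\<Sum>i\<in>A. S (g i) w)"
  using linear_on_sum[OF linear_fromD(1)[OF S(1)] carr, of A g] by (simp add: sum_fun_apply)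

lemma S_v: assumes "m \<in> mcarr N" shows "S m v = vs m"
proof (rule fw_eq[OF _ linear_fromD(1)[OF vs(1)] _ assms])
  show "linear_on (mcarr N) (\<lambda>m. S m v)" by (auto simp: linear_on_def S_simps)
  show "S (fw is) v = vs (fw is)" for "is"
  proof (cases "is")
    case (Cons i js)
    have "mact N (\<omega> (f i)) v = 0" using v_np[OF e_np] by (simp add: \<omega>_simps act_left_simps)
    then show ?thesis
      using S(4)[of "fw js" v "f i"] vs(3)[of "is"] linear_on_0[OF S_linear carr] by (simp add: Cons fw_Cons)
  qed (simp add: S(3))
qed

lemma GD_subspace: "cvec.subspace GD"
  unfolding cvec.subspace_def
proof (intro conjI ballI allI)
  fix \<psi> \<psi>' assume *: "\<psi> \<in> GD" "\<psi>' \<in> GD"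
  let ?A = "\<lambda>\<psi>. {\<gamma>\<in>\<hh>. \<exists>w\<in>weight_space K N \<gamma>. \<psi> w \<noteq> 0}"
  have "?A (\<psi> + \<psi>') \<subseteq> ?A \<psi> \<union> ?A \<psi>'" by auto
  then have "finite (?A (\<psi> + \<psi>'))" by (rule finite_subset) (use * in \<open>simp add: GD_iff\<close>)
  then show "\<psi> + \<psi>' \<in> GD" using * by (auto simp: GD_iff linear_from_def linear_on_def algebra_simps)
next
  fix c \<psi> assume *: "\<psi> \<in> GD"
  then have "finite {\<gamma>\<in>\<hh>. \<exists>w\<in>weight_space K N \<gamma>. (c *\<^sub>C \<psi>) w \<noteq> 0}"
    by (rule_tac rev_finite_subset[of "{\<gamma>\<in>\<hh>. \<exists>w\<in>weight_space K N \<gamma>. \<psi> w \<noteq> 0}"]) (auto simp: GD_iff)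
  then show "c *\<^sub>C \<psi> \<in> GD" using * by (auto simp: GD_iff linear_from_def linear_on_def algebra_simps)
qed (simp add: GD_iff linear_from_def linear_on_def)

lemma S_weight:
  assumes m: "m \<in> weight_space K N \<gamma>" and w: "w \<in> weight_space K N \<delta>" and "S m w \<noteq> 0" "\<gamma> \<in> \<hh>" "\<delta> \<in> \<hh>"
  shows "\<gamma> = \<delta>"
proof (rule csa_eqI)
  fix h assume h: "h \<in> \<hh>"
  have mw: "m \<in> mcarr N" "w \<in> mcarr N" using weight_spaceD(1) m w by auto
  have "fm \<gamma> h * S m w = S (mact N h m) w" using weight_spaceD(2)[OF m h] mw by (simp add: S_simps)
  also have "\<dots> = fm \<delta> h * S m w"
    using S(4)[OF mw] weight_spaceD(2)[OF w h] mw linear_on_scale[OF S_linear] linear_on_minus[OF S_linear]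
    by (simp add: \<omega>_simps h act_left_simps)
  finally show "fm \<gamma> h = fm \<delta> h" using assms(3) by simp
qed (use assms in auto)

lemma S_GD: "m \<in> mcarr N \<Longrightarrow> S m \<in> GD"
proof -
  assume m: "m \<in> mcarr N"
  have "m \<in> {m \<in> mcarr N. S m \<in> GD}"
  proof (rule fw_induct[OF m])
    show "cvec.subspace {m \<in> mcarr N. S m \<in> GD}"
      unfolding cvec.subspace_def using linear_on_add[OF linear_fromD(1)[OF S(1)]] linear_on_scale[OF linear_fromD(1)[OF S(1)]]
        linear_on_0[OF linear_fromD(1)[OF S(1)] carr] GD_subspace
      by (auto simp: cvec.subspace_add cvec.subspace_scale cvec.subspace_0)
    fix "is"
    have k: "\<kappa> - wt is \<in> \<hh>" using \<kappa> wt_csa csa_subspace by (simp add: cvec.subspace_diff)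
    have "{\<gamma>\<in>\<hh>. \<exists>w\<in>weight_space K N \<gamma>. S (fw is) w \<noteq> 0} \<subseteq> {\<kappa> - wt is}"
      using S_weight[OF fw_weight _ _ k] by blast
    from finite_subset[OF this] have "S (fw is) \<in> GD" using S(2)[OF fw_carr] unfolding GD_iff by blast
    then show "fw is \<in> {m \<in> mcarr N. S m \<in> GD}" by simp
  qed
  then show ?thesis by simp
qed

end

section \<open>Boundedness of weights in category O\<close>

lemma (in bd_setting) category_O_bound:
  assumes "category_O K V" "\<gamma> \<in> \<hh>"
  shows "\<exists>n. \<forall>\<beta>\<in>Q. ht \<beta> > n \<longrightarrow> weight_space K V (\<gamma> + \<beta>) \<subseteq> {0}"
proof -
  obtain S where S: "finite S" "\<forall>\<kappa>\<in>\<hh>. weight_space K V \<kappa> \<noteq> {0} \<longrightarrow> (\<exists>s\<in>S. s - \<kappa> \<in> Q)"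
    using assms(1) unfolding category_O_def by blast
  \<comment> \<open>The sum over \<open>S\<close> is used as an upper bound for each of its terms.
    Where s - \<gamma> is outside \<open>Q\<close> the height has a default value, which can only
    enlarge the bound.\<close>
  have "weight_space K V (\<gamma> + \<beta>) \<subseteq> {0}" if b: "\<beta> \<in> Q" "ht \<beta> > (\<Sum>s\<in>S. ht (s - \<gamma>))" for \<beta>
  proof (rule ccontr)
    assume "\<not> weight_space K V (\<gamma> + \<beta>) \<subseteq> {0}"
    moreover have "\<gamma> + \<beta> \<in> \<hh>" using assms(2) Q_csa[OF b(1)] csa_subspace by (simp add: cvec.subspace_add)
    ultimately obtain s where s: "s \<in> S" "s - (\<gamma> + \<beta>) \<in> Q" using S(2) by blast
    then have "ht (s - \<gamma>) = ht (s - (\<gamma> + \<beta>)) + ht \<beta>" using ht_add[OF s(2) b(1)] by simp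
    moreover have "ht (s - \<gamma>) \<le> (\<Sum>s\<in>S. ht (s - \<gamma>))" using S(1) s(1) by (intro member_le_sum) auto
    ultimately show False using b(2) by simp
  qed
  then show ?thesis by blast
qed

lemma (in bd_setting) E_eventually_0_O:
  assumes V: "category_O K V" and w: "w \<in> mcarr V"
  shows "\<exists>n. \<forall>a\<in>R. ht (fst a) > n \<longrightarrow> mact V (E a) w = 0"
proof -
  interpret V: gmodule K V using V by unfold_locales (simp add: category_O_def)
  let ?W = "{w \<in> mcarr V. \<exists>n. \<forall>a\<in>R. ht (fst a) > n \<longrightarrow> mact V (E a) w = 0}"
  have "cvec.subspace ?W"
    unfolding cvec.subspace_def
  proof (intro conjI ballI allI; clarify)
    fix x y k l assume x: "x \<in> mcarr V" "y \<in> mcarr V" "\<forall>a\<in>R. ht (fst a) > k \<longrightarrow> mact V (E a) x = 0"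
      "\<forall>a\<in>R. ht (fst a) > l \<longrightarrow> mact V (E a) y = 0"
    then have "\<forall>a\<in>R. ht (fst a) > max k l \<longrightarrow> mact V (E a) (x + y) = 0" by (simp add: V.act_simps)
    with x show "x + y \<in> mcarr V \<and> (\<exists>n. \<forall>a\<in>R. ht (fst a) > n \<longrightarrow> mact V (E a) (x + y) = 0)"
      by (intro conjI exI[of _ "max k l"]) simp_all
  next
    fix c x k assume "x \<in> mcarr V" "\<forall>a\<in>R. ht (fst a) > k \<longrightarrow> mact V (E a) x = 0"
    then show "c *\<^sub>C x \<in> mcarr V \<and> (\<exists>n. \<forall>a\<in>R. ht (fst a) > n \<longrightarrow> mact V (E a) (c *\<^sub>C x) = 0)"
      by (auto simp: V.act_simps)
  qed (simp add: V.act_simps)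
  moreover have "(\<Union>\<kappa>\<in>\<hh>. weight_space K V \<kappa>) \<subseteq> ?W"
  proof clarify
    fix \<gamma> w assume g: "\<gamma> \<in> \<hh>" "w \<in> weight_space K V \<gamma>"
    obtain n where n: "\<forall>\<beta>\<in>Q. ht \<beta> > n \<longrightarrow> weight_space K V (\<gamma> + \<beta>) \<subseteq> {0}" using category_O_bound[OF V g(1)] by blast
    have "mact V (E a) w = 0" if "a \<in> R" "ht (fst a) > n" for a
      using act_weight[OF V.gm g(2) rootD(6)[OF that(1)]] n rootD(3)[OF that(1)] that(2) by blast
    then show "w \<in> mcarr V \<and> (\<exists>n. \<forall>a\<in>R. ht (fst a) > n \<longrightarrow> mact V (E a) w = 0)" using weight_spaceD(1)[OF g(2)] by blast
  qed
  moreover have "mcarr V = cvec.span (\<Union>\<kappa>\<in>\<hh>. weight_space K V \<kappa>)" using V unfolding category_O_def by blast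
  ultimately have "mcarr V \<subseteq> ?W" using cvec.span_minimal[of "\<Union>\<kappa>\<in>\<hh>. weight_space K V \<kappa>" ?W] by simp
  then show ?thesis using w by blast
qed

section \<open>Intertwining operators\<close>

locale tensor_module = Nm: gmodule K N + Vm: gmodule K V
  for K :: "('n::finite, 'g::complex_vector) km_algebra" and N :: "('g, 'm::complex_vector) gmod"
    and V :: "('g, 'v::complex_vector) gmod"
begin

abbreviation "V' \<equiv> dual_space (mcarr V)"
abbreviation "pc x \<phi> \<equiv> precomp (mcarr V) (mact V x) \<phi>"

lemma V'_simps: "\<phi> \<in> V' \<Longrightarrow> \<phi>' \<in> V' \<Longrightarrow> \<phi> + \<phi>' \<in> V'" "\<phi> \<in> V' \<Longrightarrow> c *\<^sub>C \<phi> \<in> V'" "0 \<in> V'" "\<phi> \<in> V' \<Longrightarrow> pc x \<phi> \<in> V'"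
  using precomp_dual_space[OF Vm.gm] by (auto simp: dual_space_def linear_from_def linear_on_def algebra_simps)

lemma pc_br: assumes "\<phi> \<in> V'" shows "pc (bracket K x y) \<phi> = pc y (pc x \<phi>) - pc x (pc y \<phi>)"
proof -
  have "linear_on (mcarr V) \<phi>" using assms by (simp add: dual_space_def linear_from_def)
  then show ?thesis by (auto simp: precomp_def fun_eq_iff Vm.act_br linear_on_diff[OF _ Vm.carr])
qed

lemma pc_linear:
  assumes "\<phi> \<in> V'" shows "pc (x + y) \<phi> = pc x \<phi> + pc y \<phi>" "pc (c *\<^sub>C x) \<phi> = c *\<^sub>C pc x \<phi>"
proof -
  have "linear_on (mcarr V) \<phi>" using assms by (simp add: dual_space_def linear_from_def)
  then show "pc (x + y) \<phi> = pc x \<phi> + pc y \<phi>" "pc (c *\<^sub>C x) \<phi> = c *\<^sub>C pc x \<phi>"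
    by (auto simp: precomp_def fun_eq_iff Vm.act_left_simps linear_on_add linear_on_scale)
qed

lemma pc_linear_right: "pc x (\<phi> + \<phi>') = pc x \<phi> + pc x \<phi>'" "pc x (c *\<^sub>C \<phi>) = c *\<^sub>C pc x \<phi>"
  by (auto simp: precomp_def fun_eq_iff)

lemma mv_subspace: "cvec.subspace (mv_tensor N V)"
  unfolding mv_tensor_def by (rule cvec.subspace_span)

lemma mv_induct:
  assumes t: "t \<in> mv_tensor N V" and W: "cvec.subspace W"
    and "\<And>m w. m \<in> mcarr N \<Longrightarrow> w \<in> mcarr V \<Longrightarrow> mv_pure V m w \<in> W"
  shows "t \<in> W"
proof -
  have "mv_tensor N V \<subseteq> W" unfolding mv_tensor_def by (rule cvec.span_minimal[OF _ W]) (use assms(3) in blast)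
  with t show ?thesis by blast
qed

lemma mv_facts:
  assumes "t \<in> mv_tensor N V"
  shows "t \<phi> \<in> mcarr N" "\<phi> \<notin> V' \<Longrightarrow> t \<phi> = 0"
    "\<phi> \<in> V' \<Longrightarrow> \<phi>' \<in> V' \<Longrightarrow> t (\<phi> + \<phi>') = t \<phi> + t \<phi>'" "\<phi> \<in> V' \<Longrightarrow> t (c *\<^sub>C \<phi>) = c *\<^sub>C t \<phi>"
proof -
  let ?W = "{t. (\<forall>\<phi>. t \<phi> \<in> mcarr N) \<and> (\<forall>\<phi>. \<phi> \<notin> V' \<longrightarrow> t \<phi> = 0) \<and>
    (\<forall>\<phi>\<in>V'. \<forall>\<phi>'\<in>V'. t (\<phi> + \<phi>') = t \<phi> + t \<phi>') \<and> (\<forall>\<phi>\<in>V'. \<forall>c. t (c *\<^sub>C \<phi>) = c *\<^sub>C t \<phi>)}"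
  have "t \<in> ?W"
    by (rule mv_induct[OF assms])
      (auto simp: cvec.subspace_def cvec.scale_right_distrib mv_pure_def V'_simps cvec.scale_left_distrib mult.commute)
  then show "t \<phi> \<in> mcarr N" "\<phi> \<notin> V' \<Longrightarrow> t \<phi> = 0"
    "\<phi> \<in> V' \<Longrightarrow> \<phi>' \<in> V' \<Longrightarrow> t (\<phi> + \<phi>') = t \<phi> + t \<phi>'" "\<phi> \<in> V' \<Longrightarrow> t (c *\<^sub>C \<phi>) = c *\<^sub>C t \<phi>" by auto
qed

text \<open>An element of M \<otimes> V is a finite sum of pure tensors, so one finite set serves
  all functionals. This uniformity is what later yields cut-offs independent of the
  functional.\<close>

lemma mv_finite_range: assumes "t \<in> mv_tensor N V" shows "\<exists>M\<subseteq>mcarr N. finite M \<and> (\<forall>\<phi>. t \<phi> \<in> cvec.span M)"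
proof -
  let ?W = "{t :: ('v \<Rightarrow> complex) \<Rightarrow> 'm. \<exists>M\<subseteq>mcarr N. finite M \<and> (\<forall>\<phi>. t \<phi> \<in> cvec.span M)}"
  have "t \<in> ?W"
  proof (rule mv_induct[OF assms])
    show "cvec.subspace ?W"
      unfolding cvec.subspace_def
    proof (intro conjI ballI allI; clarify)
      show "\<exists>M\<subseteq>mcarr N. finite M \<and> (\<forall>\<phi>. 0 \<phi> \<in> cvec.span M)" by (intro exI[of _ "{}"]) simp
    next
      fix s t :: "('v \<Rightarrow> complex) \<Rightarrow> 'm" and M M' assume "M \<subseteq> mcarr N" "M' \<subseteq> mcarr N" "finite M" "finite M'"
        "\<forall>\<phi>. s \<phi> \<in> cvec.span M" "\<forall>\<phi>. t \<phi> \<in> cvec.span M'"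
      then show "\<exists>M\<subseteq>mcarr N. finite M \<and> (\<forall>\<phi>. (s + t) \<phi> \<in> cvec.span M)"
        by (intro exI[of _ "M \<union> M'"]) (auto intro!: cvec.span_add intro: subsetD[OF cvec.span_mono, rotated])
    next
      fix c and t :: "('v \<Rightarrow> complex) \<Rightarrow> 'm" and M assume "M \<subseteq> mcarr N" "finite M" "\<forall>\<phi>. t \<phi> \<in> cvec.span M"
      then show "\<exists>M\<subseteq>mcarr N. finite M \<and> (\<forall>\<phi>. (c *\<^sub>C t) \<phi> \<in> cvec.span M)"
        by (intro exI[of _ M]) (auto intro: cvec.span_scale)
    qed
    show "mv_pure V m w \<in> ?W" if "m \<in> mcarr N" for m w
      using that by (intro CollectI exI[of _ "{m}"]) (auto simp: mv_pure_def cvec.span_zero intro: cvec.span_scale cvec.span_base)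
  qed
  then show ?thesis by simp
qed

lemma mv_act_linear: "linear_on (mv_tensor N V) (mv_act N V x)"
  unfolding linear_on_def
  using mv_facts(1) by (auto simp: fun_eq_iff mv_act_def Nm.act_simps cvec.scale_right_distrib)

lemma mv_module: "g_module K \<lparr>mcarr = mv_tensor N V, mact = mv_act N V\<rparr>"
  unfolding g_module_def gmod.simps
proof (intro conjI allI ballI)
  show "cvec.subspace (mv_tensor N V)" by (rule mv_subspace)
  show "linear_on (mv_tensor N V) (mv_act N V x)" for x by (rule mv_act_linear)
  show "mv_act N V x ` mv_tensor N V \<subseteq> mv_tensor N V" for x
  proof clarify
    fix t assume "t \<in> mv_tensor N V"
    then show "mv_act N V x t \<in> mv_tensor N V"
      using mv_act_linear mv_subspace unfolding mv_tensor_def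
    proof (rule linear_on_span_mem[rotated -1])
      fix s assume "s \<in> {mv_pure V m w |m w. m \<in> mcarr N \<and> w \<in> mcarr V}"
      then obtain m w where *: "s = mv_pure V m w" "m \<in> mcarr N" "w \<in> mcarr V" by blast
      then have "mv_act N V x s = mv_pure V (mact N x m) w + mv_pure V m (mact V x w)"
        using mv_act_pure[OF Vm.gm Nm.gm] by simp
      then show "mv_act N V x s \<in> cvec.span {mv_pure V m w |m w. m \<in> mcarr N \<and> w \<in> mcarr V}"
        using * by (simp only:) (intro cvec.span_add cvec.span_base; blast intro: Nm.act_carr Vm.act_carr)
    qed
  qed
  fix t assume t: "t \<in> mv_tensor N V"
  note tf = mv_facts[OF t]
  have td: "t (\<phi> - \<phi>') = t \<phi> - t \<phi>'" if "\<phi> \<in> V'" "\<phi>' \<in> V'" for \<phi> \<phi>'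
    using tf(3)[OF that(1) V'_simps(2)[OF that(2), of "-1"]] tf(4)[OF that(2), of "-1"] by simp
  show "linear_on UNIV (\<lambda>x. mv_act N V x t)"
    using tf by (auto simp: linear_on_def fun_eq_iff mv_act_def Nm.act_left_simps pc_linear V'_simps algebra_simps)
  show "mv_act N V (bracket K x y) t = mv_act N V x (mv_act N V y t) - mv_act N V y (mv_act N V x t)" for x y
    using tf by (auto simp: fun_eq_iff mv_act_def Nm.act_br pc_br td V'_simps Nm.act_simps algebra_simps)
qed

end

section \<open>Irreducibility makes the contravariant form invertible\<close>

locale verma_irr = verma K \<tau> D \<rho> \<kappa> N v
  for K :: "('n::finite, 'g::complex_vector) km_algebra" and \<tau> D \<rho> \<kappa> and N :: "('g, 'm::complex_vector) gmod" and v +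
  assumes irr: "irreducible_module (graded_dual K N)"
begin

lemma irrD: "W \<subseteq> GD \<Longrightarrow> cvec.subspace W \<Longrightarrow> (\<And>x \<psi>. \<psi> \<in> W \<Longrightarrow> mact (graded_dual K N) x \<psi> \<in> W) \<Longrightarrow> W \<noteq> {0} \<Longrightarrow> W = GD"
  using irr unfolding irreducible_module_def by blast

lemma graded_dual_act_S: assumes m: "m \<in> mcarr N" shows "mact (graded_dual K N) x (S m) = S (mact N (\<omega> x) m)"
proof
  fix m'
  show "mact (graded_dual K N) x (S m) m' = S (mact N (\<omega> x) m) m'"
    using S(4)[OF m, of m' "\<omega> x"] linear_fromD(2)[OF S(2)[OF act_carr[OF m]]]
    by (cases "m' \<in> mcarr N") (auto simp: graded_dual_def precomp_def \<omega>_simps)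
qed

lemma vs_nonzero: "vs \<noteq> 0"
proof
  assume "vs = 0"
  then show False using vs(2) by simp
qed

text \<open>x acts on \<open>S m\<close> as \<open>S\<close> of the involuted action on m, so the
  image is a submodule of the graded dual, and it contains \<open>vs\<close>.\<close>

lemma S_surj: "S ` mcarr N = GD"
proof (rule irrD)
  show "S ` mcarr N \<subseteq> GD" using S_GD by blast
  note lo = linear_fromD(1)[OF S(1)]
  show "cvec.subspace (S ` mcarr N)"
    unfolding cvec.subspace_def
  proof (intro conjI ballI allI)
    show "0 \<in> S ` mcarr N" using linear_on_0[OF lo carr] by (intro image_eqI[of _ _ 0]) auto
    show "x + y \<in> S ` mcarr N" if "x \<in> S ` mcarr N" "y \<in> S ` mcarr N" for x y
      using that by (auto simp: linear_on_add[OF lo, symmetric])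
    show "c *\<^sub>C x \<in> S ` mcarr N" if "x \<in> S ` mcarr N" for c x
      using that by (auto simp: linear_on_scale[OF lo, symmetric])
  qed
  show "mact (graded_dual K N) x \<psi> \<in> S ` mcarr N" if "\<psi> \<in> S ` mcarr N" for x \<psi>
    using that by (auto simp: graded_dual_act_S)
  have "vs \<in> S ` mcarr N" using S(3) v_carr by (metis imageI)
  then show "S ` mcarr N \<noteq> {0}" using vs_nonzero by blast
qed

definition coord :: "'m \<Rightarrow> 'm \<Rightarrow> complex" where "coord b m = (if m \<in> mcarr N then rep m b else 0)"

lemma coord_GD: assumes "b \<in> Bs" shows "coord b \<in> GD"
proof -
  obtain \<gamma> where g: "\<gamma> \<in> \<hh>" "b \<in> weight_space K N \<gamma>" using Bs_weight[OF assms] by blast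
  have "{\<delta>\<in>\<hh>. \<exists>w\<in>weight_space K N \<delta>. coord b w \<noteq> 0} \<subseteq> {\<gamma>}"
  proof (clarify, rule csa_eqI)
    fix \<delta> w h assume *: "w \<in> weight_space K N \<delta>" "coord b w \<noteq> 0" "h \<in> \<hh>"
    note w = weight_spaceD[OF *(1)]
    have "fm \<delta> h * rep w b = fm \<gamma> h * rep w b"
      using rep_act[OF assms weight_spaceD(2)[OF g(2) *(3)] *(3) w(1)] w(2)[OF *(3)] linear_on_scale[OF rep_linear w(1)] by simp
    then show "fm \<delta> h = fm \<gamma> h" using * w by (auto simp: coord_def)
  qed (use g in auto)
  then have "finite {\<delta>\<in>\<hh>. \<exists>w\<in>weight_space K N \<delta>. coord b w \<noteq> 0}" using finite_subset by blast
  moreover have "linear_from (mcarr N) (coord b)"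
    using rep_linear[of b] by (auto simp: linear_from_def linear_on_def coord_def)
  ultimately show ?thesis by (simp add: GD_iff)
qed

text \<open>The functionals vanishing on the radical of the form make up a submodule of the graded
  dual that contains \<open>vs\<close>, hence all of it. Coordinate functionals belong to it and
  separate points, so the radical is zero.\<close>

lemma S_inj: assumes m: "m \<in> mcarr N" "\<And>w. w \<in> mcarr N \<Longrightarrow> S m w = 0" shows "m = 0"
proof (rule ccontr)
  let ?K = "{k \<in> mcarr N. \<forall>w\<in>mcarr N. S k w = 0}"
  let ?W = "{\<psi> \<in> GD. \<forall>k\<in>?K. \<psi> k = 0}"
  have "?W = GD"
  proof (rule irrD)
    show "cvec.subspace ?W" using GD_subspace by (auto simp: cvec.subspace_def)
    fix x \<psi> assume p: "\<psi> \<in> ?W"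
    then obtain n where n: "n \<in> mcarr N" "\<psi> = S n" using S_surj by blast
    have "mact (graded_dual K N) x \<psi> \<in> GD" unfolding n(2) graded_dual_act_S[OF n(1)] by (rule S_GD) (simp add: n)
    moreover have "mact (graded_dual K N) x \<psi> k = 0" if k: "k \<in> ?K" for k
    proof -
      have "mact N x k \<in> ?K" using k S(4)[of k _ x] by auto
      then show ?thesis using p k by (auto simp: graded_dual_def precomp_def)
    qed
    ultimately show "mact (graded_dual K N) x \<psi> \<in> ?W" by blast
  next
    have "vs k = 0" if "k \<in> ?K" for k using that S_v[of k] by auto
    then have "vs \<in> ?W" using S_GD[OF v_carr] by (simp add: S(3))
    then show "?W \<noteq> {0}" using vs_nonzero by blast
  qed auto
  assume "m \<noteq> 0"
  then obtain b where b: "rep m b \<noteq> 0" using rep_expand[OF m(1)] by (metis (mono_tags, lifting) mem_Collect_eq sum.neutral cvec.scale_zero_left)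
  then have "b \<in> Bs" using rep_expand[OF m(1)] by blast
  then have "coord b \<in> ?W" using coord_GD \<open>?W = GD\<close> by blast
  moreover have "m \<in> ?K" using m by simp
  ultimately have "coord b m = 0" by blast
  then show False using b m by (simp add: coord_def)
qed

end

section \<open>Existence and uniqueness of the intertwiner\<close>

locale intertwining = bd_setting K \<tau> D \<rho>
  for K :: "('n::finite, 'g::complex_vector) km_algebra" and \<tau> D \<rho> +
  fixes M :: "'g \<Rightarrow> ('g, 'm::complex_vector) gmod" and vac :: "'g \<Rightarrow> 'm" and \<kappa> \<nu> :: 'g
    and V :: "('g, 'v::complex_vector) gmod" and w :: 'v
  assumes verma_M: "\<gamma> \<in> csa K \<Longrightarrow> verma_module K \<gamma> (M \<gamma>) (vac \<gamma>)"
    and \<kappa>: "\<kappa> \<in> csa K" and \<nu>: "\<nu> \<in> csa K" and V_O: "category_O K V" and w: "w \<in> weight_space K V \<nu>"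
    and irr: "irreducible_module (graded_dual K (M (\<kappa> - \<nu>)))"
begin

sublocale src: verma K \<tau> D \<rho> \<kappa> "M \<kappa>" "vac \<kappa>"
  by unfold_locales (use \<kappa> verma_M in auto)

sublocale tgt: verma_irr K \<tau> D \<rho> "\<kappa> - \<nu>" "M (\<kappa> - \<nu>)" "vac (\<kappa> - \<nu>)"
  by unfold_locales (use \<kappa> \<nu> verma_M irr csa_subspace in \<open>auto simp: cvec.subspace_diff\<close>)

sublocale tensor_module K "M (\<kappa> - \<nu>)" V
  by unfold_locales (use V_O in \<open>auto simp: category_O_def\<close>)

abbreviation "N \<equiv> M (\<kappa> - \<nu>)"
abbreviation "v \<equiv> vac (\<kappa> - \<nu>)"

lemma w_carr: "w \<in> mcarr V"
  using w weight_spaceD by blast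

text \<open>The value of the intertwiner on \<open>vac \<kappa>\<close> is found from \<open>\<phi> \<circ> \<Theta>\<close> by inverting the contravariant form.\<close>

definition \<Theta> :: "'m \<Rightarrow> 'v" where
  "\<Theta> = (SOME \<theta>. linear_from (mcarr N) \<theta> \<and> \<theta> ` mcarr N \<subseteq> mcarr V \<and> \<theta> v = w \<and>
    (\<forall>x\<in>nm. \<forall>m\<in>mcarr N. \<theta> (mact N x m) = mact V (\<omega> x) (\<theta> m)))"

lemma \<Theta>: "linear_from (mcarr N) \<Theta>" "m \<in> mcarr N \<Longrightarrow> \<Theta> m \<in> mcarr V" "\<Theta> v = w"
  "x \<in> nm \<Longrightarrow> m \<in> mcarr N \<Longrightarrow> \<Theta> (mact N x m) = mact V (\<omega> x) (\<Theta> m)"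
proof -
  have "\<exists>\<theta>. linear_from (mcarr N) \<theta> \<and> \<theta> ` mcarr N \<subseteq> mcarr V \<and> \<theta> v = w \<and>
    (\<forall>x\<in>nm. \<forall>m\<in>mcarr N. \<theta> (mact N x m) = mact V (\<omega> x) (\<theta> m))"
  proof (rule tgt.free_map_exists)
    show "linear_on nm (\<lambda>x. mact V (\<omega> x) u)" if "u \<in> mcarr V" for u
      using that by (auto simp: linear_on_def \<omega>_simps Vm.act_left_simps)
  qed (auto simp: Vm.carr w_carr Vm.act_linear \<omega>_simps Vm.act_br)
  from someI_ex[OF this] show "linear_from (mcarr N) \<Theta>" "m \<in> mcarr N \<Longrightarrow> \<Theta> m \<in> mcarr V" "\<Theta> v = w"
    "x \<in> nm \<Longrightarrow> m \<in> mcarr N \<Longrightarrow> \<Theta> (mact N x m) = mact V (\<omega> x) (\<Theta> m)"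
    unfolding \<Theta>_def[symmetric] by blast+
qed

lemmas \<Theta>_linear = linear_fromD(1)[OF \<Theta>(1)]

lemma \<Theta>_fw: "\<Theta> (tgt.fw is) \<in> weight_space K V (\<nu> + tgt.wt is)"
proof (induction "is")
  case Nil
  then show ?case using w by (simp add: \<Theta> tgt.wt_def)
next
  case (Cons i "is")
  have "\<Theta> (tgt.fw (i # is)) = (-1) *\<^sub>C mact V (e i) (\<Theta> (tgt.fw is))"
    by (simp add: tgt.fw_Cons \<Theta> f_nm \<omega>_simps Vm.act_left_simps)
  moreover have "mact V (e i) (\<Theta> (tgt.fw is)) \<in> weight_space K V (\<nu> + tgt.wt is + \<alpha> i)"
    by (rule act_weight[OF Vm.gm Cons.IH e_root_space])
  ultimately show ?case
    using weight_space_subspace[OF Vm.gm]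
    by (simp only: cvec.subspace_scale tgt.wt_def list.map sum_list.Cons add.assoc add.commute[of "\<alpha> i"])
qed

text \<open>Lowering in M is turned by \<Theta> into raising in V, and the weights of V are bounded
  above. So long monomials go to zero.\<close>

lemma \<Theta>_finite: "finite {b \<in> tgt.Bs. \<Theta> b \<noteq> 0}"
proof -
  obtain n where n: "\<forall>\<beta>\<in>Q. ht \<beta> > n \<longrightarrow> weight_space K V (\<nu> + \<beta>) \<subseteq> {0}" using category_O_bound[OF V_O \<nu>] by blast
  have fw0: "\<Theta> (tgt.fw is) = 0" if "length is > n" for "is"
    using n tgt.wt_Q[of "is"] that \<Theta>_fw[of "is"] by (auto simp: tgt.ht_wt)
  let ?T = "tgt.fw ` {is. set is \<subseteq> UNIV \<and> length is \<le> n}"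
  have "b \<in> cvec.span ?T" if b: "b \<in> tgt.Bs" "\<Theta> b \<noteq> 0" for b
  proof -
    obtain \<gamma> where g: "b \<in> weight_space K N \<gamma>" using tgt.Bs_weight[OF b(1)] by blast
    let ?U = "{tgt.fw is | is. \<forall>h\<in>\<hh>. fm (\<kappa> - \<nu> - tgt.wt is) h = fm \<gamma> h}"
    have bU: "b \<in> cvec.span ?U"
      by (rule tgt.weight_vector_span) (use g weight_spaceD in auto)
    \<comment> \<open>Some monomial of the weight of b survives \<Theta>; the degree shows that all
      monomials of this weight have the same length, which is then at most n.\<close>
    have "\<exists>js. tgt.fw js \<in> ?U \<and> \<Theta> (tgt.fw js) \<noteq> 0 \<and> (\<forall>h\<in>\<hh>. fm (\<kappa> - \<nu> - tgt.wt js) h = fm \<gamma> h)"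
    proof (rule ccontr)
      assume *: "\<not> ?thesis"
      have "?U \<subseteq> mcarr N" by auto
      then have "cvec.span ?U \<subseteq> mcarr N" by (rule cvec.span_minimal[OF _ tgt.carr])
      then have "\<Theta> b \<in> {0}"
        by (intro linear_on_span_mem[OF linear_on_subset[OF \<Theta>_linear] _ _ bU]) (use * in auto)
      then show False using b by simp
    qed
    then obtain js where js: "\<Theta> (tgt.fw js) \<noteq> 0" "\<forall>h\<in>\<hh>. fm (\<kappa> - \<nu> - tgt.wt js) h = fm \<gamma> h" by blast
    have l: "fm (tgt.wt is) dd = of_nat (length is)" for "is"
      using fm_dd_Q[OF tgt.wt_Q, of "is"] fm_sym[of dd] by (simp add: tgt.ht_wt)
    have "length is \<le> n" if "\<forall>h\<in>\<hh>. fm (\<kappa> - \<nu> - tgt.wt is) h = fm \<gamma> h" for "is"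
    proof -
      have "fm (\<kappa> - \<nu> - tgt.wt is) dd = fm (\<kappa> - \<nu> - tgt.wt js) dd" using that js(2) dd(3) by simp
      then have "(of_nat (length is) :: complex) = of_nat (length js)" by (simp add: fm_simps l)
      then have "length is = length js" by simp
      then show ?thesis using fw0[of js] js(1) by (metis linorder_not_le)
    qed
    then have "?U \<subseteq> ?T" by auto
    then show ?thesis using cvec.span_mono bU by blast
  qed
  then have "{b \<in> tgt.Bs. \<Theta> b \<noteq> 0} \<subseteq> cvec.span ?T" by blast
  moreover have "finite ?T" using finite_lists_length_le[of "UNIV :: 'n set" n] by simp
  moreover have "cvec.independent {b \<in> tgt.Bs. \<Theta> b \<noteq> 0}" by (rule cvec.independent_mono[OF tgt.Bs(1)]) auto
  ultimately show ?thesis using cvec.independent_span_bound by blast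
qed

text \<open>The vector is the sum over basis elements b of g_b \<otimes> \<Theta> b, where
  \<open>S\<close> sends g_b to the coordinate functional of b. Only finitely many b have \<Theta> b
  \<noteq> 0, so the sum lies in the algebraic tensor product.\<close>

lemma singular_vector:
  "\<exists>u\<in>mv_tensor N V. \<forall>\<phi>\<in>V'. \<forall>m\<in>mcarr N. tgt.S (u \<phi>) m = \<phi> (\<Theta> m)"
proof -
  let ?B = "{b \<in> tgt.Bs. \<Theta> b \<noteq> 0}"
  have "\<exists>n. n \<in> mcarr N \<and> tgt.S n = tgt.coord b" if "b \<in> tgt.Bs" for b
    using tgt.S_surj tgt.coord_GD[OF that] by (metis imageE)
  then obtain g where g: "\<And>b. b \<in> tgt.Bs \<Longrightarrow> g b \<in> mcarr N \<and> tgt.S (g b) = tgt.coord b" by metis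
  define u where "u = (\<Sum>b\<in>?B. mv_pure V (g b) (\<Theta> b))"
  have "u \<in> mv_tensor N V"
    unfolding u_def mv_tensor_def by (intro cvec.span_sum cvec.span_base) (use g \<Theta>(2) tgt.Bs(3) in blast)
  moreover have "tgt.S (u \<phi>) m = \<phi> (\<Theta> m)" if p: "\<phi> \<in> V'" and m: "m \<in> mcarr N" for \<phi> m
  proof -
    have lp: "linear_on (mcarr V) \<phi>" using p by (simp add: dual_space_def linear_from_def)
    have lin: "linear_on (mcarr N) (\<lambda>m. \<phi> (\<Theta> m))"
      by (rule linear_on_compose[OF \<Theta>_linear _ lp]) (use \<Theta>(2) in blast)
    have "u \<phi> = (\<Sum>b\<in>?B. \<phi> (\<Theta> b) *\<^sub>C g b)"
      using p by (simp add: u_def sum_fun_apply mv_pure_def)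
    then have "tgt.S (u \<phi>) m = (\<Sum>b\<in>?B. tgt.S (\<phi> (\<Theta> b) *\<^sub>C g b) m)"
      by (simp only:) (rule tgt.S_sum, use g in auto)
    also have "\<dots> = (\<Sum>b\<in>?B. \<phi> (\<Theta> b) * tgt.rep m b)"
      using g m by (intro sum.cong) (auto simp: tgt.S_simps tgt.coord_def)
    also have "\<dots> = (\<Sum>b | tgt.rep m b \<noteq> 0. tgt.rep m b * \<phi> (\<Theta> b))"
      using tgt.rep_expand[OF m] \<Theta>_finite linear_on_0[OF lp Vm.carr]
      by (intro sum.mono_neutral_cong) (auto simp: mult.commute)
    also have "\<dots> = (\<Sum>b | tgt.rep m b \<noteq> 0. \<phi> (\<Theta> (tgt.rep m b *\<^sub>C b)))"
      using tgt.rep_expand[OF m] tgt.Bs(3) linear_on_scale[OF lin] by (intro sum.cong) auto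
    also have "\<dots> = \<phi> (\<Theta> (\<Sum>b | tgt.rep m b \<noteq> 0. tgt.rep m b *\<^sub>C b))"
      using tgt.rep_expand[OF m] tgt.Bs(3) by (intro linear_on_sum[OF lin tgt.carr, symmetric]) auto
    also have "\<dots> = \<phi> (\<Theta> m)" using tgt.rep_expand[OF m] by metis
    finally show ?thesis .
  qed
  ultimately show ?thesis by blast
qed

lemma S_eqI:
  assumes "m \<in> mcarr N" "m' \<in> mcarr N" "\<And>is. tgt.S m (tgt.fw is) = tgt.S m' (tgt.fw is)" shows "m = m'"
proof -
  have "m - m' = 0"
  proof (rule tgt.S_inj)
    fix u assume u: "u \<in> mcarr N"
    have "tgt.S m u = tgt.S m' u"
      by (rule tgt.fw_eq[OF tgt.S_linear tgt.S_linear _ u]) (use assms in auto)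
    moreover have "tgt.S (m - m') u = tgt.S m u - tgt.S m' u"
      using linear_on_diff[OF linear_fromD(1)[OF tgt.S(1)] tgt.carr assms(1,2)] by simp
    ultimately show "tgt.S (m - m') u = 0" by simp
  qed (use assms in simp)
  then show ?thesis by simp
qed

definition is_intertwiner :: "('m \<Rightarrow> ('v \<Rightarrow> complex) \<Rightarrow> 'm) \<Rightarrow> bool" where
  "is_intertwiner \<Phi> \<longleftrightarrow> linear_from (mcarr (M \<kappa>)) \<Phi> \<and> \<Phi> ` mcarr (M \<kappa>) \<subseteq> mv_tensor N V \<and>
     (\<forall>x. \<forall>m\<in>mcarr (M \<kappa>). \<Phi> (mact (M \<kappa>) x m) = mv_act N V x (\<Phi> m)) \<and>
     (\<forall>\<phi>\<in>V'. tgt.vs (\<Phi> (vac \<kappa>) \<phi>) = \<phi> w)"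

text \<open>The vector u with S (u \<phi>) = \<phi> \<circ> \<Theta> is singular of weight \<kappa>.
  This is tested after applying the injective map \<open>S\<close>: contravariance turns e_i on M
  into -\<phi> \<circ> \<Theta> after the involuted e_i, and equivariance of \<Theta> makes this
  cancel the action of e_i on V.\<close>

lemma intertwiner_exists: "\<exists>\<Phi>. is_intertwiner \<Phi>"
proof -
  obtain u where u: "u \<in> mv_tensor N V" and Su: "\<And>\<phi> m. \<phi> \<in> V' \<Longrightarrow> m \<in> mcarr N \<Longrightarrow> tgt.S (u \<phi>) m = \<phi> (\<Theta> m)"
    using singular_vector by blast
  note uf = mv_facts[OF u]
  have lp: "linear_on (mcarr V) \<phi>" if "\<phi> \<in> V'" for \<phi> using that by (simp add: dual_space_def linear_from_def)
  have S_act: "tgt.S (mact N x (u \<phi>)) m = - \<phi> (\<Theta> (mact N (\<omega> x) m))" if "\<phi> \<in> V'" "m \<in> mcarr N" for x \<phi> m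
    using that uf(1) by (simp add: tgt.S(4) Su)
  have pcT: "pc x \<phi> (\<Theta> m) = \<phi> (mact V x (\<Theta> m))" if "m \<in> mcarr N" for x \<phi> m
    using \<Theta>(2)[OF that] by (simp add: precomp_def)
  have "mv_act N V (e i) u = 0" for i
  proof
    fix \<phi>
    show "mv_act N V (e i) u \<phi> = 0 \<phi>"
    proof (cases "\<phi> \<in> V'")
      case True
      have "mact N (e i) (u \<phi>) + u (pc (e i) \<phi>) = 0"
      proof (rule S_eqI)
        fix "is" let ?m = "tgt.fw is"
        have "\<Theta> (mact N (\<omega> (e i)) ?m) = mact V (e i) (\<Theta> ?m)"
          using \<Theta>(4)[OF \<omega>_np[OF e_np], of ?m i] by (simp add: \<omega>_simps(4))
        then show "tgt.S (mact N (e i) (u \<phi>) + u (pc (e i) \<phi>)) ?m = tgt.S 0 ?m"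
          using True uf(1) linear_on_0[OF linear_fromD(1)[OF tgt.S(1)] tgt.carr]
          by (simp add: tgt.S_simps S_act Su V'_simps pcT)
      qed (use uf(1) in auto)
      then show ?thesis using True by (simp add: mv_act_def)
    qed (simp add: mv_act_def)
  qed
  moreover have "mv_act N V h u = fm \<kappa> h *\<^sub>C u" if h: "h \<in> \<hh>" for h
  proof
    fix \<phi>
    show "mv_act N V h u \<phi> = (fm \<kappa> h *\<^sub>C u) \<phi>"
    proof (cases "\<phi> \<in> V'")
      case True
      have "mact N h (u \<phi>) + u (pc h \<phi>) = fm \<kappa> h *\<^sub>C u \<phi>"
      proof (rule S_eqI)
        fix "is" let ?m = "tgt.fw is"
        have 1: "\<Theta> (mact N (\<omega> h) ?m) = (- fm (\<kappa> - \<nu> - tgt.wt is) h) *\<^sub>C \<Theta> ?m"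
          using weight_spaceD(2)[OF tgt.fw_weight h, of "is"] linear_on_scale[OF \<Theta>_linear] linear_on_minus[OF \<Theta>_linear]
          by (simp add: \<omega>_simps h tgt.act_left_simps)
        have 2: "mact V h (\<Theta> ?m) = fm (\<nu> + tgt.wt is) h *\<^sub>C \<Theta> ?m" using weight_spaceD(2)[OF \<Theta>_fw h] .
        have "tgt.S (mact N h (u \<phi>) + u (pc h \<phi>)) ?m = - \<phi> (\<Theta> (mact N (\<omega> h) ?m)) + \<phi> (mact V h (\<Theta> ?m))"
          using True uf(1) by (simp add: tgt.S_simps S_act Su V'_simps pcT)
        also have "\<dots> = fm \<kappa> h * \<phi> (\<Theta> ?m)"
          unfolding 1 2 linear_on_scale[OF lp[OF True] \<Theta>(2)[OF tgt.fw_carr]] scaleC_complex by (simp add: fm_simps algebra_simps)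
        also have "\<dots> = tgt.S (fm \<kappa> h *\<^sub>C u \<phi>) ?m" using True uf(1) by (simp add: tgt.S_simps Su)
        finally show "tgt.S (mact N h (u \<phi>) + u (pc h \<phi>)) ?m = tgt.S (fm \<kappa> h *\<^sub>C u \<phi>) ?m" .
      qed (use uf(1) in auto)
      then show ?thesis using True by (simp add: mv_act_def)
    next
      case False
      then show ?thesis using uf(2) by (simp add: mv_act_def)
    qed
  qed
  ultimately obtain \<Phi> where P: "linear_from (mcarr (M \<kappa>)) \<Phi>" "\<Phi> ` mcarr (M \<kappa>) \<subseteq> mv_tensor N V" "\<Phi> (vac \<kappa>) = u"
    "\<forall>x. \<forall>m\<in>mcarr (M \<kappa>). \<Phi> (mact (M \<kappa>) x m) = mv_act N V x (\<Phi> m)"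
    using src.hom_exists[OF mv_module, of u] u by auto
  have "tgt.vs (u \<phi>) = \<phi> w" if "\<phi> \<in> V'" for \<phi>
    using tgt.S_v[OF uf(1)[of \<phi>]] Su[OF that tgt.v_carr] \<Theta>(3) by simp
  then show ?thesis using P unfolding is_intertwiner_def by auto
qed

text \<open>Two intertwiners differ on the highest weight vector by a singular u without vacuum
  component. Contravariance evaluates S (u \<phi>) at f_i m through e_i (u \<phi>), which
  singularity replaces by u at another functional; induction over monomials gives S (u \<phi>) = 0
  and so u = 0.\<close>

lemma intertwiner_unique: assumes "is_intertwiner \<Phi>" "is_intertwiner \<Psi>" shows "\<Phi> = \<Psi>"
proof -
  note A = assms[unfolded is_intertwiner_def]
  define u where "u = \<Phi> (vac \<kappa>) - \<Psi> (vac \<kappa>)"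
  have mem: "\<Phi> m \<in> mv_tensor N V" "\<Psi> m \<in> mv_tensor N V" if "m \<in> mcarr (M \<kappa>)" for m using A that by auto
  have u: "u \<in> mv_tensor N V" unfolding u_def by (rule cvec.subspace_diff[OF mv_subspace]) (use mem in auto)
  note uf = mv_facts[OF u]
  have e0: "mact N (e i) (u \<phi>) + u (pc (e i) \<phi>) = 0" if p: "\<phi> \<in> V'" for i \<phi>
  proof -
    have z: "mact (M \<kappa>) (e i) (vac \<kappa>) = 0" by (rule src.v_np[OF e_np])
    have "mv_act N V (e i) (\<Phi> (vac \<kappa>)) = 0" "mv_act N V (e i) (\<Psi> (vac \<kappa>)) = 0"
      using A z linear_on_0[OF linear_fromD(1) src.carr] by (metis src.v_carr)+
    then have "mv_act N V (e i) u = 0"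
      unfolding u_def using linear_on_diff[OF mv_act_linear mv_subspace] mem by simp
    from fun_cong[OF this, of \<phi>] show ?thesis using p by (simp add: mv_act_def)
  qed
  have "tgt.S (u \<phi>) (tgt.fw is) = 0" if "\<phi> \<in> V'" for "is" \<phi>
    using that
  proof (induction "is" arbitrary: \<phi>)
    case Nil
    have "tgt.vs (u \<phi>) = 0"
      using A Nil mv_facts(1)[OF mem(1)] mv_facts(1)[OF mem(2)] linear_on_diff[OF linear_fromD(1)[OF tgt.vs(1)] tgt.carr]
      by (simp add: u_def)
    then show ?case using tgt.S_v[OF uf(1)] by simp
  next
    case (Cons i "is")
    let ?m = "tgt.fw is"
    have "mact N (e i) (u \<phi>) = - u (pc (e i) \<phi>)" using e0[OF Cons.prems, of i] by (simp add: eq_neg_iff_add_eq_0)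
    moreover have "tgt.S (u (pc (e i) \<phi>)) ?m = 0" by (rule Cons.IH) (rule V'_simps(4)[OF Cons.prems])
    moreover have "tgt.S (- u (pc (e i) \<phi>)) ?m = - tgt.S (u (pc (e i) \<phi>)) ?m"
      using tgt.S_simps(2)[OF uf(1), of "-1"] by simp
    ultimately have "tgt.S (mact N (e i) (u \<phi>)) ?m = 0" by simp
    then have "tgt.S (u \<phi>) (mact N (\<omega> (e i)) ?m) = 0" using tgt.S(4)[OF uf(1) tgt.fw_carr] by simp
    then show ?case
      using linear_on_minus[OF tgt.S_linear[OF uf(1)]] by (simp add: \<omega>_simps tgt.act_left_simps tgt.fw_Cons)
  qed
  then have "u \<phi> = 0" if "\<phi> \<in> V'" for \<phi>
    using S_eqI[OF uf(1) tgt.carr_simps(1)] that linear_on_0[OF linear_fromD(1)[OF tgt.S(1)] tgt.carr] by simp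
  then have "u = 0" using uf(2) by (auto simp: fun_eq_iff)
  then have vac: "\<Phi> (vac \<kappa>) = \<Psi> (vac \<kappa>)" by (simp add: u_def)
  have fw: "\<Phi> (src.fw is) = \<Psi> (src.fw is)" for "is"
    using A vac by (induction "is") (auto simp: src.fw_Cons)
  show ?thesis
  proof
    fix m show "\<Phi> m = \<Psi> m"
      using src.fw_eq[of \<Phi> \<Psi> m] fw A by (cases "m \<in> mcarr (M \<kappa>)") (auto simp: linear_from_def)
  qed
qed

abbreviation "\<Phi> \<equiv> intertwiner K M vac V w \<nu> \<kappa>"

lemma intertwiner: "is_intertwiner \<Phi>"
proof -
  have "\<exists>!\<Phi>. is_intertwiner \<Phi>" using intertwiner_exists intertwiner_unique by blast
  from theI'[OF this] show ?thesis unfolding intertwiner_def is_intertwiner_def[symmetric] .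
qed

lemma \<Phi>_mv: "m \<in> mcarr (M \<kappa>) \<Longrightarrow> \<Phi> m \<in> mv_tensor N V"
  using intertwiner by (auto simp: is_intertwiner_def)

lemma \<Phi>_linear: "linear_on (mcarr (M \<kappa>)) (\<lambda>m. \<Phi> m \<phi>)"
  using intertwiner by (auto simp: is_intertwiner_def linear_from_def linear_on_def)

lemma \<Phi>_act: "m \<in> mcarr (M \<kappa>) \<Longrightarrow> \<phi> \<in> V' \<Longrightarrow> \<Phi> (mact (M \<kappa>) x m) \<phi> = mact N x (\<Phi> m \<phi>) + \<Phi> m (pc x \<phi>)"
  using intertwiner by (auto simp: is_intertwiner_def mv_act_def)

lemmas \<Phi>_facts = mv_facts[OF \<Phi>_mv]

lemma \<Phi>_E_eventually_0:
  assumes "m \<in> mcarr (M \<kappa>)" shows "\<exists>n. \<forall>a\<in>R. ht (fst a) > n \<longrightarrow> (\<forall>\<phi>\<in>V'. \<Phi> m (pc (E a) \<phi>) = 0)"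
proof -
  let ?W = "{t :: ('v \<Rightarrow> complex) \<Rightarrow> 'm. \<exists>n. \<forall>a\<in>R. ht (fst a) > n \<longrightarrow> (\<forall>\<phi>\<in>V'. t (pc (E a) \<phi>) = 0)}"
  have "\<Phi> m \<in> ?W"
  proof (rule mv_induct[OF \<Phi>_mv[OF assms]])
    show "cvec.subspace ?W"
      unfolding cvec.subspace_def
    proof (intro conjI ballI allI; clarify)
      fix s t :: "('v \<Rightarrow> complex) \<Rightarrow> 'm" and k l
      assume "\<forall>a\<in>R. ht (fst a) > k \<longrightarrow> (\<forall>\<phi>\<in>V'. s (pc (E a) \<phi>) = 0)" "\<forall>a\<in>R. ht (fst a) > l \<longrightarrow> (\<forall>\<phi>\<in>V'. t (pc (E a) \<phi>) = 0)"
      then show "\<exists>n. \<forall>a\<in>R. ht (fst a) > n \<longrightarrow> (\<forall>\<phi>\<in>V'. (s + t) (pc (E a) \<phi>) = 0)"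
        by (intro exI[of _ "max k l"]) simp
    qed auto
    fix n :: 'm and u assume u: "u \<in> mcarr V"
    obtain k where k: "\<forall>a\<in>R. ht (fst a) > k \<longrightarrow> mact V (E a) u = 0" using E_eventually_0_O[OF V_O u] by blast
    have "mv_pure V n u (pc (E a) \<phi>) = 0" if "a \<in> R" "ht (fst a) > k" "\<phi> \<in> V'" for a \<phi>
    proof -
      have "linear_on (mcarr V) \<phi>" using that(3) by (simp add: dual_space_def linear_from_def)
      then have "pc (E a) \<phi> u = 0" using k that u linear_on_0[OF _ Vm.carr] by (simp add: precomp_def)
      then show ?thesis by (simp add: mv_pure_def)
    qed
    then show "mv_pure V n u \<in> ?W" by blast
  qed
  then show ?thesis by simp
qed

end

section \<open>The twisted trace of a Verma module\<close>

context bd_setting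
begin

definition cone :: "'g set" where "cone = lproj K \<tau> ` Q"

text \<open>(\<rho>, \<alpha>_i) = (\<alpha>_i, \<alpha>_i)/2 is invariant under T. Consequently B
  acts on M_{-\<rho>} itself, and the \<rho>-term of the Casimir element is carried entirely by
  \<ll>.\<close>

lemma rho_lsub: "\<rho> \<in> \<ll>"
  using rho_csa by (auto simp: lsub_iff fm_simps fm_sym[of _ \<rho>] rho_root T_form)

lemma cone_lsub: "\<gamma> \<in> cone \<Longrightarrow> \<gamma> \<in> \<ll>"
  using lproj(1) by (auto simp: cone_def)

lemma cone_0: "0 \<in> cone"
  using Q_0 lproj_lsub[OF cvec.subspace_0[OF lsub_subspace]] unfolding cone_def by (metis imageI)

lemma cone_add: "\<gamma> \<in> cone \<Longrightarrow> \<delta> \<in> cone \<Longrightarrow> \<gamma> + \<delta> \<in> cone"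
  using Q_add by (auto simp: cone_def lproj_add[symmetric])

lemma ht_lproj: "\<beta> \<in> Q \<Longrightarrow> ht (lproj K \<tau> \<beta>) = ht \<beta>"
  by (rule ht_eqI) (simp add: lproj_sym[OF dd(1)] fm_sym[of \<beta>] fm_dd_Q)

lemma fm_dd_cone: "\<gamma> \<in> cone \<Longrightarrow> fm dd \<gamma> = of_nat (ht \<gamma>)"
  by (auto simp: cone_def ht_lproj lproj_sym[OF dd(1)] fm_sym[of _ dd] fm_dd_Q)

lemma ht_add_cone: "\<gamma> \<in> cone \<Longrightarrow> \<delta> \<in> cone \<Longrightarrow> ht (\<gamma> + \<delta>) = ht \<gamma> + ht \<delta>"
  by (rule ht_eqI) (simp add: fm_simps fm_dd_cone)

lemma ht_pos_cone: "\<gamma> \<in> cone \<Longrightarrow> \<gamma> \<noteq> 0 \<Longrightarrow> ht \<gamma> > 0"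
  using ht_lproj ht_pos lproj_lsub[OF cvec.subspace_0[OF lsub_subspace]] unfolding cone_def by (metis imageE neq0_conv)

lemma finite_cone: "finite {\<gamma> \<in> cone. ht \<gamma> \<le> n}"
proof (rule finite_subset)
  show "{\<gamma> \<in> cone. ht \<gamma> \<le> n} \<subseteq> lproj K \<tau> ` {\<gamma> \<in> Q. ht \<gamma> \<le> n}" using ht_lproj by (auto simp: cone_def)
qed (use finite_Q in auto)

definition rp :: "'g \<times> nat \<Rightarrow> 'g" where "rp a = lproj K \<tau> (fst a)"

lemma rp: assumes "a \<in> R" shows "rp a \<in> cone" "rp a \<in> \<ll>" "ht (rp a) = ht (fst a)" "ht (rp a) > 0" "x \<in> \<ll> \<Longrightarrow> fm (rp a) x = fm (fst a) x"
  using rootD[OF assms] lproj ht_lproj by (auto simp: rp_def cone_def)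

lemma cone_of_nat: "\<gamma> \<in> cone \<Longrightarrow> of_nat n *\<^sub>C \<gamma> \<in> cone"
  by (induction n) (auto simp: cone_0 cvec.scale_left_distrib intro: cone_add)

lemma ht_of_nat: "\<gamma> \<in> cone \<Longrightarrow> ht (of_nat n *\<^sub>C \<gamma>) = n * ht \<gamma>"
  by (rule ht_eqI) (simp add: fm_simps fm_dd_cone)

lemma lsub_of_nat: "\<gamma> \<in> \<ll> \<Longrightarrow> of_nat n *\<^sub>C \<gamma> \<in> \<ll>"
  by (rule cvec.subspace_scale[OF lsub_subspace])

text \<open>\<open>e_\<alpha> \<otimes> B\<^sup>l f_\<alpha>\<close> may be replaced by \<open>B\<^sup>*\<^sup>l e_\<alpha> \<otimes> f_\<alpha>\<close> in sums over roots, also with coefficients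
  depending on the restriction of \<open>\<alpha>\<close> to \<open>\<ll>\<close>.\<close>

lemma rp_matrix: assumes "a \<in> R" "b \<in> R" "fm (E a) ((B ^^ l) (F b)) \<noteq> 0" shows "rp a = rp b"
proof (rule lsub_eqI)
  fix y assume "y \<in> \<ll>"
  then show "fm (rp a) y = fm (rp b) y" using Bpow_matrix[OF assms(1,2), of y l] assms(3) rp(5) assms(1,2) by auto
qed (use rp assms in auto)

lemma sum_adjoint:
  assumes lin1: "\<And>a y. a \<in> Rn n \<Longrightarrow> linear_on UNIV (\<lambda>x. g x y (rp a))" and lin2: "\<And>a x. a \<in> Rn n \<Longrightarrow> linear_on UNIV (\<lambda>y. g x y (rp a))"
  shows "(\<Sum>a\<in>Rn n. g (Et l a) (F a) (rp a)) = (\<Sum>a\<in>Rn n. g (E a) ((B ^^ l) (F a)) (rp a) :: 'z::complex_vector)"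
proof -
  let ?c = "\<lambda>a b. fm (E a) ((B ^^ l) (F b))"
  have "g (Et l a) (F a) (rp a) = (\<Sum>b\<in>Rn n. ?c a b *\<^sub>C g (E b) (F a) (rp b))" if a: "a \<in> Rn n" for a
  proof -
    have "g (Et l a) (F a) (rp a) = (\<Sum>b\<in>Rn n. ?c a b *\<^sub>C g (E b) (F a) (rp a))"
      using linear_on_sum[OF lin1[OF a], of "Rn n" "\<lambda>b. ?c a b *\<^sub>C E b"] linear_on_scale[OF lin1[OF a]]
      by (simp add: Et_extend[OF a])
    also have "\<dots> = (\<Sum>b\<in>Rn n. ?c a b *\<^sub>C g (E b) (F a) (rp b))"
      using rp_matrix[OF Rn(1)[OF a] Rn(1)] by (intro sum.cong) auto
    finally show ?thesis .
  qed
  then have "(\<Sum>a\<in>Rn n. g (Et l a) (F a) (rp a)) = (\<Sum>b\<in>Rn n. \<Sum>a\<in>Rn n. ?c a b *\<^sub>C g (E b) (F a) (rp b))"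
    by (subst sum.swap) simp
  also have "\<dots> = (\<Sum>b\<in>Rn n. g (E b) ((B ^^ l) (F b)) (rp b))"
  proof (rule sum.cong[OF refl])
    fix b assume b: "b \<in> Rn n"
    have "g (E b) ((B ^^ l) (F b)) (rp b) = g (E b) (\<Sum>a\<in>Rn n. ?c a b *\<^sub>C F a) (rp b)"
      using Bpow_F_expand[OF b, of l] by simp
    then show "(\<Sum>a\<in>Rn n. ?c a b *\<^sub>C g (E b) (F a) (rp b)) = g (E b) ((B ^^ l) (F b)) (rp b)"
      using linear_on_sum[OF lin2[OF b], of "Rn n" "\<lambda>a. ?c a b *\<^sub>C F a"] linear_on_scale[OF lin2[OF b]] by simp
  qed
  finally show ?thesis .
qed

end

text \<open>Exponents of the trace lie below \<kappa>, and n restricted positive roots raise the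
  exponent by height at least n. This is what ends every journey around the trace.\<close>

lemma (in verma) tt_shift_0:
  assumes "a \<in> R" "ht (\<kappa> - \<eta>) < n" shows "tt A (\<eta> + of_nat n *\<^sub>C rp a) = 0"
proof (rule ccontr)
  assume "tt A (\<eta> + of_nat n *\<^sub>C rp a) \<noteq> 0"
  then obtain \<beta> where b: "\<beta> \<in> Q" "\<eta> + of_nat n *\<^sub>C rp a = lproj K \<tau> (\<kappa> - \<beta>)" using tt_support by blast
  have "fm dd (\<eta> + of_nat n *\<^sub>C rp a) = fm dd \<kappa> - of_nat (ht \<beta>)"
    unfolding b(2) using lproj_sym[OF dd(1), of "\<kappa> - \<beta>"] fm_sym[of dd] fm_dd_Q[OF b(1)] by (simp add: fm_simps)
  then have "fm dd (\<kappa> - \<eta>) = of_nat (n * ht (fst a) + ht \<beta>)"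
    using fm_dd_cone[OF rp(1)[OF assms(1)]] rp(3)[OF assms(1)] by (simp add: fm_simps algebra_simps)
  then have "ht (\<kappa> - \<eta>) = n * ht (fst a) + ht \<beta>" by (rule ht_eqI)
  moreover have "n * 1 \<le> n * ht (fst a)" using rootD(5)[OF assms(1)] by (intro mult_le_mono2) simp
  ultimately show False using assms(2) by simp
qed

locale twisted_verma = verma K \<tau> D \<rho> \<kappa> N v
  for K :: "('n::finite, 'g::complex_vector) km_algebra" and \<tau> D \<rho> \<kappa> and N :: "('g, 'm::complex_vector) gmod" and v +
  assumes Binv: "i \<in> Gam1 \<tau> \<Longrightarrow> form K \<kappa> (root K i) = form K \<kappa> (root K (Tmap \<tau> i))"
begin

sublocale pr: verma_pair K \<tau> D \<rho> \<kappa> \<kappa> N N v v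
  by unfold_locales (rule Binv)

abbreviation "G \<equiv> tt pr.BV"

end

text \<open>Two Verma modules whose highest weights differ by an element of \<ll>. Both are free of
  rank one over U(n_-); identifying them matches the actions of n_- and of B, while \<hh> changes by
  a scalar.\<close>

locale twisted_shift = src: twisted_verma K \<tau> D \<rho> \<kappa> N v + tgt: twisted_verma K \<tau> D \<rho> "\<kappa> + y" N2 v2
  for K :: "('n::finite, 'g::complex_vector) km_algebra" and \<tau> D \<rho> \<kappa> y
    and N N2 :: "('g, 'm::complex_vector) gmod" and v v2 +
  assumes y: "y \<in> lsub K \<tau>"
begin

lemma transport_exists:
  "\<exists>J. linear_from (mcarr N) J \<and> J ` mcarr N \<subseteq> mcarr N2 \<and> J v = v2 \<and> (\<forall>x\<in>src.nm. \<forall>m\<in>mcarr N. J (mact N x m) = mact N2 x (J m))"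
  "\<exists>J. linear_from (mcarr N2) J \<and> J ` mcarr N2 \<subseteq> mcarr N \<and> J v2 = v \<and> (\<forall>x\<in>src.nm. \<forall>m\<in>mcarr N2. J (mact N2 x m) = mact N x (J m))"
proof -
  show "\<exists>J. linear_from (mcarr N) J \<and> J ` mcarr N \<subseteq> mcarr N2 \<and> J v = v2 \<and> (\<forall>x\<in>src.nm. \<forall>m\<in>mcarr N. J (mact N x m) = mact N2 x (J m))"
    by (rule src.free_map_exists) (auto simp: tgt.carr tgt.act_linear tgt.act_br intro: linear_on_subset[OF tgt.act_linear_left])
  show "\<exists>J. linear_from (mcarr N2) J \<and> J ` mcarr N2 \<subseteq> mcarr N \<and> J v2 = v \<and> (\<forall>x\<in>src.nm. \<forall>m\<in>mcarr N2. J (mact N2 x m) = mact N x (J m))"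
    by (rule tgt.free_map_exists) (auto simp: src.carr src.act_linear src.act_br intro: linear_on_subset[OF src.act_linear_left])
qed

definition J :: "'m \<Rightarrow> 'm" where
  "J = (SOME J. linear_from (mcarr N) J \<and> J ` mcarr N \<subseteq> mcarr N2 \<and> J v = v2 \<and> (\<forall>x\<in>src.nm. \<forall>m\<in>mcarr N. J (mact N x m) = mact N2 x (J m)))"
definition J' :: "'m \<Rightarrow> 'm" where
  "J' = (SOME J. linear_from (mcarr N2) J \<and> J ` mcarr N2 \<subseteq> mcarr N \<and> J v2 = v \<and> (\<forall>x\<in>src.nm. \<forall>m\<in>mcarr N2. J (mact N2 x m) = mact N x (J m)))"

lemma J: "linear_on (mcarr N) J" "m \<in> mcarr N \<Longrightarrow> J m \<in> mcarr N2" "J v = v2"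
    "x \<in> src.nm \<Longrightarrow> m \<in> mcarr N \<Longrightarrow> J (mact N x m) = mact N2 x (J m)"
  and J': "linear_on (mcarr N2) J'" "m2 \<in> mcarr N2 \<Longrightarrow> J' m2 \<in> mcarr N" "J' v2 = v"
    "x \<in> src.nm \<Longrightarrow> m2 \<in> mcarr N2 \<Longrightarrow> J' (mact N2 x m2) = mact N x (J' m2)"
  using someI_ex[OF transport_exists(1)] someI_ex[OF transport_exists(2)]
  unfolding J_def[symmetric] J'_def[symmetric] by (auto simp: linear_from_def)

lemma J_fw: "J (src.fw is) = tgt.fw is" and J'_fw: "J' (tgt.fw is) = src.fw is"
  by (induction "is") (auto simp: J J' src.fw_Cons tgt.fw_Cons src.f_nm)

lemma J'J: "m \<in> mcarr N \<Longrightarrow> J' (J m) = m"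
  by (rule src.fw_eq[where g = "\<lambda>m. J' (J m)" and g' = "\<lambda>m. m"])
    (auto simp: J_fw J'_fw linear_on_def linear_on_add[OF J(1)] linear_on_add[OF J'(1)] linear_on_scale[OF J(1)] linear_on_scale[OF J'(1)] J(2))

lemma JJ': "u \<in> mcarr N2 \<Longrightarrow> J (J' u) = u"
  by (rule tgt.fw_eq[where g = "\<lambda>m. J (J' m)" and g' = "\<lambda>m. m"])
    (auto simp: J_fw J'_fw linear_on_def linear_on_add[OF J(1)] linear_on_add[OF J'(1)] linear_on_scale[OF J(1)] linear_on_scale[OF J'(1)] J'(2))

lemma J_csa: assumes h: "h \<in> src.\<hh>" and m: "m \<in> mcarr N" shows "mact N2 h (J m) = J (mact N h m) + form K y h *\<^sub>C J m"
proof (rule src.fw_eq[OF _ _ _ m, where g = "\<lambda>m. mact N2 h (J m)"])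
  show "linear_on (mcarr N) (\<lambda>m. mact N2 h (J m))"
    by (rule linear_on_compose[OF J(1) image_subsetI[OF J(2)] tgt.act_linear])
  have "linear_on (mcarr N) (\<lambda>m. J (mact N h m))"
    by (rule linear_on_compose[OF src.act_linear image_subsetI[OF src.act_carr] J(1)])
  then show "linear_on (mcarr N) (\<lambda>m. J (mact N h m) + form K y h *\<^sub>C J m)"
    using J(1) by (simp add: linear_on_def cvec.scale_right_distrib mult.commute add_ac)
  fix "is" show "mact N2 h (J (src.fw is)) = J (mact N h (src.fw is)) + form K y h *\<^sub>C J (src.fw is)"
  proof -
    have "mact N2 h (tgt.fw is) = form K (\<kappa> + y - src.wt is) h *\<^sub>C tgt.fw is"
      using src.weight_spaceD(2)[OF tgt.fw_weight h, of "is"] by (simp add: src.wt_def tgt.wt_def)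
    moreover have "J (mact N h (src.fw is)) = form K (\<kappa> - src.wt is) h *\<^sub>C tgt.fw is"
      using src.weight_spaceD(2)[OF src.fw_weight h, of "is"] linear_on_scale[OF J(1) src.fw_carr] by (simp add: J_fw)
    moreover have "form K (\<kappa> + y - src.wt is) h = form K (\<kappa> - src.wt is) h + form K y h" by (simp add: src.fm_simps)
    ultimately show ?thesis by (simp add: J_fw cvec.scale_left_distrib)
  qed
qed

lemma J'_csa: assumes h: "h \<in> src.\<hh>" and m: "m \<in> mcarr N" shows "J' (mact N2 h (J m)) = mact N h m + form K y h *\<^sub>C m"
  using J_csa[OF assms] linear_on_add[OF J'(1)] linear_on_scale[OF J'(1)] J(2) m J'J by simp

lemma J_BV: "m \<in> mcarr N \<Longrightarrow> J (src.pr.BV m) = tgt.pr.BV (J m)"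
proof (rule src.fw_eq[where g = "\<lambda>m. J (src.pr.BV m)"])
  show "linear_on (mcarr N) (\<lambda>m. J (src.pr.BV m))"
    by (rule linear_on_compose[OF src.pr.BV_linear image_subsetI[OF src.pr.BV(2)] J(1)])
  show "linear_on (mcarr N) (\<lambda>m. tgt.pr.BV (J m))"
    by (rule linear_on_compose[OF J(1) image_subsetI[OF J(2)] tgt.pr.BV_linear])
  show "J (src.pr.BV (src.fw is)) = tgt.pr.BV (J (src.fw is))" for "is"
    by (induction "is") (auto simp: src.pr.BV tgt.pr.BV J src.fw_Cons src.f_nm src.B_nm)
qed

lemma J'_linear_simps: "m \<in> mcarr N2 \<Longrightarrow> m' \<in> mcarr N2 \<Longrightarrow> J' (m + m') = J' m + J' m'"
  "m \<in> mcarr N2 \<Longrightarrow> J' (c *\<^sub>C m) = c *\<^sub>C J' m" "m \<in> mcarr N2 \<Longrightarrow> m' \<in> mcarr N2 \<Longrightarrow> J' (m - m') = J' m - J' m'" "J' 0 = 0"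
  using J'(1) tgt.carr by (auto simp: linear_on_add linear_on_scale linear_on_diff linear_on_0)

lemma J'_BV: "m \<in> mcarr N \<Longrightarrow> J' (tgt.pr.BV (J m)) = src.pr.BV m"
  using J_BV J'J src.pr.BV(2) by metis

text \<open>The difference of the actions of \<open>\<gg>\<close> on \<open>M_\<^bsub>\<kappa>+y\<^esub>\<close> and \<open>M_\<kappa>\<close>, both identified with \<open>U\<nn>\<^sub>-\<close>. It kills
  \<open>\<nn>\<^sub>-\<close> and is scalar on \<open>\<hh>\<close>, so that the Casimir elements of the two modules give a first order equation
  for the twisted trace.\<close>

definition Df :: "'g \<Rightarrow> 'm \<Rightarrow> 'm" where "Df z m = J' (mact N2 z (J m)) - mact N z m"

lemma Df_carr [simp]: "m \<in> mcarr N \<Longrightarrow> Df z m \<in> mcarr N"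
  using J J' by (simp add: Df_def)

lemma Df_linear: "linear_on (mcarr N) (Df z)"
proof -
  have "linear_on (mcarr N) (\<lambda>m. J' (mact N2 z (J m)))"
    by (rule linear_on_compose[OF J(1) _ linear_on_compose[OF tgt.act_linear _ J'(1)]]) (use J(2) in auto)
  then show ?thesis using src.act_linear[of z] by (auto simp: Df_def linear_on_def algebra_simps cvec.scale_right_diff_distrib)
qed

lemma Df_left: assumes "m \<in> mcarr N" shows "linear_on UNIV (\<lambda>z. Df z m)"
  using assms J(2) by (auto simp: linear_on_def Df_def tgt.act_left_simps src.act_left_simps J'_linear_simps
      algebra_simps cvec.scale_right_diff_distrib)

lemma Df_csa: "h \<in> src.\<hh> \<Longrightarrow> m \<in> mcarr N \<Longrightarrow> Df h m = form K y h *\<^sub>C m"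
  by (simp add: Df_def J'_csa)

lemma Df_nm: assumes x: "x \<in> src.nm" and m: "m \<in> mcarr N" shows "Df z (mact N x m) = mact N x (Df z m) + Df (src.br z x) m"
proof -
  have "J' (mact N2 z (J (mact N x m))) = J' (mact N2 x (mact N2 z (J m)) + mact N2 (src.br z x) (J m))"
    using x m J by (simp add: tgt.act_swap[of _ z x])
  then show ?thesis
    using x m J J' by (simp add: Df_def J'_linear_simps src.act_swap[of _ z x] src.act_simps)
qed

lemma Df_adj: assumes a: "src.adj x x'" and m: "m \<in> mcarr N" shows "Df x (src.pr.BV m) = src.pr.BV (Df x' m)"
proof -
  have "J' (mact N2 x (J (src.pr.BV m))) = J' (tgt.pr.BV (mact N2 x' (J m)))"
    using m J(2) by (simp add: J_BV tgt.pr.BV_adj[OF a])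
  also have "\<dots> = src.pr.BV (J' (mact N2 x' (J m)))"
    using m J(2) J'_BV[of "J' (mact N2 x' (J m))"] J'(2) JJ' by simp
  finally show ?thesis
    using m J(2) J'(2) src.pr.BV(2) src.pr.BV_adj[OF a m]
    by (simp add: Df_def linear_on_diff[OF src.pr.BV_linear src.carr])
qed

lemma Df_shift:
  assumes h: "h \<in> src.\<hh>" and x: "src.br h x = c *\<^sub>C x" and m: "m \<in> mcarr N"
  shows "mact N h (Df x m) = Df x (mact N h m) + c *\<^sub>C Df x m"
proof -
  have 1: "mact N h (J' u) = J' (mact N2 h u) - form K y h *\<^sub>C J' u" if u: "u \<in> mcarr N2" for u
    using J'_csa[OF h J'(2)[OF u]] by (simp add: JJ'[OF u])
  have 2: "mact N2 h (mact N2 x (J m)) = mact N2 x (J (mact N h m)) + form K y h *\<^sub>C mact N2 x (J m) + c *\<^sub>C mact N2 x (J m)"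
    using m J(2) by (simp add: tgt.act_swap[of _ h x] J_csa[OF h m] x tgt.act_simps tgt.act_left_simps)
  have "mact N h (J' (mact N2 x (J m))) = J' (mact N2 x (J (mact N h m))) + c *\<^sub>C J' (mact N2 x (J m))"
    using m J(2) by (simp add: 1 2 J'_linear_simps)
  then show ?thesis
    using m J(2) J'(2) by (simp add: Df_def src.act_simps src.act_swap[of _ h x] x src.act_left_simps algebra_simps
        cvec.scale_right_diff_distrib)
qed

text \<open>The difference of the two Casimir identities. Shifting \<hh> by scalars changes the
  quadratic part by 2 y + (y, y) and the linear part by 2 (y, \<rho>), whereas \<Delta> changes by 2
  (\<kappa>, y) + (y, y) + 2 (y, \<rho>). The constants cancel.\<close>

lemma casimir_Df:
  assumes m: "m \<in> mcarr N"
  shows "\<forall>\<^sub>F n in sequentially. (\<Sum>a\<in>src.Rn n. mact N (src.F a) (Df (src.E a) m)) = form K \<kappa> y *\<^sub>C m - mact N y m"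
proof -
  have Jm: "J m \<in> mcarr N2" by (rule J(2)[OF m])
  let ?\<kappa> = "\<kappa> + y" and ?x = "src.\<xi>"
  have x: "?x j \<in> src.\<hh>" if "j \<in> src.I" for j by (rule src.onb_mem(3)[OF that])
  have yh: "y \<in> src.\<hh>" using y src.lsub_csa by simp
  have xx: "J' (mact N2 (?x j) (mact N2 (?x j) (J m))) = mact N (?x j) (mact N (?x j) m)
      + (2 * form K y (?x j)) *\<^sub>C mact N (?x j) m + (form K y (?x j) * form K y (?x j)) *\<^sub>C m" if j: "j \<in> src.I" for j
  proof -
    have "J' (mact N2 (?x j) (mact N2 (?x j) (J m))) = J' (mact N2 (?x j) (J (mact N (?x j) m + form K y (?x j) *\<^sub>C m)))"
      using J_csa[OF x[OF j] m] linear_on_add[OF J(1)] linear_on_scale[OF J(1)] m by simp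
    also have "\<dots> = mact N (?x j) (mact N (?x j) m + form K y (?x j) *\<^sub>C m)
        + form K y (?x j) *\<^sub>C (mact N (?x j) m + form K y (?x j) *\<^sub>C m)"
      by (rule J'_csa[OF x[OF j]]) (use m in simp)
    finally show ?thesis
      using m by (simp add: src.act_simps cvec.scale_right_distrib cvec.scale_left_distrib[of 1 1, simplified]
          cvec.scale_scale[symmetric] del: cvec.scale_scale)
  qed
  have ye: "y = (\<Sum>j\<in>src.I. form K y (?x j) *\<^sub>C ?x j)" by (rule src.csa_expand[OF yh])
  have s1: "(\<Sum>j\<in>src.I. (2 * form K y (?x j)) *\<^sub>C mact N (?x j) m) = 2 *\<^sub>C mact N y m"
    by (subst (2) ye) (simp add: src.act_left_sum m src.act_left_simps cvec.scale_sum_right)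
  have s2: "(\<Sum>j\<in>src.I. (form K y (?x j) * form K y (?x j)) *\<^sub>C m) = form K y y *\<^sub>C m"
  proof -
    have "form K y y = form K y (\<Sum>j\<in>src.I. form K y (?x j) *\<^sub>C ?x j)" using ye by simp
    then show ?thesis by (simp add: src.fm_sum src.fm_simps cvec.scale_sum_left)
  qed
  have D: "Delta K \<rho> ?\<kappa> = Delta K \<rho> \<kappa> + 2 * form K \<kappa> y + form K y y + 2 * form K y \<rho>"
    using src.fm_sym[of y \<kappa>] by (simp add: Delta_def src.fm_simps algebra_simps)
  show ?thesis
    using src.casimir[OF m] tgt.casimir[OF Jm]
  proof eventually_elim
    case (elim n)
    have c: "(\<Sum>a\<in>src.Rn n. mact N2 (src.F a) (mact N2 (src.E a) (J m))) \<in> mcarr N2"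
      "(\<Sum>j\<in>src.I. mact N2 (?x j) (mact N2 (?x j) (J m))) \<in> mcarr N2" using Jm by (auto intro: tgt.carr_sum)
    have "J' (2 *\<^sub>C (\<Sum>a\<in>src.Rn n. mact N2 (src.F a) (mact N2 (src.E a) (J m)))
      + (\<Sum>j\<in>src.I. mact N2 (?x j) (mact N2 (?x j) (J m))) + 2 *\<^sub>C mact N2 \<rho> (J m)) = Delta K \<rho> ?\<kappa> *\<^sub>C m"
      using elim(2) m Jm by (simp add: J'_linear_simps J'J)
    moreover have "J' (\<Sum>a\<in>src.Rn n. mact N2 (src.F a) (mact N2 (src.E a) (J m)))
        = (\<Sum>a\<in>src.Rn n. mact N (src.F a) (J' (mact N2 (src.E a) (J m))))"
      using Jm J'(4) src.F_nm src.Rn(1) by (subst linear_on_sum[OF J'(1) tgt.carr]) auto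
    moreover have "J' (\<Sum>j\<in>src.I. mact N2 (?x j) (mact N2 (?x j) (J m)))
        = (\<Sum>j\<in>src.I. mact N (?x j) (mact N (?x j) m)) + 2 *\<^sub>C mact N y m + form K y y *\<^sub>C m"
      using Jm xx by (subst linear_on_sum[OF J'(1) tgt.carr]) (auto simp: sum.distrib s1 s2)
    ultimately have 2: "2 *\<^sub>C (\<Sum>a\<in>src.Rn n. mact N (src.F a) (J' (mact N2 (src.E a) (J m))))
        + ((\<Sum>j\<in>src.I. mact N (?x j) (mact N (?x j) m)) + 2 *\<^sub>C mact N y m + form K y y *\<^sub>C m)
        + 2 *\<^sub>C (mact N \<rho> m + form K y \<rho> *\<^sub>C m) = Delta K \<rho> ?\<kappa> *\<^sub>C m"
      using c m Jm by (simp add: J'_linear_simps J'_csa[OF src.rho_csa m])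
    let ?S = "\<Sum>a\<in>src.Rn n. mact N (src.F a) (Df (src.E a) m)"
    have S: "?S = (\<Sum>a\<in>src.Rn n. mact N (src.F a) (J' (mact N2 (src.E a) (J m)))) - (\<Sum>a\<in>src.Rn n. mact N (src.F a) (mact N (src.E a) m))"
      using m Jm J'(2) by (simp add: Df_def src.act_simps sum_subtractf)
    have "2 *\<^sub>C ?S = (Delta K \<rho> ?\<kappa> - Delta K \<rho> \<kappa> - form K y y - 2 * form K y \<rho>) *\<^sub>C m - 2 *\<^sub>C mact N y m"
      unfolding S cvec.scale_right_diff_distrib cvec.scale_left_diff_distrib
      unfolding 2[symmetric] elim(1)[symmetric]
      by (simp add: cvec.scale_right_distrib cvec.scale_left_distrib cvec.scale_left_diff_distrib)
    also have "\<dots> = 2 *\<^sub>C (form K \<kappa> y *\<^sub>C m - mact N y m)"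
      unfolding D by (simp add: cvec.scale_right_diff_distrib)
    finally show ?case by simp
  qed
qed

text \<open>One turn around the trace: the adjoint carries the operator past B, cyclicity brings it
  back with the exponent raised, and moving it past F_a leaves a bracket behind.\<close>

lemma trace_step:
  assumes a: "a \<in> src.R"
  shows "src.tt (\<lambda>m. mact N (src.F a) (Df (src.Et l a) (src.pr.BV m))) \<eta>
    = src.tt (\<lambda>m. mact N (src.F a) (Df (src.Et (Suc l) a) (src.pr.BV m))) (\<eta> + src.rp a)
      + src.tt (\<lambda>m. Df (src.br (src.Et (Suc l) a) (src.F a)) (src.pr.BV m)) (\<eta> + src.rp a)"
proof -
  let ?x = "src.Et l a" and ?x' = "src.Et (Suc l) a" and ?F = "src.F a"
  have F: "?F \<in> src.nm" by (rule src.F_nm[OF a])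
  have "src.tt (\<lambda>m. mact N ?F (Df ?x (src.pr.BV m))) \<eta> = src.tt (\<lambda>m. mact N ?F (src.pr.BV (Df ?x' m))) \<eta>"
    by (rule src.tt_cong) (simp add: Df_adj[OF src.adj_Et[OF a]])
  also have "\<dots> = src.tt (\<lambda>m. Df ?x' (mact N ?F (src.pr.BV m))) (\<eta> + src.rp a)"
  proof (rule src.tt_cyclic[symmetric])
    show "linear_on (mcarr N) (\<lambda>m. mact N ?F (src.pr.BV m))"
      by (rule linear_on_compose[OF src.pr.BV_linear _ src.act_linear]) (use src.pr.BV(2) in auto)
    fix x m assume x: "x \<in> src.\<ll>" and m: "m \<in> mcarr N"
    show "mact N x (Df ?x' m) = Df ?x' (mact N x m) + form K (src.rp a) x *\<^sub>C Df ?x' m"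
      using Df_shift[OF src.lsub_csa[OF x] src.br_lsub_Et[OF a x] m] src.rp(5)[OF a x] by simp
  qed (use Df_linear src.pr.BV(2) src.rp[OF a] in auto)
  also have "\<dots> = src.tt (\<lambda>m. mact N ?F (Df ?x' (src.pr.BV m)) + Df (src.br ?x' ?F) (src.pr.BV m)) (\<eta> + src.rp a)"
    by (rule src.tt_cong) (simp add: Df_nm[OF F] src.pr.BV(2))
  also have "\<dots> = src.tt (\<lambda>m. mact N ?F (Df ?x' (src.pr.BV m))) (\<eta> + src.rp a)
      + src.tt (\<lambda>m. Df (src.br ?x' ?F) (src.pr.BV m)) (\<eta> + src.rp a)"
    by (rule src.tt_add) (use src.pr.BV(2) in auto)
  finally show ?thesis .
qed

lemma trace_iterate:
  assumes a: "a \<in> src.R"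
  shows "src.tt (\<lambda>m. mact N (src.F a) (Df (src.E a) (src.pr.BV m))) \<eta>
    = src.tt (\<lambda>m. mact N (src.F a) (Df (src.Et n a) (src.pr.BV m))) (\<eta> + of_nat n *\<^sub>C src.rp a)
      + (\<Sum>l\<in>{1..n}. src.tt (\<lambda>m. Df (src.br (src.Et l a) (src.F a)) (src.pr.BV m)) (\<eta> + of_nat l *\<^sub>C src.rp a))"
proof (induction n)
  case 0
  then show ?case by (simp add: src.Et_0[OF a])
next
  case (Suc n)
  have "\<eta> + of_nat n *\<^sub>C src.rp a + src.rp a = \<eta> + of_nat (Suc n) *\<^sub>C src.rp a"
    by (simp add: cvec.scale_left_distrib add_ac)
  then show ?case using Suc trace_step[OF a, of n "\<eta> + of_nat n *\<^sub>C src.rp a"]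
    by (simp only: sum.nat_ivl_Suc' le_add1 Suc_eq_plus1_left[symmetric]) (simp add: add_ac)
qed

text \<open>The differential equation of the trace in the direction y. After transposing powers of
  B, the brackets become multiples of \<alpha>, on which \<open>Df\<close> is the scalar (\<alpha>,
  y).\<close>

lemma trace_equation:
  "\<forall>\<^sub>F n in sequentially. (form K \<kappa> y - form K \<eta> y) * src.G \<eta>
    = (\<Sum>a\<in>src.Rn n. \<Sum>l\<in>{1..n}. src.zc l a * form K (fst a) y * src.G (\<eta> + of_nat l *\<^sub>C src.rp a))"
proof (cases "\<eta> \<in> src.\<ll>")
  case False
  have "\<eta> + of_nat l *\<^sub>C src.rp a \<notin> src.\<ll>" if "a \<in> src.R" for a l
    using False cvec.subspace_diff[OF src.lsub_subspace _ src.lsub_of_nat[OF src.rp(2)[OF that]], of "\<eta> + of_nat l *\<^sub>C src.rp a" l] by auto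
  then show ?thesis using False src.Rn(1) by (simp add: src.tt_outside)
next
  case True
  let ?B = "src.pr.BV"
  have fin: "finite (src.Bl \<eta>)" by (rule src.finite_Bl[OF True])
  have "\<forall>\<^sub>F n in sequentially. \<forall>b\<in>src.Bl \<eta>.
      (\<Sum>a\<in>src.Rn n. mact N (src.F a) (Df (src.E a) (?B b))) = form K \<kappa> y *\<^sub>C ?B b - mact N y (?B b)"
    using casimir_Df[OF src.pr.BV(2)] src.Bs(3) by (intro eventually_ball_finite[OF fin]) (auto simp: src.Bl_def)
  \<comment> \<open>With this n the remainder after n turns is beyond the support of the
    trace.\<close>
  moreover have "\<forall>\<^sub>F n in sequentially. n > src.ht (\<kappa> - \<eta>)" by (rule eventually_gt_at_top)
  ultimately show ?thesis
  proof eventually_elim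
    case (elim n)
    have "src.tt (\<lambda>m. \<Sum>a\<in>src.Rn n. mact N (src.F a) (Df (src.E a) (?B m))) \<eta>
        = src.tt (\<lambda>m. form K \<kappa> y *\<^sub>C ?B m + (-1) *\<^sub>C mact N y (?B m)) \<eta>"
      using elim(1) True by (simp add: src.tt_eq)
    also have "\<dots> = form K \<kappa> y * src.G \<eta> + (-1) * src.tt (\<lambda>m. mact N y (?B m)) \<eta>"
      using src.pr.BV(2) by (simp only: src.tt_add src.tt_scale src.carr_simps src.act_carr)
    also have "src.tt (\<lambda>m. mact N y (?B m)) \<eta> = src.tt (\<lambda>m. ?B (mact N y m)) \<eta>"
      by (rule src.tt_cong) (rule src.pr.BV_csa[OF src.compat_lsub[OF y] refl])
    also have "\<dots> = form K \<eta> y * src.G \<eta>" by (rule src.tt_lsub[OF src.pr.BV_linear src.pr.BV(2) y])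
    finally have 1: "(form K \<kappa> y - form K \<eta> y) * src.G \<eta>
        = (\<Sum>a\<in>src.Rn n. src.tt (\<lambda>m. mact N (src.F a) (Df (src.E a) (?B m))) \<eta>)"
      using src.pr.BV(2) by (simp add: src.tt_sum algebra_simps)
    also have "\<dots> = (\<Sum>a\<in>src.Rn n. \<Sum>l\<in>{1..n}.
        src.tt (\<lambda>m. Df (src.br (src.Et l a) (src.F a)) (?B m)) (\<eta> + of_nat l *\<^sub>C src.rp a))"
    proof (rule sum.cong[OF refl])
      fix a assume "a \<in> src.Rn n"
      then have a: "a \<in> src.R" by (rule src.Rn)
      show "src.tt (\<lambda>m. mact N (src.F a) (Df (src.E a) (?B m))) \<eta> = (\<Sum>l\<in>{1..n}.
        src.tt (\<lambda>m. Df (src.br (src.Et l a) (src.F a)) (?B m)) (\<eta> + of_nat l *\<^sub>C src.rp a))"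
        using trace_iterate[OF a, of \<eta> n] src.tt_shift_0[OF a, of \<eta> n] elim(2) by simp
    qed
    also have "\<dots> = (\<Sum>l\<in>{1..n}. \<Sum>a\<in>src.Rn n.
        src.tt (\<lambda>m. Df (src.br (src.Et l a) (src.F a)) (?B m)) (\<eta> + of_nat l *\<^sub>C src.rp a))"
      by (rule sum.swap)
    also have "\<dots> = (\<Sum>l\<in>{1..n}. \<Sum>a\<in>src.Rn n. src.zc l a * form K (fst a) y * src.G (\<eta> + of_nat l *\<^sub>C src.rp a))"
    proof (rule sum.cong[OF refl])
      fix l
      let ?g = "\<lambda>x z r. src.tt (\<lambda>m. Df (src.br x z) (?B m)) (\<eta> + of_nat l *\<^sub>C r)"
      have lin: "linear_on UNIV (\<lambda>x. src.tt (\<lambda>m. Df x (?B m)) \<zeta>)" for \<zeta>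
        unfolding linear_on_def
        using src.pr.BV(2) Df_left src.tt_add[of "\<lambda>m. Df _ (?B m)" "\<lambda>m. Df _ (?B m)"]
        by (auto simp: linear_on_def src.tt_scale[of "\<lambda>m. Df _ (?B m)", symmetric] src.tt_add[of "\<lambda>m. Df _ (?B m)" "\<lambda>m. Df _ (?B m)", symmetric]
            intro!: src.tt_cong)
      have "(\<Sum>a\<in>src.Rn n. ?g (src.Et l a) (src.F a) (src.rp a)) = (\<Sum>a\<in>src.Rn n. ?g (src.E a) ((src.B ^^ l) (src.F a)) (src.rp a))"
        by (rule src.sum_adjoint)
          (use linear_on_compose[OF src.linear_br(1) _ lin] linear_on_compose[OF src.linear_br(2) _ lin] in auto)
      also have "\<dots> = (\<Sum>a\<in>src.Rn n. src.zc l a * form K (fst a) y * src.G (\<eta> + of_nat l *\<^sub>C src.rp a))"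
      proof (rule sum.cong[OF refl])
        fix a assume "a \<in> src.Rn n"
        then have a: "a \<in> src.R" by (rule src.Rn)
        have "src.tt (\<lambda>m. Df (src.br (src.E a) ((src.B ^^ l) (src.F a))) (?B m)) \<zeta>
            = src.tt (\<lambda>m. (src.zc l a * form K (fst a) y) *\<^sub>C ?B m) \<zeta>" for \<zeta>
          using src.pr.BV(2) linear_on_scale[OF Df_left] src.fm_sym[of y]
          by (intro src.tt_cong) (simp add: src.br_E_B_pow_F[OF a] Df_csa src.rootD(4)[OF a])
        then show "?g (src.E a) ((src.B ^^ l) (src.F a)) (src.rp a) = src.zc l a * form K (fst a) y * src.G (\<eta> + of_nat l *\<^sub>C src.rp a)"
          using src.pr.BV(2) by (simp add: src.tt_scale)
      qed
      finally show "(\<Sum>a\<in>src.Rn n. ?g (src.Et l a) (src.F a) (src.rp a)) = \<dots>" .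
    qed
    also have "\<dots> = (\<Sum>a\<in>src.Rn n. \<Sum>l\<in>{1..n}. src.zc l a * form K (fst a) y * src.G (\<eta> + of_nat l *\<^sub>C src.rp a))"
      by (rule sum.swap)
    finally show ?case .
  qed
qed

end

section \<open>Formal series\<close>

context bd_setting
begin

abbreviation "sm \<equiv> series_mult K \<tau>"

text \<open>Support in a single cone below the top exponent t. This refines
  \<open>formal_series\<close>: tops add up under products, and coefficients of products become
  finite sums.\<close>

definition bdd :: "'g \<Rightarrow> ('g \<Rightarrow> 'z::zero) \<Rightarrow> bool" where
  "bdd t G \<longleftrightarrow> t \<in> \<ll> \<and> (\<forall>\<eta>. G \<eta> \<noteq> 0 \<longrightarrow> t - \<eta> \<in> cone)"

text \<open>An interval of the order given by the cone. Heights add up along it, which makes it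
  finite; it is the range of summation in a coefficient of a product.\<close>

definition iv :: "'g \<Rightarrow> 'g \<Rightarrow> 'g set" where "iv a b = {x. x - a \<in> cone \<and> b - x \<in> cone}"

lemma ht_diff_cone: assumes "b - a \<in> cone" "x \<in> iv a b" shows "ht (x - a) + ht (b - x) = ht (b - a)"
  using ht_add_cone[of "x - a" "b - x"] assms by (simp add: iv_def)

lemma iv_cone: "x \<in> iv a b \<Longrightarrow> b - a \<in> cone"
  using cone_add[of "x - a" "b - x"] by (simp add: iv_def)

lemma finite_iv: "finite (iv a b)"
proof (rule finite_subset)
  show "iv a b \<subseteq> (\<lambda>\<gamma>. a + \<gamma>) ` {\<gamma> \<in> cone. ht \<gamma> \<le> ht (b - a)}"
  proof
    fix x assume x: "x \<in> iv a b"
    then have "ht (x - a) \<le> ht (b - a)" using ht_diff_cone[OF iv_cone] by (metis le_add1)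
    then show "x \<in> (\<lambda>\<gamma>. a + \<gamma>) ` {\<gamma> \<in> cone. ht \<gamma> \<le> ht (b - a)}"
      using x by (intro image_eqI[of _ _ "x - a"]) (auto simp: iv_def)
  qed
qed (use finite_cone in auto)

lemma bddD: assumes "bdd t G" shows "t \<in> \<ll>" "G \<eta> \<noteq> 0 \<Longrightarrow> t - \<eta> \<in> cone" "G \<eta> \<noteq> 0 \<Longrightarrow> \<eta> \<in> \<ll>"
proof -
  show 1: "t \<in> \<ll>" "G \<eta> \<noteq> 0 \<Longrightarrow> t - \<eta> \<in> cone" using assms by (auto simp: bdd_def)
  show "G \<eta> \<noteq> 0 \<Longrightarrow> \<eta> \<in> \<ll>" using cvec.subspace_diff[OF lsub_subspace 1(1) cone_lsub[OF 1(2)]] by simp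
qed

lemma lsub_simps: "x \<in> \<ll> \<Longrightarrow> y \<in> \<ll> \<Longrightarrow> x + y \<in> \<ll>" "x \<in> \<ll> \<Longrightarrow> y \<in> \<ll> \<Longrightarrow> x - y \<in> \<ll>" "x \<in> \<ll> \<Longrightarrow> - x \<in> \<ll>" "0 \<in> \<ll>"
  using lsub_subspace by (auto simp: cvec.subspace_add cvec.subspace_diff cvec.subspace_0 cvec.subspace_neg)

lemma bdd_formal_series: "bdd t G \<Longrightarrow> formal_series K \<tau> G"
  unfolding formal_series_def by (rule exI[of _ "{t}"]) (auto simp: cone_def[symmetric] dest: bddD)

lemma bdd_shift: assumes "bdd t G" "c \<in> cone" shows "bdd t (\<lambda>\<eta>. G (\<eta> + c))"
  unfolding bdd_def
proof (intro conjI allI impI)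
  fix \<eta> assume "G (\<eta> + c) \<noteq> 0"
  then show "t - \<eta> \<in> cone" using cone_add[OF bddD(2)[OF assms(1)] assms(2)] by fastforce
qed (rule bddD[OF assms(1)])

lemma conv_eq:
  assumes "bdd s d" "bdd t G" "finite X" "iv (\<eta> - t) s \<subseteq> X"
  shows "sm d G \<eta> = (\<Sum>\<xi>\<in>X. d \<xi> *\<^sub>C G (\<eta> - \<xi>))"
proof -
  have iv: "\<xi> \<in> iv (\<eta> - t) s" if "d \<xi> *\<^sub>C G (\<eta> - \<xi>) \<noteq> 0" for \<xi>
    using bddD(2)[OF assms(1), of \<xi>] bddD(2)[OF assms(2), of "\<eta> - \<xi>"] that by (auto simp: iv_def algebra_simps)
  have l: "\<xi> \<in> \<ll>" if "\<xi> \<in> iv (\<eta> - t) s" for \<xi>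
    using that lsub_simps(2)[OF bddD(1)[OF assms(1)] cone_lsub[of "s - \<xi>"]] by (simp add: iv_def)
  have "sm d G \<eta> = (\<Sum>\<xi>\<in>iv (\<eta> - t) s. d \<xi> *\<^sub>C G (\<eta> - \<xi>))"
    unfolding series_mult_def by (rule lfsum_eq_sum) (use finite_iv iv l in auto)
  also have "\<dots> = (\<Sum>\<xi>\<in>X. d \<xi> *\<^sub>C G (\<eta> - \<xi>))"
    by (rule sum.mono_neutral_left) (use assms iv in auto)
  finally show ?thesis .
qed

lemma conv_bdd: assumes "bdd s d" "bdd t G" shows "bdd (s + t) (sm d G)"
  unfolding bdd_def
proof (intro conjI allI impI)
  show "s + t \<in> \<ll>" using assms by (auto intro: lsub_simps dest: bddD)
  fix \<eta> assume "sm d G \<eta> \<noteq> 0"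
  then have "iv (\<eta> - t) s \<noteq> {}" using conv_eq[OF assms finite_iv order_refl, of \<eta>] by auto
  then show "s + t - \<eta> \<in> cone" using iv_cone by (fastforce simp: algebra_simps)
qed

lemma conv_comm: fixes G :: "'g \<Rightarrow> complex" assumes "bdd s d" "bdd t G" shows "sm d G \<eta> = sm G d \<eta>"
  unfolding conv_eq[OF assms finite_iv order_refl] conv_eq[OF assms(2,1) finite_iv order_refl]
  by (rule sum.reindex_bij_witness[of _ "\<lambda>x. \<eta> - x" "\<lambda>x. \<eta> - x"]) (auto simp: iv_def algebra_simps scaleC_complex)

lemma conv_shift: "sm d (\<lambda>\<eta>. G (\<eta> + c)) \<eta> = sm d G (\<eta> + c)"
  by (simp add: series_mult_def algebra_simps)

lemma conv_add:
  fixes G H :: "'g \<Rightarrow> complex"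
  assumes "bdd s d" "bdd t G" "bdd t H"
  shows "sm d (\<lambda>\<eta>. G \<eta> + H \<eta>) \<eta> = sm d G \<eta> + sm d H \<eta>" "bdd t (\<lambda>\<eta>. G \<eta> + H \<eta>)"
proof -
  show 1: "bdd t (\<lambda>\<eta>. G \<eta> + H \<eta>)" using assms(2,3) unfolding bdd_def by (metis add_0)
  show "sm d (\<lambda>\<eta>. G \<eta> + H \<eta>) \<eta> = sm d G \<eta> + sm d H \<eta>"
    by (simp add: conv_eq[OF assms(1) 1 finite_iv order_refl] conv_eq[OF assms(1,2) finite_iv order_refl]
        conv_eq[OF assms(1,3) finite_iv order_refl] sum.distrib algebra_simps)
qed

lemma conv_scale:
  fixes G :: "'g \<Rightarrow> complex"
  assumes "bdd s d" "bdd t G"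
  shows "sm d (\<lambda>\<eta>. c * G \<eta>) \<eta> = c * sm d G \<eta>" "bdd t (\<lambda>\<eta>. k \<eta> * G \<eta>)"
proof -
  show 1: "bdd t (\<lambda>\<eta>. k \<eta> * G \<eta>)" for k using assms(2) by (auto simp: bdd_def)
  show "sm d (\<lambda>\<eta>. c * G \<eta>) \<eta> = c * sm d G \<eta>"
    by (simp add: conv_eq[OF assms(1) 1 finite_iv order_refl] conv_eq[OF assms(1,2) finite_iv order_refl]
        sum_distrib_left scaleC_complex algebra_simps)
qed

lemma conv_deriv:
  fixes G :: "'g \<Rightarrow> complex"
  assumes "bdd s d" "bdd t G"
  shows "fm \<eta> y * sm d G \<eta> = sm (\<lambda>\<xi>. fm \<xi> y * d \<xi>) G \<eta> + sm d (\<lambda>\<eta>. fm \<eta> y * G \<eta>) \<eta>"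
  unfolding conv_eq[OF assms finite_iv order_refl] conv_eq[OF assms(1) conv_scale(2)[OF assms] finite_iv order_refl]
    conv_eq[OF conv_scale(2)[OF assms(1,1)] assms(2) finite_iv order_refl]
  by (simp add: sum_distrib_left sum.distrib[symmetric] fm_simps scaleC_complex algebra_simps)

section \<open>The multiplication operator in the logarithmic derivative\<close>

definition psum :: "('g \<times> nat \<Rightarrow> nat \<Rightarrow> complex) \<Rightarrow> complex" where
  "psum h = lfsum (R \<times> {1..}) (\<lambda>(a, l). h a l)"

lemma psum_eq:
  assumes "\<And>a l. a \<in> R \<Longrightarrow> h a l \<noteq> 0 \<Longrightarrow> l * ht (fst a) \<le> n"
  shows "psum h = (\<Sum>a\<in>Rn n. \<Sum>l\<in>{1..n}. h a l)"
proof -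
  have "psum h = (\<Sum>(a, l)\<in>Rn n \<times> {1..n}. h a l)"
    unfolding psum_def
  proof (rule lfsum_eq_sum)
    fix s assume s: "s \<in> R \<times> {1::nat..}" "s \<notin> Rn n \<times> {1..n}"
    obtain a l where al: "s = (a, l)" by (cases s)
    have "ht (fst a) > 0" "l > 0" using s al rootD(5) by auto
    then have "ht (fst a) \<le> l * ht (fst a)" "l \<le> l * ht (fst a)" by simp_all
    moreover have "a \<in> R" "\<not> (ht (fst a) \<le> n \<and> l \<le> n)" using s al \<open>l > 0\<close> by (auto simp: Rn_def)
    ultimately have "h a l = 0" using assms[of a l] by linarith
    then show "(case s of (a, l) \<Rightarrow> h a l) = 0" by (simp add: al)
  qed (use finite_Rn Rn in auto)
  then show ?thesis by (simp add: sum.cartesian_product)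
qed

text \<open>Multiplication by the series with coefficients \<open>zc l a\<close> (\<alpha>, y) at
  e^{-l(\<alpha>,\<lambda>)}. Together with the constant (\<rho>, y) this series turns out to be the
  logarithmic derivative of \<delta>_B along y.\<close>

definition P :: "'g \<Rightarrow> ('g \<Rightarrow> complex) \<Rightarrow> 'g \<Rightarrow> complex" where
  "P y G \<eta> = psum (\<lambda>a l. zc l a * fm (fst a) y * G (\<eta> + of_nat l *\<^sub>C rp a))"

lemma bdd_rp_ht: assumes "bdd t G" "a \<in> R" "G (\<eta> + of_nat l *\<^sub>C rp a) \<noteq> 0"
  shows "t - \<eta> \<in> cone" "l * ht (fst a) \<le> ht (t - \<eta>)"
proof -
  have c: "t - (\<eta> + of_nat l *\<^sub>C rp a) \<in> cone" "of_nat l *\<^sub>C rp a \<in> cone"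
    using bddD(2)[OF assms(1,3)] cone_of_nat[OF rp(1)[OF assms(2)]] by auto
  then show "t - \<eta> \<in> cone" using cone_add[OF c] by (simp add: algebra_simps)
  show "l * ht (fst a) \<le> ht (t - \<eta>)"
    using ht_add_cone[OF c] ht_of_nat[OF rp(1)[OF assms(2)]] rp(3)[OF assms(2)] by (simp add: algebra_simps)
qed

lemma P_eq:
  assumes "bdd t G" "ht (t - \<eta>) \<le> n"
  shows "P y G \<eta> = (\<Sum>a\<in>Rn n. \<Sum>l\<in>{1..n}. zc l a * fm (fst a) y * G (\<eta> + of_nat l *\<^sub>C rp a))"
  unfolding P_def by (rule psum_eq) (use bdd_rp_ht(2)[OF assms(1)] assms(2) in fastforce)

lemma P_bdd: assumes "bdd t G" shows "bdd t (P y G)"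
  unfolding bdd_def
proof (intro conjI allI impI)
  fix \<eta> assume "P y G \<eta> \<noteq> 0"
  then obtain a l where "a \<in> Rn (ht (t - \<eta>))" "G (\<eta> + of_nat l *\<^sub>C rp a) \<noteq> 0"
    unfolding P_eq[OF assms order_refl] by (metis (no_types, lifting) mult_zero_right sum.neutral)
  then show "t - \<eta> \<in> cone" using bdd_rp_ht(1)[OF assms] Rn(1) by blast
qed (rule bddD[OF assms])

text \<open>\<open>P y\<close> multiplies by a fixed series, so it passes through products. The
  cut-off belonging to the top s + t of the product serves for all terms at once.\<close>

lemma conv_P_right:
  assumes d: "bdd s d" and G: "bdd t G" shows "sm d (P y G) \<eta> = P y (sm d G) \<eta>"
proof -
  let ?n = "ht (s + t - \<eta>)" and ?X = "iv (\<eta> - t) s"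
  let ?k = "\<lambda>a l. zc l a * fm (fst a) y"
  have "sm d (P y G) \<eta> = (\<Sum>\<xi>\<in>?X. d \<xi> * (\<Sum>a\<in>Rn ?n. \<Sum>l\<in>{1..?n}. ?k a l * G (\<eta> - \<xi> + of_nat l *\<^sub>C rp a)))"
    unfolding conv_eq[OF d P_bdd[OF G] finite_iv order_refl] scaleC_complex
  proof (rule sum.cong[OF refl])
    fix \<xi> assume x: "\<xi> \<in> ?X"
    have "ht (t - (\<eta> - \<xi>)) \<le> ?n"
      using ht_diff_cone[OF iv_cone[OF x] x] by (simp add: algebra_simps)
    then show "d \<xi> * P y G (\<eta> - \<xi>) = d \<xi> * (\<Sum>a\<in>Rn ?n. \<Sum>l\<in>{1..?n}. ?k a l * G (\<eta> - \<xi> + of_nat l *\<^sub>C rp a))"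
      by (simp only: P_eq[OF G])
  qed
  also have "\<dots> = (\<Sum>a\<in>Rn ?n. \<Sum>l\<in>{1..?n}. ?k a l * (\<Sum>\<xi>\<in>?X. d \<xi> * G (\<eta> + of_nat l *\<^sub>C rp a - \<xi>)))"
    unfolding sum_distrib_left sum.swap[of _ _ ?X] by (simp only: mult.left_commute diff_add_eq)
  also have "\<dots> = (\<Sum>a\<in>Rn ?n. \<Sum>l\<in>{1..?n}. ?k a l * sm d G (\<eta> + of_nat l *\<^sub>C rp a))"
  proof (intro sum.cong refl arg_cong[where f = "(*) (?k _ _)"])
    fix a l assume "a \<in> Rn ?n"
    then have c: "of_nat l *\<^sub>C rp a \<in> cone" using cone_of_nat rp(1) Rn(1) by blast
    have "iv (\<eta> + of_nat l *\<^sub>C rp a - t) s \<subseteq> ?X"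
      using cone_add[OF _ c] by (fastforce simp: iv_def algebra_simps)
    then show "(\<Sum>\<xi>\<in>?X. d \<xi> * G (\<eta> + of_nat l *\<^sub>C rp a - \<xi>)) = sm d G (\<eta> + of_nat l *\<^sub>C rp a)"
      by (simp add: conv_eq[OF d G finite_iv] scaleC_complex)
  qed
  also have "\<dots> = P y (sm d G) \<eta>" by (rule P_eq[OF conv_bdd[OF d G] order_refl, symmetric])
  finally show ?thesis .
qed

lemma conv_P_left: assumes d: "bdd s d" and G: "bdd t G" shows "sm (P y d) G \<eta> = P y (sm d G) \<eta>"
proof -
  have "sm G d = sm d G" using conv_comm[OF d G] by auto
  then show ?thesis using conv_comm[OF P_bdd[OF d] G] conv_P_right[OF G d] by simp
qed

text \<open>Two series with the same product with \<open>G\<close> agree: compare the coefficients at a maximal exponent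
  where they differ.\<close>

lemma conv_inj:
  fixes G :: "'g \<Rightarrow> complex"
  assumes G: "bdd t G" "G t = 1" and d: "formal_series K \<tau> d1" "formal_series K \<tau> d2" and eq: "sm d1 G = sm d2 G"
  shows "d1 = d2"
proof (rule ccontr)
  assume "d1 \<noteq> d2"
  then obtain \<xi>0 where x0: "d1 \<xi>0 \<noteq> d2 \<xi>0" by blast
  obtain S where S: "finite S" "S \<subseteq> \<ll>" "\<And>\<xi>. d1 \<xi> \<noteq> 0 \<or> d2 \<xi> \<noteq> 0 \<Longrightarrow> \<xi> \<in> \<ll> \<and> (\<exists>s\<in>S. s - \<xi> \<in> cone)"
  proof -
    obtain S1 S2 where "finite S1" "S1 \<subseteq> \<ll>" "\<forall>\<xi>. d1 \<xi> \<noteq> 0 \<longrightarrow> \<xi> \<in> \<ll> \<and> (\<exists>s\<in>S1. s - \<xi> \<in> cone)"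
      "finite S2" "S2 \<subseteq> \<ll>" "\<forall>\<xi>. d2 \<xi> \<noteq> 0 \<longrightarrow> \<xi> \<in> \<ll> \<and> (\<exists>s\<in>S2. s - \<xi> \<in> cone)"
      using d unfolding formal_series_def cone_def[symmetric] by metis
    then show ?thesis by (intro that[of "S1 \<union> S2"]) auto
  qed
  define X where "X = (\<lambda>\<zeta>. \<Union>s\<in>S. iv \<zeta> s)"
  have finX: "finite (X \<zeta>)" for \<zeta> using S(1) finite_iv by (auto simp: X_def)
  have X: "\<xi> \<in> X \<zeta>" if "d1 \<xi> \<noteq> 0 \<or> d2 \<xi> \<noteq> 0" "\<xi> - \<zeta> \<in> cone" for \<xi> \<zeta>
    using S(3)[OF that(1)] that(2) by (auto simp: X_def iv_def)
  have Xl: "X \<zeta> \<subseteq> \<ll>" for \<zeta>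
    using S(2) lsub_simps(2)[OF _ cone_lsub] by (fastforce simp: X_def iv_def)
  let ?A = "{\<xi> \<in> X \<xi>0. d1 \<xi> \<noteq> d2 \<xi>}"
  have "d1 \<xi>0 \<noteq> 0 \<or> d2 \<xi>0 \<noteq> 0" using x0 by auto
  then have "\<xi>0 \<in> ?A" using x0 X[of \<xi>0 \<xi>0] cone_0 by simp
  then have "Max ((\<lambda>\<xi>. ht (\<xi> - \<xi>0)) ` ?A) \<in> (\<lambda>\<xi>. ht (\<xi> - \<xi>0)) ` ?A" using finX by (intro Max_in) auto
  then obtain \<zeta> where z: "\<zeta> \<in> X \<xi>0" "d1 \<zeta> \<noteq> d2 \<zeta>" and "ht (\<zeta> - \<xi>0) = Max ((\<lambda>\<xi>. ht (\<xi> - \<xi>0)) ` ?A)" by auto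
  then have max: "\<And>\<xi>. \<xi> \<in> ?A \<Longrightarrow> ht (\<xi> - \<xi>0) \<le> ht (\<zeta> - \<xi>0)" using finX by auto
  have sum: "sm d' G (\<zeta> + t) = (\<Sum>\<xi>\<in>X \<zeta>. d' \<xi> * G (\<zeta> + t - \<xi>))" if "d' = d1 \<or> d' = d2" for d'
    unfolding series_mult_def scaleC_complex
  proof (rule lfsum_eq_sum[OF finX Xl])
    fix \<xi> assume "\<xi> \<notin> X \<zeta>"
    then show "d' \<xi> * G (\<zeta> + t - \<xi>) = 0"
      using X[of \<xi> \<zeta>] that bddD(2)[OF G(1), of "\<zeta> + t - \<xi>"] by (auto simp: algebra_simps)
  qed
  have "(\<Sum>\<xi>\<in>X \<zeta>. (d1 \<xi> - d2 \<xi>) * G (\<zeta> + t - \<xi>)) = 0"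
    using eq sum[of d1] sum[of d2] by (simp add: algebra_simps sum_subtractf)
  moreover have "(\<Sum>\<xi>\<in>X \<zeta>. (d1 \<xi> - d2 \<xi>) * G (\<zeta> + t - \<xi>)) = (\<Sum>\<xi>\<in>{\<zeta>}. (d1 \<xi> - d2 \<xi>) * G (\<zeta> + t - \<xi>))"
  proof (rule sum.mono_neutral_right[OF finX])
    have "d1 \<zeta> \<noteq> 0 \<or> d2 \<zeta> \<noteq> 0" using z(2) by auto
    then show "{\<zeta>} \<subseteq> X \<zeta>" using X[of \<zeta> \<zeta>] cone_0 by simp
    show "\<forall>\<xi>\<in>X \<zeta> - {\<zeta>}. (d1 \<xi> - d2 \<xi>) * G (\<zeta> + t - \<xi>) = 0"
    proof
      fix \<xi> assume x: "\<xi> \<in> X \<zeta> - {\<zeta>}"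
      then have c: "\<xi> - \<zeta> \<in> cone" "\<zeta> - \<xi>0 \<in> cone" using z(1) by (auto simp: X_def iv_def)
      have "\<xi> - \<xi>0 \<in> cone" using cone_add[OF c] by simp
      then have "\<xi> \<in> X \<xi>0" using x by (auto simp: X_def iv_def)
      moreover have "ht (\<xi> - \<xi>0) = ht (\<xi> - \<zeta>) + ht (\<zeta> - \<xi>0)" using ht_add_cone[OF c] by simp
      moreover have "ht (\<xi> - \<zeta>) > 0" using ht_pos_cone[OF c(1)] x by simp
      ultimately have "d1 \<xi> = d2 \<xi>" using max[of \<xi>] by force
      then show "(d1 \<xi> - d2 \<xi>) * G (\<zeta> + t - \<xi>) = 0" by simp
    qed
  qed
  ultimately show False using z(2) G(2) by simp
qed

end

section \<open>Inverses of series with leading coefficient 1\<close>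

locale unital_series = bd_setting K \<tau> D \<rho>
  for K :: "('n::finite, 'g::complex_vector) km_algebra" and \<tau> D \<rho> +
  fixes G :: "'g \<Rightarrow> complex" and t :: 'g
  assumes G: "bdd t G" "G t = 1"
begin

text \<open>\<open>ic \<gamma>\<close> is the coefficient of the inverse at depth \<gamma> below its
  top exponent -t. The recursion expresses that the product has no coefficient besides the leading
  one; the height decreases because \<delta> \<noteq> 0.\<close>

function ic :: "'g \<Rightarrow> complex" where
  "ic \<gamma> = (if \<gamma> \<in> cone then if \<gamma> = 0 then 1 else - (\<Sum>\<delta>\<in>{\<delta>. \<delta> \<noteq> 0 \<and> \<delta> \<in> iv 0 \<gamma>}. G (t - \<delta>) * ic (\<gamma> - \<delta>)) else 0)"
  by auto

termination
proof (relation "measure ht")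
  fix \<gamma> \<delta> assume a: "\<gamma> \<in> cone" "\<gamma> \<noteq> 0" "\<delta> \<in> {\<delta>. \<delta> \<noteq> 0 \<and> \<delta> \<in> iv 0 \<gamma>}"
  then show "(\<gamma> - \<delta>, \<gamma>) \<in> measure ht"
    using ht_diff_cone[of \<gamma> 0 \<delta>] ht_pos_cone[of \<delta>] by (auto simp: iv_def)
qed simp

declare ic.simps [simp del]

lemma inverse_exists: "bdd (- t) (\<lambda>\<xi>. ic (- t - \<xi>))" "sm (\<lambda>\<xi>. ic (- t - \<xi>)) G = series_one"
proof -
  have ic0: "ic \<gamma> \<noteq> 0 \<Longrightarrow> \<gamma> \<in> cone" for \<gamma> by (subst (asm) ic.simps) (auto split: if_splits)
  show b: "bdd (- t) (\<lambda>\<xi>. ic (- t - \<xi>))" using ic0 bddD(1)[OF G(1)] lsub_simps(3) by (auto simp: bdd_def)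
  show "sm (\<lambda>\<xi>. ic (- t - \<xi>)) G = series_one"
  proof
    fix \<eta>
    have "sm (\<lambda>\<xi>. ic (- t - \<xi>)) G \<eta> = (\<Sum>\<delta>\<in>iv 0 (- \<eta>). G (t - \<delta>) * ic (- \<eta> - \<delta>))"
      unfolding conv_eq[OF b G(1) finite_iv order_refl]
      by (rule sum.reindex_bij_witness[of _ "\<lambda>x. \<eta> - t + x" "\<lambda>x. x - (\<eta> - t)"])
        (auto simp: iv_def algebra_simps scaleC_complex minus_diff_commute)
    also have "\<dots> = (if \<eta> = 0 then 1 else 0)"
    proof (cases "- \<eta> \<in> cone")
      case False
      then have "iv 0 (- \<eta>) = {}" using iv_cone by fastforce
      then show ?thesis using False cone_0 by auto
    next
      case True
      then have 0: "0 \<in> iv 0 (- \<eta>)" using cone_0 by (simp add: iv_def)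
      have "{\<delta>. \<delta> \<noteq> 0 \<and> \<delta> \<in> iv 0 (- \<eta>)} = iv 0 (- \<eta>) - {0}" by auto
      then have s: "(\<Sum>\<delta>\<in>iv 0 (- \<eta>). G (t - \<delta>) * ic (- \<eta> - \<delta>))
          = ic (- \<eta>) + (\<Sum>\<delta>\<in>{\<delta>. \<delta> \<noteq> 0 \<and> \<delta> \<in> iv 0 (- \<eta>)}. G (t - \<delta>) * ic (- \<eta> - \<delta>))"
        using G(2) sum.remove[OF finite_iv 0, of "\<lambda>\<delta>. G (t - \<delta>) * ic (- \<eta> - \<delta>)"] by simp
      show ?thesis
      proof (cases "\<eta> = 0")
        case True
        have e: "{\<delta>. \<delta> \<noteq> 0 \<and> \<delta> \<in> iv 0 (- \<eta>)} = {}"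
          using True ht_diff_cone[of 0 0] ht_pos_cone cone_0 by (fastforce simp: iv_def)
        show ?thesis unfolding s e using True cone_0 by (simp add: ic.simps[of 0])
      next
        case False
        then show ?thesis unfolding s using True by (subst ic.simps) simp
      qed
    qed
    finally show "sm (\<lambda>\<xi>. ic (- t - \<xi>)) G \<eta> = series_one \<eta>" by (simp add: series_one_def)
  qed
qed

lemma series_inverse: "bdd (- t) (series_inverse K \<tau> G)" "sm (series_inverse K \<tau> G) G = series_one"
proof -
  have "series_inverse K \<tau> G = (\<lambda>\<xi>. ic (- t - \<xi>))"
    unfolding series_inverse_def
    by (rule the_equality) (simp_all add: inverse_exists bdd_formal_series[OF inverse_exists(1)] conv_inj[OF G])
  then show "bdd (- t) (series_inverse K \<tau> G)" "sm (series_inverse K \<tau> G) G = series_one"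
    using inverse_exists by auto
qed

end

section \<open>The factor \<delta>_B and its derivative\<close>

locale delta_setting = bd_setting K \<tau> D \<rho>
  for K :: "('n::finite, 'g::complex_vector) km_algebra" and \<tau> D \<rho> +
  fixes M :: "'g \<Rightarrow> ('g, 'm::complex_vector) gmod" and vac :: "'g \<Rightarrow> 'm"
  assumes verma_M: "\<gamma> \<in> csa K \<Longrightarrow> verma_module K \<gamma> (M \<gamma>) (vac \<gamma>)"
begin

lemma twisted_verma_M:
  assumes "\<gamma> \<in> \<ll>" shows "twisted_verma K \<tau> D \<rho> \<gamma> (M \<gamma>) (vac \<gamma>)"
proof unfold_locales
  show g: "\<gamma> \<in> \<hh>" by (rule lsub_csa[OF assms])
  show "verma_module K \<gamma> (M \<gamma>) (vac \<gamma>)" by (rule verma_M[OF g])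
  fix i assume "i \<in> G1"
  then show "fm \<gamma> (\<alpha> i) = fm \<gamma> (\<alpha> (T i))" using assms fm_sym[of \<gamma>] by (simp add: lsub_iff fm_simps)
qed

lemma tt_bdd: assumes "\<gamma> \<in> \<hh>" shows "bdd (lproj K \<tau> \<gamma>) (twisted_trace K \<tau> (M \<gamma>) A)"
proof -
  interpret N: verma K \<tau> D \<rho> \<gamma> "M \<gamma>" "vac \<gamma>" by unfold_locales (use assms verma_M in auto)
  show ?thesis unfolding bdd_def using N.tt_support lproj(1) by (fastforce simp: lproj_diff cone_def)
qed

abbreviation "G0 \<equiv> twisted_trace K \<tau> (M (- \<rho>)) (Bverma K \<tau> (M (- \<rho>)) (vac (- \<rho>)) (M (- \<rho>)) (vac (- \<rho>)))"

lemma minus_rho: "- \<rho> \<in> \<ll>" "- \<rho> \<in> \<hh>"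
  using rho_lsub lsub_simps(3) lsub_csa by auto

text \<open>\<open>dd\<close> shows that only multiples of the highest weight vector have exponent
  -\<rho>, and B fixes this vector. So the trace over M_{-\<rho>} starts with coefficient 1 and is
  invertible.\<close>

sublocale us: unital_series K \<tau> D \<rho> G0 "- \<rho>"
proof unfold_locales
  interpret N: twisted_verma K \<tau> D \<rho> "- \<rho>" "M (- \<rho>)" "vac (- \<rho>)" by (rule twisted_verma_M[OF minus_rho(1)])
  show "bdd (- \<rho>) G0" using tt_bdd[OF minus_rho(2)] by (simp only: lproj_lsub[OF minus_rho(1)])
  let ?v = "vac (- \<rho>)"
  have span: "b \<in> cvec.span {?v}" if "b \<in> N.Bl (- \<rho>)" for b
  proof -
    have b: "b \<in> N.Bs" "\<And>x. x \<in> \<ll> \<Longrightarrow> mact (M (- \<rho>)) x b = fm (- \<rho>) x *\<^sub>C b" using that by (auto simp: N.Bl_def)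
    have "b \<in> cvec.span {N.fw is | is. \<forall>h\<in>\<ll>. fm (- \<rho> - N.wt is) h = fm (- \<rho>) h}"
      by (rule N.weight_vector_span) (use b N.Bs(3) lsub_csa in auto)
    moreover have "{N.fw is | is. \<forall>h\<in>\<ll>. fm (- \<rho> - N.wt is) h = fm (- \<rho>) h} \<subseteq> {?v}"
    proof clarify
      fix "is" assume "\<forall>h\<in>\<ll>. fm (- \<rho> - N.wt is) h = fm (- \<rho>) h"
      then have "fm (N.wt is) dd = 0" using dd(1) by (simp add: fm_simps)
      then have "ht (N.wt is) = 0" using fm_sym[of dd] by (intro ht_eqI) simp
      then show "N.fw is = ?v" using N.ht_wt[of "is"] by simp
    qed
    ultimately show ?thesis using cvec.span_mono by blast
  qed
  have ex: "\<exists>c. b = c *\<^sub>C ?v" if "b \<in> N.Bl (- \<rho>)" for b using span[OF that] by (auto simp: cvec.span_singleton)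
  have v: "?v \<in> mcarr (M (- \<rho>))" using N.fw_carr[of "[]"] by simp
  \<comment> \<open>The basis in the trace is an arbitrary weight basis, so the highest weight
    vector itself may be missing from it. A basis vector occurring in its expansion is taken, and it
    proves to be a multiple of it.\<close>
  obtain b where b: "N.rep ?v b \<noteq> 0" 
  proof -
    have "?v \<noteq> 0" using N.vs(2) linear_on_0[OF linear_fromD(1)[OF N.vs(1)] N.carr] by auto
    then have "{b. N.rep ?v b \<noteq> 0} \<noteq> {}" using N.rep_expand[OF v] by (metis sum.empty)
    then show ?thesis using that by blast
  qed
  have bB: "b \<in> N.Bl (- \<rho>)"
  proof -
    have "b \<in> N.Bs" using N.rep_expand[OF v] b by blast
    then obtain \<eta> where e: "\<eta> \<in> \<ll>" "b \<in> N.Bl \<eta>" using N.Bl_exists by blast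
    have "\<eta> = - \<rho>"
    proof (rule lsub_eqI[OF e(1) minus_rho(1)])
      fix x assume x: "x \<in> \<ll>"
      have "N.rep (mact (M (- \<rho>)) x ?v) b = fm \<eta> x * N.rep ?v b"
        by (rule N.rep_act) (use e x v lsub_csa in \<open>auto simp: N.Bl_def\<close>)
      moreover have "mact (M (- \<rho>)) x ?v = fm (- \<rho>) x *\<^sub>C ?v" by (rule N.v_csa[OF lsub_csa[OF x]])
      ultimately have "fm (- \<rho>) x * N.rep ?v b = fm \<eta> x * N.rep ?v b"
        using linear_on_scale[OF N.rep_linear v] by (simp add: scaleC_complex)
      then show "fm \<eta> x = fm (- \<rho>) x" using b by auto
    qed
    then show ?thesis using e(2) by simp
  qed
  obtain c where c: "b = c *\<^sub>C ?v" using ex[OF bB] by blast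
  have bs: "b \<in> N.Bs" "b \<noteq> 0" using bB N.Bs(4) by (auto simp: N.Bl_def)
  have Bl: "N.Bl (- \<rho>) = {b}"
  proof -
    have "b' = b" if "b' \<in> N.Bl (- \<rho>)" for b'
    proof -
      obtain c' where c': "b' = c' *\<^sub>C ?v" using ex[OF \<open>b' \<in> N.Bl (- \<rho>)\<close>] by blast
      have "c \<noteq> 0" using c bs by auto
      then have "b' = (c' / c) *\<^sub>C b" using c c' by simp
      moreover have b': "b' \<in> N.Bs" "b' \<noteq> 0" using that N.Bs(4) by (auto simp: N.Bl_def)
      moreover have "N.rep ((c' / c) *\<^sub>C b) b = (c' / c) *\<^sub>C N.rep b b"
        by (rule linear_on_scale[OF N.rep_linear N.Bs(3)[OF bs(1)]])
      ultimately have "N.rep b' b \<noteq> 0" using N.rep_basis[OF bs(1), of b] by auto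
      then show ?thesis using N.rep_basis[OF b'(1), of b] by presburger
    qed
    then show ?thesis using bB by blast
  qed
  have "N.pr.BV b = b" using c v N.pr.BV(3) linear_on_scale[OF N.pr.BV_linear v] by simp
  then show "G0 (- \<rho>) = 1" using N.tt_eq[OF minus_rho(1)] Bl N.rep_basis[OF bs(1)] by simp
qed

abbreviation "dl \<equiv> delta_B K \<tau> M vac \<rho>"

lemma delta: "bdd \<rho> dl" "sm dl G0 = series_one"
  using us.series_inverse by (simp_all add: delta_B_def)

lemma G0_deriv: assumes y: "y \<in> \<ll>" shows "fm \<eta> y * G0 \<eta> = - fm \<rho> y * G0 \<eta> - P y G0 \<eta>"
proof -
  interpret N: twisted_shift K \<tau> D \<rho> "- \<rho>" y "M (- \<rho>)" "M (- \<rho> + y)" "vac (- \<rho>)" "vac (- \<rho> + y)"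
    by (intro twisted_shift.intro twisted_verma_M minus_rho lsub_simps y twisted_shift_axioms.intro)
  have "\<forall>\<^sub>F n in sequentially. (- fm \<rho> y - fm \<eta> y) * G0 \<eta> = P y G0 \<eta>"
    using N.trace_equation[of \<eta>] eventually_ge_at_top[of "ht (- \<rho> - \<eta>)"]
    by eventually_elim (simp add: P_eq[OF us.G(1)] fm_simps)
  then have "(- fm \<rho> y - fm \<eta> y) * G0 \<eta> = P y G0 \<eta>" by simp
  then show ?thesis by (simp add: algebra_simps)
qed

text \<open>Differentiate \<delta>_B G0 = 1 and insert the equation for G0. Both candidates for the
  derivative of \<delta>_B have the same product with G0, which \<open>conv_inj\<close>
  cancels.\<close>

lemma delta_deriv: assumes y: "y \<in> \<ll>" shows "fm x y * dl x = fm \<rho> y * dl x + P y dl x"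
proof -
  note d = delta(1) and G = us.G(1)
  let ?d1 = "\<lambda>\<xi>. fm \<xi> y * dl \<xi>" and ?d2 = "\<lambda>\<xi>. fm \<rho> y * dl \<xi> + P y dl \<xi>"
  have b: "bdd \<rho> ?d1" "bdd \<rho> ?d2"
    by (rule conv_scale(2)[OF d d]) (rule conv_add(2)[OF d conv_scale(2)[OF d d] P_bdd[OF d]])
  have "sm ?d1 G0 = sm ?d2 G0"
  proof
    fix \<eta>
    have "fm \<eta> y * sm dl G0 \<eta> = 0" unfolding delta(2) by (simp add: series_one_def fm_simps)
    then have "sm ?d1 G0 \<eta> = - sm dl (\<lambda>\<eta>. fm \<eta> y * G0 \<eta>) \<eta>" using conv_deriv[OF d G, of \<eta> y] by (simp only: eq_neg_iff_add_eq_0)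
    also have "(\<lambda>\<eta>. fm \<eta> y * G0 \<eta>) = (\<lambda>\<eta>. (- fm \<rho> y) * G0 \<eta> + (- 1) * P y G0 \<eta>)" by (auto simp: G0_deriv[OF y])
    also have "- sm dl \<dots> \<eta> = fm \<rho> y * sm dl G0 \<eta> + P y (sm dl G0) \<eta>"
      using conv_add(1)[OF d conv_scale(2)[OF d G] conv_scale(2)[OF d P_bdd[OF G]], of "\<lambda>_. - fm \<rho> y" "\<lambda>_. - 1"]
      by (simp only: conv_scale(1)[OF d G] conv_scale(1)[OF d P_bdd[OF G]] conv_P_right[OF d G]) simp
    also have "\<dots> = sm ?d2 G0 \<eta>"
    proof -
      have "sm ?d2 G0 \<eta> = sm G0 ?d2 \<eta>" by (rule conv_comm[OF b(2) G])
      also have "\<dots> = fm \<rho> y * sm G0 dl \<eta> + sm G0 (P y dl) \<eta>"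
        by (simp only: conv_add(1)[OF G conv_scale(2)[OF d d] P_bdd[OF d]] conv_scale(1)[OF G d])
      finally show ?thesis using conv_comm[OF d G, of \<eta>] conv_comm[OF P_bdd[OF d] G, of y \<eta>] conv_P_left[OF d G] by simp
    qed
    finally show "sm ?d1 G0 \<eta> = sm ?d2 G0 \<eta>" .
  qed
  then have "?d1 = ?d2" by (rule conv_inj[OF us.G bdd_formal_series[OF b(1)] bdd_formal_series[OF b(2)]])
  then show ?thesis by (rule fun_cong)
qed

text \<open>Product rule: multiplication by \<delta>_B turns the derivative along y into the
  derivative minus (\<rho>, y) minus \<open>P y\<close>.\<close>

lemma hat_deriv:
  assumes G: "bdd t G" and y: "y \<in> \<ll>"
  shows "sm dl (\<lambda>\<eta>. fm \<eta> y * G \<eta>) \<eta> = (fm \<eta> y - fm \<rho> y) * sm dl G \<eta> - P y (sm dl G) \<eta>"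
proof -
  note d = delta(1)
  have "sm (\<lambda>\<xi>. fm \<xi> y * dl \<xi>) G \<eta> = sm G (\<lambda>\<xi>. fm \<rho> y * dl \<xi> + P y dl \<xi>) \<eta>"
    using conv_comm[OF conv_scale(2)[OF d d] G, of "\<lambda>\<xi>. fm \<xi> y"] delta_deriv[OF y] by simp
  also have "\<dots> = fm \<rho> y * sm dl G \<eta> + P y (sm dl G) \<eta>"
    using conv_comm[OF d G] conv_comm[OF P_bdd[OF d] G] conv_P_left[OF d G]
    by (simp only: conv_add(1)[OF G conv_scale(2)[OF d d] P_bdd[OF d]] conv_scale(1)[OF G d])
  finally show ?thesis using conv_deriv[OF d G, of \<eta> y] by (simp add: algebra_simps)
qed

end

section \<open>Moving operators through the trace\<close>

locale trace_setting = delta_setting K \<tau> D \<rho> M vac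
  for K :: "('n::finite, 'g::complex_vector) km_algebra" and \<tau> D \<rho>
    and M :: "'g \<Rightarrow> ('g, 'm::complex_vector) gmod" and vac :: "'g \<Rightarrow> 'm" +
  fixes r :: nat and V :: "nat \<Rightarrow> ('g, 'v::complex_vector) gmod" and v :: "nat \<Rightarrow> 'v" and \<nu> :: "nat \<Rightarrow> 'g" and \<mu> :: 'g
  assumes V_O: "k \<in> {1..r} \<Longrightarrow> category_O K (V k)"
    and \<nu>: "k \<in> {1..r} \<Longrightarrow> \<nu> k \<in> csa K" and w: "k \<in> {1..r} \<Longrightarrow> v k \<in> weight_space K (V k) (\<nu> k)"
    and \<nu>_h0: "(\<Sum>k\<in>{1..r}. \<nu> k) \<in> h0sub K \<tau>" and \<mu>: "\<mu> \<in> csa K"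
    and \<mu>_T: "j \<in> Gam1 \<tau> \<Longrightarrow> form K (\<mu> - (\<Sum>k\<in>{1..r}. \<nu> k)) (root K j) = form K \<mu> (root K (Tmap \<tau> j))"
    and irr: "k \<in> {1..r} \<Longrightarrow> irreducible_module (graded_dual K (M (\<mu> - (\<Sum>j\<in>{k..r}. \<nu> j))))"
begin

text \<open>Highest weights along the composition: the k-th intertwiner leads from M_{wk k} to M_{wk
  (k - 1)}. The chain starts at \<mu> = \<open>wk r\<close>, where B arrives, and ends at \<mu> -
  \<nu> = \<open>wk 0\<close>.\<close>

definition wk :: "nat \<Rightarrow> 'g" where "wk k = \<mu> - (\<Sum>j\<in>{k<..r}. \<nu> j)"

lemma wk: "wk r = \<mu>" "wk 0 = \<mu> - (\<Sum>k\<in>{1..r}. \<nu> k)"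
    "k \<in> {1..r} \<Longrightarrow> wk (k - 1) = \<mu> - (\<Sum>j\<in>{k..r}. \<nu> j)" "k \<in> {1..r} \<Longrightarrow> wk k - \<nu> k = wk (k - 1)" "wk k \<in> \<hh>"
proof -
  show "wk r = \<mu>" by (simp add: wk_def)
  have "{0<..r} = {1..r}" by auto
  then show "wk 0 = \<mu> - (\<Sum>k\<in>{1..r}. \<nu> k)" by (simp add: wk_def)
  have iv: "{k - 1<..r} = {k..r}" "{k..r} = insert k {k<..r}" if "k \<in> {1..r}" for k using that by auto
  show "k \<in> {1..r} \<Longrightarrow> wk (k - 1) = \<mu> - (\<Sum>j\<in>{k..r}. \<nu> j)" by (simp only: wk_def iv(1))
  show "k \<in> {1..r} \<Longrightarrow> wk k - \<nu> k = wk (k - 1)" unfolding wk_def by (simp only: iv) (simp add: algebra_simps)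
  show "wk k \<in> \<hh>" unfolding wk_def
    by (intro cvec.subspace_diff[OF csa_subspace \<mu>] cvec.subspace_sum[OF csa_subspace] \<nu>) auto
qed

abbreviation "Mo k \<equiv> M (wk k)"
abbreviation "A k m \<psi> \<equiv> intertwiner K M vac (V k) (v k) (\<nu> k) (wk k) m \<psi>"
abbreviation "pk k x \<equiv> precomp (mcarr (V k)) (mact (V k) x)"
abbreviation "DF \<equiv> dual_families V r"

lemma itw: assumes k: "k \<in> {1..r}" shows "intertwining K \<tau> D \<rho> M vac (wk k) (\<nu> k) (V k) (v k)"
  by unfold_locales (use k V_O \<nu> w verma_M wk(5) irr wk(3,4)[OF k] in auto)

lemma verma_Mo: "verma K \<tau> D \<rho> (wk k) (Mo k) (vac (wk k))"
  by unfold_locales (use wk(5) verma_M in auto)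

lemma gmodule_Mo: "gmodule K (Mo k)"
proof -
  interpret N: verma K \<tau> D \<rho> "wk k" "Mo k" "vac (wk k)" by (rule verma_Mo)
  show ?thesis by (rule N.gmodule_axioms)
qed

lemma tensor_Mo: "k \<in> {1..r} \<Longrightarrow> tensor_module K (Mo (k - 1)) (V k)"
proof -
  assume k: "k \<in> {1..r}"
  interpret intertwining K \<tau> D \<rho> M vac "wk k" "\<nu> k" "V k" "v k" by (rule itw[OF k])
  show ?thesis using tensor_module_axioms by (simp add: wk(4)[OF k])
qed

sublocale pr: verma_pair K \<tau> D \<rho> "wk 0" \<mu> "M (wk 0)" "M \<mu>" "vac (wk 0)" "vac \<mu>"
  by unfold_locales (simp_all only: wk(5) \<mu> verma_M \<mu>_T[folded wk(2)])

abbreviation "BV \<equiv> pr.BV"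
abbreviation "tt \<equiv> twisted_trace K \<tau> (M (wk 0))"

lemma BV_carr: "m \<in> mcarr (Mo 0) \<Longrightarrow> BV m \<in> mcarr (Mo r)"
  using pr.BV(2) wk(1) by simp

lemma A:
  assumes k: "k \<in> {1..r}"
  shows "m \<in> mcarr (Mo k) \<Longrightarrow> A k m \<psi> \<in> mcarr (Mo (k - 1))" "linear_on (mcarr (Mo k)) (\<lambda>m. A k m \<psi>)"
    "m \<in> mcarr (Mo k) \<Longrightarrow> \<psi> \<in> dual_space (mcarr (V k)) \<Longrightarrow>
      A k (mact (Mo k) x m) \<psi> = mact (Mo (k - 1)) x (A k m \<psi>) + A k m (pk k x \<psi>)"
    "m \<in> mcarr (Mo k) \<Longrightarrow> linear_on (dual_space (mcarr (V k))) (\<lambda>\<psi>. A k m \<psi>)"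
proof -
  interpret intertwining K \<tau> D \<rho> M vac "wk k" "\<nu> k" "V k" "v k" by (rule itw[OF k])
  note wk = wk(4)[OF k]
  show "m \<in> mcarr (Mo k) \<Longrightarrow> A k m \<psi> \<in> mcarr (Mo (k - 1))" using \<Phi>_facts(1) by (simp add: wk)
  show "linear_on (mcarr (Mo k)) (\<lambda>m. A k m \<psi>)" by (rule \<Phi>_linear)
  show "m \<in> mcarr (Mo k) \<Longrightarrow> \<psi> \<in> dual_space (mcarr (V k)) \<Longrightarrow>
      A k (mact (Mo k) x m) \<psi> = mact (Mo (k - 1)) x (A k m \<psi>) + A k m (pk k x \<psi>)" using \<Phi>_act by (simp add: wk)
  show "m \<in> mcarr (Mo k) \<Longrightarrow> linear_on (dual_space (mcarr (V k))) (\<lambda>\<psi>. A k m \<psi>)"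
    using \<Phi>_facts(3,4) by (simp add: linear_on_def)
qed

text \<open>The action of x in the k-th tensor factor, transposed to families of functionals. Nested
  occurrences, read from the inside outwards, give the product from left to right.\<close>

definition ac :: "(nat \<Rightarrow> 'v \<Rightarrow> complex) \<Rightarrow> nat \<Rightarrow> 'g \<Rightarrow> nat \<Rightarrow> 'v \<Rightarrow> complex" where
  "ac \<phi> k x = \<phi>(k := pk k x (\<phi> k))"

lemma DF: "\<phi> \<in> DF \<Longrightarrow> k \<in> {1..r} \<Longrightarrow> \<phi> k \<in> dual_space (mcarr (V k))"
  by (simp add: dual_families_def)

lemma pc_dual: assumes "k \<in> {1..r}" "\<psi> \<in> dual_space (mcarr (V k))" shows "pk k x \<psi> \<in> dual_space (mcarr (V k))"
proof (rule precomp_dual_space[OF _ assms(2)])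
  show "g_module K (V k)" using V_O[OF assms(1)] by (simp add: category_O_def)
qed

lemma ac_DF: "\<phi> \<in> DF \<Longrightarrow> k \<in> {1..r} \<Longrightarrow> ac \<phi> k x \<in> DF"
  using pc_dual by (auto simp: dual_families_def ac_def)

lemma ac_commute: "j \<noteq> k \<Longrightarrow> ac (ac \<phi> j x) k y = ac (ac \<phi> k y) j x"
  by (auto simp: ac_def fun_upd_twist)

text \<open>The partial composition of the intertwiners with numbers p+1, ..., q, a map from M_{wk
  q} to M_{wk p} once functionals are inserted.\<close>

definition ch :: "nat \<Rightarrow> nat \<Rightarrow> (nat \<Rightarrow> 'v \<Rightarrow> complex) \<Rightarrow> 'm \<Rightarrow> 'm" where
  "ch p q \<phi> m = foldr (\<lambda>k m'. A k m' (\<phi> k)) [Suc p..<Suc q] m"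

lemma ch_self [simp]: "ch p p \<phi> m = m"
  by (simp add: ch_def)

lemma ch_split: "p \<le> s \<Longrightarrow> s \<le> q \<Longrightarrow> ch p q \<phi> m = ch p s \<phi> (ch s q \<phi> m)"
  using upt_add_eq_append[of "Suc p" "Suc s" "q - s"] by (simp add: ch_def del: upt_Suc)

lemma ch_right: "k \<in> {1..r} \<Longrightarrow> ch 0 k \<phi> m = ch 0 (k - 1) \<phi> (A k m (\<phi> k))"
  by (cases k) (simp_all add: ch_def)

lemma ch_cong: "(\<And>k. p < k \<Longrightarrow> k \<le> q \<Longrightarrow> \<phi> k = \<phi>' k) \<Longrightarrow> ch p q \<phi> m = ch p q \<phi>' m"
  unfolding ch_def by (rule foldr_cong) auto

lemma ch_facts:
  assumes "p \<le> q" "q \<le> r"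
  shows "(\<forall>m\<in>mcarr (Mo q). ch p q \<phi> m \<in> mcarr (Mo p)) \<and> linear_on (mcarr (Mo q)) (ch p q \<phi>)"
  using assms(1)
proof (induction p rule: inc_induct)
  case base
  then show ?case by (simp add: linear_on_def)
next
  case (step p)
  have k: "Suc p \<in> {1..r}" using step assms by simp
  have "ch p q \<phi> = (\<lambda>m. A (Suc p) (ch (Suc p) q \<phi> m) (\<phi> (Suc p)))"
    using step(2) by (simp add: ch_def upt_conv_Cons fun_eq_iff del: upt_Suc)
  then show ?case
    using step(3) A(1)[OF k, of _ "\<phi> (Suc p)"] linear_on_compose[OF _ _ A(2)[OF k], of "mcarr (Mo q)" "ch (Suc p) q \<phi>" "\<phi> (Suc p)"]
    by auto
qed

lemma ch_carr [simp]: "p \<le> q \<Longrightarrow> q \<le> r \<Longrightarrow> m \<in> mcarr (Mo q) \<Longrightarrow> ch p q \<phi> m \<in> mcarr (Mo p)"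
  and ch_linear: "p \<le> q \<Longrightarrow> q \<le> r \<Longrightarrow> linear_on (mcarr (Mo q)) (ch p q \<phi>)"
  using ch_facts by auto

text \<open>The trace with x inserted between the intertwiners p and p+1. At p = 0 it stands left of
  all intertwiners, at p = r between the last intertwiner and B.\<close>

definition TT :: "nat \<Rightarrow> 'g \<Rightarrow> (nat \<Rightarrow> 'v \<Rightarrow> complex) \<Rightarrow> 'g \<Rightarrow> complex" where
  "TT p x \<phi> = tt (\<lambda>m. ch 0 p \<phi> (mact (Mo p) x (ch p r \<phi> (BV m))))"

definition Fs :: "(nat \<Rightarrow> 'v \<Rightarrow> complex) \<Rightarrow> 'g \<Rightarrow> complex" where
  "Fs \<phi> = tt (\<lambda>m. ch 0 r \<phi> (BV m))"

lemma Fs_upd: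
  assumes k: "k \<in> {1..r}"
  shows "Fs (\<phi>(k := \<psi>)) \<eta> = tt (\<lambda>m. ch 0 (k - 1) \<phi> (A k (ch k r \<phi> (BV m)) \<psi>)) \<eta>"
proof -
  have "ch 0 r (\<phi>(k := \<psi>)) m = ch 0 (k - 1) \<phi> (A k (ch k r \<phi> m) \<psi>)" for m
  proof -
    have "ch 0 r (\<phi>(k := \<psi>)) m = ch 0 (k - 1) (\<phi>(k := \<psi>)) (A k (ch k r (\<phi>(k := \<psi>)) m) \<psi>)"
      using k ch_split[of 0 k r] by (simp add: ch_right[OF k])
    also have "ch k r (\<phi>(k := \<psi>)) m = ch k r \<phi> m" by (rule ch_cong) simp
    also have "ch 0 (k - 1) (\<phi>(k := \<psi>)) m' = ch 0 (k - 1) \<phi> m'" for m' by (rule ch_cong) (use k in auto)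
    finally show ?thesis .
  qed
  then show ?thesis by (simp add: Fs_def)
qed

lemma Fs_carr: "m \<in> mcarr (Mo 0) \<Longrightarrow> ch 0 r \<phi> (BV m) \<in> mcarr (Mo 0)"
  using BV_carr by simp

lemma ChBV_linear: "linear_on (mcarr (Mo 0)) (\<lambda>m. ch 0 r \<phi> (BV m))"
  by (rule linear_on_compose[OF pr.BV_linear _ ch_linear]) (use BV_carr in auto)

lemma TT_linear: assumes p: "p \<le> r" shows "linear_on UNIV (\<lambda>x. TT p x \<phi> \<eta>)"
proof -
  interpret N: gmodule K "Mo p" by (rule gmodule_Mo)
  have "TT p (x + y) \<phi> \<eta> = TT p x \<phi> \<eta> + TT p y \<phi> \<eta>" for x y
    unfolding TT_def using p BV_carr ch_linear[of 0 p \<phi>]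
    by (subst pr.src.tt_add[symmetric]) (auto simp: N.act_left_simps linear_on_add intro!: pr.src.tt_cong)
  moreover have "TT p (c *\<^sub>C x) \<phi> \<eta> = c * TT p x \<phi> \<eta>" for c x
    unfolding TT_def using p BV_carr ch_linear[of 0 p \<phi>]
    by (subst pr.src.tt_scale[symmetric]) (auto simp: N.act_left_simps linear_on_scale intro!: pr.src.tt_cong)
  ultimately show ?thesis by (simp add: linear_on_def scaleC_complex)
qed

lemma Fs_linear: assumes k: "k \<in> {1..r}" shows "linear_on (dual_space (mcarr (V k))) (\<lambda>\<psi>. Fs (\<phi>(k := \<psi>)) \<eta>)"
proof -
  have c: "A k (ch k r \<phi> (BV m)) \<psi> \<in> mcarr (Mo (k - 1))" "ch k r \<phi> (BV m) \<in> mcarr (Mo k)"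
    "ch 0 (k - 1) \<phi> (A k (ch k r \<phi> (BV m)) \<psi>) \<in> mcarr (Mo 0)" if "m \<in> mcarr (Mo 0)" for m \<psi>
    using k A(1)[OF k] BV_carr[OF that] by auto
  have "linear_on (mcarr (Mo (k - 1))) (ch 0 (k - 1) \<phi>)" using k by (intro ch_linear) auto
  note l = linear_on_add[OF this c(1,1)] linear_on_scale[OF this c(1)] linear_on_add[OF A(4)[OF k c(2)]] linear_on_scale[OF A(4)[OF k c(2)]]
  have "Fs (\<phi>(k := \<psi> + \<psi>')) \<eta> = Fs (\<phi>(k := \<psi>)) \<eta> + Fs (\<phi>(k := \<psi>')) \<eta>"
    if "\<psi> \<in> dual_space (mcarr (V k))" "\<psi>' \<in> dual_space (mcarr (V k))" for \<psi> \<psi>'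
    unfolding Fs_upd[OF k] by (subst pr.src.tt_add[symmetric]) (use that c l in \<open>auto intro!: pr.src.tt_cong\<close>)
  moreover have "Fs (\<phi>(k := z *\<^sub>C \<psi>)) \<eta> = z * Fs (\<phi>(k := \<psi>)) \<eta>" if "\<psi> \<in> dual_space (mcarr (V k))" for \<psi> z
    unfolding Fs_upd[OF k] by (subst pr.src.tt_scale[symmetric]) (use that c l in \<open>auto intro!: pr.src.tt_cong\<close>)
  ultimately show ?thesis by (simp add: linear_on_def scaleC_complex)
qed

lemma pc_linear: assumes k: "k \<in> {1..r}" and \<psi>: "\<psi> \<in> dual_space (mcarr (V k))"
  shows "linear_on UNIV (\<lambda>x. pk k x \<psi>)" "linear_on UNIV (\<lambda>x. pk k y (pk k x \<psi>))" "pk k (br x y) \<psi> = pk k y (pk k x \<psi>) - pk k x (pk k y \<psi>)"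
proof -
  interpret tensor_module K "Mo (k - 1)" "V k" by (rule tensor_Mo[OF k])
  show "linear_on UNIV (\<lambda>x. pk k x \<psi>)" "linear_on UNIV (\<lambda>x. pk k y (pk k x \<psi>))"
    "pk k (br x y) \<psi> = pk k y (pk k x \<psi>) - pk k x (pk k y \<psi>)"
    using pc_linear[OF \<psi>] pc_linear_right pc_br[OF \<psi>] by (simp_all add: linear_on_def)
qed

lemma Fs_ac_linear: assumes "\<phi> \<in> DF" "k \<in> {1..r}" shows "linear_on UNIV (\<lambda>x. Fs (ac \<phi> k x) \<eta>)"
  unfolding ac_def
  by (rule linear_on_compose[OF pc_linear(1) _ Fs_linear]) (use assms DF pc_dual in auto)

lemma Fs_ac_linear2: assumes "\<phi> \<in> DF" "i \<in> {1..r}" "k \<in> {1..r}" shows "linear_on UNIV (\<lambda>x. Fs (ac (ac \<phi> i x) k y) \<eta>)"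
proof (cases "i = k")
  case True
  have "linear_on UNIV (\<lambda>x. Fs (\<phi>(k := pk k y (pk k x (\<phi> k)))) \<eta>)"
    by (rule linear_on_compose[OF pc_linear(2) _ Fs_linear]) (use assms DF pc_dual in auto)
  then show ?thesis by (simp add: ac_def True)
next
  case False
  then show ?thesis using Fs_ac_linear[OF ac_DF[OF assms(1,3)] assms(2)] by (simp add: ac_commute)
qed

lemma Fs_br:
  assumes "\<phi> \<in> DF" "k \<in> {1..r}"
  shows "Fs (ac (ac \<phi> k x) k y) \<eta> - Fs (ac (ac \<phi> k y) k x) \<eta> = Fs (ac \<phi> k (br x y)) \<eta>"
proof -
  note d = DF[OF assms] and p = pc_dual[OF assms(2)]
  have "cvec.subspace (dual_space (mcarr (V k)))"
    by (auto simp: cvec.subspace_def dual_space_def linear_from_def linear_on_def algebra_simps)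
  then show ?thesis
    using linear_on_diff[OF Fs_linear[OF assms(2)] _ p[OF p[OF d]] p[OF p[OF d]]] by (simp add: ac_def pc_linear(3)[OF assms(2) d])
qed

lemma TT_step:
  assumes \<phi>: "\<phi> \<in> DF" and k: "k \<in> {1..r}"
  shows "TT k x \<phi> \<eta> = TT (k - 1) x \<phi> \<eta> + Fs (ac \<phi> k x) \<eta>"
proof -
  interpret N: gmodule K "Mo (k - Suc 0)" by (rule gmodule_Mo)
  let ?ch = "\<lambda>m. ch k r \<phi> (BV m)"
  have c: "?ch m \<in> mcarr (Mo k)" "A k (?ch m) \<psi> \<in> mcarr (Mo (k - 1))" if "m \<in> mcarr (Mo 0)" for m \<psi>
    using k A(1)[OF k] BV_carr[OF that] by auto
  have l: "linear_on (mcarr (Mo (k - Suc 0))) (ch 0 (k - Suc 0) \<phi>)" using k by (intro ch_linear) auto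
  have s: "ch (k - Suc 0) r \<phi> m = A k (ch k r \<phi> m) (\<phi> k)" for m
    using k ch_split[of "k - Suc 0" k r \<phi> m] by (cases k) (auto simp: ch_def)
  have "TT k x \<phi> \<eta> = tt (\<lambda>m. ch 0 (k - 1) \<phi> (mact (Mo (k - 1)) x (ch (k - 1) r \<phi> (BV m)))
      + ch 0 (k - 1) \<phi> (A k (?ch m) (pk k x (\<phi> k)))) \<eta>"
    unfolding TT_def ch_right[OF k]
    by (rule pr.src.tt_cong) (use c in \<open>simp add: A(3)[OF k c(1) DF[OF \<phi> k]] linear_on_add[OF l] s\<close>)
  also have "\<dots> = TT (k - 1) x \<phi> \<eta> + Fs (ac \<phi> k x) \<eta>"
    unfolding TT_def ac_def Fs_upd[OF k] using k c
    by (intro pr.src.tt_add) (auto simp: s)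
  finally show ?thesis .
qed

lemma TT_sum:
  assumes \<phi>: "\<phi> \<in> DF" and "q \<le> p" "p \<le> r"
  shows "TT p x \<phi> \<eta> = TT q x \<phi> \<eta> + (\<Sum>k\<in>{q<..p}. Fs (ac \<phi> k x) \<eta>)"
  using assms(2,3)
proof (induction p rule: dec_induct)
  case (step p)
  have "{q<..Suc p} = insert (Suc p) {q<..p}" using step by auto
  then show ?case using step TT_step[OF \<phi>, of "Suc p" x \<eta>] by simp
qed simp

lemma TT_0_cyclic:
  assumes s: "s \<in> \<ll>" and x: "\<And>y. y \<in> \<ll> \<Longrightarrow> br y x = fm s y *\<^sub>C x"
  shows "TT 0 x \<phi> (\<eta> + s) = tt (\<lambda>m. ch 0 r \<phi> (BV (mact (Mo 0) x m))) \<eta>"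
proof -
  have "tt (\<lambda>m. mact (Mo 0) x (ch 0 r \<phi> (BV m))) (\<eta> + s) = tt (\<lambda>m. ch 0 r \<phi> (BV (mact (Mo 0) x m))) \<eta>"
    using pr.src.act_linear pr.src.act_carr ChBV_linear Fs_carr s
    by (intro pr.src.tt_cyclic) (auto simp: pr.src.act_swap[of _ _ x] x pr.src.act_left_simps)
  then show ?thesis by (simp add: TT_def)
qed

text \<open>From the left end cyclicity brings x' behind B and e^\<lambda>, which shifts the
  exponent by s; on the other side of B it becomes x.\<close>

lemma TT_adj:
  assumes "adj x x'" "s \<in> \<ll>" "\<And>y. y \<in> \<ll> \<Longrightarrow> br y x' = fm s y *\<^sub>C x'"
  shows "TT r x \<phi> \<eta> = TT 0 x' \<phi> (\<eta> + s)"
proof -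
  have "TT 0 x' \<phi> (\<eta> + s) = tt (\<lambda>m. ch 0 r \<phi> (BV (mact (Mo 0) x' m))) \<eta>" by (rule TT_0_cyclic[OF assms(2,3)])
  also have "\<dots> = TT r x \<phi> \<eta>"
    unfolding TT_def wk(1) by (rule pr.src.tt_cong) (simp add: pr.BV_adj[OF assms(1)])
  finally show ?thesis by simp
qed

lemma TT_B:
  assumes a: "a \<in> R" shows "TT 0 ((B ^^ l) (F a)) \<phi> \<eta> = TT r ((B ^^ Suc l) (F a)) \<phi> (\<eta> + rp a)"
proof -
  have s: "- rp a \<in> \<ll>" using rp(2)[OF a] by (rule lsub_simps)
  have "TT 0 ((B ^^ l) (F a)) \<phi> (\<eta> + rp a + - rp a) = tt (\<lambda>m. ch 0 r \<phi> (BV (mact (Mo 0) ((B ^^ l) (F a)) m))) (\<eta> + rp a)"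
    by (rule TT_0_cyclic[OF s]) (simp add: B_pow_F[OF a] fm_simps rp(5)[OF a])
  also have "\<dots> = TT r ((B ^^ Suc l) (F a)) \<phi> (\<eta> + rp a)"
    unfolding TT_def wk(1) by (rule pr.src.tt_cong) (simp add: pr.BV(4)[OF B_pow_nm[OF F_nm[OF a]]])
  finally show ?thesis by simp
qed

lemma TT_compat:
  assumes "compat h h'" "fm \<mu> h' = fm (wk 0) h" shows "TT r h' \<phi> \<eta> = TT 0 h \<phi> \<eta>"
proof -
  have "TT 0 h \<phi> (\<eta> + 0) = tt (\<lambda>m. ch 0 r \<phi> (BV (mact (Mo 0) h m))) \<eta>"
    using csa_comm[OF lsub_csa compat_csa(1)[OF assms(1)]] by (intro TT_0_cyclic lsub_simps) (auto simp: fm_simps)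
  also have "\<dots> = TT r h' \<phi> \<eta>"
    unfolding TT_def wk(1) by (rule pr.src.tt_cong) (simp add: pr.BV_csa[OF assms])
  finally show ?thesis by simp
qed

lemma TT_lsub:
  assumes y: "y \<in> \<ll>" shows "TT 0 y \<phi> \<eta> = fm \<eta> y * Fs \<phi> \<eta>" "TT r y \<phi> \<eta> = fm \<eta> y * Fs \<phi> \<eta>"
proof -
  have "TT 0 y \<phi> (\<eta> + 0) = tt (\<lambda>m. ch 0 r \<phi> (BV (mact (Mo 0) y m))) \<eta>"
    using csa_comm[OF lsub_csa lsub_csa[OF y]] by (intro TT_0_cyclic lsub_simps) (auto simp: fm_simps)
  also have "\<dots> = fm \<eta> y * Fs \<phi> \<eta>"
    unfolding Fs_def by (rule pr.src.tt_lsub[OF ChBV_linear Fs_carr y])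
  finally show 1: "TT 0 y \<phi> \<eta> = fm \<eta> y * Fs \<phi> \<eta>" by simp
  \<comment> \<open>Since \<nu> is orthogonal to \<ll>, the weights \<mu> and \<mu> - \<nu> agree on
    \<ll>, so y passes B unchanged.\<close>
  have "fm \<mu> y = fm (wk 0) y"
    using lsub_h0sub[OF y \<nu>_h0] fm_sym[of y] by (simp add: wk(2) fm_simps)
  then show "TT r y \<phi> \<eta> = fm \<eta> y * Fs \<phi> \<eta>" using TT_compat[OF compat_lsub[OF y]] 1 by simp
qed

lemma TT_root: "i \<in> G1 \<Longrightarrow> TT r (\<alpha> (T i)) \<phi> \<eta> = TT 0 (\<alpha> i) \<phi> \<eta>"
  by (rule TT_compat[OF compat_root]) (use \<mu>_T wk(2) in auto)

lemma TT_outside: "a \<in> R \<Longrightarrow> ht (wk 0 - \<eta>) < n \<Longrightarrow> TT p x \<phi> (\<eta> + of_nat n *\<^sub>C rp a) = 0"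
  "a \<in> R \<Longrightarrow> ht (wk 0 - \<eta>) < n \<Longrightarrow> Fs \<phi> (\<eta> + of_nat n *\<^sub>C rp a) = 0"
  unfolding TT_def Fs_def by (rule pr.src.tt_shift_0, assumption+)+

text \<open>Carrying \<open>e_\<alpha>\<close>, respectively \<open>f_\<alpha>\<close>, around the trace again and again. Each turn applies \<open>B\<close> once and
  moves the exponent, so that the process ends.\<close>

lemma TT_E:
  assumes \<phi>: "\<phi> \<in> DF" and a: "a \<in> R" and p: "p \<le> r" and n: "ht (wk 0 - \<eta>) < n"
  shows "TT p (E a) \<phi> \<eta> = - (\<Sum>k\<in>{p<..r}. Fs (ac \<phi> k (E a)) \<eta>)
    - (\<Sum>l\<in>{1..n}. \<Sum>k\<in>{1..r}. Fs (ac \<phi> k (Et l a)) (\<eta> + of_nat l *\<^sub>C rp a))"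
proof -
  let ?u = "\<lambda>l. \<Sum>k\<in>{p<..r}. Fs (ac \<phi> k (Et l a)) (\<eta> + of_nat l *\<^sub>C rp a)"
  let ?s = "\<lambda>l. \<Sum>k\<in>{1..r}. Fs (ac \<phi> k (Et l a)) (\<eta> + of_nat l *\<^sub>C rp a)"
  let ?t = "\<lambda>l. TT p (Et l a) \<phi> (\<eta> + of_nat l *\<^sub>C rp a)"
  have step: "?t l + ?u l = ?t (Suc l) + ?u (Suc l) - ?s (Suc l)" for l
  proof -
    have e: "\<eta> + of_nat (Suc l) *\<^sub>C rp a = \<eta> + of_nat l *\<^sub>C rp a + rp a" by (simp add: cvec.scale_left_distrib add_ac)
    have "?t l + ?u l = TT r (Et l a) \<phi> (\<eta> + of_nat l *\<^sub>C rp a)" using TT_sum[OF \<phi> p order_refl] by simp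
    also have "\<dots> = TT 0 (Et (Suc l) a) \<phi> (\<eta> + of_nat (Suc l) *\<^sub>C rp a)"
      unfolding e by (rule TT_adj[OF adj_Et[OF a] rp(2)[OF a]]) (simp add: br_lsub_Et[OF a] rp(5)[OF a])
    also have "\<dots> = TT r (Et (Suc l) a) \<phi> (\<eta> + of_nat (Suc l) *\<^sub>C rp a) - ?s (Suc l)"
    proof -
      have "{0<..r} = {1..r}" by auto
      then show ?thesis using TT_sum[OF \<phi> le0 order_refl, of "Et (Suc l) a"] by (simp only: add_diff_cancel)
    qed
    also have "TT r (Et (Suc l) a) \<phi> (\<eta> + of_nat (Suc l) *\<^sub>C rp a) = ?t (Suc l) + ?u (Suc l)"
      using TT_sum[OF \<phi> p order_refl] by simp
    finally show ?thesis .
  qed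
  have "?t 0 + ?u 0 = ?t N + ?u N - (\<Sum>l\<in>{1..N}. ?s l)" for N
  proof (induction N)
    case (Suc N)
    then show ?case using step[of N] by (simp only: sum.nat_ivl_Suc' le_add1 Suc_eq_plus1_left[symmetric]) (simp add: algebra_simps)
  qed simp
  \<comment> \<open>After n turns both the inserted trace and the terms left behind sit at an
    exponent beyond the support, so only the telescoped sum survives.\<close>
  from this[of n] show ?thesis
    using TT_outside[OF a n] Et_0[OF a] by (simp add: eq_neg_iff_add_eq_0 eq_diff_eq add_ac)
qed

lemma TT_F:
  assumes \<phi>: "\<phi> \<in> DF" and a: "a \<in> R" and p: "p \<le> r" and n: "ht (wk 0 - \<eta>) < n"
  shows "TT p (F a) \<phi> \<eta> = (\<Sum>k\<in>{1..p}. Fs (ac \<phi> k (F a)) \<eta>)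
    + (\<Sum>l\<in>{1..n}. \<Sum>k\<in>{1..r}. Fs (ac \<phi> k ((B ^^ l) (F a))) (\<eta> + of_nat l *\<^sub>C rp a))"
proof -
  let ?u = "\<lambda>l. \<Sum>k\<in>{1..p}. Fs (ac \<phi> k ((B ^^ l) (F a))) (\<eta> + of_nat l *\<^sub>C rp a)"
  let ?s = "\<lambda>l. \<Sum>k\<in>{1..r}. Fs (ac \<phi> k ((B ^^ l) (F a))) (\<eta> + of_nat l *\<^sub>C rp a)"
  let ?t = "\<lambda>l. TT p ((B ^^ l) (F a)) \<phi> (\<eta> + of_nat l *\<^sub>C rp a)"
  have 0: "{0<..q} = {1..q}" for q :: nat by auto
  have step: "?t l - ?u l = ?t (Suc l) - ?u (Suc l) + ?s (Suc l)" for l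
  proof -
    have e: "\<eta> + of_nat (Suc l) *\<^sub>C rp a = \<eta> + of_nat l *\<^sub>C rp a + rp a" by (simp add: cvec.scale_left_distrib add_ac)
    have T0: "?t m - ?u m = TT 0 ((B ^^ m) (F a)) \<phi> (\<eta> + of_nat m *\<^sub>C rp a)" for m
      using TT_sum[OF \<phi> le0 p, of "(B ^^ m) (F a)"] by (simp only: add_diff_cancel 0)
    have "?t l - ?u l = TT 0 ((B ^^ l) (F a)) \<phi> (\<eta> + of_nat l *\<^sub>C rp a)" by (rule T0)
    also have "\<dots> = TT r ((B ^^ Suc l) (F a)) \<phi> (\<eta> + of_nat (Suc l) *\<^sub>C rp a)" unfolding e by (rule TT_B[OF a])
    also have "\<dots> = TT 0 ((B ^^ Suc l) (F a)) \<phi> (\<eta> + of_nat (Suc l) *\<^sub>C rp a) + ?s (Suc l)"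
      using TT_sum[OF \<phi> le0 order_refl, of "(B ^^ Suc l) (F a)"] by (simp only: 0)
    finally show ?thesis unfolding T0 .
  qed
  have "?t 0 - ?u 0 = ?t N - ?u N + (\<Sum>l\<in>{1..N}. ?s l)" for N
  proof (induction N)
    case (Suc N)
    then show ?case using step[of N] by (simp only: sum.nat_ivl_Suc' le_add1 Suc_eq_plus1_left[symmetric]) (simp add: algebra_simps)
  qed simp
  from this[of n] show ?thesis
    using TT_outside[OF a n] by (simp add: algebra_simps)
qed

end

section \<open>The Cayley transform\<close>

context bd_setting
begin

abbreviation "\<hh>0 \<equiv> h0sub K \<tau>"
abbreviation "C \<equiv> cayley K \<tau>"

text \<open>Double orthogonality. A vector outside the span would be detected by a functional
  vanishing on the span; the element z of \<hh> representing it lies in \<ll>, hence is orthogonal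
  to \<hh>_0, a contradiction.\<close>

lemma h0sub_iff_span: "\<hh>0 = cvec.span {\<alpha> i - \<alpha> (T i) | i. i \<in> G1}" (is "_ = cvec.span ?W")
proof
  have W: "?W \<subseteq> \<hh>0"
  proof clarify
    fix i assume "i \<in> G1"
    then have "fm y (\<alpha> i - \<alpha> (T i)) = 0" if "y \<in> \<ll>" for y
      using that fm_sym[of y] by (auto simp: lsub_iff fm_simps)
    then show "\<alpha> i - \<alpha> (T i) \<in> \<hh>0" using root_csa csa_subspace by (auto simp: h0sub_def cvec.subspace_diff)
  qed
  then show "cvec.span ?W \<subseteq> \<hh>0" by (rule cvec.span_minimal[OF _ h0sub_subspace])
  show "\<hh>0 \<subseteq> cvec.span ?W"
  proof
    fix x assume x: "x \<in> \<hh>0"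
    show "x \<in> cvec.span ?W"
    proof (rule ccontr)
      assume nx: "x \<notin> cvec.span ?W"
      interpret vp: vector_space_pair "scaleC :: complex \<Rightarrow> 'g \<Rightarrow> 'g" "scaleC :: complex \<Rightarrow> complex \<Rightarrow> complex" by unfold_locales
      obtain Bw where Bw: "Bw \<subseteq> ?W" "cvec.independent Bw" "?W \<subseteq> cvec.span Bw"
        using cvec.maximal_independent_subset[of ?W] by auto
      have sp: "cvec.span Bw = cvec.span ?W"
        using cvec.span_minimal[OF Bw(3) cvec.subspace_span] cvec.span_mono[OF Bw(1)] by blast
      have "cvec.independent (insert x Bw)"
        using nx Bw(2) cvec.span_base[of x Bw] by (simp add: cvec.independent_insert sp)
      from vp.linear_independent_extend[OF this, of "\<lambda>b. if b = x then 1 else 0"]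
      obtain g where g: "Vector_Spaces.linear (*\<^sub>C) (*\<^sub>C) g" "\<forall>b\<in>insert x Bw. g b = (if b = x then 1 else 0 :: complex)" by blast
      have gl: "g (y + y') = g y + g y'" "g (c *\<^sub>C y) = c * g y" for y y' c
        using vp.linear_add[OF g(1)] vp.linear_scale[OF g(1)] by (auto simp: scaleC_complex)
      have lin: "linear_on UNIV g" by (simp add: linear_on_def gl scaleC_complex)
      define z where "z = (\<Sum>j\<in>I. g (\<xi> j) *\<^sub>C \<xi> j)"
      have z: "fm z y = g y" if "y \<in> \<hh>" for y
      proof -
        have "g y = g (\<Sum>j\<in>I. fm y (\<xi> j) *\<^sub>C \<xi> j)" using csa_expand[OF that] by simp
        also have "\<dots> = (\<Sum>j\<in>I. fm y (\<xi> j) * g (\<xi> j))"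
          using linear_on_sum[OF lin, of I "\<lambda>j. fm y (\<xi> j) *\<^sub>C \<xi> j"] by (simp add: gl)
        also have "\<dots> = fm z y" unfolding z_def using fm_sym[of y] by (simp add: fm_sum fm_simps mult.commute)
        finally show ?thesis by simp
      qed
      have zh: "z \<in> \<hh>" unfolding z_def
        by (intro cvec.subspace_sum[OF csa_subspace] cvec.subspace_scale[OF csa_subspace] onb_mem(3))
      have "g b = 0" if "b \<in> Bw" for b using g(2) that nx sp cvec.span_base[of b Bw] by auto
      then have "g y = 0" if "y \<in> cvec.span Bw" for y
        using linear_on_span_eq[where f = g and g = "\<lambda>_. 0" and x = y and S = Bw] that linear_on_subset[OF lin] by (auto simp: linear_on_def)
      then have g0: "g y = 0" if "y \<in> ?W" for y using that Bw(3) by blast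
      have "z \<in> \<ll>"
      proof -
        have "fm z (\<alpha> i) = fm z (\<alpha> (T i))" if "i \<in> G1" for i
        proof -
          have "fm z (\<alpha> i - \<alpha> (T i)) = 0" using z[of "\<alpha> i - \<alpha> (T i)"] g0[of "\<alpha> i - \<alpha> (T i)"] that root_csa csa_subspace
            by (auto simp: cvec.subspace_diff)
          then show ?thesis by (simp add: fm_simps)
        qed
        then show ?thesis using zh fm_sym[of z] by (auto simp: lsub_iff)
      qed
      then have "fm z x = 0" using lsub_h0sub x by blast
      then show False using z[OF h0sub_csa[OF x]] g(2) by simp
    qed
  qed
qed

text \<open>With w = \<Sum> c_i \<alpha>_i and u = \<Sum> c_i T \<alpha>_i, every x in \<hh>_0 is (u
  - w)/2, and C x is the projection of (u + w)/2 to \<hh>_0. The defining equation reduces to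
  (\<alpha>_i, w) = (T \<alpha>_i, u); u and w have the same projection to \<ll>, subtracted as the
  last sum.\<close>

lemma cayley_rep:
  assumes x: "x \<in> \<hh>0"
  obtains c where "x = (1/2) *\<^sub>C ((\<Sum>i\<in>G1. c i *\<^sub>C \<alpha> (T i)) - (\<Sum>i\<in>G1. c i *\<^sub>C \<alpha> i))"
    "C x = (1/2) *\<^sub>C ((\<Sum>i\<in>G1. c i *\<^sub>C \<alpha> (T i)) + (\<Sum>i\<in>G1. c i *\<^sub>C \<alpha> i)) - (\<Sum>i\<in>G1. c i *\<^sub>C lproj K \<tau> (\<alpha> i))"
    "C x \<in> \<hh>0" "\<And>i. i \<in> G1 \<Longrightarrow> fm (\<alpha> i - \<alpha> (T i)) (C x) = fm (\<alpha> i + \<alpha> (T i)) x"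
proof -
  let ?S = "{\<Sum>i\<in>G1. d i *\<^sub>C (\<alpha> i - \<alpha> (T i)) | d. True}"
  have "cvec.span {\<alpha> i - \<alpha> (T i) | i. i \<in> G1} \<subseteq> ?S"
  proof (rule cvec.span_minimal)
    show "{\<alpha> i - \<alpha> (T i) | i. i \<in> G1} \<subseteq> ?S"
    proof clarify
      fix i assume "i \<in> G1"
      then have "\<alpha> i - \<alpha> (T i) = (\<Sum>j\<in>G1. (if j = i then 1 else 0) *\<^sub>C (\<alpha> j - \<alpha> (T j)))"
        by (simp add: if_distrib[of "\<lambda>c. c *\<^sub>C _"] cong: if_cong)
      then show "\<exists>d. \<alpha> i - \<alpha> (T i) = (\<Sum>j\<in>G1. d j *\<^sub>C (\<alpha> j - \<alpha> (T j))) \<and> True"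
        by (intro exI[of _ "\<lambda>j. if j = i then 1 else 0"] conjI TrueI)
    qed
    show "cvec.subspace ?S"
      unfolding cvec.subspace_def
    proof (intro conjI ballI allI; clarify)
      show "\<exists>d. 0 = (\<Sum>i\<in>G1. d i *\<^sub>C (\<alpha> i - \<alpha> (T i))) \<and> True" by (intro exI[of _ "\<lambda>_. 0"]) simp
      fix d d' k
      show "\<exists>d''. (\<Sum>i\<in>G1. d i *\<^sub>C (\<alpha> i - \<alpha> (T i))) + (\<Sum>i\<in>G1. d' i *\<^sub>C (\<alpha> i - \<alpha> (T i))) = (\<Sum>i\<in>G1. d'' i *\<^sub>C (\<alpha> i - \<alpha> (T i))) \<and> True"
        by (intro exI[of _ "\<lambda>i. d i + d' i"]) (simp add: cvec.scale_left_distrib sum.distrib)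
      show "\<exists>d''. k *\<^sub>C (\<Sum>i\<in>G1. d i *\<^sub>C (\<alpha> i - \<alpha> (T i))) = (\<Sum>i\<in>G1. d'' i *\<^sub>C (\<alpha> i - \<alpha> (T i))) \<and> True"
        by (intro exI[of _ "\<lambda>i. k * d i"]) (simp add: cvec.scale_sum_right)
    qed
  qed
  then obtain d where d: "x = (\<Sum>i\<in>G1. d i *\<^sub>C (\<alpha> i - \<alpha> (T i)))" using x h0sub_iff_span by blast
  \<comment> \<open>The spanning vectors are \<alpha>_i - T \<alpha>_i while the formula uses (T
    \<alpha>_i - \<alpha>_i)/2, hence the factor -2.\<close>
  define c where "c i = - 2 * d i" for i
  define u where "u = (\<Sum>i\<in>G1. c i *\<^sub>C \<alpha> (T i))"
  define w where "w = (\<Sum>i\<in>G1. c i *\<^sub>C \<alpha> i)"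
  define z where "z = (\<Sum>i\<in>G1. c i *\<^sub>C lproj K \<tau> (\<alpha> i))"
  define y where "y = (1/2) *\<^sub>C (u + w) - z"
  have xu: "x = (1/2) *\<^sub>C (u - w)"
    by (simp add: d u_def w_def c_def sum_subtractf[symmetric] cvec.scale_right_diff_distrib[symmetric] cvec.scale_sum_right
        minus_diff_commute sum_negf[symmetric] flip: cvec.scale_minus_right)
  have uw: "u \<in> \<hh>" "w \<in> \<hh>" unfolding u_def w_def
    by (intro cvec.subspace_sum[OF csa_subspace] cvec.subspace_scale[OF csa_subspace] root_csa)+
  have zl: "z \<in> \<ll>" unfolding z_def
    by (intro cvec.subspace_sum[OF lsub_subspace] cvec.subspace_scale[OF lsub_subspace] lproj(1))
  have yl: "fm l u = fm l w" "fm l z = fm l w" if l: "l \<in> \<ll>" for l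
    using l fm_sym[of l] lproj(2)[OF l] by (auto simp: u_def w_def z_def fm_sum fm_simps lsub_iff intro!: sum.cong)
  have y0: "y \<in> \<hh>0"
    unfolding h0sub_def y_def using uw lsub_csa[OF zl] csa_subspace yl
    by (auto simp: cvec.subspace_diff cvec.subspace_add cvec.subspace_scale fm_simps)
  have ch: "fm (\<alpha> i - \<alpha> (T i)) y = fm (\<alpha> i + \<alpha> (T i)) x" if i: "i \<in> G1" for i
  proof -
    have "fm (\<alpha> i) w = fm (\<alpha> (T i)) u"
      using T_form[OF i] by (auto simp: u_def w_def fm_sum fm_simps intro!: sum.cong)
    moreover have "fm (\<alpha> i - \<alpha> (T i)) z = 0" using zl i fm_sym[of _ z] by (auto simp: lsub_iff fm_simps)
    ultimately show ?thesis unfolding y_def xu by (simp add: fm_simps field_simps)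
  qed
  have "C x = y" unfolding cayley_def
  proof (rule the_equality)
    fix y' assume y': "y' \<in> \<hh>0 \<and> (\<forall>i\<in>G1. fm (\<alpha> i - \<alpha> (T i)) y' = fm (\<alpha> i + \<alpha> (T i)) x)"
    have d0: "y' - y \<in> \<hh>0" using y' y0 h0sub_subspace by (simp add: cvec.subspace_diff)
    have "fm b (y' - y) = 0" if "b \<in> cvec.span {\<alpha> i - \<alpha> (T i) | i. i \<in> G1}" for b
      by (rule linear_on_span_eq[where f = "\<lambda>b. fm b (y' - y)" and g = "\<lambda>_. 0" and x = b, OF _ _ _ that])
        (use y' ch in \<open>auto simp: linear_on_def fm_simps scaleC_complex right_diff_distrib\<close>)
    then have "fm b (y' - y) = 0" if "b \<in> \<hh>0" for b using that h0sub_iff_span by simp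
    then have "y' - y = 0" using h0sub_expand[OF d0] onb_mem(2) fm_sym[of "y' - y"]
      by (metis (no_types, lifting) cvec.scale_zero_left sum.neutral)
    then show "y' = y" by simp
  qed (use y0 ch in auto)
  then show ?thesis using that[of c] xu y0 ch unfolding y_def u_def w_def z_def by auto
qed

lemma cayley: assumes "x \<in> \<hh>0" shows "C x \<in> \<hh>0" "i \<in> G1 \<Longrightarrow> fm (\<alpha> i - \<alpha> (T i)) (C x) = fm (\<alpha> i + \<alpha> (T i)) x"
  using cayley_rep[OF assms] by metis+

text \<open>Insert the explicit form of C x. Its \<ll>-part is orthogonal to y, and the equation for
  C y converts the sums \<alpha>_i + T \<alpha>_i into the differences that make up x.\<close>

lemma cayley_skew: assumes x: "x \<in> \<hh>0" and y: "y \<in> \<hh>0" shows "fm (C x) y = - fm x (C y)"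
proof -
  obtain c where c: "x = (1/2) *\<^sub>C ((\<Sum>i\<in>G1. c i *\<^sub>C \<alpha> (T i)) - (\<Sum>i\<in>G1. c i *\<^sub>C \<alpha> i))"
    "C x = (1/2) *\<^sub>C ((\<Sum>i\<in>G1. c i *\<^sub>C \<alpha> (T i)) + (\<Sum>i\<in>G1. c i *\<^sub>C \<alpha> i)) - (\<Sum>i\<in>G1. c i *\<^sub>C lproj K \<tau> (\<alpha> i))"
    using cayley_rep[OF x] by blast
  have l0: "fm (lproj K \<tau> (\<alpha> i)) y = 0" for i using lsub_h0sub[OF lproj(1) y] .
  have "fm (C x) y = (1/2) * (\<Sum>i\<in>G1. c i * fm (\<alpha> i + \<alpha> (T i)) y)"
    unfolding c(2) by (simp add: fm_simps fm_sum l0 sum.distrib[symmetric] algebra_simps)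
  also have "\<dots> = (1/2) * (\<Sum>i\<in>G1. c i * fm (\<alpha> i - \<alpha> (T i)) (C y))"
    using cayley(2)[OF y] by (intro arg_cong2[where f = "(*)"] sum.cong) auto
  also have "\<dots> = - fm x (C y)"
    unfolding c(1) by (simp add: fm_simps fm_sum sum_subtractf[symmetric] sum_negf[symmetric] algebra_simps)
  finally show ?thesis .
qed

lemma sum_cayley:
  assumes "\<And>y. linear_on UNIV (\<lambda>x. g x y)" "\<And>x. linear_on UNIV (g x)"
  shows "(\<Sum>j\<in>I2 D. g (\<xi> j) (C (\<xi> j))) = - (\<Sum>j\<in>I2 D. g (C (\<xi> j)) (\<xi> j) :: complex)"
proof -
  have e: "C (\<xi> j) = (\<Sum>k\<in>I2 D. fm (C (\<xi> j)) (\<xi> k) *\<^sub>C \<xi> k)" if "j \<in> I2 D" for j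
    by (rule h0sub_expand[OF cayley(1)[OF onb_mem(2)[OF that]]])
  have "(\<Sum>j\<in>I2 D. g (\<xi> j) (C (\<xi> j))) = (\<Sum>j\<in>I2 D. g (\<xi> j) (\<Sum>k\<in>I2 D. fm (C (\<xi> j)) (\<xi> k) *\<^sub>C \<xi> k))"
    using e by (intro sum.cong) auto
  also have "\<dots> = (\<Sum>j\<in>I2 D. \<Sum>k\<in>I2 D. fm (C (\<xi> j)) (\<xi> k) * g (\<xi> j) (\<xi> k))"
    by (simp add: linear_on_sum[OF assms(2)] linear_on_scale[OF assms(2)] scaleC_complex)
  also have "\<dots> = (\<Sum>k\<in>I2 D. \<Sum>j\<in>I2 D. - fm (C (\<xi> k)) (\<xi> j) * g (\<xi> j) (\<xi> k))"
  proof (subst sum.swap, intro sum.cong refl)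
    fix j k assume "k \<in> I2 D" "j \<in> I2 D"
    then have "fm (C (\<xi> j)) (\<xi> k) = - fm (C (\<xi> k)) (\<xi> j)"
      using cayley_skew[OF onb_mem(2) onb_mem(2), of j k] fm_sym[of "\<xi> j"] by simp
    then show "fm (C (\<xi> j)) (\<xi> k) * g (\<xi> j) (\<xi> k) = - fm (C (\<xi> k)) (\<xi> j) * g (\<xi> j) (\<xi> k)" by simp
  qed
  also have "\<dots> = (\<Sum>k\<in>I2 D. - g (\<Sum>j\<in>I2 D. fm (C (\<xi> k)) (\<xi> j) *\<^sub>C \<xi> j) (\<xi> k))"
    by (simp add: linear_on_sum[OF assms(1)] linear_on_scale[OF assms(1)] scaleC_complex sum_negf)
  also have "\<dots> = - (\<Sum>j\<in>I2 D. g (C (\<xi> j)) (\<xi> j))"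
    using e by (simp add: sum_negf)
  finally show ?thesis .
qed

text \<open>The sum is a weighted trace of \<open>B\<^sup>l\<close> on \<open>\<nn>\<^sub>-\<close>. Cyclicity, applied to \<open>B B\<^sup>l\<^sup>-\<^sup>1\<close>, replaces the weight \<open>\<langle>\<alpha>, \<alpha>_i\<rangle>\<close>
  by \<open>\<langle>\<alpha>, \<alpha>_{T i}\<rangle>\<close>.\<close>

lemma zc_orthogonal:
  assumes h: "h \<in> \<hh>0" and l: "l > 0" shows "(\<Sum>a\<in>Rn n. zc l a * fm (fst a) h * g (rp a)) = 0"
proof -
  \<comment> \<open>The exchange of weights takes place at one factor B split off from B^l, so l
    must be positive.\<close>
  obtain l' where l': "l = Suc l'" using l by (cases l) auto
  let ?s = "\<lambda>h. \<Sum>a\<in>Rn n. zc l a * fm (fst a) h * g (rp a)"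
  have s: "?s h' = ?s h" if c: "compat h h'" for h h'
  proof -
    let ?b = "\<lambda>a b. fm (E a) (B (F b))" and ?b' = "\<lambda>a b. fm (E a) ((B ^^ l') (F b))"
    have z1: "zc l a = (\<Sum>b\<in>Rn n. ?b a b * ?b' b a)" if a: "a \<in> Rn n" for a
    proof -
      have "(B ^^ l) (F a) = B (\<Sum>b\<in>Rn n. ?b' b a *\<^sub>C F b)" using Bpow_F_expand[OF a, of l'] by (simp add: l')
      also have "\<dots> = (\<Sum>b\<in>Rn n. ?b' b a *\<^sub>C B (F b))"
        using linear_on_sum[OF B_linear nm_subspace, of "Rn n" "\<lambda>b. ?b' b a *\<^sub>C F b"] F_nm Rn(1) nm_subspace
        by (auto simp: B_scale cvec.subspace_scale)
      finally show ?thesis by (simp add: zc_def fm_sum fm_simps mult.commute)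
    qed
    have z2: "zc l b = (\<Sum>a\<in>Rn n. ?b a b * ?b' b a)" if b: "b \<in> Rn n" for b
    proof -
      have "(B ^^ l) (F b) = (B ^^ l') (\<Sum>a\<in>Rn n. ?b a b *\<^sub>C F a)"
        using Bpow_F_expand[OF b, of 1] by (simp add: l' funpow_swap1)
      also have "\<dots> = (\<Sum>a\<in>Rn n. ?b a b *\<^sub>C (B ^^ l') (F a))"
        using linear_on_sum[OF B_pow_linear nm_subspace, of "Rn n" "\<lambda>a. ?b a b *\<^sub>C F a" l'] F_nm Rn(1) nm_subspace
        by (auto simp: linear_on_scale[OF B_pow_linear] cvec.subspace_scale)
      finally show ?thesis by (simp add: zc_def fm_sum fm_simps)
    qed
    have "?s h' = (\<Sum>a\<in>Rn n. \<Sum>b\<in>Rn n. fm h' (fst a) * ?b a b * ?b' b a * g (rp a))"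
      using fm_sym[of _ h'] by (intro sum.cong) (auto simp: z1 sum_distrib_left sum_distrib_right mult_ac)
    also have "\<dots> = (\<Sum>a\<in>Rn n. \<Sum>b\<in>Rn n. fm h (fst b) * ?b a b * ?b' b a * g (rp b))"
    proof (intro sum.cong refl)
      fix a b assume "a \<in> Rn n" "b \<in> Rn n"
      then have ab: "a \<in> R" "b \<in> R" by (auto dest: Rn(1))
      show "fm h' (fst a) * ?b a b * ?b' b a * g (rp a) = fm h (fst b) * ?b a b * ?b' b a * g (rp b)"
        using B_matrix_compat[OF ab c] rp_matrix[OF ab, of 1] by (cases "?b a b = 0") auto
    qed
    also have "\<dots> = ?s h"
      using fm_sym[of _ h] by (subst sum.swap, intro sum.cong) (auto simp: z2 sum_distrib_left sum_distrib_right mult_ac)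
    finally show ?thesis .
  qed
  have lin: "linear_on UNIV ?s"
    by (simp add: linear_on_def fm_simps sum.distrib sum_distrib_left algebra_simps scaleC_complex)
  show ?thesis
  proof (rule linear_on_span_eq[where f = ?s and g = "\<lambda>_. 0" and x = h])
    show "h \<in> cvec.span {\<alpha> i - \<alpha> (T i) | i. i \<in> G1}" using h h0sub_iff_span by simp
    show "linear_on (cvec.span {\<alpha> i - \<alpha> (T i) | i. i \<in> G1}) ?s" by (rule linear_on_subset[OF lin]) simp
    fix x assume "x \<in> {\<alpha> i - \<alpha> (T i) | i. i \<in> G1}"
    then obtain i where i: "x = \<alpha> i - \<alpha> (T i)" "i \<in> G1" by blast
    have "?s (\<alpha> i - \<alpha> (T i)) = ?s (\<alpha> i) - ?s (\<alpha> (T i))" by (rule linear_on_diff[OF lin]) auto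
    then show "?s x = 0" using s[OF compat_root[OF i(2)]] i(1) by simp
  qed (simp add: linear_on_def)
qed

end

section \<open>Inserting the Casimir element\<close>

context trace_setting
begin

text \<open>The two legs of a product x y are moved through the intertwiner one after the other,
  which leaves y to its right with x in V_k, or x to its left with y in V_k. With this placement no
  term has both legs in V_k, apart from the linear \<rho>-term.\<close>

lemma casimir_A:
  assumes k: "k \<in> {1..r}" and m: "m \<in> mcarr (Mo k)" and \<psi>: "\<psi> \<in> dual_space (mcarr (V k))"
  shows "\<forall>\<^sub>F n in sequentially. (Delta K \<rho> (wk k) - Delta K \<rho> (wk (k - 1))) *\<^sub>C A k m \<psi>
    = 2 *\<^sub>C (\<Sum>a\<in>Rn n. A k (mact (Mo k) (E a) m) (pk k (F a) \<psi>) + mact (Mo (k - 1)) (F a) (A k m (pk k (E a) \<psi>)))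
      + (\<Sum>j\<in>I. A k (mact (Mo k) (\<xi> j) m) (pk k (\<xi> j) \<psi>) + mact (Mo (k - 1)) (\<xi> j) (A k m (pk k (\<xi> j) \<psi>)))
      + 2 *\<^sub>C A k m (pk k \<rho> \<psi>)"
proof -
  interpret N: verma K \<tau> D \<rho> "wk k" "Mo k" "vac (wk k)" by (rule verma_Mo)
  interpret N': verma K \<tau> D \<rho> "wk (k - 1)" "Mo (k - 1)" "vac (wk (k - 1))" by (rule verma_Mo)
  let ?L = "\<lambda>m. A k m \<psi>"
  note p = pc_dual[OF k]
  have tw: "?L (mact (Mo k) x (mact (Mo k) y m)) = mact (Mo (k - 1)) x (mact (Mo (k - 1)) y (?L m))
      + (A k (mact (Mo k) y m) (pk k x \<psi>) + mact (Mo (k - 1)) x (A k m (pk k y \<psi>)))" for x y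
    using m A(1)[OF k] by (simp add: A(3)[OF k _ \<psi>] N'.act_simps del: One_nat_def)
  have L: "linear_on (mcarr (Mo k)) ?L" by (rule A(2)[OF k])
  show ?thesis
    using N.casimir[OF m] N'.casimir[OF A(1)[OF k m, of \<psi>]]
  proof eventually_elim
    case (elim n)
    have c: "(\<Sum>a\<in>Rn n. mact (Mo k) (F a) (mact (Mo k) (E a) m)) \<in> mcarr (Mo k)"
      "(\<Sum>j\<in>I. mact (Mo k) (\<xi> j) (mact (Mo k) (\<xi> j) m)) \<in> mcarr (Mo k)" using m by (auto intro: N.carr_sum)
    have "Delta K \<rho> (wk k) *\<^sub>C ?L m = ?L (Delta K \<rho> (wk k) *\<^sub>C m)" by (rule linear_on_scale[OF L m, symmetric])
    also have "\<dots> = 2 *\<^sub>C (\<Sum>a\<in>Rn n. ?L (mact (Mo k) (F a) (mact (Mo k) (E a) m)))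
        + (\<Sum>j\<in>I. ?L (mact (Mo k) (\<xi> j) (mact (Mo k) (\<xi> j) m))) + 2 *\<^sub>C ?L (mact (Mo k) \<rho> m)"
    proof -
      have "?L (\<Sum>a\<in>Rn n. mact (Mo k) (F a) (mact (Mo k) (E a) m)) = (\<Sum>a\<in>Rn n. ?L (mact (Mo k) (F a) (mact (Mo k) (E a) m)))"
        "?L (\<Sum>j\<in>I. mact (Mo k) (\<xi> j) (mact (Mo k) (\<xi> j) m)) = (\<Sum>j\<in>I. ?L (mact (Mo k) (\<xi> j) (mact (Mo k) (\<xi> j) m)))"
        using m by (intro linear_on_sum[OF L N.carr]; simp)+
      then show ?thesis
        unfolding elim(1)[symmetric] using m c by (simp add: linear_on_add[OF L] linear_on_scale[OF L])
    qed
    also have "\<dots> = 2 *\<^sub>C (\<Sum>a\<in>Rn n. mact (Mo (k - 1)) (F a) (mact (Mo (k - 1)) (E a) (?L m)))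
        + (\<Sum>j\<in>I. mact (Mo (k - 1)) (\<xi> j) (mact (Mo (k - 1)) (\<xi> j) (?L m))) + 2 *\<^sub>C mact (Mo (k - 1)) \<rho> (?L m)
      + (2 *\<^sub>C (\<Sum>a\<in>Rn n. A k (mact (Mo k) (E a) m) (pk k (F a) \<psi>) + mact (Mo (k - 1)) (F a) (A k m (pk k (E a) \<psi>)))
      + (\<Sum>j\<in>I. A k (mact (Mo k) (\<xi> j) m) (pk k (\<xi> j) \<psi>) + mact (Mo (k - 1)) (\<xi> j) (A k m (pk k (\<xi> j) \<psi>)))
      + 2 *\<^sub>C A k m (pk k \<rho> \<psi>))"
      unfolding tw A(3)[OF k m \<psi>] sum.distrib cvec.scale_right_distrib by (simp only: add_ac)
    finally show ?case unfolding elim(2) by (simp add: cvec.scale_left_diff_distrib)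
  qed
qed

lemma ac_same: "ac \<phi> k x k = pk k x (\<phi> k)"
  by (simp add: ac_def)

lemma ch_ac: "q < k \<or> k \<le> p \<Longrightarrow> ch p q (ac \<phi> k x) m = ch p q \<phi> m"
  by (rule ch_cong) (auto simp: ac_def)

lemma trace_casimir:
  assumes \<phi>: "\<phi> \<in> DF" and i: "i \<in> {1..r}"
  shows "\<forall>\<^sub>F n in sequentially. (Delta K \<rho> (wk i) - Delta K \<rho> (wk (i - 1))) * Fs \<phi> \<eta>
    = 2 * (\<Sum>a\<in>Rn n. TT i (E a) (ac \<phi> i (F a)) \<eta> + TT (i - 1) (F a) (ac \<phi> i (E a)) \<eta>)
      + (\<Sum>j\<in>I. TT i (\<xi> j) (ac \<phi> i (\<xi> j)) \<eta> + TT (i - 1) (\<xi> j) (ac \<phi> i (\<xi> j)) \<eta>)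
      + 2 * Fs (ac \<phi> i \<rho>) \<eta>"
proof -
  interpret N: gmodule K "Mo i" by (rule gmodule_Mo)
  interpret N': gmodule K "Mo (i - 1)" by (rule gmodule_Mo)
  let ?m = "\<lambda>b. ch i r \<phi> (BV b)" and ?\<psi> = "\<phi> i"
  \<comment> \<open>\<open>U\<close> puts an operator with values in M_{wk (i - 1)} under the trace,
    at the place of the i-th intertwiner; \<open>ok\<close> records that it has values
    there.\<close>
  define U where "U u = tt (\<lambda>b. ch 0 (i - 1) \<phi> (u b)) \<eta>" for u
  define ok where "ok u \<longleftrightarrow> (\<forall>b\<in>mcarr (Mo 0). u b \<in> mcarr (Mo (i - 1)))" for u
  have l: "linear_on (mcarr (Mo (i - 1))) (ch 0 (i - 1) \<phi>)" and i1: "0 \<le> i - 1" "i - 1 \<le> r" "i \<le> r"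
    using i by (auto intro: ch_linear)
  have U_add: "U (\<lambda>b. u b + u' b) = U u + U u'" if "ok u" "ok u'" for u u'
  proof -
    have "U (\<lambda>b. u b + u' b) = tt (\<lambda>b. ch 0 (i - 1) \<phi> (u b) + ch 0 (i - 1) \<phi> (u' b)) \<eta>"
      unfolding U_def by (rule pr.src.tt_cong) (use that linear_on_add[OF l] in \<open>simp add: ok_def\<close>)
    then show ?thesis unfolding U_def using that ch_carr[OF i1(1,2)] by (subst (asm) pr.src.tt_add) (auto simp: ok_def)
  qed
  have U_scale: "U (\<lambda>b. c *\<^sub>C u b) = c * U u" if "ok u" for u c
  proof -
    have "U (\<lambda>b. c *\<^sub>C u b) = tt (\<lambda>b. c *\<^sub>C ch 0 (i - 1) \<phi> (u b)) \<eta>"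
      unfolding U_def by (rule pr.src.tt_cong) (use that linear_on_scale[OF l] in \<open>simp add: ok_def\<close>)
    then show ?thesis unfolding U_def using that ch_carr[OF i1(1,2)] by (subst (asm) pr.src.tt_scale) (auto simp: ok_def)
  qed
  have U_sum: "U (\<lambda>b. \<Sum>s\<in>S. u s b) = (\<Sum>s\<in>S. U (u s))" if "\<And>s. s \<in> S \<Longrightarrow> ok (u s)" for u and S :: "'z set"
  proof -
    have "U (\<lambda>b. \<Sum>s\<in>S. u s b) = tt (\<lambda>b. \<Sum>s\<in>S. ch 0 (i - 1) \<phi> (u s b)) \<eta>"
      unfolding U_def by (intro pr.src.tt_cong linear_on_sum[OF l N'.carr]) (use that in \<open>simp add: ok_def\<close>)
    then show ?thesis unfolding U_def using that ch_carr[OF i1(1,2)] by (subst (asm) pr.src.tt_sum) (auto simp: ok_def)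
  qed
  have m: "?m b \<in> mcarr (Mo i)" if "b \<in> mcarr (Mo 0)" for b using i1 BV_carr[OF that] by simp
  have t1: "TT i x (ac \<phi> i y) \<eta> = U (\<lambda>b. A i (mact (Mo i) x (?m b)) (pk i y ?\<psi>))" for x y
    unfolding TT_def U_def ch_right[OF i] using i by (simp add: ac_same ch_ac)
  have t2: "TT (i - 1) x (ac \<phi> i y) \<eta> = U (\<lambda>b. mact (Mo (i - 1)) x (A i (?m b) (pk i y ?\<psi>)))" for x y
  proof -
    have "ch (i - 1) r (ac \<phi> i y) m' = A i (ch i r \<phi> m') (pk i y ?\<psi>)" for m'
      using i ch_split[of "i - 1" i r "ac \<phi> i y" m'] ch_ac[of r i i \<phi> y] by (cases i) (auto simp: ch_def ac_same)
    then show ?thesis unfolding TT_def U_def using i by (simp add: ch_ac)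
  qed
  have t3: "Fs (ac \<phi> i y) \<eta> = U (\<lambda>b. A i (?m b) (pk i y ?\<psi>))" for y
    unfolding ac_def Fs_upd[OF i] U_def ..
  have t4: "Fs \<phi> \<eta> = U (\<lambda>b. A i (?m b) ?\<psi>)"
    using Fs_upd[OF i, of \<phi> "\<phi> i" \<eta>] by (simp add: U_def)
  have ok: "ok (\<lambda>b. A i (mact (Mo i) x (?m b)) \<zeta>)" "ok (\<lambda>b. mact (Mo (i - 1)) x (A i (?m b) \<zeta>))" "ok (\<lambda>b. A i (?m b) \<zeta>)" for x \<zeta>
    using m A(1)[OF i] unfolding ok_def by (auto simp del: One_nat_def)
  have oks: "ok (\<lambda>b. u b + u' b)" "ok (\<lambda>b. c *\<^sub>C u b)" if "ok u" "ok u'" for u u' c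
    using that by (auto simp: ok_def simp del: One_nat_def)
  have oksum: "ok (\<lambda>b. \<Sum>s\<in>S. u s b)" if "\<And>s. s \<in> S \<Longrightarrow> ok (u s)" for u and S :: "'z set"
    unfolding ok_def by (intro ballI N'.carr_sum) (use that in \<open>simp add: ok_def\<close>)
  let ?rhs = "\<lambda>n b. 2 *\<^sub>C (\<Sum>a\<in>Rn n. A i (mact (Mo i) (E a) (?m b)) (pk i (F a) ?\<psi>) + mact (Mo (i - 1)) (F a) (A i (?m b) (pk i (E a) ?\<psi>)))
      + (\<Sum>j\<in>I. A i (mact (Mo i) (\<xi> j) (?m b)) (pk i (\<xi> j) ?\<psi>) + mact (Mo (i - 1)) (\<xi> j) (A i (?m b) (pk i (\<xi> j) ?\<psi>)))
      + 2 *\<^sub>C A i (?m b) (pk i \<rho> ?\<psi>)"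
  let ?d = "Delta K \<rho> (wk i) - Delta K \<rho> (wk (i - 1))"
  have "\<forall>\<^sub>F n in sequentially. U (\<lambda>b. ?d *\<^sub>C A i (?m b) ?\<psi>) = U (?rhs n)"
  proof (cases "\<eta> \<in> \<ll>")
    case False
    then show ?thesis by (simp add: U_def pr.src.tt_outside)
  next
    case True
    have "\<forall>\<^sub>F n in sequentially. \<forall>b\<in>pr.src.Bl \<eta>. ?d *\<^sub>C A i (?m b) ?\<psi> = ?rhs n b"
      using casimir_A[OF i m DF[OF \<phi> i]] pr.src.Bs(3)
      by (intro eventually_ball_finite[OF pr.src.finite_Bl[OF True]]) (auto simp: pr.src.Bl_def)
    then show ?thesis by eventually_elim (simp add: U_def pr.src.tt_eq[OF True])
  qed
  then show ?thesis
  proof eventually_elim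
    case (elim n)
    have 1: "U (\<lambda>b. ?d *\<^sub>C A i (?m b) ?\<psi>) = ?d * Fs \<phi> \<eta>" unfolding t4 by (rule U_scale[OF ok(3)])
    have 2: "U (\<lambda>b. \<Sum>a\<in>Rn n. A i (mact (Mo i) (E a) (?m b)) (pk i (F a) ?\<psi>) + mact (Mo (i - 1)) (F a) (A i (?m b) (pk i (E a) ?\<psi>)))
      = (\<Sum>a\<in>Rn n. TT i (E a) (ac \<phi> i (F a)) \<eta> + TT (i - 1) (F a) (ac \<phi> i (E a)) \<eta>)"
      unfolding t1 t2 by (subst U_sum; (intro oks(1) ok | simp only: U_add[OF ok(1,2)]))
    have 3: "U (\<lambda>b. \<Sum>j\<in>I. A i (mact (Mo i) (\<xi> j) (?m b)) (pk i (\<xi> j) ?\<psi>) + mact (Mo (i - 1)) (\<xi> j) (A i (?m b) (pk i (\<xi> j) ?\<psi>)))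
      = (\<Sum>j\<in>I. TT i (\<xi> j) (ac \<phi> i (\<xi> j)) \<eta> + TT (i - 1) (\<xi> j) (ac \<phi> i (\<xi> j)) \<eta>)"
      unfolding t1 t2 by (subst U_sum; (intro oks(1) ok | simp only: U_add[OF ok(1,2)]))
    have o2: "ok (\<lambda>b. \<Sum>a\<in>Rn n. A i (mact (Mo i) (E a) (?m b)) (pk i (F a) ?\<psi>) + mact (Mo (i - 1)) (F a) (A i (?m b) (pk i (E a) ?\<psi>)))"
      and o3: "ok (\<lambda>b. \<Sum>j\<in>I. A i (mact (Mo i) (\<xi> j) (?m b)) (pk i (\<xi> j) ?\<psi>) + mact (Mo (i - 1)) (\<xi> j) (A i (?m b) (pk i (\<xi> j) ?\<psi>)))"
      by (intro oksum oks ok)+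
    show ?case
      using elim unfolding 1 U_add[OF oks(1)[OF oks(2)[OF o2 o2] o3] oks(2)[OF ok(3) ok(3)]] U_add[OF oks(2)[OF o2 o2] o3]
        U_scale[OF o2] U_scale[OF ok(3)] 2 3 t3[symmetric] .
  qed
qed

text \<open>With u, w as in the explicit Cayley formula and z its \<ll>-part, x + C x = u - z and x
  - C x = z - w. Passing B turns u into w and fixes z, so TT r (x + C x) + TT 0 (x - C x) vanishes.
  The difference of TT r and TT 0 on C x is the sum of its actions in the V_k.\<close>

lemma TT_cayley:
  assumes x: "x \<in> \<hh>0" and \<phi>: "\<phi> \<in> DF"
  shows "TT r x \<phi> \<eta> + TT 0 x \<phi> \<eta> = - (\<Sum>k\<in>{1..r}. Fs (ac \<phi> k (C x)) \<eta>)"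
proof -
  obtain c where c: "x = (1/2) *\<^sub>C ((\<Sum>i\<in>G1. c i *\<^sub>C \<alpha> (T i)) - (\<Sum>i\<in>G1. c i *\<^sub>C \<alpha> i))"
    "C x = (1/2) *\<^sub>C ((\<Sum>i\<in>G1. c i *\<^sub>C \<alpha> (T i)) + (\<Sum>i\<in>G1. c i *\<^sub>C \<alpha> i)) - (\<Sum>i\<in>G1. c i *\<^sub>C lproj K \<tau> (\<alpha> i))"
    using cayley_rep[OF x] by blast
  define u where "u = (\<Sum>i\<in>G1. c i *\<^sub>C \<alpha> (T i))"
  define w where "w = (\<Sum>i\<in>G1. c i *\<^sub>C \<alpha> i)"
  define z where "z = (\<Sum>i\<in>G1. c i *\<^sub>C lproj K \<tau> (\<alpha> i))"
  have lin: "TT p (a + b) \<phi> \<eta> = TT p a \<phi> \<eta> + TT p b \<phi> \<eta>" "TT p (a - b) \<phi> \<eta> = TT p a \<phi> \<eta> - TT p b \<phi> \<eta>"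
    "TT p (s *\<^sub>C a) \<phi> \<eta> = s * TT p a \<phi> \<eta>" "TT p (\<Sum>i\<in>S. g i) \<phi> \<eta> = (\<Sum>i\<in>S. TT p (g i) \<phi> \<eta>)" if "p \<le> r" for p a b s g and S :: "'n set"
    using linear_on_add[OF TT_linear[OF that]] linear_on_diff[OF TT_linear[OF that]] linear_on_scale[OF TT_linear[OF that]]
      linear_on_sum[OF TT_linear[OF that]] by (auto simp: scaleC_complex)
  have uw: "TT r u \<phi> \<eta> = TT 0 w \<phi> \<eta>" unfolding u_def w_def using TT_root by (simp add: lin)
  have "z \<in> \<ll>" unfolding z_def by (intro cvec.subspace_sum[OF lsub_subspace] cvec.subspace_scale[OF lsub_subspace] lproj(1))
  then have z: "TT r z \<phi> \<eta> = TT 0 z \<phi> \<eta>" by (simp add: TT_lsub)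
  have "{0<..r} = {1..r}" by auto
  then have s: "(\<Sum>k\<in>{1..r}. Fs (ac \<phi> k (C x)) \<eta>) = TT r (C x) \<phi> \<eta> - TT 0 (C x) \<phi> \<eta>"
    using TT_sum[OF \<phi> le0 order_refl, of "C x" \<eta>] by simp
  have xe: "x = (1/2) *\<^sub>C (u - w)" and ye: "C x = (1/2) *\<^sub>C (u + w) - z" using c by (simp_all add: u_def w_def z_def)
  have "TT r x \<phi> \<eta> + TT 0 x \<phi> \<eta> + (TT r (C x) \<phi> \<eta> - TT 0 (C x) \<phi> \<eta>) = 0"
    unfolding ye unfolding xe lin[OF order_refl] lin[OF le0] uw z by (simp add: field_simps)
  then show ?thesis unfolding s by (simp only: eq_neg_iff_add_eq_0)
qed

text \<open>\<open>rT_act\<close> cut off at \<open>n\<close> and transposed to the functionals \<open>\<phi>\<close>.\<close>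

definition rfin :: "nat \<Rightarrow> (nat \<Rightarrow> 'v \<Rightarrow> complex) \<Rightarrow> nat \<Rightarrow> nat \<Rightarrow> ((nat \<Rightarrow> 'v \<Rightarrow> complex) \<Rightarrow> 'g \<Rightarrow> complex) \<Rightarrow> 'g \<Rightarrow> complex" where
  "rfin n \<phi> p q G \<eta> = - (1/2) * (\<Sum>j\<in>I. G (ac (ac \<phi> p (\<xi> j)) q (\<xi> j)) \<eta>)
    + (1/2) * (\<Sum>j\<in>I2 D. G (ac (ac \<phi> p (C (\<xi> j))) q (\<xi> j)) \<eta>)
    - (\<Sum>a\<in>Rn n. G (ac (ac \<phi> p (F a)) q (E a)) \<eta>)
    + (\<Sum>a\<in>Rn n. \<Sum>l\<in>{1..n}. G (ac (ac \<phi> p (E a)) q ((B ^^ l) (F a))) (\<eta> + of_nat l *\<^sub>C rp a)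
        - G (ac (ac \<phi> p ((B ^^ l) (F a))) q (E a)) (\<eta> + of_nat l *\<^sub>C rp a))"

lemma root_part:
  assumes \<phi>: "\<phi> \<in> DF" and i: "i \<in> {1..r}" and n: "ht (wk 0 - \<eta>) < n"
  shows "(\<Sum>a\<in>Rn n. TT i (E a) (ac \<phi> i (F a)) \<eta> + TT (i - 1) (F a) (ac \<phi> i (E a)) \<eta>)
    = - (\<Sum>k\<in>{i<..r}. \<Sum>a\<in>Rn n. Fs (ac (ac \<phi> i (F a)) k (E a)) \<eta>) + (\<Sum>k\<in>{1..<i}. \<Sum>a\<in>Rn n. Fs (ac (ac \<phi> i (E a)) k (F a)) \<eta>)
      + (\<Sum>k\<in>{1..r} - {i}. \<Sum>a\<in>Rn n. \<Sum>l\<in>{1..n}. Fs (ac (ac \<phi> i (E a)) k ((B ^^ l) (F a))) (\<eta> + of_nat l *\<^sub>C rp a)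
          - Fs (ac (ac \<phi> i ((B ^^ l) (F a))) k (E a)) (\<eta> + of_nat l *\<^sub>C rp a))
      + (\<Sum>a\<in>Rn n. \<Sum>l\<in>{1..n}. zc l a * Fs (ac \<phi> i (fst a)) (\<eta> + of_nat l *\<^sub>C rp a))"
proof -
  let ?X = "\<lambda>k a l. Fs (ac (ac \<phi> i (E a)) k ((B ^^ l) (F a))) (\<eta> + of_nat l *\<^sub>C rp a)"
  let ?Y = "\<lambda>k a l. Fs (ac (ac \<phi> i ((B ^^ l) (F a))) k (E a)) (\<eta> + of_nat l *\<^sub>C rp a)"
  have i': "i \<le> r" "i - 1 \<le> r" "{1..i - 1} = {1..<i}" using i by auto
  have sw: "(\<Sum>a\<in>X. \<Sum>l\<in>{1..n}. \<Sum>k\<in>Y. g a l k) = (\<Sum>k\<in>Y. \<Sum>a\<in>X. \<Sum>l\<in>{1..n}. g a l k)"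
    for X :: "('g \<times> nat) set" and Y :: "nat set" and g :: "'g \<times> nat \<Rightarrow> nat \<Rightarrow> nat \<Rightarrow> complex"
  proof -
    have "(\<Sum>a\<in>X. \<Sum>l\<in>{1..n}. \<Sum>k\<in>Y. g a l k) = (\<Sum>a\<in>X. \<Sum>k\<in>Y. \<Sum>l\<in>{1..n}. g a l k)" by (intro sum.cong refl sum.swap)
    also have "\<dots> = (\<Sum>k\<in>Y. \<Sum>a\<in>X. \<Sum>l\<in>{1..n}. g a l k)" by (rule sum.swap)
    finally show ?thesis .
  qed
  have "(\<Sum>a\<in>Rn n. TT i (E a) (ac \<phi> i (F a)) \<eta>) = (\<Sum>a\<in>Rn n. - (\<Sum>k\<in>{i<..r}. Fs (ac (ac \<phi> i (F a)) k (E a)) \<eta>)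
    - (\<Sum>l\<in>{1..n}. \<Sum>k\<in>{1..r}. Fs (ac (ac \<phi> i (F a)) k (Et l a)) (\<eta> + of_nat l *\<^sub>C rp a)))"
    by (intro sum.cong refl TT_E[OF ac_DF[OF \<phi> i] Rn(1) i'(1) n])
  also have "\<dots> = - (\<Sum>k\<in>{i<..r}. \<Sum>a\<in>Rn n. Fs (ac (ac \<phi> i (F a)) k (E a)) \<eta>)
    - (\<Sum>k\<in>{1..r}. \<Sum>l\<in>{1..n}. \<Sum>a\<in>Rn n. Fs (ac (ac \<phi> i (F a)) k (Et l a)) (\<eta> + of_nat l *\<^sub>C rp a))"
    unfolding sum_subtractf sum_negf sum.swap[of _ "{i<..r}"] sw[of _ "{1..r}" "Rn n"] by (simp only: sum.swap[of _ "{1..n}" "Rn n"])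
  \<comment> \<open>The powers of the adjoint on e_\<alpha> are traded for powers of B on
    f_\<alpha>, the form in which they occur in r_T.\<close>
  also have "(\<Sum>k\<in>{1..r}. \<Sum>l\<in>{1..n}. \<Sum>a\<in>Rn n. Fs (ac (ac \<phi> i (F a)) k (Et l a)) (\<eta> + of_nat l *\<^sub>C rp a))
      = (\<Sum>k\<in>{1..r}. \<Sum>l\<in>{1..n}. \<Sum>a\<in>Rn n. ?Y k a l)"
  proof (rule sum.cong[OF refl], rule sum.cong[OF refl])
    fix k l assume k: "k \<in> {1..r}"
    show "(\<Sum>a\<in>Rn n. Fs (ac (ac \<phi> i (F a)) k (Et l a)) (\<eta> + of_nat l *\<^sub>C rp a)) = (\<Sum>a\<in>Rn n. ?Y k a l)"
      by (rule sum_adjoint[where g = "\<lambda>x y b. Fs (ac (ac \<phi> i y) k x) (\<eta> + of_nat l *\<^sub>C b)"])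
        (use Fs_ac_linear[OF ac_DF[OF \<phi> i] k] Fs_ac_linear2[OF \<phi> i k] in auto)
  qed
  also have "\<dots> = (\<Sum>k\<in>{1..r}. \<Sum>a\<in>Rn n. \<Sum>l\<in>{1..n}. ?Y k a l)"
    by (rule sum.cong[OF refl], rule sum.swap)
  finally have 1: "(\<Sum>a\<in>Rn n. TT i (E a) (ac \<phi> i (F a)) \<eta>) = - (\<Sum>k\<in>{i<..r}. \<Sum>a\<in>Rn n. Fs (ac (ac \<phi> i (F a)) k (E a)) \<eta>)
    - (\<Sum>k\<in>{1..r}. \<Sum>a\<in>Rn n. \<Sum>l\<in>{1..n}. ?Y k a l)" .
  have "(\<Sum>a\<in>Rn n. TT (i - 1) (F a) (ac \<phi> i (E a)) \<eta>) = (\<Sum>a\<in>Rn n. (\<Sum>k\<in>{1..<i}. Fs (ac (ac \<phi> i (E a)) k (F a)) \<eta>)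
    + (\<Sum>l\<in>{1..n}. \<Sum>k\<in>{1..r}. ?X k a l))"
    unfolding i'(3)[symmetric] by (intro sum.cong refl TT_F[OF ac_DF[OF \<phi> i] Rn(1) i'(2) n])
  also have "\<dots> = (\<Sum>k\<in>{1..<i}. \<Sum>a\<in>Rn n. Fs (ac (ac \<phi> i (E a)) k (F a)) \<eta>) + (\<Sum>k\<in>{1..r}. \<Sum>a\<in>Rn n. \<Sum>l\<in>{1..n}. ?X k a l)"
    unfolding sum.distrib sum.swap[of _ "{1..<i}"] sw[of _ "{1..r}" "Rn n"] ..
  finally have 2: "(\<Sum>a\<in>Rn n. TT (i - 1) (F a) (ac \<phi> i (E a)) \<eta>)
    = (\<Sum>k\<in>{1..<i}. \<Sum>a\<in>Rn n. Fs (ac (ac \<phi> i (E a)) k (F a)) \<eta>) + (\<Sum>k\<in>{1..r}. \<Sum>a\<in>Rn n. \<Sum>l\<in>{1..n}. ?X k a l)" .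
  have "(\<Sum>k\<in>{1..r}. \<Sum>a\<in>Rn n. \<Sum>l\<in>{1..n}. ?X k a l - ?Y k a l)
      = (\<Sum>k\<in>{1..r} - {i}. \<Sum>a\<in>Rn n. \<Sum>l\<in>{1..n}. ?X k a l - ?Y k a l) + (\<Sum>a\<in>Rn n. \<Sum>l\<in>{1..n}. ?X i a l - ?Y i a l)"
    by (simp only: sum.remove[OF _ i] finite_atLeastAtMost add.commute)
  \<comment> \<open>For k = i both legs act in V_i, in the two possible orders, so the difference is
    the action of [e_\<alpha>, B^l f_\<alpha>].\<close>
  also have "(\<Sum>a\<in>Rn n. \<Sum>l\<in>{1..n}. ?X i a l - ?Y i a l) = (\<Sum>a\<in>Rn n. \<Sum>l\<in>{1..n}. zc l a * Fs (ac \<phi> i (fst a)) (\<eta> + of_nat l *\<^sub>C rp a))"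
  proof (intro sum.cong refl)
    fix a l assume "a \<in> Rn n"
    then have a: "a \<in> R" by (rule Rn)
    show "?X i a l - ?Y i a l = zc l a * Fs (ac \<phi> i (fst a)) (\<eta> + of_nat l *\<^sub>C rp a)"
      unfolding Fs_br[OF \<phi> i] br_E_B_pow_F[OF a] using linear_on_scale[OF Fs_ac_linear[OF \<phi> i]] by (simp add: scaleC_complex)
  qed
  finally have 3: "(\<Sum>k\<in>{1..r}. \<Sum>a\<in>Rn n. \<Sum>l\<in>{1..n}. ?X k a l) - (\<Sum>k\<in>{1..r}. \<Sum>a\<in>Rn n. \<Sum>l\<in>{1..n}. ?Y k a l)
      = (\<Sum>k\<in>{1..r} - {i}. \<Sum>a\<in>Rn n. \<Sum>l\<in>{1..n}. ?X k a l - ?Y k a l)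
        + (\<Sum>a\<in>Rn n. \<Sum>l\<in>{1..n}. zc l a * Fs (ac \<phi> i (fst a)) (\<eta> + of_nat l *\<^sub>C rp a))"
    by (simp only: sum_subtractf)
  show ?thesis unfolding sum.distrib 1 2 using 3 by (simp only: algebra_simps)
qed

lemma cartan_part:
  assumes \<phi>: "\<phi> \<in> DF" and i: "i \<in> {1..r}"
  shows "(\<Sum>j\<in>I. TT i (\<xi> j) (ac \<phi> i (\<xi> j)) \<eta> + TT (i - 1) (\<xi> j) (ac \<phi> i (\<xi> j)) \<eta>)
    = - (\<Sum>k\<in>{i<..r}. \<Sum>j\<in>I. Fs (ac (ac \<phi> i (\<xi> j)) k (\<xi> j)) \<eta>) + (\<Sum>k\<in>{1..<i}. \<Sum>j\<in>I. Fs (ac (ac \<phi> i (\<xi> j)) k (\<xi> j)) \<eta>)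
      + 2 * (\<Sum>j\<in>I1 D. fm \<eta> (\<xi> j) * Fs (ac \<phi> i (\<xi> j)) \<eta>)
      + (\<Sum>k\<in>{1..r} - {i}. \<Sum>j\<in>I2 D. Fs (ac (ac \<phi> i (C (\<xi> j))) k (\<xi> j)) \<eta>)"
proof -
  let ?W = "\<lambda>x k y. Fs (ac (ac \<phi> i x) k y) \<eta>"
  have i': "i \<le> r" "i - 1 \<le> r" "{0<..i - 1} = {1..<i}" using i by auto
  have "(\<Sum>j\<in>I. TT i (\<xi> j) (ac \<phi> i (\<xi> j)) \<eta> + TT (i - 1) (\<xi> j) (ac \<phi> i (\<xi> j)) \<eta>)
    = (\<Sum>j\<in>I. (TT r (\<xi> j) (ac \<phi> i (\<xi> j)) \<eta> + TT 0 (\<xi> j) (ac \<phi> i (\<xi> j)) \<eta>) - (\<Sum>k\<in>{i<..r}. ?W (\<xi> j) k (\<xi> j)) + (\<Sum>k\<in>{1..<i}. ?W (\<xi> j) k (\<xi> j)))"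
  proof (rule sum.cong[OF refl])
    fix j
    show "TT i (\<xi> j) (ac \<phi> i (\<xi> j)) \<eta> + TT (i - 1) (\<xi> j) (ac \<phi> i (\<xi> j)) \<eta>
      = (TT r (\<xi> j) (ac \<phi> i (\<xi> j)) \<eta> + TT 0 (\<xi> j) (ac \<phi> i (\<xi> j)) \<eta>) - (\<Sum>k\<in>{i<..r}. ?W (\<xi> j) k (\<xi> j)) + (\<Sum>k\<in>{1..<i}. ?W (\<xi> j) k (\<xi> j))"
      using TT_sum[OF ac_DF[OF \<phi> i] i'(1) order_refl, of "\<xi> j" "\<xi> j" \<eta>] TT_sum[OF ac_DF[OF \<phi> i] le0 i'(2), of "\<xi> j" "\<xi> j" \<eta>]
      unfolding i'(3) by simp
  qed
  also have "\<dots> = (\<Sum>j\<in>I. TT r (\<xi> j) (ac \<phi> i (\<xi> j)) \<eta> + TT 0 (\<xi> j) (ac \<phi> i (\<xi> j)) \<eta>)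
      - (\<Sum>k\<in>{i<..r}. \<Sum>j\<in>I. ?W (\<xi> j) k (\<xi> j)) + (\<Sum>k\<in>{1..<i}. \<Sum>j\<in>I. ?W (\<xi> j) k (\<xi> j))"
    by (simp only: sum.distrib sum_subtractf sum.swap[of _ "{i<..r}" I] sum.swap[of _ "{1..<i}" I])
  also have "(\<Sum>j\<in>I. TT r (\<xi> j) (ac \<phi> i (\<xi> j)) \<eta> + TT 0 (\<xi> j) (ac \<phi> i (\<xi> j)) \<eta>)
    = (\<Sum>j\<in>I1 D. 2 * (fm \<eta> (\<xi> j) * Fs (ac \<phi> i (\<xi> j)) \<eta>)) + (\<Sum>j\<in>I2 D. - (\<Sum>k\<in>{1..r}. ?W (\<xi> j) k (C (\<xi> j))))"
    using TT_lsub[OF onb_mem(1)] TT_cayley[OF onb_mem(2) ac_DF[OF \<phi> i]] onb_facts(2,3,4)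
    by (subst sum.union_disjoint) (auto intro!: sum.cong arg_cong2[where f = "(+)"])
  also have "(\<Sum>j\<in>I2 D. - (\<Sum>k\<in>{1..r}. ?W (\<xi> j) k (C (\<xi> j)))) = (\<Sum>k\<in>{1..r}. - (\<Sum>j\<in>I2 D. ?W (\<xi> j) k (C (\<xi> j))))"
    by (simp only: sum_negf sum.swap[of _ "{1..r}" "I2 D"])
  also have "\<dots> = (\<Sum>k\<in>{1..r}. \<Sum>j\<in>I2 D. ?W (C (\<xi> j)) k (\<xi> j))"
  proof (rule sum.cong[OF refl])
    fix k assume k: "k \<in> {1..r}"
    show "- (\<Sum>j\<in>I2 D. ?W (\<xi> j) k (C (\<xi> j))) = (\<Sum>j\<in>I2 D. ?W (C (\<xi> j)) k (\<xi> j))"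
      using sum_cayley[of "\<lambda>x y. ?W x k y"] Fs_ac_linear[OF ac_DF[OF \<phi> i] k] Fs_ac_linear2[OF \<phi> i k] by simp
  qed
  also have "\<dots> = (\<Sum>k\<in>{1..r} - {i}. \<Sum>j\<in>I2 D. ?W (C (\<xi> j)) k (\<xi> j)) + (\<Sum>j\<in>I2 D. ?W (C (\<xi> j)) i (\<xi> j))"
    by (simp only: sum.remove[OF _ i] finite_atLeastAtMost add.commute)
  \<comment> \<open>In one factor the sum of C x_j times x_j is symmetric, as \<hh> is commutative,
    and antisymmetric, as C is skew.\<close>
  also have "(\<Sum>j\<in>I2 D. ?W (C (\<xi> j)) i (\<xi> j)) = 0"
  proof -
    have "?W (C (\<xi> j)) i (\<xi> j) = ?W (\<xi> j) i (C (\<xi> j))" if j: "j \<in> I2 D" for j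
    proof -
      have "br (C (\<xi> j)) (\<xi> j) = 0" using csa_comm h0sub_csa cayley(1) onb_mem(2)[OF j] by blast
      then show ?thesis using Fs_br[OF \<phi> i, of "C (\<xi> j)" "\<xi> j" \<eta>] linear_on_0[OF Fs_ac_linear[OF \<phi> i]] by simp
    qed
    then have "(\<Sum>j\<in>I2 D. ?W (C (\<xi> j)) i (\<xi> j)) = (\<Sum>j\<in>I2 D. ?W (\<xi> j) i (C (\<xi> j)))" by (rule sum.cong[OF refl])
    also have "\<dots> = - (\<Sum>j\<in>I2 D. ?W (C (\<xi> j)) i (\<xi> j))"
      using sum_cayley[of "\<lambda>x y. ?W x i y"] Fs_ac_linear[OF ac_DF[OF \<phi> i] i] Fs_ac_linear2[OF \<phi> i i] by simp
    finally show ?thesis by simp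
  qed
  finally show ?thesis by (simp add: sum_distrib_left)
qed

lemma Fs_identity:
  assumes \<phi>: "\<phi> \<in> DF" and i: "i \<in> {1..r}"
  shows "\<forall>\<^sub>F n in sequentially. (1/2) * (Delta K \<rho> (wk i) - Delta K \<rho> (wk (i - 1))) * Fs \<phi> \<eta>
    = (\<Sum>k\<in>{i<..r}. rfin n \<phi> i k Fs \<eta>) - (\<Sum>k\<in>{1..<i}. rfin n \<phi> k i Fs \<eta>)
      + (\<Sum>a\<in>Rn n. \<Sum>l\<in>{1..n}. zc l a * Fs (ac \<phi> i (fst a)) (\<eta> + of_nat l *\<^sub>C rp a))
      + (\<Sum>j\<in>I1 D. fm \<eta> (\<xi> j) * Fs (ac \<phi> i (\<xi> j)) \<eta>) + Fs (ac \<phi> i \<rho>) \<eta>"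
  using trace_casimir[OF \<phi> i, of \<eta>] eventually_gt_at_top[of "ht (wk 0 - \<eta>)"]
proof eventually_elim
  case (elim n)
  let ?H = "\<lambda>k. \<Sum>j\<in>I. Fs (ac (ac \<phi> i (\<xi> j)) k (\<xi> j)) \<eta>"
  let ?C = "\<lambda>k. \<Sum>j\<in>I2 D. Fs (ac (ac \<phi> i (C (\<xi> j))) k (\<xi> j)) \<eta>"
  let ?Z = "\<lambda>k. \<Sum>a\<in>Rn n. \<Sum>l\<in>{1..n}. Fs (ac (ac \<phi> i (E a)) k ((B ^^ l) (F a))) (\<eta> + of_nat l *\<^sub>C rp a)
          - Fs (ac (ac \<phi> i ((B ^^ l) (F a))) k (E a)) (\<eta> + of_nat l *\<^sub>C rp a)"
  have iv: "{1..r} - {i} = {i<..r} \<union> {1..<i}" "{i<..r} \<inter> {1..<i} = {}" using i by auto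
  have r1: "rfin n \<phi> i k Fs \<eta> = - (1/2) * ?H k + (1/2) * ?C k - (\<Sum>a\<in>Rn n. Fs (ac (ac \<phi> i (F a)) k (E a)) \<eta>) + ?Z k" for k
    by (simp add: rfin_def)
  \<comment> \<open>Here r_T acts on V_k \<otimes> V_i with the legs exchanged. Exchanging them back
    reverses the signs of the Cayley term and of the wedge product, and turns f \<otimes> e into e
    \<otimes> f.\<close>
  have r2: "rfin n \<phi> k i Fs \<eta> = - (1/2) * ?H k - (1/2) * ?C k - (\<Sum>a\<in>Rn n. Fs (ac (ac \<phi> i (E a)) k (F a)) \<eta>) - ?Z k" if "k \<in> {1..<i}" for k
  proof -
    have ki: "k \<noteq> i" "k \<in> {1..r}" using that i by auto
    have c: "(\<Sum>j\<in>I2 D. Fs (ac (ac \<phi> k (C (\<xi> j))) i (\<xi> j)) \<eta>) = - ?C k"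
      unfolding ac_commute[OF ki(1)]
      using sum_cayley[of "\<lambda>x y. Fs (ac (ac \<phi> i x) k y) \<eta>"] Fs_ac_linear[OF ac_DF[OF \<phi> i] ki(2)] Fs_ac_linear2[OF \<phi> i ki(2)] by simp
    have z: "(\<Sum>a\<in>Rn n. \<Sum>l\<in>{1..n}. Fs (ac (ac \<phi> k (E a)) i ((B ^^ l) (F a))) (\<eta> + of_nat l *\<^sub>C rp a)
          - Fs (ac (ac \<phi> k ((B ^^ l) (F a))) i (E a)) (\<eta> + of_nat l *\<^sub>C rp a)) = - ?Z k"
      unfolding ac_commute[OF ki(1)] sum_negf[symmetric] minus_diff_eq ..
    show ?thesis unfolding rfin_def c z unfolding ac_commute[OF ki(1)] by simp
  qed
  have 2: "(\<Sum>k\<in>{1..<i}. rfin n \<phi> k i Fs \<eta>)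
    = - (1/2) * (\<Sum>k\<in>{1..<i}. ?H k) - (1/2) * (\<Sum>k\<in>{1..<i}. ?C k) - (\<Sum>k\<in>{1..<i}. \<Sum>a\<in>Rn n. Fs (ac (ac \<phi> i (E a)) k (F a)) \<eta>) - (\<Sum>k\<in>{1..<i}. ?Z k)"
    by (simp only: r2 sum_subtractf sum_distrib_left cong: sum.cong)
  have 1: "(\<Sum>k\<in>{i<..r}. rfin n \<phi> i k Fs \<eta>)
    = - (1/2) * (\<Sum>k\<in>{i<..r}. ?H k) + (1/2) * (\<Sum>k\<in>{i<..r}. ?C k) - (\<Sum>k\<in>{i<..r}. \<Sum>a\<in>Rn n. Fs (ac (ac \<phi> i (F a)) k (E a)) \<eta>) + (\<Sum>k\<in>{i<..r}. ?Z k)"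
    by (simp only: r1 sum_subtractf sum.distrib sum_distrib_left)
  have u: "(\<Sum>k\<in>{1..r} - {i}. g k) = (\<Sum>k\<in>{i<..r}. g k) + (\<Sum>k\<in>{1..<i}. g k)" for g :: "nat \<Rightarrow> complex"
    unfolding iv(1) by (rule sum.union_disjoint) (use iv(2) in auto)
  show ?case
    unfolding mult.assoc elim(1) root_part[OF \<phi> i elim(2)] cartan_part[OF \<phi> i] 1 2 u by (simp only: algebra_simps) simp
qed

end

section \<open>Normalization by \<open>\<delta>\<^sub>B\<close>\<close>

context trace_setting
begin

abbreviation "t0 \<equiv> lproj K \<tau> (wk 0)"

definition FH :: "(nat \<Rightarrow> 'v \<Rightarrow> complex) \<Rightarrow> 'g \<Rightarrow> complex" where "FH \<phi> = sm dl (Fs \<phi>)"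

text \<open>The coefficient at \<eta> of the product with \<delta>_B as a finite sum whose range is
  independent of the series. It can therefore be applied to identities that hold for large n at
  finitely many exponents.\<close>

definition L :: "'g \<Rightarrow> ('g \<Rightarrow> complex) \<Rightarrow> complex" where
  "L \<eta> G = (\<Sum>x\<in>iv (\<eta> - t0) \<rho>. dl x * G (\<eta> - x))"

lemma Fs_bdd: "bdd t0 (Fs \<phi>)"
  unfolding Fs_def by (rule tt_bdd[OF wk(5)])

lemma FH_bdd: "bdd (\<rho> + t0) (FH \<phi>)"
  unfolding FH_def by (rule conv_bdd[OF delta(1) Fs_bdd])

lemma L_eq: "bdd t0 G \<Longrightarrow> L \<eta> G = sm dl G \<eta>"
  unfolding L_def by (subst conv_eq[OF delta(1) _ finite_iv order_refl]) (simp_all add: scaleC_complex)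

lemma L_Fs: "c \<in> cone \<Longrightarrow> L \<eta> (\<lambda>x. Fs \<phi> (x + c)) = FH \<phi> (\<eta> + c)"
  unfolding L_eq[OF bdd_shift[OF Fs_bdd]] FH_def by (rule conv_shift)

lemma L_Fs0: "L \<eta> (\<lambda>x. Fs \<phi> x) = FH \<phi> \<eta>"
  by (simp add: L_eq[OF Fs_bdd] FH_def)

lemma L_add: "L \<eta> (\<lambda>x. G x + H x) = L \<eta> G + L \<eta> H" and L_diff: "L \<eta> (\<lambda>x. G x - H x) = L \<eta> G - L \<eta> H"
  and L_scale: "L \<eta> (\<lambda>x. c * G x) = c * L \<eta> G"
  by (simp_all add: L_def sum.distrib sum_subtractf sum_distrib_left algebra_simps)

lemma L_sum: "L \<eta> (\<lambda>x. \<Sum>s\<in>S. G s x) = (\<Sum>s\<in>S. L \<eta> (G s))"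
  by (simp add: L_def sum_distrib_left) (rule sum.swap)

lemma L_rfin: "L \<eta> (rfin n \<phi> p q Fs) = rfin n \<phi> p q FH \<eta>"
proof -
  have s: "(\<Sum>a\<in>Rn n. \<Sum>l\<in>{1..n}. L \<eta> (\<lambda>x. Fs (G a l) (x + of_nat l *\<^sub>C rp a)) - L \<eta> (\<lambda>x. Fs (H a l) (x + of_nat l *\<^sub>C rp a)))
    = (\<Sum>a\<in>Rn n. \<Sum>l\<in>{1..n}. FH (G a l) (\<eta> + of_nat l *\<^sub>C rp a) - FH (H a l) (\<eta> + of_nat l *\<^sub>C rp a))" for G H
    by (intro sum.cong refl arg_cong2[where f = "(-)"] L_Fs cone_of_nat rp(1) Rn(1))
  show ?thesis unfolding rfin_def by (simp only: L_add L_diff L_scale L_sum L_Fs0 s)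
qed

lemma FH_ac_linear: assumes "\<phi> \<in> DF" "i \<in> {1..r}" shows "linear_on UNIV (\<lambda>x. FH (ac \<phi> i x) \<eta>)"
  unfolding L_Fs0[symmetric] L_def using Fs_ac_linear[OF assms]
  by (simp add: linear_on_def scaleC_complex sum.distrib sum_distrib_left algebra_simps)

text \<open>Expand \<alpha> in the orthonormal basis. The components in \<hh>_0 sum to zero by
  \<open>zc_orthogonal\<close>; those in \<ll> form exactly the operators \<open>P\<close> that the
  derivative of \<delta>_B produces.\<close>

lemma FH_root_cartan:
  assumes \<phi>: "\<phi> \<in> DF" and i: "i \<in> {1..r}" and n: "ht (\<rho> + t0 - \<eta>) \<le> n"
  shows "(\<Sum>a\<in>Rn n. \<Sum>l\<in>{1..n}. zc l a * FH (ac \<phi> i (fst a)) (\<eta> + of_nat l *\<^sub>C rp a))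
    = (\<Sum>j\<in>I1 D. P (\<xi> j) (FH (ac \<phi> i (\<xi> j))) \<eta>)"
proof -
  let ?t = "\<lambda>a l j. zc l a * fm (fst a) (\<xi> j) * FH (ac \<phi> i (\<xi> j)) (\<eta> + of_nat l *\<^sub>C rp a)"
  have "zc l a * FH (ac \<phi> i (fst a)) x = (\<Sum>j\<in>I. zc l a * fm (fst a) (\<xi> j) * FH (ac \<phi> i (\<xi> j)) x)" if "a \<in> Rn n" for a l x
  proof -
    have "fst a = (\<Sum>j\<in>I. fm (fst a) (\<xi> j) *\<^sub>C \<xi> j)" by (rule csa_expand[OF rootD(4)[OF Rn(1)[OF that]]])
    then have "FH (ac \<phi> i (fst a)) x = FH (ac \<phi> i (\<Sum>j\<in>I. fm (fst a) (\<xi> j) *\<^sub>C \<xi> j)) x" by simp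
    then show ?thesis
      by (simp add: linear_on_sum[OF FH_ac_linear[OF \<phi> i]] linear_on_scale[OF FH_ac_linear[OF \<phi> i]] scaleC_complex sum_distrib_left mult.assoc)
  qed
  then have "(\<Sum>a\<in>Rn n. \<Sum>l\<in>{1..n}. zc l a * FH (ac \<phi> i (fst a)) (\<eta> + of_nat l *\<^sub>C rp a)) = (\<Sum>a\<in>Rn n. \<Sum>l\<in>{1..n}. \<Sum>j\<in>I. ?t a l j)"
    by (intro sum.cong refl) auto
  also have "\<dots> = (\<Sum>a\<in>Rn n. \<Sum>j\<in>I. \<Sum>l\<in>{1..n}. ?t a l j)" by (rule sum.cong[OF refl], rule sum.swap)
  also have "\<dots> = (\<Sum>j\<in>I. \<Sum>a\<in>Rn n. \<Sum>l\<in>{1..n}. ?t a l j)" by (rule sum.swap)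
  also have "\<dots> = (\<Sum>j\<in>I1 D. \<Sum>a\<in>Rn n. \<Sum>l\<in>{1..n}. ?t a l j) + (\<Sum>j\<in>I2 D. \<Sum>a\<in>Rn n. \<Sum>l\<in>{1..n}. ?t a l j)"
    by (rule sum.union_disjoint) (use onb_facts in auto)
  also have "(\<Sum>j\<in>I2 D. \<Sum>a\<in>Rn n. \<Sum>l\<in>{1..n}. ?t a l j) = 0"
  proof (rule sum.neutral, rule ballI)
    fix j assume j: "j \<in> I2 D"
    have "(\<Sum>a\<in>Rn n. \<Sum>l\<in>{1..n}. ?t a l j) = (\<Sum>l\<in>{1..n}. \<Sum>a\<in>Rn n. ?t a l j)" by (rule sum.swap)
    also have "\<dots> = 0"
      using zc_orthogonal[OF onb_mem(2)[OF j], where g = "\<lambda>b. FH (ac \<phi> i (\<xi> j)) (\<eta> + of_nat _ *\<^sub>C b)"] by (intro sum.neutral) auto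
    finally show "(\<Sum>a\<in>Rn n. \<Sum>l\<in>{1..n}. ?t a l j) = 0" .
  qed
  also have "(\<Sum>j\<in>I1 D. \<Sum>a\<in>Rn n. \<Sum>l\<in>{1..n}. ?t a l j) + 0 = (\<Sum>j\<in>I1 D. P (\<xi> j) (FH (ac \<phi> i (\<xi> j))) \<eta>)"
    by (simp only: P_eq[OF FH_bdd n] add_0_right)
  finally show ?thesis .
qed

lemma FH_identity:
  assumes \<phi>: "\<phi> \<in> DF" and i: "i \<in> {1..r}"
  shows "\<forall>\<^sub>F n in sequentially. (1/2) * (Delta K \<rho> (wk i) - Delta K \<rho> (wk (i - 1))) * FH \<phi> \<eta>
    = (\<Sum>k\<in>{i<..r}. rfin n \<phi> i k FH \<eta>) - (\<Sum>k\<in>{1..<i}. rfin n \<phi> k i FH \<eta>) + (\<Sum>j\<in>I1 D. fm \<eta> (\<xi> j) * FH (ac \<phi> i (\<xi> j)) \<eta>)"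
proof -
  let ?c = "(1/2) * (Delta K \<rho> (wk i) - Delta K \<rho> (wk (i - 1)))"
  let ?X = "iv (\<eta> - t0) \<rho>"
  let ?rhs = "\<lambda>n y. (\<Sum>k\<in>{i<..r}. rfin n \<phi> i k Fs y) - (\<Sum>k\<in>{1..<i}. rfin n \<phi> k i Fs y)
      + (\<Sum>a\<in>Rn n. \<Sum>l\<in>{1..n}. zc l a * Fs (ac \<phi> i (fst a)) (y + of_nat l *\<^sub>C rp a))
      + (\<Sum>j\<in>I1 D. fm y (\<xi> j) * Fs (ac \<phi> i (\<xi> j)) y) + Fs (ac \<phi> i \<rho>) y"
  have "\<forall>\<^sub>F n in sequentially. \<forall>x\<in>?X. ?c * Fs \<phi> (\<eta> - x) = ?rhs n (\<eta> - x)"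
    by (intro eventually_ball_finite[OF finite_iv] ballI Fs_identity[OF \<phi> i])
  then show ?thesis
    using eventually_ge_at_top[of "ht (\<rho> + t0 - \<eta>)"]
  proof eventually_elim
    case (elim n)
    have "?c * FH \<phi> \<eta> = L \<eta> (\<lambda>y. ?c * Fs \<phi> y)" by (simp only: L_scale L_Fs0)
    also have "\<dots> = L \<eta> (?rhs n)" unfolding L_def using elim(1) by (intro sum.cong) auto
    also have "\<dots> = (\<Sum>k\<in>{i<..r}. rfin n \<phi> i k FH \<eta>) - (\<Sum>k\<in>{1..<i}. rfin n \<phi> k i FH \<eta>)
      + (\<Sum>a\<in>Rn n. \<Sum>l\<in>{1..n}. zc l a * FH (ac \<phi> i (fst a)) (\<eta> + of_nat l *\<^sub>C rp a))
      + (\<Sum>j\<in>I1 D. L \<eta> (\<lambda>y. fm y (\<xi> j) * Fs (ac \<phi> i (\<xi> j)) y)) + FH (ac \<phi> i \<rho>) \<eta>"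
    proof -
      have "(\<Sum>a\<in>Rn n. \<Sum>l\<in>{1..n}. zc l a * L \<eta> (\<lambda>y. Fs (ac \<phi> i (fst a)) (y + of_nat l *\<^sub>C rp a)))
        = (\<Sum>a\<in>Rn n. \<Sum>l\<in>{1..n}. zc l a * FH (ac \<phi> i (fst a)) (\<eta> + of_nat l *\<^sub>C rp a))"
        by (intro sum.cong refl arg_cong2[where f = "(*)"] L_Fs cone_of_nat rp(1) Rn(1))
      then show ?thesis by (simp only: L_add L_diff L_scale L_sum L_Fs0 L_rfin)
    qed
    \<comment> \<open>The product rule for \<delta>_B yields the summands -(\<rho>, x_j) and
      -\<open>P\<close>. They cancel the \<rho>-term of the Casimir element and the terms with both
      legs in V_i.\<close>
    also have "(\<Sum>j\<in>I1 D. L \<eta> (\<lambda>y. fm y (\<xi> j) * Fs (ac \<phi> i (\<xi> j)) y))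
      = (\<Sum>j\<in>I1 D. (fm \<eta> (\<xi> j) - fm \<rho> (\<xi> j)) * FH (ac \<phi> i (\<xi> j)) \<eta> - P (\<xi> j) (FH (ac \<phi> i (\<xi> j))) \<eta>)"
      unfolding FH_def
      by (intro sum.cong refl) (simp only: L_eq[OF conv_scale(2)[OF delta(1) Fs_bdd]] hat_deriv[OF Fs_bdd onb_mem(1)])
    also have "\<dots> = (\<Sum>j\<in>I1 D. fm \<eta> (\<xi> j) * FH (ac \<phi> i (\<xi> j)) \<eta>) - (\<Sum>j\<in>I1 D. fm \<rho> (\<xi> j) * FH (ac \<phi> i (\<xi> j)) \<eta>)
        - (\<Sum>j\<in>I1 D. P (\<xi> j) (FH (ac \<phi> i (\<xi> j))) \<eta>)"
      by (simp only: sum_subtractf left_diff_distrib)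
    also have "(\<Sum>j\<in>I1 D. fm \<rho> (\<xi> j) * FH (ac \<phi> i (\<xi> j)) \<eta>) = FH (ac \<phi> i \<rho>) \<eta>"
    proof -
      have "FH (ac \<phi> i \<rho>) \<eta> = FH (ac \<phi> i (\<Sum>j\<in>I1 D. fm \<rho> (\<xi> j) *\<^sub>C \<xi> j)) \<eta>" using lsub_expand[OF rho_lsub] by simp
      then show ?thesis
        by (simp add: linear_on_sum[OF FH_ac_linear[OF \<phi> i]] linear_on_scale[OF FH_ac_linear[OF \<phi> i]] scaleC_complex)
    qed
    finally show ?case unfolding FH_root_cartan[OF \<phi> i elim(2)] by simp
  qed
qed

text \<open>As long as the starting vector is fixed, the values for all functionals lie in one
  finite-dimensional space, because each intertwiner has values in an algebraic tensor
  product.\<close>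

lemma ch_range:
  assumes "p \<le> q" "q \<le> r" and m: "m \<in> mcarr (Mo q)"
  shows "\<exists>X. finite X \<and> X \<subseteq> mcarr (Mo p) \<and> (\<forall>\<phi>. ch p q \<phi> m \<in> cvec.span X)"
  using assms(1)
proof (induction p rule: inc_induct)
  case base
  show ?case using m by (intro exI[of _ "{m}"]) (auto intro: cvec.span_base)
next
  case (step p)
  then obtain X where X: "finite X" "X \<subseteq> mcarr (Mo (Suc p))" "\<And>\<phi>. ch (Suc p) q \<phi> m \<in> cvec.span X" by blast
  have k: "Suc p \<in> {1..r}" using step assms by simp
  interpret intertwining K \<tau> D \<rho> M vac "wk (Suc p)" "\<nu> (Suc p)" "V (Suc p)" "v (Suc p)" by (rule itw[OF k])
  have "\<forall>x\<in>X. \<exists>Z\<subseteq>mcarr (Mo p). finite Z \<and> (\<forall>\<psi>. local.A (Suc p) x \<psi> \<in> cvec.span Z)"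
  proof
    fix x assume "x \<in> X"
    then show "\<exists>Z\<subseteq>mcarr (Mo p). finite Z \<and> (\<forall>\<psi>. local.A (Suc p) x \<psi> \<in> cvec.span Z)"
      using mv_finite_range[OF \<Phi>_mv[of x]] X(2) wk(4)[OF k] by auto
  qed
  then obtain Z where Z: "\<And>x. x \<in> X \<Longrightarrow> Z x \<subseteq> mcarr (Mo p) \<and> finite (Z x) \<and> (\<forall>\<psi>. local.A (Suc p) x \<psi> \<in> cvec.span (Z x))"
    by metis
  let ?Z = "\<Union>x\<in>X. Z x"
  have "local.A (Suc p) u \<psi> \<in> cvec.span ?Z" if u: "u \<in> cvec.span X" for u \<psi>
  proof -
    have sX: "cvec.span X \<subseteq> mcarr (Mo (Suc p))" by (rule cvec.span_minimal[OF X(2) gmodule.carr[OF gmodule_Mo]])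
    have "cvec.span X \<subseteq> {u \<in> mcarr (Mo (Suc p)). local.A (Suc p) u \<psi> \<in> cvec.span ?Z}"
    proof (rule cvec.span_minimal)
      show "X \<subseteq> {u \<in> mcarr (Mo (Suc p)). local.A (Suc p) u \<psi> \<in> cvec.span ?Z}"
        using X(2) Z cvec.span_mono[of "Z _" ?Z] by blast
      show "cvec.subspace {u \<in> mcarr (Mo (Suc p)). local.A (Suc p) u \<psi> \<in> cvec.span ?Z}"
        using gmodule.carr[OF gmodule_Mo, of "Suc p"] linear_on_add[OF A(2)[OF k, of \<psi>]] linear_on_scale[OF A(2)[OF k, of \<psi>]]
          linear_on_0[OF A(2)[OF k, of \<psi>]]
        by (auto simp: cvec.subspace_def intro: cvec.span_add cvec.span_scale cvec.span_zero)
    qed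
    then show ?thesis using u by blast
  qed
  moreover have "ch p q \<phi> m = local.A (Suc p) (ch (Suc p) q \<phi> m) (\<phi> (Suc p))" for \<phi>
    using step(2) by (simp add: ch_def upt_conv_Cons del: upt_Suc)
  moreover have "?Z \<subseteq> mcarr (Mo p)" using Z by blast
  ultimately show ?case using X Z by (intro exI[of _ ?Z]) auto
qed

text \<open>The locally finite sums in \<open>rT_act\<close> run over tensor-valued terms, and a
  term is dropped only if it vanishes at every family of functionals. So the bound on the height has
  to be uniform in \<phi>.\<close>

lemma Fs_E_eventually_0:
  assumes k: "k \<in> {1..r}" shows "\<exists>n. \<forall>\<phi>\<in>DF. \<forall>a\<in>R. ht (fst a) > n \<longrightarrow> Fs (ac \<phi> k (E a)) \<eta> = 0"
proof (cases "\<eta> \<in> \<ll>")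
  case False
  then show ?thesis by (simp add: Fs_def pr.src.tt_outside)
next
  case True
  interpret it: intertwining K \<tau> D \<rho> M vac "wk k" "\<nu> k" "V k" "v k" by (rule itw[OF k])
  have "\<exists>n. \<forall>\<phi>\<in>DF. \<forall>a\<in>R. ht (fst a) > n \<longrightarrow> A k (ch k r \<phi> (BV b)) (pk k (E a) (\<phi> k)) = 0" if b: "b \<in> mcarr (Mo 0)" for b
  proof -
    obtain X where X: "finite X" "X \<subseteq> mcarr (Mo k)" "\<And>\<phi>. ch k r \<phi> (BV b) \<in> cvec.span X"
      using ch_range[of k r "BV b"] k BV_carr[OF b] by auto
    have "\<forall>x\<in>X. \<exists>n. \<forall>a\<in>R. ht (fst a) > n \<longrightarrow> (\<forall>\<psi>\<in>dual_space (mcarr (V k)). A k x (pk k (E a) \<psi>) = 0)"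
      using it.\<Phi>_E_eventually_0 X(2) by blast
    then obtain f where f: "\<And>x a \<psi>. x \<in> X \<Longrightarrow> a \<in> R \<Longrightarrow> ht (fst a) > f x \<Longrightarrow> \<psi> \<in> dual_space (mcarr (V k)) \<Longrightarrow> A k x (pk k (E a) \<psi>) = 0"
      by metis
    obtain n where n: "\<And>x. x \<in> X \<Longrightarrow> f x \<le> n" using X(1) finite_nat_set_iff_bounded_le[of "f ` X"] by auto
    have "A k u (pk k (E a) \<psi>) = 0" if "u \<in> cvec.span X" "a \<in> R" "ht (fst a) > n" "\<psi> \<in> dual_space (mcarr (V k))" for u a \<psi>
    proof (rule linear_on_span_eq[where f = "\<lambda>u. A k u (pk k (E a) \<psi>)" and g = "\<lambda>_. 0" and x = u, OF _ _ _ that(1)])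
      show "linear_on (cvec.span X) (\<lambda>u. A k u (pk k (E a) \<psi>))"
        by (rule linear_on_subset[OF A(2)[OF k] cvec.span_minimal[OF X(2) gmodule.carr[OF gmodule_Mo]]])
      show "A k x (pk k (E a) \<psi>) = 0" if "x \<in> X" for x
        using f[OF \<open>x \<in> X\<close> \<open>a \<in> R\<close> _ \<open>\<psi> \<in> _\<close>] n[OF \<open>x \<in> X\<close>] \<open>n < _\<close> by simp
    qed (simp add: linear_on_def)
    then show ?thesis using X(3) DF[OF _ k] by blast
  qed
  then obtain f where f: "\<And>b \<phi> a. b \<in> mcarr (Mo 0) \<Longrightarrow> \<phi> \<in> DF \<Longrightarrow> a \<in> R \<Longrightarrow> ht (fst a) > f b \<Longrightarrow> A k (ch k r \<phi> (BV b)) (pk k (E a) (\<phi> k)) = 0"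
    by metis
  obtain n where n: "\<And>b. b \<in> pr.src.Bl \<eta> \<Longrightarrow> f b \<le> n"
    using pr.src.finite_Bl[OF True] finite_nat_set_iff_bounded_le[of "f ` pr.src.Bl \<eta>"] by auto
  have "Fs (ac \<phi> k (E a)) \<eta> = 0" if "\<phi> \<in> DF" "a \<in> R" "ht (fst a) > n" for \<phi> a
  proof -
    have "linear_on (mcarr (Mo (k - 1))) (ch 0 (k - 1) \<phi>)" using k by (intro ch_linear) auto
    from linear_on_0[OF this gmodule.carr[OF gmodule_Mo]] have "ch 0 (k - 1) \<phi> 0 = 0" .
    moreover have "A k (ch k r \<phi> (BV b)) (pk k (E a) (\<phi> k)) = 0" if b: "b \<in> pr.src.Bl \<eta>" for b
      using f[OF _ \<open>\<phi> \<in> DF\<close> \<open>a \<in> R\<close>, of b] n[OF b] \<open>n < _\<close> b pr.src.Bs(3) by (auto simp: pr.src.Bl_def)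
    ultimately show ?thesis
      unfolding ac_def Fs_upd[OF k] pr.src.tt_eq[OF True] by (intro sum.neutral) (auto simp: cvec.representation_zero simp del: One_nat_def)
  qed
  then show ?thesis by blast
qed

lemma FH_E_eventually_0:
  assumes k: "k \<in> {1..r}" shows "\<forall>\<^sub>F n in sequentially. \<forall>\<phi>\<in>DF. \<forall>a\<in>R. ht (fst a) > n \<longrightarrow> FH (ac \<phi> k (E a)) \<eta> = 0"
proof -
  have "\<forall>\<^sub>F n in sequentially. \<forall>x\<in>iv (\<eta> - t0) \<rho>. \<forall>\<phi>\<in>DF. \<forall>a\<in>R. ht (fst a) > n \<longrightarrow> Fs (ac \<phi> k (E a)) (\<eta> - x) = 0"
  proof (intro eventually_ball_finite[OF finite_iv] ballI)
    fix x
    obtain n0 where n0: "\<forall>\<phi>\<in>DF. \<forall>a\<in>R. ht (fst a) > n0 \<longrightarrow> Fs (ac \<phi> k (E a)) (\<eta> - x) = 0" using Fs_E_eventually_0[OF k] by blast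
    show "\<forall>\<^sub>F n in sequentially. \<forall>\<phi>\<in>DF. \<forall>a\<in>R. ht (fst a) > n \<longrightarrow> Fs (ac \<phi> k (E a)) (\<eta> - x) = 0"
      using eventually_ge_at_top[of n0] by eventually_elim (use n0 in auto)
  qed
  then show ?thesis by eventually_elim (simp add: L_Fs0[symmetric] L_def)
qed

section \<open>From finite cut-offs to the r-matrix and the differential equation\<close>

abbreviation "FF \<equiv> trace_FF K \<tau> \<rho> M vac r V v \<nu> \<mu>"

lemma trace_F_eq: "trace_F K \<tau> M vac r V v \<nu> \<mu> \<eta> \<phi> = (if \<phi> \<in> DF then Fs \<phi> \<eta> else 0)"
  unfolding trace_F_def Let_def wk(2)[symmetric] wk_def[symmetric] Fs_def ch_def wk(1) by simp

lemma FF_eq: "FF \<eta> \<phi> = (if \<phi> \<in> DF then FH \<phi> \<eta> else 0)"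
proof -
  have b: "bdd t0 (trace_F K \<tau> M vac r V v \<nu> \<mu>)"
    unfolding bdd_def
  proof (intro conjI allI impI)
    fix \<eta> assume "trace_F K \<tau> M vac r V v \<nu> \<mu> \<eta> \<noteq> 0"
    then obtain \<phi> where "trace_F K \<tau> M vac r V v \<nu> \<mu> \<eta> \<phi> \<noteq> 0" by (auto simp: fun_eq_iff)
    then have "Fs \<phi> \<eta> \<noteq> 0" by (auto simp: trace_F_eq split: if_splits)
    then show "t0 - \<eta> \<in> cone" by (rule bddD(2)[OF Fs_bdd])
  qed (rule lproj(1))
  have "FF \<eta> = (\<Sum>x\<in>iv (\<eta> - t0) \<rho>. dl x *\<^sub>C trace_F K \<tau> M vac r V v \<nu> \<mu> (\<eta> - x))"
    unfolding trace_FF_def by (rule conv_eq[OF delta(1) b finite_iv order_refl])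
  then show ?thesis by (simp add: sum_fun_apply scaleC_fun_apply trace_F_eq scaleC_complex L_Fs0[symmetric] L_def)
qed

lemma slot2: "\<phi> \<in> DF \<Longrightarrow> p \<in> {1..r} \<Longrightarrow> q \<in> {1..r} \<Longrightarrow> slot V r p x (slot V r q y t) \<phi> = t (ac (ac \<phi> p x) q y)"
  using ac_DF[of \<phi> p x] by (simp add: slot_def ac_def)

lemma rT_act_outside: "\<phi> \<notin> DF \<Longrightarrow> rT_act K \<tau> D r V p q F' \<eta> \<phi> = 0"
  by (simp add: rT_act_def Let_def sum_fun_apply scaleC_fun_apply slot_def lfsum_def scaleC_complex case_prod_beta)

text \<open>Both infinite sums become finite for different reasons: in the first, e_\<alpha> of
  large height annihilates what it meets in the factor q; in the second, the shifted exponent leaves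
  the support of the series once the height of l\<alpha> is too large.\<close>

lemma rT_act_eq:
  assumes p: "p \<in> {1..r}" and q: "q \<in> {1..r}"
  shows "\<forall>\<^sub>F n in sequentially. \<forall>\<phi>\<in>DF. rT_act K \<tau> D r V p q FF \<eta> \<phi> = rfin n \<phi> p q FH \<eta>"
  using FH_E_eventually_0[OF q, of \<eta>] eventually_ge_at_top[of "ht (\<rho> + t0 - \<eta>)"]
proof eventually_elim
  case (elim n)
  let ?s = "\<lambda>x y t. slot V r p x (slot V r q y t)"
  have s: "?s x y (FF \<zeta>) \<phi> = (if \<phi> \<in> DF then FH (ac (ac \<phi> p x) q y) \<zeta> else 0)" for x y \<zeta> \<phi>
    using ac_DF[OF ac_DF[OF _ p] q] by (simp add: slot2[OF _ p q] FF_eq) (simp add: slot_def)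
  have 1: "lfsum R (\<lambda>(\<alpha>, t). ?s (fb D \<alpha> t) (eb D \<alpha> t) (FF \<eta>)) = (\<Sum>a\<in>Rn n. ?s (F a) (E a) (FF \<eta>))"
  proof -
    have "lfsum R (\<lambda>a. ?s (F a) (E a) (FF \<eta>)) = (\<Sum>a\<in>Rn n. ?s (F a) (E a) (FF \<eta>))"
    proof (rule lfsum_eq_sum[OF finite_Rn Rn(3)])
      fix a assume "a \<in> R" "a \<notin> Rn n"
      then show "?s (F a) (E a) (FF \<eta>) = 0" using elim(1) ac_DF[OF _ p] by (auto simp: fun_eq_iff s Rn_def)
    qed
    then show ?thesis by (simp add: case_prod_beta')
  qed
  let ?g = "\<lambda>a l. ?s (E a) ((B ^^ l) (F a)) (FF (\<eta> + of_nat l *\<^sub>C rp a)) - ?s ((B ^^ l) (F a)) (E a) (FF (\<eta> + of_nat l *\<^sub>C rp a))"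
  have 2: "lfsum (R \<times> {1..}) (\<lambda>((\<alpha>, t), l). ?s (eb D \<alpha> t) ((B ^^ l) (fb D \<alpha> t)) (FF (\<eta> + of_nat l *\<^sub>C lproj K \<tau> \<alpha>))
      - ?s ((B ^^ l) (fb D \<alpha> t)) (eb D \<alpha> t) (FF (\<eta> + of_nat l *\<^sub>C lproj K \<tau> \<alpha>))) = (\<Sum>(a, l)\<in>Rn n \<times> {1..n}. ?g a l)"
  proof -
    have "lfsum (R \<times> {1..}) (\<lambda>(a, l). ?g a l) = (\<Sum>(a, l)\<in>Rn n \<times> {1..n}. ?g a l)"
    proof (rule lfsum_eq_sum)
      fix c assume c: "c \<in> R \<times> {1::nat..}" "c \<notin> Rn n \<times> {1..n}"
      obtain a l where al: "c = (a, l)" by (cases c)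
      have a: "a \<in> R" and l: "l > 0" using c al by auto
      have "ht (fst a) > 0" using rootD(5)[OF a] .
      with l have "ht (fst a) \<le> l * ht (fst a)" "l \<le> l * ht (fst a)" by simp_all
      moreover have "\<not> (ht (fst a) \<le> n \<and> l \<le> n)" using c al l by (auto simp: Rn_def)
      ultimately have "FH \<psi> (\<eta> + of_nat l *\<^sub>C rp a) = 0" for \<psi>
        using bdd_rp_ht(2)[OF FH_bdd a, of \<psi> \<eta> l] elim(2) by linarith
      then show "(case c of (a, l) \<Rightarrow> ?g a l) = 0" by (simp add: al fun_eq_iff s)
    qed (use finite_Rn Rn in auto)
    then show ?thesis by (simp add: case_prod_beta' rp_def)
  qed
  show ?case
  proof
    fix \<phi> assume "\<phi> \<in> DF"
    then show "rT_act K \<tau> D r V p q FF \<eta> \<phi> = rfin n \<phi> p q FH \<eta>"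
      unfolding rT_act_def Let_def 1 2 rfin_def
      by (simp add: sum_fun_apply scaleC_fun_apply s scaleC_complex sum.cartesian_product case_prod_beta)
  qed
qed

lemma KZB_equation:
  assumes i: "i \<in> {1..r}"
  shows "(\<Sum>j\<in>I1 D. slot V r i (\<xi> j) (series_deriv K (\<xi> j) FF \<eta>) \<phi>) + (\<Sum>j\<in>{i<..r}. rT_act K \<tau> D r V i j FF \<eta> \<phi>)
      - (\<Sum>j\<in>{1..<i}. rT_act K \<tau> D r V j i FF \<eta> \<phi>)
    = (1/2) * (Delta K \<rho> (wk i) - Delta K \<rho> (wk (i - 1))) * FF \<eta> \<phi>"
proof (cases "\<phi> \<in> DF")
  case False
  then show ?thesis by (simp add: rT_act_outside FF_eq slot_def)
next
  case True
  have e1: "\<forall>\<^sub>F n in sequentially. \<forall>k\<in>{i<..r}. \<forall>\<phi>\<in>DF. rT_act K \<tau> D r V i k FF \<eta> \<phi> = rfin n \<phi> i k FH \<eta>"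
    using i by (intro eventually_ball_finite ballI rT_act_eq) auto
  have e2: "\<forall>\<^sub>F n in sequentially. \<forall>k\<in>{1..<i}. \<forall>\<phi>\<in>DF. rT_act K \<tau> D r V k i FF \<eta> \<phi> = rfin n \<phi> k i FH \<eta>"
    using i by (intro eventually_ball_finite ballI rT_act_eq) auto
  have "\<forall>\<^sub>F n in sequentially. ?thesis"
    using FH_identity[OF True i, of \<eta>] e1 e2
  proof eventually_elim
    case (elim n)
    have "slot V r i (\<xi> j) (series_deriv K (\<xi> j) FF \<eta>) \<phi> = fm \<eta> (\<xi> j) * FH (ac \<phi> i (\<xi> j)) \<eta>" for j
      using True ac_DF[OF True i, of "\<xi> j"] by (simp add: slot_def series_deriv_def scaleC_fun_apply FF_eq ac_def scaleC_complex)
    then show ?case using elim True by (simp add: FF_eq)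
  qed
  then show ?thesis by simp
qed

end

theorem theorem3p1:
  fixes K :: "('n::finite, 'g::complex_vector) km_algebra"
    and \<tau> :: "'n triple"
    and D :: "'g bases"
    and \<rho> \<mu> :: 'g
    and M :: "'g \<Rightarrow> ('g, 'm::complex_vector) gmod" and vac :: "'g \<Rightarrow> 'm"
    and r i :: nat
    and V :: "nat \<Rightarrow> ('g, 'v::complex_vector) gmod" and v :: "nat \<Rightarrow> 'v" and \<nu> :: "nat \<Rightarrow> 'g"
  assumes "symmetrizable_kac_moody K" and "invariant_form K" and "weyl_vector K \<rho>"
    and "BD_triple K \<tau>" and "nondegenerate_triple K \<tau>"
    and "root_bases K \<tau> D" and "adapted_onb K \<tau> D"
    and verma: "\<forall>\<kappa>\<in>csa K. verma_module K \<kappa> (M \<kappa>) (vac \<kappa>)"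
    and "\<forall>k\<in>{1..r}. category_O K (V k)"
    and "\<forall>k\<in>{1..r}. \<nu> k \<in> csa K \<and> v k \<in> weight_space K (V k) (\<nu> k)"
    and "(\<Sum>k\<in>{1..r}. \<nu> k) \<in> h0sub K \<tau>"
    and "\<mu> \<in> csa K"
    and "\<forall>j\<in>Gam1 \<tau>. form K (\<mu> - (\<Sum>k\<in>{1..r}. \<nu> k)) (root K j) = form K \<mu> (root K (Tmap \<tau> j))"
    and generic: "\<forall>k\<in>{1..r}. irreducible_module (graded_dual K (M (\<mu> - (\<Sum>j\<in>{k..r}. \<nu> j))))"
    and "i \<in> {1..r}"
  defines "FF \<equiv> trace_FF K \<tau> \<rho> M vac r V v \<nu> \<mu>"
  shows "(\<Sum>j\<in>I1 D. (\<lambda>\<eta>. slot V r i (onb D j) (series_deriv K (onb D j) FF \<eta>)))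
         + (\<Sum>j\<in>{i<..r}. rT_act K \<tau> D r V i j FF)
         - (\<Sum>j\<in>{1..<i}. rT_act K \<tau> D r V j i FF)
       = ((1/2) * (Delta K \<rho> (\<mu> - (\<Sum>j\<in>{i<..r}. \<nu> j)) - Delta K \<rho> (\<mu> - (\<Sum>j\<in>{i..r}. \<nu> j)))) *\<^sub>C FF"
proof -
  interpret trace_setting K \<tau> D \<rho> M vac r V v \<nu> \<mu>
    by unfold_locales (use assms in auto)
  show ?thesis
    using KZB_equation[OF \<open>i \<in> {1..r}\<close>] unfolding FF_def wk(3)[OF \<open>i \<in> {1..r}\<close>] unfolding wk_def
    by (simp add: fun_eq_iff sum_fun_apply scaleC_fun_apply scaleC_complex)
qed

end
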